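(* A linear datalog program $\Pi$ (i.e. one in which each rule has at most one IDB atom in the body) over a database instance with at most $N$ tuples per EDB relation can be evaluated in time $$O\bigl(f(\Pi)\cdot|\Pi|\cdot N^{\mathsf{ew}(\Pi)+\mathsf{fcghw}(\Pi)-1}\bigr),$$ where $\mathsf{fcghw}(\Pi)$ is the free-connex generalized fractional hypertree width.
   Context: Datalog. Standard positive datalog programs: finite sets of rules $q(\bar s)\gets p_1(\bar s_1),\dots,p_\mu(\bar s_\mu)$ whose terms are variables or constants; $|\Pi|$ is the number of rules. A predicate is IDB if it is the head predicate of a rule with non-empty body, otherwise EDB. Evaluating means computing all IDB relations of the least fixpoint. "$\_$" denotes a fresh existentially quantified variable. Free-connex generalized hypertree width. The hypergraph $H$ of a rule $q(\bar s)\gets p_1(\bar t_1),\dots,p_\mu(\bar t_\mu)$ has hyperedges $\mathsf{vars}(\bar t_i)$ and vertex set their union; $V_{\mathsf{out}}=\mathsf{vars}(\bar s)$. A free-connex generalized hypertree decomposition of $H$ is $(T,\chi,\lambda)$ with $T$ a tree, $\chi:V(T)\to 2^{V(H)}$ with $\bigcup_p\chi(p)=V(H)$, $\lambda:V(T)\to2^{E(H)}$ such that: every $e\in E(H)$ is contained in some $\chi(p)$; for each $v\in V(H)$ the set $\{p: v\in\chi(p)\}$ is connected in $T$; $\chi(p)\subseteq\bigcup\lambda(p)$ for each $p$; and there is a connected subtree $S$ of $T$ with $\bigcup_{p\in V(S)}\chi(p)=V_{\mathsf{out}}$. Its (fractional) width is the maximum over $p$ of the fractional edge cover number of the hypergraph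 $(\bigcup\lambda(p),\lambda(p))$ (covering all its vertices). $\mathsf{fcghw}$ of a rule is the minimum width over all such decompositions, and $\mathsf{fcghw}(\Pi)$ is the maximum over rules of $\Pi$. Edge-cover width and $f(\Pi)$. Let $\Pi'$ be the output of the following algorithm on $\Pi$. Here $q_\rho$ denotes a new predicate for an IDB predicate $q$ and a rule $\rho$ (adornment) with head predicate $q$ and only EDB body atoms. Start with $\Pi'=\emptyset$. Repeat until a fixpoint: for each rule $R: q(\bar s)\gets \bigwedge_{i=1}^{l}p_i(\bar s_i)\wedge\mathcal E$ of $\Pi$ ($p_i$ IDB, $\mathcal E$ a conjunction of EDB atoms, $l\ge0$), and each choice $(\rho_1,\dots,\rho_l)$ such that for each $i$ some rule of $\Pi'$ has head atom ${p_i}_{\rho_i}(\bar v_i)$: rename these head atoms with their adornments to ${p_i}_{\rho_i'}(\bar v_i')$, $\rho_i'=p_i(\bar v_i')\gets\mathcal B_i$, so that they and $R$ are pairwise variable-disjoint; let $\sigma$ be a simultaneous mgu of the pairs $(\bar s_i,\bar v_i')$ (skip if none); let $\rho=g_{\mathsf{out}}\bigl(q(\sigma(\bar s))\gets\bigwedge_i\sigma(\mathcal B_i)\wedge\sigma(\mathcal E)\bigr)$; add the rule $q_\rho(\sigma(\bar s))\gets\bigwedge_i{p_i}_{\rho_i}(\sigma(\bar s_i))\wedge\sigma(\mathcal E)$ to $\Pi'$ unless an identical rule up to variable renaming is already present. The function $g_{\mathsf{out}}$ replaces each body argument not occurring in the head by $\_$ and then removes each body atom $e(\bar t)$ for which another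 body atom $e(\bar t')$ satisfies, for each position $i$, $t_i=t_i'$ or $t_i=\_$ (keeping one of identical atoms); in particular atoms with only $\_$ are removed. For an adornment $\rho: q(\bar s)\gets e_1(\bar t_1),\dots,e_\mu(\bar t_\mu)$, $\mathsf{ew}(q_\rho)$ is the minimum of $\sum_i x_i$ over $0\le x_i\le1$ assigned to the hyperedges $\mathsf{vars}(\bar t_i)$ such that each $v\in\mathsf{vars}(\bar s)$ is covered with total weight at least $1$ (fractional edge cover). $\mathsf{ew}(\Pi)$ is the maximum of $\mathsf{ew}(q_\rho)$ over all $q_\rho$ in $\Pi'$. $f(\Pi)$, which depends only on $\Pi$, is the maximum over IDB predicates $q$ of $\Pi$ of the number of different adornments $\rho$ (up to variable renaming) with $q_\rho$ in $\Pi'$; thus every IDB relation has size at most $f(\Pi)\cdot N^{\mathsf{ew}(\Pi)}$.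
   Formalization: Adds ew(Π) > 0 and N ≥ 1 (with ew = 0, q() ← e(x), e'(x) would get time O(1)) and lets the algorithm and the constant in O depend on a bound on the size of a single rule (q(x) ← e_1(x),…,e_m(x) needs about m·N steps although f, |Π|, ew, fcghw are all 1). *)

theory Defs
  imports Complex_Main
begin

section \<open>Datalog\<close>

text \<open>Predicate symbols, variables and constants are named by natural numbers, so that programs and
  databases can be placed in the memory of the machine defined at the end of this theory.\<close>

datatype trm = Var nat | Cst nat

type_synonym atom = "nat \<times> trm list"
type_synonym fact = "nat \<times> nat list"

datatype rule = Rule (head: atom) (body: "atom list")

type_synonym program = "rule set"

fun vars_trm :: "trm \<Rightarrow> nat set" where
  "vars_trm (Var x) = {x}"
| "vars_trm (Cst c) = {}"

definition vars_list :: "trm list \<Rightarrow> nat set" where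
  "vars_list ts = (\<Union>t\<in>set ts. vars_trm t)"

definition rule_atoms :: "rule \<Rightarrow> atom list" where
  "rule_atoms R = head R # body R"

definition vars_rule :: "rule \<Rightarrow> nat set" where
  "vars_rule R = (\<Union>A\<in>set (rule_atoms R). vars_list (snd A))"

definition rule_size :: "rule \<Rightarrow> nat" where
  "rule_size R = (\<Sum>A\<leftarrow>rule_atoms R. 1 + length (snd A))"

definition preds :: "program \<Rightarrow> nat set" where
  "preds \<Pi> = (\<Union>R\<in>\<Pi>. fst ` set (rule_atoms R))"

definition idb :: "program \<Rightarrow> nat set" where
  "idb \<Pi> = {fst (head R) | R. R \<in> \<Pi> \<and> body R \<noteq> []}"

definition edb :: "program \<Rightarrow> nat set" where
  "edb \<Pi> = preds \<Pi> - idb \<Pi>"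

definition idb_atoms :: "program \<Rightarrow> rule \<Rightarrow> atom list" where
  "idb_atoms \<Pi> R = filter (\<lambda>A. fst A \<in> idb \<Pi>) (body R)"

definition edb_atoms :: "program \<Rightarrow> rule \<Rightarrow> atom list" where
  "edb_atoms \<Pi> R = filter (\<lambda>A. fst A \<notin> idb \<Pi>) (body R)"

text \<open>The usual well-formedness of datalog: finitely many rules, every head variable occurs in the
  body (range restriction), and every predicate symbol is used with one arity.\<close>

definition datalog_program :: "program \<Rightarrow> bool" where
  "datalog_program \<Pi> \<longleftrightarrow>
     finite \<Pi> \<and>
     (\<forall>R\<in>\<Pi>. vars_list (snd (head R)) \<subseteq> (\<Union>A\<in>set (body R). vars_list (snd A))) \<and>
     (\<exists>ar. \<forall>R\<in>\<Pi>. \<forall>A\<in>set (rule_atoms R). length (snd A) = ar (fst A))"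

definition linear_program :: "program \<Rightarrow> bool" where
  "linear_program \<Pi> \<longleftrightarrow> (\<forall>R\<in>\<Pi>. length (idb_atoms \<Pi> R) \<le> 1)"

definition db_instance :: "program \<Rightarrow> fact set \<Rightarrow> bool" where
  "db_instance \<Pi> D \<longleftrightarrow>
     finite D \<and> fst ` D \<subseteq> edb \<Pi> \<and>
     (\<forall>(p, t)\<in>D. \<forall>R\<in>\<Pi>. \<forall>A\<in>set (rule_atoms R). fst A = p \<longrightarrow> length (snd A) = length t)"

fun ground_trm :: "(nat \<Rightarrow> nat) \<Rightarrow> trm \<Rightarrow> nat" where
  "ground_trm \<theta> (Var x) = \<theta> x"
| "ground_trm \<theta> (Cst c) = c"

definition ground_atom :: "(nat \<Rightarrow> nat) \<Rightarrow> atom \<Rightarrow> fact" where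
  "ground_atom \<theta> A = (fst A, map (ground_trm \<theta>) (snd A))"

definition immediate_consequence :: "program \<Rightarrow> fact set \<Rightarrow> fact set \<Rightarrow> fact set" where
  "immediate_consequence \<Pi> D I =
     D \<union> {ground_atom \<theta> (head R) | \<theta> R. R \<in> \<Pi> \<and> (\<forall>A\<in>set (body R). ground_atom \<theta> A \<in> I)}"

definition least_fixpoint :: "program \<Rightarrow> fact set \<Rightarrow> fact set" where
  "least_fixpoint \<Pi> D = lfp (immediate_consequence \<Pi> D)"

text \<open>For an EDB predicate this is its relation in \<open>D\<close> together with the facts for it (rules
  with empty body) that \<open>\<Pi>\<close> itself may contain.\<close>

definition derived_relation :: "program \<Rightarrow> fact set \<Rightarrow> nat \<Rightarrow> nat list set" where
  "derived_relation \<Pi> D p = {t. (p, t) \<in> least_fixpoint \<Pi> D}"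

section \<open>Fractional edge covers\<close>

text \<open>Minimum weight of a fractional cover of the vertices \<open>X\<close> by the hyperedges
  \<open>e i\<close>, \<open>i \<in> I\<close>. Whenever some cover exists the infimum is attained. Capping weights at 1
  never changes the optimum.\<close>

definition fractional_cover_number :: "nat set \<Rightarrow> 'i set \<Rightarrow> ('i \<Rightarrow> nat set) \<Rightarrow> real" where
  "fractional_cover_number X I e =
     Inf {(\<Sum>i\<in>I. x i) | x :: 'i \<Rightarrow> real.
            (\<forall>i\<in>I. 0 \<le> x i \<and> x i \<le> 1) \<and> (\<forall>v\<in>X. 1 \<le> (\<Sum>i\<in>{i\<in>I. v \<in> e i}. x i))}"

section \<open>Free-connex generalized fractional hypertree width\<close>

definition rule_edges :: "rule \<Rightarrow> nat set set" where
  "rule_edges R = (\<lambda>A. vars_list (snd A)) ` set (body R)"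

definition rule_vertices :: "rule \<Rightarrow> nat set" where
  "rule_vertices R = \<Union>(rule_edges R)"

definition rule_out :: "rule \<Rightarrow> nat set" where
  "rule_out R = vars_list (snd (head R))"

definition path_in :: "nat set \<Rightarrow> nat set set \<Rightarrow> nat \<Rightarrow> nat list \<Rightarrow> nat \<Rightarrow> bool" where
  "path_in S E u xs v \<longleftrightarrow>
     xs \<noteq> [] \<and> hd xs = u \<and> last xs = v \<and> distinct xs \<and> set xs \<subseteq> S \<and>
     successively (\<lambda>a b. {a, b} \<in> E) xs"

definition connected_in :: "nat set \<Rightarrow> nat set set \<Rightarrow> bool" where
  "connected_in S E \<longleftrightarrow> (\<forall>u\<in>S. \<forall>v\<in>S. \<exists>xs. path_in S E u xs v)"

definition is_tree :: "nat set \<Rightarrow> nat set set \<Rightarrow> bool" where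
  "is_tree V E \<longleftrightarrow>
     finite V \<and> V \<noteq> {} \<and> E \<subseteq> {{u, v} | u v. u \<in> V \<and> v \<in> V \<and> u \<noteq> v} \<and>
     (\<forall>u\<in>V. \<forall>v\<in>V. \<exists>!xs. path_in V E u xs v)"

definition free_connex_decomposition ::
  "rule \<Rightarrow> nat set \<Rightarrow> nat set set \<Rightarrow> (nat \<Rightarrow> nat set) \<Rightarrow> (nat \<Rightarrow> nat set set) \<Rightarrow> bool" where
  "free_connex_decomposition R V E \<chi> \<Lambda> \<longleftrightarrow>
     is_tree V E \<and>
     (\<Union>p\<in>V. \<chi> p) = rule_vertices R \<and>
     (\<forall>p\<in>V. \<Lambda> p \<subseteq> rule_edges R) \<and>
     (\<forall>e\<in>rule_edges R. \<exists>p\<in>V. e \<subseteq> \<chi> p) \<and>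
     (\<forall>v\<in>rule_vertices R. connected_in {p\<in>V. v \<in> \<chi> p} E) \<and>
     (\<forall>p\<in>V. \<chi> p \<subseteq> \<Union>(\<Lambda> p)) \<and>
     (\<exists>S. S \<noteq> {} \<and> S \<subseteq> V \<and> connected_in S E \<and> (\<Union>p\<in>S. \<chi> p) = rule_out R)"

definition decomposition_width :: "nat set \<Rightarrow> (nat \<Rightarrow> nat set set) \<Rightarrow> real" where
  "decomposition_width V \<Lambda> =
     Max ((\<lambda>p. fractional_cover_number (\<Union>(\<Lambda> p)) (\<Lambda> p) id) ` V)"

text \<open>The infimum is a minimum: a width is determined by a subset of the finitely many subsets of
  \<open>rule_edges R\<close>.\<close>

definition fcghw_rule :: "rule \<Rightarrow> real" where
  "fcghw_rule R =
     Inf {decomposition_width V \<Lambda> | V E \<chi> \<Lambda>. free_connex_decomposition R V E \<chi> \<Lambda>}"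

definition fcghw :: "program \<Rightarrow> real" where
  "fcghw \<Pi> = Max (fcghw_rule ` \<Pi>)"

section \<open>Adornments, edge-cover width\<close>

text \<open>In the body of an adornment \<open>None\<close> stands for \<open>_\<close>. Bodies are sets, which
  identifies repeated atoms and disregards their order.\<close>

type_synonym masked_atom = "nat \<times> trm option list"

datatype adornment =
  Adornment (ad_pred: nat) (ad_args: "trm list") (ad_body: "masked_atom set")

fun subst_trm :: "(nat \<Rightarrow> trm) \<Rightarrow> trm \<Rightarrow> trm" where
  "subst_trm \<sigma> (Var x) = \<sigma> x"
| "subst_trm \<sigma> (Cst c) = Cst c"

definition subst_list :: "(nat \<Rightarrow> trm) \<Rightarrow> trm list \<Rightarrow> trm list" where
  "subst_list \<sigma> = map (subst_trm \<sigma>)"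

definition subst_body :: "(nat \<Rightarrow> trm) \<Rightarrow> masked_atom set \<Rightarrow> masked_atom set" where
  "subst_body \<sigma> B = (\<lambda>(e, us). (e, map (map_option (subst_trm \<sigma>)) us)) ` B"

definition vars_masked :: "masked_atom \<Rightarrow> nat set" where
  "vars_masked A = (\<Union>t\<in>{t. Some t \<in> set (snd A)}. vars_trm t)"

definition vars_adornment :: "adornment \<Rightarrow> nat set" where
  "vars_adornment \<rho> = vars_list (ad_args \<rho>) \<union> (\<Union>A\<in>ad_body \<rho>. vars_masked A)"

definition variant :: "adornment \<Rightarrow> adornment \<Rightarrow> bool" where
  "variant \<rho> \<rho>' \<longleftrightarrow>
     (\<exists>\<pi>. bij \<pi> \<and>
        \<rho>' = Adornment (ad_pred \<rho>) (subst_list (Var \<circ> \<pi>) (ad_args \<rho>)) (subst_body (Var \<circ> \<pi>) (ad_body \<rho>)))"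

definition unifier :: "(nat \<Rightarrow> trm) \<Rightarrow> (trm list \<times> trm list) list \<Rightarrow> bool" where
  "unifier \<sigma> ps \<longleftrightarrow> (\<forall>(ss, ts)\<in>set ps. subst_list \<sigma> ss = subst_list \<sigma> ts)"

definition mgu :: "(nat \<Rightarrow> trm) \<Rightarrow> (trm list \<times> trm list) list \<Rightarrow> bool" where
  "mgu \<sigma> ps \<longleftrightarrow>
     unifier \<sigma> ps \<and> (\<forall>\<theta>. unifier \<theta> ps \<longrightarrow> (\<exists>\<tau>. \<forall>x. \<theta> x = subst_trm \<tau> (\<sigma> x)))"

definition mask :: "trm list \<Rightarrow> trm option \<Rightarrow> trm option" where
  "mask ss u = (case u of None \<Rightarrow> None | Some t \<Rightarrow> if t \<in> set ss then Some t else None)"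

text \<open>Atoms all of whose arguments are \<open>_\<close> are dropped even if no other atom with the same
  predicate symbol is left.\<close>

definition g_out :: "nat \<Rightarrow> trm list \<Rightarrow> masked_atom set \<Rightarrow> adornment" where
  "g_out q ss B =
     (let B' = (\<lambda>(e, us). (e, map (mask ss) us)) ` B
      in Adornment q ss
           {(e, us) \<in> B'. (\<exists>u\<in>set us. u \<noteq> None) \<and>
              \<not> (\<exists>us'. (e, us') \<in> B' \<and> us' \<noteq> us \<and> list_all2 (\<lambda>u u'. u = u' \<or> u = None) us us')})"

text \<open>The adornment \<open>\<rho>\<close> carries its head predicate \<open>q = ad_pred \<rho>\<close> and serves
  itself as the new predicate symbol \<open>q\<^sub>\<rho>\<close>.\<close>

datatype adorned_rule =
  Adorned_Rule (ar_head: "adornment \<times> trm list") (ar_idb: "(adornment \<times> trm list) list")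
    (ar_edb: "atom list")

text \<open>The program \<open>\<Pi>'\<close>. Instead of keeping one representative per renaming class, the set
  contains the rules obtained from every choice of renaming and of mgu; these differ only by
  renaming, and \<open>adornment_count\<close> below counts classes modulo renaming.\<close>

inductive_set adorned_program :: "program \<Rightarrow> adorned_rule set" for \<Pi> :: program where
  adorn: "\<lbrakk> R \<in> \<Pi>; length \<rho>s = length (idb_atoms \<Pi> R); length \<rho>s' = length \<rho>s;
     \<forall>i<length \<rho>s. ad_pred (\<rho>s ! i) = fst (idb_atoms \<Pi> R ! i) \<and>
        (\<exists>r. r \<in> adorned_program \<Pi> \<and> fst (ar_head r) = \<rho>s ! i);
     \<forall>i<length \<rho>s. variant (\<rho>s ! i) (\<rho>s' ! i) \<and> vars_adornment (\<rho>s' ! i) \<inter> vars_rule R = {};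
     \<forall>i<length \<rho>s. \<forall>j<i. vars_adornment (\<rho>s' ! i) \<inter> vars_adornment (\<rho>s' ! j) = {};
     mgu \<sigma> (zip (map snd (idb_atoms \<Pi> R)) (map ad_args \<rho>s'));
     ss = subst_list \<sigma> (snd (head R));
     \<E> = map (\<lambda>(e, ts). (e, subst_list \<sigma> ts)) (edb_atoms \<Pi> R);
     \<rho> = g_out (fst (head R)) ss
           ((\<Union>\<rho>'\<in>set \<rho>s'. subst_body \<sigma> (ad_body \<rho>')) \<union> (\<lambda>(e, ts). (e, map Some ts)) ` set \<E>) \<rbrakk>
   \<Longrightarrow> Adorned_Rule (\<rho>, ss) (zip \<rho>s (map (subst_list \<sigma> \<circ> snd) (idb_atoms \<Pi> R))) \<E>
         \<in> adorned_program \<Pi>"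

definition adornments :: "program \<Rightarrow> adornment set" where
  "adornments \<Pi> = {fst (ar_head r) | r. r \<in> adorned_program \<Pi>}"

definition ew_adornment :: "adornment \<Rightarrow> real" where
  "ew_adornment \<rho> = fractional_cover_number (vars_list (ad_args \<rho>)) (ad_body \<rho>) vars_masked"

text \<open>Both maxima are over finite sets, since there are only finitely many adornments up to renaming;
  the maximum over the empty set is 0. Covering a vertex takes weight at least 1, so \<open>ew \<Pi>\<close> is
  either 0 (no adornment has a variable in its head) or at least 1.\<close>

definition ew :: "program \<Rightarrow> real" where
  "ew \<Pi> = Max (insert 0 (ew_adornment ` adornments \<Pi>))"

definition adornment_count :: "program \<Rightarrow> nat" where
  "adornment_count \<Pi> =
     Max (insert 0 ((\<lambda>q. card ({\<rho> \<in> adornments \<Pi>. ad_pred \<rho> = q} // {(\<rho>, \<rho>'). variant \<rho> \<rho>'})) ` idb \<Pi>))"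

section \<open>Machine model\<close>

text \<open>A unit-cost random access machine, presented as a while language. Its memory consists of
  registers and of zero-initialised arrays: a memory cell is addressed by a list of numbers, and
  accessing it costs 1 plus the length of the address. The only arithmetic is the successor function,
  so that after \<open>t\<close> steps no number exceeds \<open>t\<close> plus the largest number in the program
  text and the input: unit cost is not exploited through long words.\<close>

datatype test = Eq nat nat | Less nat nat

datatype com =
    Set nat nat
  | Copy nat nat
  | Inc nat nat
  | Load nat "nat list"
  | Store "nat list" nat
  | Seq com com
  | If test com com
  | While test com

type_synonym mem = "nat list \<Rightarrow> nat"
type_synonym state = "(nat \<Rightarrow> nat) \<times> mem"

fun holds :: "test \<Rightarrow> (nat \<Rightarrow> nat) \<Rightarrow> bool" where
  "holds (Eq x y) r \<longleftrightarrow> r x = r y"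
| "holds (Less x y) r \<longleftrightarrow> r x < r y"

text \<open>\<open>exec c s t s'\<close>: started in \<open>s\<close>, \<open>c\<close> halts in \<open>s'\<close> after time \<open>t\<close>.\<close>

inductive exec :: "com \<Rightarrow> state \<Rightarrow> nat \<Rightarrow> state \<Rightarrow> bool" where
  exec_Set: "exec (Set x n) (r, m) 1 (r(x := n), m)"
| exec_Copy: "exec (Copy x y) (r, m) 1 (r(x := r y), m)"
| exec_Inc: "exec (Inc x y) (r, m) 1 (r(x := Suc (r y)), m)"
| exec_Load: "exec (Load x ys) (r, m) (1 + length ys) (r(x := m (map r ys)), m)"
| exec_Store: "exec (Store ys x) (r, m) (1 + length ys) (r, m(map r ys := r x))"
| exec_Seq: "exec c1 s t1 s1 \<Longrightarrow> exec c2 s1 t2 s2 \<Longrightarrow> exec (Seq c1 c2) s (t1 + t2) s2"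
| exec_If_true: "holds b (fst s) \<Longrightarrow> exec c1 s t s' \<Longrightarrow> exec (If b c1 c2) s (1 + t) s'"
| exec_If_false: "\<not> holds b (fst s) \<Longrightarrow> exec c2 s t s' \<Longrightarrow> exec (If b c1 c2) s (1 + t) s'"
| exec_While_false: "\<not> holds b (fst s) \<Longrightarrow> exec (While b c) s 1 s"
| exec_While_true: "holds b (fst s) \<Longrightarrow> exec c s t1 s1 \<Longrightarrow> exec (While b c) s1 t2 s2 \<Longrightarrow>
     exec (While b c) s (1 + t1 + t2) s2"

text \<open>Input layout. Array 0 holds the program, given as a list of rules: \<open>[0]\<close> the number of
  rules; \<open>[0, i]\<close> the number of body atoms of rule \<open>i\<close>; for its atom \<open>a\<close> (0 is the
  head), \<open>[0, i, a]\<close> the predicate symbol, \<open>[0, i, a, 0]\<close> the number of arguments,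
  \<open>[0, i, a, k, 0]\<close> the kind of the argument \<open>k\<close> (0 variable, 1 constant) and
  \<open>[0, i, a, k, 1]\<close> its name. Array 1 holds the database: \<open>[1, p]\<close> the number of
  tuples of \<open>p\<close>, \<open>[1, p, j, k]\<close> component \<open>k\<close> of tuple \<open>j\<close>. All other
  cells are 0.\<close>

fun trm_kind :: "trm \<Rightarrow> nat" where
  "trm_kind (Var x) = 0"
| "trm_kind (Cst c) = 1"

fun trm_name :: "trm \<Rightarrow> nat" where
  "trm_name (Var x) = x"
| "trm_name (Cst c) = c"

definition nth_or_0 :: "nat list \<Rightarrow> nat \<Rightarrow> nat" where
  "nth_or_0 xs i = (if i < length xs then xs ! i else 0)"

fun program_mem :: "rule list \<Rightarrow> nat list \<Rightarrow> nat" where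
  "program_mem Rs [] = length Rs"
| "program_mem Rs (i # as) =
     (if i < length Rs then
        (case as of
           [] \<Rightarrow> length (body (Rs ! i))
         | a # ks \<Rightarrow>
             (if a < length (rule_atoms (Rs ! i)) then
                (let (p, ts) = rule_atoms (Rs ! i) ! a in
                 case ks of
                   [] \<Rightarrow> p
                 | [k] \<Rightarrow> (if k = 0 then length ts else 0)
                 | [k, b] \<Rightarrow>
                     (if b = 0 then nth_or_0 (map trm_kind ts) k
                      else if b = 1 then nth_or_0 (map trm_name ts) k else 0)
                 | _ \<Rightarrow> 0)
              else 0))
      else 0)"

fun relation_mem :: "(nat \<Rightarrow> nat list list) \<Rightarrow> nat list \<Rightarrow> nat" where
  "relation_mem T [p] = length (T p)"
| "relation_mem T [p, j, k] = (if j < length (T p) then nth_or_0 (T p ! j) k else 0)"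
| "relation_mem T _ = 0"

definition input_mem :: "rule list \<Rightarrow> (nat \<Rightarrow> nat list list) \<Rightarrow> mem" where
  "input_mem Rs T a =
     (case a of
        [] \<Rightarrow> 0
      | b # as \<Rightarrow> (if b = 0 then program_mem Rs as else if b = 1 then relation_mem T as else 0))"

text \<open>Output layout: relation \<open>q\<close> is listed without repetition in array 2, with its cardinality
  in \<open>[2, q]\<close> and component \<open>k\<close> of tuple \<open>j\<close> in \<open>[2, q, j, k]\<close>.\<close>

definition output_relation :: "mem \<Rightarrow> nat \<Rightarrow> nat list set \<Rightarrow> bool" where
  "output_relation m q X \<longleftrightarrow>
     (\<exists>xs. distinct xs \<and> set xs = X \<and> m [2, q] = length xs \<and>
        (\<forall>j<length xs. \<forall>k<length (xs ! j). m [2, q, j, k] = xs ! j ! k))"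

text \<open>Rules and tuples may be presented in any order.\<close>

definition evaluates_within :: "com \<Rightarrow> program \<Rightarrow> fact set \<Rightarrow> real \<Rightarrow> bool" where
  "evaluates_within c \<Pi> D B \<longleftrightarrow>
     (\<forall>Rs T. distinct Rs \<and> set Rs = \<Pi> \<and>
             (\<forall>p. distinct (T p) \<and> set (T p) = {t. (p, t) \<in> D}) \<longrightarrow>
        (\<exists>t r m. exec c (\<lambda>_. 0, input_mem Rs T) t (r, m) \<and> real t \<le> B \<and>
           (\<forall>q\<in>idb \<Pi>. output_relation m q (derived_relation \<Pi> D q))))"

end

theory Submission
 imports Defs "HOL-Library.Nat_Bijection"
begin

text \<open>
The evaluator is a forward-chaining engine run on a generic query plan. For each rule and each pair
\<open>Y \<subseteq> Z\<close> of sets of its variables it maintains a relation of assignments on \<open>Y\<close> that extend to \<open>Z\<close>, and it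
applies every locally valid step (extension by a variable, projection, join, semijoin) between such
relations. Rules of bounded size have finitely many shapes, so an optimal free-connex decomposition of
each is built into the evaluator. Only its bags are used: \<open>Y\<close> must lie in a bag or among the head
variables. A walk through the tree shows that the pair (head variables, all variables) is reached.

A relation on a subset of a bag is bounded by Hoelder's inequality in the manner of the AGM bound:
an EDB atom with weight \<open>x\<close> contributes the factor \<open>N powr x\<close>. An IDB relation has at most
\<open>f * N powr ew\<close> tuples, because every derived tuple is an instance of an adornment and these are
counted by covers as well. A linear rule has only one IDB atom, whose weight is at most 1 and can be
charged \<open>f * N powr (ew - 1)\<close> beyond the factor \<open>N\<close> of an EDB atom; so each relation of assignments has
at most \<open>f * N powr (ew + fcghw - 1)\<close> elements. Each step scans a smallest bucket of join partners, and
the plan uses joins in which this cost is bounded by the number of assignments as well.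
\<close>

section \<open>A structured language over the machine\<close>

text \<open>A pair of facts is tried only when its later member is popped, and the existence tests
  \<open>needs\<close> look at the buckets as they are at that moment. A test that fails too early
  is never repeated, so a relation may serve as a filter only once it is complete. This dictates the
  schedule: rule facts head the queue, so that every tuple meets them when it is popped; a first run
  completes the assignments of the EDB atoms; only then are the seeds pushed and the recursion
  started by a second run. The filters themselves are forced by the size bound: an assignment on
  \<open>Y\<close> is counted through its agreement with all atoms that share variables with
  \<open>Y\<close>, since the hyperedges covering a bag need not lie inside it. The IDB atom cannot
  be a filter, because its relation is still growing; its variables are therefore bound first, and
  agreement with some IDB tuple is inherited by every later step. Positivity of \<open>ew\<close>
  gives \<open>ew \<ge> 1\<close> and at least one adornment, so that the time for reading the input
  is within the bound too.\<close>

datatype hexp = Reg nat | Num nat | Succ hexp | Cell "hexp list"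

fun heval :: "state => hexp => nat" where
 "heval s (Reg q) = fst s q"
| "heval s (Num n) = n"
| "heval s (Succ e) = Suc (heval s e)"
| "heval s (Cell es) = snd s (map (heval s) es)"

datatype hbexp = HEq hexp hexp | HLess hexp hexp

fun hholds :: "state => hbexp => bool" where
 "hholds s (HEq a b) \<longleftrightarrow> heval s a = heval s b"
| "hholds s (HLess a b) \<longleftrightarrow> heval s a < heval s b"

datatype hcom =
  Assign nat hexp
 | Put "hexp list" hexp
 | Then hcom hcom
 | Cond hbexp hcom hcom
 | Loop hbexp hcom

text \<open>\<open>hexec c s n s'\<close>: \<open>n\<close> is the number of loop iterations; everything between
 two iterations takes constant time.\<close>

inductive hexec :: "hcom => state => nat => state => bool" where
 hexec_Assign: "hexec (Assign q e) s 0 ((fst s)(q := heval s e), snd s)"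
| hexec_Put: "hexec (Put es e) s 0 (fst s, (snd s)(map (heval s) es := heval s e))"
| hexec_Then: "hexec c s n s1 ==> hexec c' s1 n' s2 ==> hexec (Then c c') s (n + n') s2"
| hexec_Cond_true: "hholds s b ==> hexec c s n s' ==> hexec (Cond b c c') s n s'"
| hexec_Cond_false: "~ hholds s b ==> hexec c' s n s' ==> hexec (Cond b c c') s n s'"
| hexec_Loop_false: "~ hholds s b ==> hexec (Loop b c) s 0 s"
| hexec_Loop_true: "hholds s b ==> hexec c s n s1 ==> hexec (Loop b c) s1 n' s2 ==>
   hexec (Loop b c) s (Suc (n + n')) s2"

text \<open>Register \<open>q\<close> of the structured language is machine register \<open>2 * q + 1\<close>; the even
 machine registers hold intermediate values of expressions.\<close>

definition odd_regs :: "(nat => nat) => nat => nat" where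
 "odd_regs r = (%q. r (2 * q + 1))"

text \<open>The depth \<open>d\<close> acts as a stack pointer: the value is left in machine
  register \<open>2 * d\<close>, and only even registers from there on are overwritten, so operands
  evaluated at smaller depths survive. \<open>Copy 0 0\<close> is a no-op.\<close>

fun eval_code :: "nat => hexp => com" and eval_codes :: "nat => hexp list => com" where
 "eval_code d (Reg q) = Copy (2 * d) (2 * q + 1)"
| "eval_code d (Num n) = Set (2 * d) n"
| "eval_code d (Succ e) = Seq (eval_code d e) (Inc (2 * d) (2 * d))"
| "eval_code d (Cell es) = Seq (eval_codes d es) (Load (2 * d) (map (%k. 2 * k) [d..<d + length es]))"
| "eval_codes d [] = Copy 0 0"
| "eval_codes d (e # es) = Seq (eval_code d e) (eval_codes (Suc d) es)"

text \<open>Evaluating an expression never writes to memory, which is why \<open>m\<close> occurs on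
  both sides; \<open>K\<close> is later chosen independently of the state.\<close>

definition runs :: "com => nat => (nat => nat) => mem => ((nat => nat) => bool) => bool" where
 "runs c K r m Q \<longleftrightarrow> (EX t r'. exec c (r, m) t (r', m) & t <= K & Q r')"

lemma runsI: "exec c (r, m) t (r', m) ==> t <= K ==> Q r' ==> runs c K r m Q"
 unfolding runs_def by blast

lemma runs_Seq:
 assumes "runs c K r m Q" "!!r'. Q r' ==> runs c' K' r' m Q'"
 shows "runs (Seq c c') (K + K') r m Q'"
 using assms exec_Seq unfolding runs_def by (meson add_mono)

lemma runs_mono: "runs c K r m Q ==> (!!r'. Q r' ==> Q' r') ==> runs c K r m Q'"
 unfolding runs_def by blast

definition keeps :: "nat => (nat => nat) => (nat => nat) => bool" where
 "keeps d r r' \<longleftrightarrow> (ALL q. (ALL k>=d. q ~= 2 * k) --> r' q = r q)"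

lemma keeps_odd: "keeps d r r' ==> odd_regs r' = odd_regs r"
proof
 assume "keeps d r r'"
 moreover have "2 * q + 1 ~= 2 * k" for q k :: nat by presburger
 ultimately show "odd_regs r' q = odd_regs r q" for q unfolding keeps_def odd_regs_def by blast
qed

lemma eval_code_correct:
 "EX K. ALL r m. runs (eval_code d e) K r m (%r'. r' (2 * d) = heval (odd_regs r, m) e & keeps d r r')"
 "EX K. ALL r m. runs (eval_codes d es) K r m (%r'. (ALL j<length es. r' (2 * (d + j)) = heval (odd_regs r, m) (es ! j)) & keeps d r r')"
proof (induction d e and d es rule: eval_code_eval_codes.induct)
 case (1 d q)
 show ?case unfolding eval_code.simps by (intro exI[of _ 1] allI runsI[OF exec_Copy]) (auto simp: odd_regs_def keeps_def)
next
 case (2 d n)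
 show ?case unfolding eval_code.simps by (intro exI[of _ 1] allI runsI[OF exec_Set]) (auto simp: keeps_def)
next
 case (3 d e)
 then obtain K where K: "!!r m. runs (eval_code d e) K r m (%r'. r' (2 * d) = heval (odd_regs r, m) e & keeps d r r')" by blast
 show ?case unfolding eval_code.simps
  by (intro exI[of _ "K + 1"] allI runs_Seq[OF K] runsI[OF exec_Inc]) (auto simp: keeps_def)
next
 case (4 d es)
 then obtain K where K: "!!r m. runs (eval_codes d es) K r m
   (%r'. (ALL j<length es. r' (2 * (d + j)) = heval (odd_regs r, m) (es ! j)) & keeps d r r')" by blast
 show ?case unfolding eval_code.simps
 proof (intro exI[of _ "K + (1 + length es)"] allI runs_Seq[OF K] runsI[OF exec_Load])
  fix r m r' assume *: "(ALL j<length es. r' (2 * (d + j)) = heval (odd_regs r, m) (es ! j)) & keeps d r r'"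
  hence "map r' (map (%k. 2 * k) [d..<d + length es]) = map (heval (odd_regs r, m)) es" by (intro nth_equalityI) auto
  thus "(r'(2 * d := m (map r' (map (%k. 2 * k) [d..<d + length es])))) (2 * d) = heval (odd_regs r, m) (Cell es) &
    keeps d r (r'(2 * d := m (map r' (map (%k. 2 * k) [d..<d + length es]))))"
   using * by (auto simp: keeps_def simp del: map_map)
 qed simp
next
 case (5 d)
 show ?case unfolding eval_codes.simps by (intro exI[of _ 1] allI runsI[OF exec_Copy]) (auto simp: keeps_def)
next
 case (6 d e es)
 from 6(1) obtain K1 where K1: "!!r m. runs (eval_code d e) K1 r m (%r'. r' (2 * d) = heval (odd_regs r, m) e & keeps d r r')" by blast
 from 6(2) obtain K2 where K2: "!!r m. runs (eval_codes (Suc d) es) K2 r m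
   (%r'. (ALL j<length es. r' (2 * (Suc d + j)) = heval (odd_regs r, m) (es ! j)) & keeps (Suc d) r r')" by blast
 show ?case unfolding eval_codes.simps
 proof (intro exI[of _ "K1 + K2"] allI runs_Seq[OF K1] runs_mono[OF K2])
  fix r m r1 r2 assume 1: "r1 (2 * d) = heval (odd_regs r, m) e & keeps d r r1"
   and 2: "(ALL j<length es. r2 (2 * (Suc d + j)) = heval (odd_regs r1, m) (es ! j)) & keeps (Suc d) r1 r2"
  have "r2 (2 * d) = r1 (2 * d)" using 2 by (simp add: keeps_def)
  hence "ALL j<length (e # es). r2 (2 * (d + j)) = heval (odd_regs r, m) ((e # es) ! j)"
   using 1 2 keeps_odd[of d r r1] by (auto simp: nth_Cons split: nat.split)
  moreover have "keeps d r r2" using 1 2 unfolding keeps_def by (metis Suc_leD)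
  ultimately show "(ALL j<length (e # es). r2 (2 * (d + j)) = heval (odd_regs r, m) ((e # es) ! j)) & keeps d r r2" ..
 qed
qed

lemma eval_codes_odd:
 "EX K. ALL r m. runs (eval_codes 0 es) K r m (%r'. (ALL j<length es. r' (2 * j) = heval (odd_regs r, m) (es ! j)) & odd_regs r' = odd_regs r)"
proof -
 obtain K where K: "!!r m. runs (eval_codes 0 es) K r m
   (%r'. (ALL j<length es. r' (2 * (0 + j)) = heval (odd_regs r, m) (es ! j)) & keeps 0 r r')" using eval_code_correct(2) by blast
 show ?thesis by (intro exI[of _ K] allI runs_mono[OF K]) (auto dest: keeps_odd)
qed

text \<open>Machine tests compare registers only, so both operands are first brought into registers
  0 and 2; \<open>b'\<close> is then a fixed comparison of these two.\<close>

lemma test_correct: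
 "EX c b' K. ALL r m. runs c K r m (%r'. holds b' r' = hholds (odd_regs r, m) b & odd_regs r' = odd_regs r)"
proof -
 obtain e1 e2 b' where b: "!!r s. r 0 = heval s e1 ==> r 2 = heval s e2 ==> holds b' r = hholds s b"
 proof (cases b)
  case (HEq e1 e2)
  thus ?thesis by (intro that[of e1 e2 "Eq 0 2"]) simp
 next
  case (HLess e1 e2)
  thus ?thesis by (intro that[of e1 e2 "Less 0 2"]) simp
 qed
 obtain K where K: "!!r m. runs (eval_codes 0 [e1, e2]) K r m
   (%r'. (ALL j<length [e1, e2]. r' (2 * j) = heval (odd_regs r, m) ([e1, e2] ! j)) & odd_regs r' = odd_regs r)"
  using eval_codes_odd by blast
 show ?thesis
 proof (intro exI[of _ "eval_codes 0 [e1, e2]"] exI[of _ b'] exI[of _ K] allI runs_mono[OF K])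
  fix r m r' assume *: "(ALL j<length [e1, e2]. r' (2 * j) = heval (odd_regs r, m) ([e1, e2] ! j)) & odd_regs r' = odd_regs r"
  hence "r' 0 = heval (odd_regs r, m) e1" "r' 2 = heval (odd_regs r, m) e2"
   using spec[OF conjunct1[OF *], of 0] spec[OF conjunct1[OF *], of 1] by auto
  thus "holds b' r' = hholds (odd_regs r, m) b & odd_regs r' = odd_regs r" using b * by blast
 qed
qed

section \<open>Compilation with overhead linear in the number of loop iterations\<close>

inductive_cases hexec_AssignE: "hexec (Assign q e) s n s'"
inductive_cases hexec_PutE: "hexec (Put es e) s n s'"
inductive_cases hexec_ThenE: "hexec (Then c c') s n s'"
inductive_cases hexec_CondE: "hexec (Cond b c c') s n s'"

text \<open>The even registers of \<open>r\<close> are left arbitrary, so that compiled fragments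
  compose whatever scratch values they leave behind. The \<open>+ 1\<close> pays for code that
  performs no iteration.\<close>

definition simulates :: "hcom => com => nat => bool" where
 "simulates h c K \<longleftrightarrow> (ALL s n s' r. hexec h s n s' --> odd_regs r = fst s -->
   (EX t r'. exec c (r, snd s) t (r', snd s') & odd_regs r' = fst s' & t <= K * (n + 1)))"

lemma simulatesI:
 "(!!s n s' r. hexec h s n s' ==> odd_regs r = fst s ==>
   EX t r'. exec c (r, snd s) t (r', snd s') & odd_regs r' = fst s' & t <= K * (n + 1)) ==> simulates h c K"
 unfolding simulates_def by blast

lemma simulatesE:
 assumes "simulates h c K" "hexec h s n s'" "odd_regs r = fst s"
 obtains t r' where "exec c (r, snd s) t (r', snd s')" "odd_regs r' = fst s'" "t <= K * (n + 1)"
 using assms unfolding simulates_def by blast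

lemma compile: "EX c K. simulates h c K"
proof (induction h)
 case (Assign q e)
 obtain K where K: "!!r m. runs (eval_codes 0 [e]) K r m
   (%r'. (ALL j<length [e]. r' (2 * j) = heval (odd_regs r, m) ([e] ! j)) & odd_regs r' = odd_regs r)" using eval_codes_odd by blast
 show ?case
 proof (rule exI[of _ "Seq (eval_codes 0 [e]) (Copy (2 * q + 1) 0)"], rule exI[of _ "K + 1"], rule simulatesI)
  fix s n s' r assume h: "hexec (Assign q e) s n s'" and r: "odd_regs r = fst s"
  obtain t r' where t: "exec (eval_codes 0 [e]) (r, snd s) t (r', snd s)" "t <= K" "r' 0 = heval s e" "odd_regs r' = fst s"
   using K[of r "snd s"] r unfolding runs_def by auto
  have "odd_regs (r'(2 * q + 1 := r' 0)) = (fst s)(q := heval s e)" using t(3,4) by (auto simp: odd_regs_def fun_eq_iff)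
  thus "EX t r'. exec (Seq (eval_codes 0 [e]) (Copy (2 * q + 1) 0)) (r, snd s) t (r', snd s') &
      odd_regs r' = fst s' & t <= (K + 1) * (n + 1)"
   using exec_Seq[OF t(1) exec_Copy[of "2 * q + 1" 0]] t(2) h
   by (intro exI[of _ "t + 1"] exI[of _ "r'(2 * q + 1 := r' 0)"]) (auto elim!: hexec_AssignE simp del: eval_codes.simps)
 qed
next
 case (Put es e)
 obtain K where K: "!!r m. runs (eval_codes 0 (es @ [e])) K r m
   (%r'. (ALL j<length (es @ [e]). r' (2 * j) = heval (odd_regs r, m) ((es @ [e]) ! j)) & odd_regs r' = odd_regs r)"
  using eval_codes_odd by blast
 let ?ys = "map (%k. 2 * k) [0..<length es]"
 show ?case
 proof (rule exI[of _ "Seq (eval_codes 0 (es @ [e])) (Store ?ys (2 * length es))"], rule exI[of _ "K + (1 + length es)"], rule simulatesI)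
  fix s n s' r assume h: "hexec (Put es e) s n s'" and r: "odd_regs r = fst s"
  obtain t r' where t: "exec (eval_codes 0 (es @ [e])) (r, snd s) t (r', snd s)" "t <= K"
    "ALL j<length (es @ [e]). r' (2 * j) = heval s ((es @ [e]) ! j)" "odd_regs r' = fst s"
   using K[of r "snd s"] r unfolding runs_def by auto
  have 1: "r' (2 * length es) = heval s e" using t(3)[rule_format, of "length es"] by simp
  have 2: "map r' ?ys = map (heval s) es" using t(3) by (intro nth_equalityI) (auto simp: nth_append)
  show "EX t r'. exec (Seq (eval_codes 0 (es @ [e])) (Store ?ys (2 * length es))) (r, snd s) t (r', snd s') &
      odd_regs r' = fst s' & t <= (K + (1 + length es)) * (n + 1)"
   using exec_Seq[OF t(1) exec_Store[of ?ys "2 * length es"]] t(2,4) h unfolding 1 2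
   by (intro exI[of _ "t + (1 + length ?ys)"] exI[of _ r']) (auto elim!: hexec_PutE simp del: eval_codes.simps)
 qed
next
 case (Then h1 h2)
 then obtain c1 K1 c2 K2 where c: "simulates h1 c1 K1" "simulates h2 c2 K2" by blast
 have "simulates (Then h1 h2) (Seq c1 c2) (K1 + K2)"
 proof (rule simulatesI)
  fix s n s' r assume h: "hexec (Then h1 h2) s n s'" and r: "odd_regs r = fst s"
  from h obtain n1 s1 n2 where n: "n = n1 + n2" "hexec h1 s n1 s1" "hexec h2 s1 n2 s'" by (auto elim: hexec_ThenE)
  obtain t r1 where t: "exec c1 (r, snd s) t (r1, snd s1)" "odd_regs r1 = fst s1" "t <= K1 * (n1 + 1)"
   by (rule simulatesE[OF c(1) n(2) r])
  obtain t' r' where t': "exec c2 (r1, snd s1) t' (r', snd s')" "odd_regs r' = fst s'" "t' <= K2 * (n2 + 1)"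
   by (rule simulatesE[OF c(2) n(3) t(2)])
  have "t + t' <= (K1 + K2) * (n + 1)" using t(3) t'(3) n(1) by (simp add: algebra_simps)
  thus "EX t r'. exec (Seq c1 c2) (r, snd s) t (r', snd s') & odd_regs r' = fst s' & t <= (K1 + K2) * (n + 1)"
   using exec_Seq[OF t(1) t'(1)] t'(2) by blast
 qed
 thus ?case by blast
next
 case (Cond b h1 h2)
 then obtain c1 K1 c2 K2 where c: "simulates h1 c1 K1" "simulates h2 c2 K2" by blast
 obtain c0 b' K where b: "!!r m. runs c0 K r m (%r'. holds b' r' = hholds (odd_regs r, m) b & odd_regs r' = odd_regs r)"
  using test_correct by blast
 have "simulates (Cond b h1 h2) (Seq c0 (If b' c1 c2)) (K + 1 + K1 + K2)"
 proof (rule simulatesI)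
  fix s n s' r assume h: "hexec (Cond b h1 h2) s n s'" and r: "odd_regs r = fst s"
  obtain t r1 where t: "exec c0 (r, snd s) t (r1, snd s)" "t <= K" "holds b' r1 = hholds s b" "odd_regs r1 = fst s"
   using b[of r "snd s"] r unfolding runs_def by auto
  obtain t' r' where t': "exec (If b' c1 c2) (r1, snd s) t' (r', snd s')" "odd_regs r' = fst s'" "t' <= 1 + (K1 + K2) * (n + 1)"
  proof (cases "hholds s b")
   case True
   hence "hexec h1 s n s'" using h by (auto elim: hexec_CondE)
   from simulatesE[OF c(1) this t(4)] obtain t' r' where "exec c1 (r1, snd s) t' (r', snd s')" "odd_regs r' = fst s'" "t' <= K1 * (n + 1)" .
   thus ?thesis using exec_If_true[of b' "(r1, snd s)" c1 t' "(r', snd s')" c2] True t(3)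
    by (intro that[of "1 + t'" r']) (auto simp: algebra_simps)
  next
   case False
   hence "hexec h2 s n s'" using h by (auto elim: hexec_CondE)
   from simulatesE[OF c(2) this t(4)] obtain t' r' where "exec c2 (r1, snd s) t' (r', snd s')" "odd_regs r' = fst s'" "t' <= K2 * (n + 1)" .
   thus ?thesis using exec_If_false[of b' "(r1, snd s)" c2 t' "(r', snd s')" c1] False t(3)
    by (intro that[of "1 + t'" r']) (auto simp: algebra_simps)
  qed
  have "t + t' <= (K + 1 + K1 + K2) * (n + 1)" using t(2) t'(3) by (simp add: algebra_simps)
  thus "EX t r'. exec (Seq c0 (If b' c1 c2)) (r, snd s) t (r', snd s') & odd_regs r' = fst s' & t <= (K + 1 + K1 + K2) * (n + 1)"
   using exec_Seq[OF t(1) t'(1)] t'(2) by blast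
 qed
 thus ?case by blast
next
 case (Loop b h)
 then obtain c1 K1 where c: "simulates h c1 K1" by blast
 obtain c0 b' K where b: "!!r m. runs c0 K r m (%r'. holds b' r' = hholds (odd_regs r, m) b & odd_regs r' = odd_regs r)"
  using test_correct by blast
 \<comment> \<open>The machine loop tests registers, so the code that evaluates the condition is run
   before the loop and again at the end of each body.\<close>
 let ?W = "While b' (Seq c1 c0)"
 have W: "EX t r'. exec ?W (r, snd s) t (r', snd s') & odd_regs r' = fst s' & t <= 1 + (1 + K1 + K) * n"
  if "hexec (Loop b h) s n s'" "holds b' r = hholds s b" "odd_regs r = fst s" for s n s' r
  using that
 proof (induction "Loop b h" s n s' arbitrary: r rule: hexec.induct)
  case (hexec_Loop_false s)
  thus ?case using exec_While_false[of b' "(r, snd s)"] by force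
 next
  case (hexec_Loop_true s n s1 n' s2)
  obtain t r1 where t: "exec c1 (r, snd s) t (r1, snd s1)" "odd_regs r1 = fst s1" "t <= K1 * (n + 1)"
   by (rule simulatesE[OF c hexec_Loop_true.hyps(2) hexec_Loop_true.prems(2)])
  obtain u r2 where u: "exec c0 (r1, snd s1) u (r2, snd s1)" "u <= K" "holds b' r2 = hholds s1 b"
   "odd_regs r2 = fst s1" using b[of r1 "snd s1"] t unfolding runs_def by auto
  obtain v r3 where v: "exec ?W (r2, snd s1) v (r3, snd s2)" "odd_regs r3 = fst s2"
   "v <= 1 + (1 + K1 + K) * n'" using hexec_Loop_true.hyps(5)[OF u(3,4)] by blast
  have "exec ?W (r, snd s) (1 + (t + u) + v) (r3, snd s2)"
   using exec_While_true[OF _ exec_Seq[OF t(1) u(1)] v(1)] hexec_Loop_true by simp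
  \<comment> \<open>An iteration that contains \<open>n\<close> inner iterations counts as
    \<open>Suc n\<close>, which pays for \<open>K1 * (n + 1)\<close>.\<close>
  moreover have "1 + (t + u) + v <= 1 + (1 + K1 + K) * Suc (n + n')" using t(3) u(2) v(3) by (simp add: algebra_simps)
  ultimately show ?case using v(2) by blast
 qed
 have "simulates (Loop b h) (Seq c0 ?W) (K + K1 + K + 1)"
 proof (rule simulatesI)
  fix s n s' r assume h: "hexec (Loop b h) s n s'" and r: "odd_regs r = fst s"
  obtain t r1 where t: "exec c0 (r, snd s) t (r1, snd s)" "t <= K" "holds b' r1 = hholds s b" "odd_regs r1 = fst s"
   using b[of r "snd s"] r unfolding runs_def by auto
  obtain t' r' where t': "exec ?W (r1, snd s) t' (r', snd s')" "odd_regs r' = fst s'" "t' <= 1 + (1 + K1 + K) * n" using W[OF h t(3,4)] by blast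
  have "t + t' <= (K + K1 + K + 1) * (n + 1)" using t(2) t'(3) by (simp add: algebra_simps)
  thus "EX t r'. exec (Seq c0 ?W) (r, snd s) t (r', snd s') & odd_regs r' = fst s' & t <= (K + K1 + K + 1) * (n + 1)"
   using exec_Seq[OF t(1) t'(1)] t'(2) by blast
 qed
 thus ?case by blast
qed

text \<open>A total-correctness triple in continuation form: the postcondition also receives the
  iteration count, so that correctness and running time come out of one symbolic execution.\<close>

definition hrun :: "hcom => state => (nat => state => bool) => bool" where
 "hrun c s Q \<longleftrightarrow> (EX n s'. hexec c s n s' & Q n s')"

lemma hrun_mono: "hrun c s Q ==> (!!n s'. Q n s' ==> Q' n s') ==> hrun c s Q'"
 unfolding hrun_def by blast

lemma hrun_Assign: "Q 0 (r(q := heval (r, m) e), m) ==> hrun (Assign q e) (r, m) Q"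
 unfolding hrun_def using hexec_Assign[of q e "(r, m)"] by auto

lemma hrun_Put: "Q 0 (r, m(map (heval (r, m)) es := heval (r, m) e)) ==> hrun (Put es e) (r, m) Q"
 unfolding hrun_def using hexec_Put[of es e "(r, m)"] by auto

lemma hrun_Then: "hrun c s (%n s1. hrun c' s1 (%n' s2. Q (n + n') s2)) ==> hrun (Then c c') s Q"
 unfolding hrun_def using hexec_Then by blast

lemma hrun_Cond: "(hholds s b ==> hrun c s Q) ==> (~ hholds s b ==> hrun c' s Q) ==> hrun (Cond b c c') s Q"
 unfolding hrun_def using hexec_Cond_true hexec_Cond_false by blast

lemma hrun_Loop_false: "~ hholds s b ==> Q 0 s ==> hrun (Loop b c) s Q"
 unfolding hrun_def using hexec_Loop_false by blast

lemma hrun_Loop_true: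
 "hholds s b ==> hrun c s (%n s1. hrun (Loop b c) s1 (%n' s2. Q (Suc (n + n')) s2)) ==> hrun (Loop b c) s Q"
 unfolding hrun_def using hexec_Loop_true by blast


section \<open>Closure under local operations by means of a queue and indexed buckets\<close>

section \<open>A forward-chaining engine\<close>

text \<open>Facts are lists of a fixed length \<open>L\<close>. The engine pops facts from a queue; a popped fact
 \<open>x\<close> is appended to the buckets named by its keys, and then every rule is tried: \<open>y\<close>
 ranges over a smallest one of the buckets at \<open>addrs\<close>, and the result is pushed unless the queue
 has contained it before. Expressions may refer to cells that the engine never changes: the
 program in array 0 and the table in array 7.\<close>

datatype oexp = XArg nat | YArg nat | Lit nat | Static bool "oexp list"

fun oeval :: "mem => nat list => nat list => oexp => nat" where
 "oeval st x y (XArg k) = nth_or_0 x k"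
| "oeval st x y (YArg k) = nth_or_0 y k"
| "oeval st x y (Lit n) = n"
| "oeval st x y (Static b es) = st ((if b then 7 else 0) # map (oeval st x y) es)"

text \<open>\<open>guard\<close> and \<open>addrs\<close> are evaluated on the popped fact
  \<open>x\<close> alone, \<open>tests\<close> and \<open>result\<close> on the pair. The entries of
  \<open>needs\<close> address buckets that only have to be nonempty: an existence test against a
  whole relation in constant time.\<close>

datatype eop = Op (guard: "(oexp \<times> oexp) list") (addrs: "oexp list list")
 (tests: "(oexp \<times> oexp) list") (needs: "oexp list list") (result: "oexp list")

definition eqs :: "mem => nat list => nat list => (oexp \<times> oexp) list => bool" where
 "eqs st x y es \<longleftrightarrow> (ALL (a, b):set es. oeval st x y a = oeval st x y b)"

definition keys :: "mem => ((oexp \<times> oexp) list \<times> oexp list) list => nat list => nat list list" where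
 "keys st ks x = map (%(g, a). map (oeval st x x) a) (filter (%(g, a). eqs st x x g) ks)"

definition bucket :: "(nat list => nat list list) => nat list list => nat => nat list => nat list" where
 "bucket kf Q h a = filter (%j. a \<in> set (kf (Q ! j))) [0..<h]"

definition fires :: "mem => (nat list => nat list) => nat list => nat list => eop => bool" where
 "fires st be x y p \<longleftrightarrow> eqs st x y (tests p) & (ALL a:set (needs p). be (map (oeval st x y) a) ~= [])"

text \<open>The bound \<open>Suc k\<close> says that operations see the buckets as they are when
  \<open>Q ! k\<close> is popped, with that fact already filed. Only one address is guaranteed to
  have been scanned, namely that of a smallest bucket, hence the existential.\<close>

definition closed_upto :: "mem => (nat list => nat list list) => eop list => nat list list => nat => bool" where
 "closed_upto st kf ops Q h \<longleftrightarrow> (ALL k<h. ALL p:set ops. eqs st (Q ! k) (Q ! k) (guard p) -->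
   (EX a:set (addrs p). ALL j:set (bucket kf Q (Suc k) (map (oeval st (Q ! k) (Q ! k)) a)).
    fires st (bucket kf Q (Suc k)) (Q ! k) (Q ! j) p -->
     map (oeval st (Q ! k) (Q ! j)) (result p) \<in> set Q))"

definition sound_set :: "mem => (nat list => nat list list) => eop list => nat list set => bool" where
 "sound_set st kf ops V \<longleftrightarrow> (ALL p:set ops. ALL x:V. ALL y:V. ALL a:set (addrs p).
   eqs st x x (guard p) --> map (oeval st x x) a \<in> set (kf y) --> eqs st x y (tests p) -->
   (ALL c:set (needs p). EX z:V. map (oeval st x y) c \<in> set (kf z)) -->
   map (oeval st x y) (result p) \<in> V)"

text \<open>Scanning the buckets in parallel until one is exhausted takes as many rounds as the
  smallest has entries; measuring them in the final set \<open>V\<close> makes the cost independent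
  of the order of the queue.\<close>

definition op_cost :: "mem => (nat list => nat list list) => nat list set => nat list => eop => nat" where
 "op_cost st kf V x p = (if eqs st x x (guard p)
   then Min ((%a. card {y \<in> V. map (oeval st x x) a \<in> set (kf y)}) ` set (addrs p)) else 0)"

definition outputs :: "nat => nat list list => nat list list" where
 "outputs p Q = filter (%z. z ! 0 = 0 & z ! 1 = p) Q"

subsection \<open>Memory layout\<close>

definition rg :: "nat => nat => nat" where
 "rg t k = prod_encode (t, k)"

lemma rg_eq [simp]: "rg t k = rg t' k' \<longleftrightarrow> t = t' & k = k'"
 unfolding rg_def by (simp add: prod_encode_eq)

lemma rg_in_image [simp]: "rg t k \<in> rg t' ` S \<longleftrightarrow> t = t' & k \<in> S"
 by (auto simp: image_iff)

text \<open>Registers \<open>rg 1 k\<close>, \<open>rg 2 k\<close> and \<open>rg 3 k\<close> hold the facts \<open>x\<close>,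
 \<open>y\<close> and the result. Array 2 is the output, array 3 the membership table of the queue, array 5
 the queue; arrays 10 and 11 hold the length and the entries of the buckets.\<close>

abbreviation "rHead == rg 0 0"
abbreviation "rTail == rg 0 6"
abbreviation "rIdx == rg 0 2"
abbreviation "rMin == rg 0 3"
abbreviation "rY == rg 0 4"
abbreviation "rCnt == rg 0 5"

text \<open>The queue is never shortened: popped facts stay in \<open>Q\<close>, and the head
  position is kept outside this invariant. Registers of \<open>x\<close> and \<open>y\<close> beyond
  \<open>L\<close> are 0 so that reading them agrees with \<open>nth_or_0\<close>. Arrays 0, 1, 7
  and 9 form the static part, compared with \<open>st\<close>.\<close>

definition rep :: "mem => nat => (nat list => nat list) => nat list list => state => bool" where
 "rep st L be Q s \<longleftrightarrow> distinct Q & (ALL z:set Q. length z = L) & fst s rTail = length Q &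
   (ALL k>=L. fst s (rg 1 k) = 0 & fst s (rg 2 k) = 0) &
   (ALL j<length Q. ALL k<L. snd s [5, j, k] = Q ! j ! k) &
   (ALL z. length z = L --> snd s (3 # z) = (if z \<in> set Q then 1 else 0)) &
   (ALL a. snd s (10 # a) = length (be a) & (ALL j<length (be a). snd s (11 # j # a) = be a ! j)) &
   (ALL p. snd s [2, p] = length (outputs p Q) &
    (ALL j<length (outputs p Q). ALL k. k + 3 < L --> snd s [2, p, j, k] = outputs p Q ! j ! (k + 3))) &
   (ALL c a. c \<in> {0, 1, 7, 9} --> snd s (c # a) = st (c # a))"

definition holds_fact :: "nat => nat list => state => bool" where
 "holds_fact t x s \<longleftrightarrow> (ALL k. fst s (rg t k) = nth_or_0 x k)"

text \<open>\<open>t\<close> is the register bank read for \<open>YArg\<close>: 2 while a candidate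
  \<open>y\<close> is loaded, 1 where only \<open>x\<close> is at hand, matching
  \<open>oeval\<close> with \<open>y = x\<close>.\<close>

fun code :: "nat => oexp => hexp" where
 "code t (XArg k) = Reg (rg 1 k)"
| "code t (YArg k) = Reg (rg t k)"
| "code t (Lit n) = Num n"
| "code t (Static b es) = Cell (Num (if b then 7 else 0) # map (code t) es)"

lemma heval_code:
 assumes "rep st L be Q s" "holds_fact 1 x s" "holds_fact t y s"
 shows "heval s (code t e) = oeval st x y e"
proof (induction e)
 case (Static b es)
 have "map (heval s) (map (code t) es) = map (oeval st x y) es"
  using Static by simp
 moreover have "snd s (c # a) = st (c # a)" if "c \<in> {0, 1, 7, 9}" for c a
  using assms(1) that unfolding rep_def by blast
 ultimately show ?case by (simp del: map_map)
qed (use assms in \<open>auto simp: holds_fact_def\<close>)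

lemma map_heval_code:
 assumes "rep st L be Q s" "holds_fact 1 x s" "holds_fact t y s"
 shows "map (heval s) (map (code t) es) = map (oeval st x y) es"
 using heval_code[OF assms] by simp

fun hregs :: "hexp => nat set" where
 "hregs (Reg q) = {q}"
| "hregs (Num n) = {}"
| "hregs (Succ e) = hregs e"
| "hregs (Cell es) = (UN e:set es. hregs e)"

lemma heval_cong: "(!!q. q \<in> hregs e ==> r q = r' q) ==> heval (r, m) e = heval (r', m) e"
proof (induction e)
 case (Cell es)
 hence "map (heval (r, m)) es = map (heval (r', m)) es" by auto
 thus ?case by (simp only: heval.simps snd_conv)
qed auto

lemma hregs_code: "hregs (code t e) <= range (rg 1) Un range (rg t)"
 by (induction e) auto

subsection \<open>Straight-line code\<close>

definition skip :: hcom where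
 "skip = Assign 0 (Reg 0)"

lemma hrun_skip: "Q 0 s ==> hrun skip s Q"
 unfolding skip_def by (cases s) (auto intro!: hrun_Assign)

fun conds :: "nat => (oexp \<times> oexp) list => hcom => hcom" where
 "conds t [] c = c"
| "conds t ((a, b) # gs) c = Cond (HEq (code t a) (code t b)) (conds t gs c) skip"

lemma hrun_conds:
 assumes "rep st L be Q s" "holds_fact 1 x s" "holds_fact t y s"
  and "eqs st x y gs ==> hrun c s P" "~ eqs st x y gs ==> P 0 s"
 shows "hrun (conds t gs c) s P"
 using assms(4,5)
proof (induction gs)
 case (Cons g gs)
 obtain a b where g: "g = (a, b)" by (cases g)
 show ?case unfolding g conds.simps
  by (rule hrun_Cond)
   (use Cons g in \<open>auto simp: heval_code[OF assms(1-3)] eqs_def intro!: hrun_skip\<close>)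
qed (simp add: eqs_def)

fun nonempties :: "oexp list list => hcom => hcom" where
 "nonempties [] c = c"
| "nonempties (a # as) c = Cond (HLess (Num 0) (Cell (Num 10 # map (code 2) a))) (nonempties as c) skip"

lemma hrun_nonempties:
 assumes "rep st L be Q s" "holds_fact 1 x s" "holds_fact 2 y s"
  and "(ALL a:set as. be (map (oeval st x y) a) ~= []) ==> hrun c s P"
    "~ (ALL a:set as. be (map (oeval st x y) a) ~= []) ==> P 0 s"
 shows "hrun (nonempties as c) s P"
 using assms(4,5)
proof (induction as)
 case (Cons a as)
 have "heval s (Cell (Num 10 # map (code 2) a)) = length (be (map (oeval st x y) a))"
  using map_heval_code[OF assms(1-3), of a] assms(1) by (simp add: rep_def del: map_map)
 hence *: "hholds s (HLess (Num 0) (Cell (Num 10 # map (code 2) a))) \<longleftrightarrow> be (map (oeval st x y) a) ~= []"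
  by (simp del: heval.simps(4))
 show ?case unfolding nonempties.simps
  by (rule hrun_Cond) (use Cons * in \<open>auto intro!: hrun_skip\<close>)
qed simp

fun assigns :: "nat => nat => hexp list => hcom" where
 "assigns t k [] = skip"
| "assigns t k (e # es) = Then (Assign (rg t k) e) (assigns t (Suc k) es)"

text \<open>No expression reads the bank being written, so the assignments made one after another
  act like a simultaneous one.\<close>

lemma hrun_assigns:
 assumes "ALL e:set es. hregs e Int range (rg t) = {}"
  and "!!r'. (ALL j<length es. r' (rg t (k + j)) = heval (r, m) (es ! j)) ==>
    (ALL q. q \<notin> rg t ` {k..<k + length es} --> r' q = r q) ==> P 0 (r', m)"
 shows "hrun (assigns t k es) (r, m) P"
 using assms
proof (induction es arbitrary: k r P)
 case Nil
 thus ?case by (auto intro!: hrun_skip)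
next
 case (Cons e es)
 let ?r = "r(rg t k := heval (r, m) e)"
 have e: "heval (?r, m) e' = heval (r, m) e'" if "e' \<in> set es" for e'
 proof (intro heval_cong)
  fix q assume "q \<in> hregs e'"
  hence "q ~= rg t k" using Cons.prems(1) that by (metis disjoint_iff list.set_intros(2) rangeI)
  thus "?r q = r q" by simp
 qed
 show ?case unfolding assigns.simps
 proof (rule hrun_Then, rule hrun_Assign, rule Cons.IH)
  fix r' assume 1: "ALL j<length es. r' (rg t (Suc k + j)) = heval (?r, m) (es ! j)"
   and 2: "ALL q. q \<notin> rg t ` {Suc k..<Suc k + length es} --> r' q = ?r q"
  show "P (0 + 0) (r', m)"
  proof (simp, rule Cons.prems(2))
   have "r' (rg t k) = heval (r, m) e" using 2[rule_format, of "rg t k"] by auto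
   thus "ALL j<length (e # es). r' (rg t (k + j)) = heval (r, m) ((e # es) ! j)"
    using 1 e by (auto simp: nth_Cons split: nat.split)
   show "ALL q. q \<notin> rg t ` {k..<k + length (e # es)} --> r' q = r q"
   proof (intro allI impI)
    fix q assume q: "q \<notin> rg t ` {k..<k + length (e # es)}"
    hence "q ~= rg t k" by auto
    moreover have "q \<notin> rg t ` {Suc k..<Suc k + length es}" using q by auto
    ultimately show "r' q = r q" using 2 by simp
   qed
  qed
 qed (use Cons.prems in auto)
qed

fun puts :: "hexp list => nat => nat => hcom" where
 "puts p off 0 = skip"
| "puts p off (Suc n) = Then (puts p off n) (Put (p @ [Num n]) (Reg (rg 3 (n + off))))"

lemma hrun_puts:
 assumes "ALL m'. map (heval (r, m')) p = p'"
  and "P 0 (r, %a. if EX k<n. a = p' @ [k] then r (rg 3 (last a + off)) else m a)"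
 shows "hrun (puts p off n) (r, m) P"
 using assms(2)
proof (induction n arbitrary: P)
 case 0
 thus ?case by (auto intro!: hrun_skip)
next
 case (Suc n)
 show ?case unfolding puts.simps
 proof (rule hrun_Then, rule Suc.IH, rule hrun_Put)
  have "(%a. if EX k<n. a = p' @ [k] then r (rg 3 (last a + off)) else m a)(p' @ [n] := r (rg 3 (n + off)))
   = (%a. if EX k<Suc n. a = p' @ [k] then r (rg 3 (last a + off)) else m a)"
   by (auto simp: fun_eq_iff less_Suc_eq)
  thus "P (0 + 0) (r, (%a. if EX k<n. a = p' @ [k] then r (rg 3 (last a + off)) else m a)
   (map (heval (r, %a. if EX k<n. a = p' @ [k] then r (rg 3 (last a + off)) else m a)) (p @ [Num n]) :=
    heval (r, %a. if EX k<n. a = p' @ [k] then r (rg 3 (last a + off)) else m a) (Reg (rg 3 (n + off)))))"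
   using Suc.prems assms(1) by simp
 qed
qed

definition add_output :: "nat => hcom" where
 "add_output L = Cond (HEq (Reg (rg 3 0)) (Num 0))
   (Then (Assign rCnt (Cell [Num 2, Reg (rg 3 1)]))
   (Then (puts [Num 2, Reg (rg 3 1), Reg rCnt] 3 (L - 3)) (Put [Num 2, Reg (rg 3 1)] (Succ (Reg rCnt))))) skip"

definition store :: "nat => hcom" where
 "store L = Then (Put (Num 3 # map (%k. Reg (rg 3 k)) [0..<L]) (Num 1))
   (Then (puts [Num 5, Reg rTail] 0 L) (Then (add_output L) (Assign rTail (Succ (Reg rTail)))))"

definition push :: "nat => hexp list => hcom" where
 "push L es = Then (assigns 3 0 es)
   (Cond (HEq (Cell (Num 3 # map (%k. Reg (rg 3 k)) [0..<L])) (Num 0)) (store L) skip)"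

definition enqueue :: "nat list list => nat list => nat list list" where
 "enqueue Q z = (if z \<in> set Q then Q else Q @ [z])"

lemma outputs_append: "outputs p (Q @ [z]) = outputs p Q @ (if z ! 0 = 0 & z ! 1 = p then [z] else [])"
 by (simp add: outputs_def)

text \<open>Array 3 is addressed by the fact itself, so the duplicate test is a single access; the
  whole code is free of loops and takes 0 iterations.\<close>

lemma hrun_push:
 assumes R: "rep st L be Q (r, m)" and L: "4 <= L" and len: "length es = L"
  and regs: "ALL e:set es. hregs e Int range (rg 3) = {}"
  and P: "!!r' m'. rep st L be (enqueue Q (map (heval (r, m)) es)) (r', m') ==>
   (ALL q. q \<notin> range (rg 3) Un {rTail, rCnt} --> r' q = r q) ==> P 0 (r', m')"
 shows "hrun (push L es) (r, m) P"
 unfolding push_def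
proof (rule hrun_Then, rule hrun_assigns[OF regs])
 fix r1 assume r1: "ALL j<length es. r1 (rg 3 (0 + j)) = heval (r, m) (es ! j)"
  "ALL q. q \<notin> rg 3 ` {0..<0 + length es} --> r1 q = r q"
 let ?z = "map (heval (r, m)) es" and ?Z = "map (%k. Reg (rg 3 k)) [0..<L]"
 let ?n = "length Q"
 have lz: "length ?z = L" using len by simp
 have zk: "r1 (rg 3 k) = ?z ! k" if "k < L" for k using r1(1) that len by simp
 have Z: "map (heval (r1, m')) ?Z = ?z" for m'
  using zk len by (intro nth_equalityI) auto
 have tail: "r1 rTail = ?n" using r1(2) R by (auto simp: rep_def)
 have "r1 (rg t k) = r (rg t k)" if "t ~= 3" for t k
  using r1(2)[rule_format, of "rg t k"] that by auto
 hence R1: "rep st L be Q (r1, m)"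
  using R unfolding rep_def by simp
 have mz: "m (3 # ?z) = (if ?z \<in> set Q then 1 else 0)" using R lz by (auto simp: rep_def)
 have frame1: "ALL q. q \<notin> range (rg 3) Un {rTail, rCnt} --> r1 q = r q" using r1(2) by auto
 show "hrun (Cond (HEq (Cell (Num 3 # ?Z)) (Num 0)) (store L) skip) (r1, m) (%n'. P (0 + n'))"
 proof (rule hrun_Cond)
  assume "~ hholds (r1, m) (HEq (Cell (Num 3 # ?Z)) (Num 0))"
  hence "?z \<in> set Q" using mz Z[of m] by (auto simp del: map_map split: if_splits)
  thus "hrun skip (r1, m) (%n'. P (0 + n'))"
   using P[of r1 m] R1 frame1 by (auto intro!: hrun_skip simp: enqueue_def)
 next
  assume "hholds (r1, m) (HEq (Cell (Num 3 # ?Z)) (Num 0))"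
  hence zQ: "?z \<notin> set Q" using mz Z[of m] by (auto simp del: map_map split: if_splits)
  \<comment> \<open>\<open>m1\<close> to \<open>m4\<close> are the memories after the successive
    writes to the membership table, the queue, the output tuple and the output counter.\<close>
  define m1 where "m1 = m(3 # ?z := 1)"
  define m2 where "m2 = (%a. if EX k<L. a = [5, ?n] @ [k] then r1 (rg 3 (last a + 0)) else m1 a)"
  let ?p = "?z ! 1"
  let ?c = "length (outputs ?p Q)"
  define m3 where "m3 = (%a. if EX k<L - 3. a = [2, ?p, ?c] @ [k] then r1 (rg 3 (last a + 3)) else m2 a)"
  define m4 where "m4 = m3([2, ?p] := Suc ?c)"
  have m2p: "m2 [2, ?p] = ?c" using R by (auto simp: m2_def m1_def rep_def)
  have enq: "enqueue Q ?z = Q @ [?z]" using zQ by (simp add: enqueue_def)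
  have fin: "P 0 (r', m')" if r': "r' rTail = Suc ?n" "ALL q. q ~= rTail --> q ~= rCnt --> r' q = r1 q"
   and m': "m' = (if ?z ! 0 = 0 then m4 else m2)" for r' m'
  proof (rule P)
   show "ALL q. q \<notin> range (rg 3) Un {rTail, rCnt} --> r' q = r q" using frame1 r'(2) by auto
   have o: "m' (c # b) = m (c # b)" if "c \<in> {0, 1, 7, 9, 10, 11}" for c b
   proof -
    have "c ~= 2" "c ~= 3" "c ~= 5" using that by auto
    thus ?thesis unfolding m' m4_def m3_def m2_def m1_def by simp
   qed
   have q5: "m' [5, j, k] = (Q @ [?z]) ! j ! k" if "j < Suc ?n" "k < L" for j k
    using that R zk by (auto simp: m' m4_def m3_def m2_def m1_def rep_def nth_append less_Suc_eq)
   have q3: "m' (3 # z) = (if z \<in> set (Q @ [?z]) then 1 else 0)" if "length z = L" for z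
    using that R by (auto simp: m' m4_def m3_def m2_def m1_def rep_def)
   have q2: "m' [2, p] = length (outputs p (Q @ [?z]))" for p
    using R by (auto simp: m' m4_def m3_def m2_def m1_def rep_def outputs_append)
   have q2': "m' [2, p, j, k] = outputs p (Q @ [?z]) ! j ! (k + 3)"
    if "j < length (outputs p (Q @ [?z]))" "k + 3 < L" for p j k
    using that R zk by (auto simp: m' m4_def m3_def m2_def m1_def rep_def outputs_append nth_append less_Suc_eq
      split: if_splits)
   show "rep st L be (enqueue Q ?z) (r', m')"
    unfolding enq rep_def
   proof (intro conjI)
    show "distinct (Q @ [?z])" using R zQ by (simp add: rep_def)
    show "ALL z:set (Q @ [?z]). length z = L" using R lz by (auto simp: rep_def)
    show "ALL k>=L. fst (r', m') (rg 1 k) = 0 & fst (r', m') (rg 2 k) = 0"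
     using R1 r' by (simp add: rep_def)
    show "ALL a. snd (r', m') (10 # a) = length (be a) &
      (ALL j<length (be a). snd (r', m') (11 # j # a) = be a ! j)"
     using R o by (simp add: rep_def)
    have "ALL c a. c \<in> {0, 1, 7, 9} --> m (c # a) = st (c # a)" using R by (simp add: rep_def)
    thus "ALL c a. c \<in> {0, 1, 7, 9} --> snd (r', m') (c # a) = st (c # a)"
     using o by simp
   qed (use r' q5 q3 q2 q2' in auto)
  qed
  show "hrun (store L) (r1, m) (%n'. P (0 + n'))"
   unfolding store_def
  proof (rule hrun_Then, rule hrun_Put, rule hrun_Then, rule hrun_puts)
   show "ALL m'. map (heval (r1, m')) [Num 5, Reg rTail] = [5, ?n]" using tail by simp
   have e: "m(map (heval (r1, m)) (Num 3 # ?Z) := heval (r1, m) (Num 1)) = m1"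
    using Z[of m] by (simp add: m1_def del: map_map)
   show "hrun (Then (add_output L) (Assign rTail (Succ (Reg rTail))))
    (r1, %a. if EX k<L. a = [5, ?n] @ [k] then r1 (rg 3 (last a + 0))
      else (m(map (heval (r1, m)) (Num 3 # ?Z) := heval (r1, m) (Num 1))) a)
    (%n' s2. P (0 + (0 + (0 + n'))) s2)"
    unfolding e m2_def[symmetric] add_output_def
   proof (rule hrun_Then, rule hrun_Cond)
    assume "~ hholds (r1, m2) (HEq (Reg (rg 3 0)) (Num 0))"
    hence "?z ! 0 ~= 0" using zk[of 0] L by simp
    thus "hrun skip (r1, m2) (%n s1. hrun (Assign rTail (Succ (Reg rTail))) s1
      (%n' s2. P (0 + (0 + (0 + (n + n')))) s2))"
     using tail by (intro hrun_skip hrun_Assign) (auto intro!: fin)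
   next
    assume "hholds (r1, m2) (HEq (Reg (rg 3 0)) (Num 0))"
    hence z0: "?z ! 0 = 0" using zk[of 0] L by simp
    have z1: "r1 (rg 3 1) = ?p" using zk[of 1] L by simp
    have c: "heval (r1, m2) (Cell [Num 2, Reg (rg 3 1)]) = ?c" using m2p z1 by simp
    show "hrun (Then (Assign rCnt (Cell [Num 2, Reg (rg 3 1)]))
     (Then (puts [Num 2, Reg (rg 3 1), Reg rCnt] 3 (L - 3))
        (Put [Num 2, Reg (rg 3 1)] (Succ (Reg rCnt))))) (r1, m2)
     (%n s1. hrun (Assign rTail (Succ (Reg rTail))) s1
      (%n' s2. P (0 + (0 + (0 + (n + n')))) s2))"
    proof (rule hrun_Then, rule hrun_Assign, unfold c, rule hrun_Then, rule hrun_puts)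
     show "ALL m'. map (heval (r1(rCnt := ?c), m')) [Num 2, Reg (rg 3 1), Reg rCnt] = [2, ?p, ?c]"
      using z1 by simp
     have e3: "(%a. if EX k<L - 3. a = [2, ?p, ?c] @ [k] then (r1(rCnt := ?c)) (rg 3 (last a + 3)) else m2 a) = m3"
      unfolding m3_def by (intro ext) auto
     show "hrun (Put [Num 2, Reg (rg 3 1)] (Succ (Reg rCnt)))
      (r1(rCnt := ?c), %a. if EX k<L - 3. a = [2, ?p, ?c] @ [k] then (r1(rCnt := ?c)) (rg 3 (last a + 3)) else m2 a)
      (%n' s2. hrun (Assign rTail (Succ (Reg rTail))) s2
       (%n'a s2. P (0 + (0 + (0 + (0 + (0 + n') + n'a)))) s2))"
      unfolding e3 using z1 z0 tail
      by (intro hrun_Put hrun_Assign) (auto intro!: fin simp: m4_def)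
    qed
   qed
  qed
 qed
qed


lemma rep_length: "rep st L be Q s ==> z \<in> set Q ==> length z = L"
 by (simp add: rep_def)

lemma holds_fact_load:
 assumes "rep st L be Q (r, m)" "j < length Q" "t = 1 | t = 2"
  and "ALL k<L. r' (rg t k) = m [5, j, k]" "ALL q. q \<notin> rg t ` {0..<L} --> r' q = r q"
 shows "holds_fact t (Q ! j) (r', m')"
proof -
 have "length (Q ! j) = L" using assms(1,2) by (auto simp: rep_def)
 moreover have "r' (rg t k) = 0" if "k >= L" for k
 proof -
  have "rg t k \<notin> rg t ` {0..<L}" using that by auto
  hence "r' (rg t k) = r (rg t k)" using assms(5) by blast
  thus ?thesis using assms(1,3) that unfolding rep_def by auto
 qed
 moreover have "r' (rg t k) = Q ! j ! k" if "k < L" for k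
  using assms(1,2,4) that unfolding rep_def by auto
 ultimately show ?thesis unfolding holds_fact_def nth_or_0_def by (auto simp: not_less)
qed

lemma rep_regs:
 assumes "rep st L be Q (r, m)" "r' rTail = r rTail" "ALL k>=L. r' (rg 1 k) = 0 & r' (rg 2 k) = 0"
 shows "rep st L be Q (r', m)"
 using assms unfolding rep_def by simp

definition load :: "nat => nat => nat => hcom" where
 "load t q L = assigns t 0 (map (%k. Cell [Num 5, Reg q, Num k]) [0..<L])"

lemma hrun_load:
 assumes R: "rep st L be Q (r, m)" and j: "r q = j" "j < length Q" and t: "t = 1 | t = 2" "q \<notin> range (rg t)"
  and P: "!!r'. rep st L be Q (r', m) ==> holds_fact t (Q ! j) (r', m) ==> (!!u k. u ~= t ==> r' (rg u k) = r (rg u k)) ==> P 0 (r', m)"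
 shows "hrun (load t q L) (r, m) P"
 unfolding load_def
proof (rule hrun_assigns)
 fix r1 assume "ALL i<length (map (%k. Cell [Num 5, Reg q, Num k]) [0..<L]). r1 (rg t (0 + i)) =
    heval (r, m) (map (%k. Cell [Num 5, Reg q, Num k]) [0..<L] ! i)"
  "ALL q'. q' \<notin> rg t ` {0..<0 + length (map (%k. Cell [Num 5, Reg q, Num k]) [0..<L])} --> r1 q' = r q'"
 hence r1: "ALL k<L. r1 (rg t k) = m [5, j, k]" "ALL q. q \<notin> rg t ` {0..<L} --> r1 q = r q" using j(1) by auto
 have X: "holds_fact t (Q ! j) (r1, m)" by (rule holds_fact_load[OF R j(2) t(1) r1])
 have o: "r1 (rg u k) = r (rg u k)" if "u ~= t" for u k using r1(2)[rule_format, of "rg u k"] that by auto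
 have "length (Q ! j) = L" using rep_length[OF R] j(2) by simp
 hence "ALL k>=L. r1 (rg 1 k) = 0 & r1 (rg 2 k) = 0"
  using R X o t(1) by (auto simp: rep_def holds_fact_def nth_or_0_def)
 hence "rep st L be Q (r1, m)" using o[of 0 6] t(1) by (intro rep_regs[OF R]) auto
 thus "P 0 (r1, m)" using X o by (rule P)
qed (use t(2) in auto)

subsection \<open>Trying one rule\<close>

definition candidate :: "nat => eop => oexp list => hcom" where
 "candidate L p a = Then (Assign rY (Cell (Num 11 # Reg rIdx # map (code 1) a)))
   (Then (load 2 rY L)
    (conds 2 (tests p) (nonempties (needs p) (push L (map (code 2) (result p))))))"

fun seqs :: "hcom list => hcom" where
 "seqs [] = skip"
| "seqs (c # cs) = Then c (seqs cs)"

fun min_counts :: "oexp list list => hcom" where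
 "min_counts [] = skip"
| "min_counts (a # as) = Then (Cond (HLess (Cell (Num 10 # map (code 1) a)) (Reg rMin))
   (Assign rMin (Cell (Num 10 # map (code 1) a))) skip) (min_counts as)"

text \<open>The buckets are scanned in parallel; when a smallest one is exhausted, one of them has been
 seen completely.\<close>

definition scan :: "nat => eop => hcom" where
 "scan L p = Loop (HLess (Reg rIdx) (Reg rMin))
   (Then (seqs (map (candidate L p) (addrs p))) (Assign rIdx (Succ (Reg rIdx))))"

definition op_code :: "nat => eop => hcom" where
 "op_code L p = conds 1 (guard p) (Then (Assign rMin (Cell (Num 10 # map (code 1) (hd (addrs p)))))
   (Then (min_counts (tl (addrs p))) (Then (Assign rIdx (Num 0)) (scan L p))))"

definition frame :: "state => state => bool" where
 "frame s s' \<longleftrightarrow> fst s' rHead = fst s rHead & (ALL k. fst s' (rg 1 k) = fst s (rg 1 k))"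

lemma frame_refl [simp]: "frame s s"
 by (simp add: frame_def)

lemma frame_trans: "frame s s' ==> frame s' s'' ==> frame s s''"
 by (simp add: frame_def)

lemma frame_holds: "frame s s' ==> holds_fact 1 x s ==> holds_fact 1 x s'"
 by (simp add: frame_def holds_fact_def)

text \<open>One operation applied to one popped fact \<open>x\<close>. \<open>Q0\<close> is the
  queue at the moment of popping; buckets hold positions in \<open>Q0\<close> and stay fixed while
  the operation appends to the queue, so a scan is not disturbed by its own results.\<close>

locale engine_step =
 fixes st :: mem and L :: nat and be :: "nat list => nat list" and p :: eop and x :: "nat list"
  and V :: "nat list set" and kf :: "nat list => nat list list" and Q0 :: "nat list list"
 assumes L: "4 <= L" and len_result: "length (result p) = L"
  and x: "x \<in> V"
  and bucket_lt: "!!a j. j \<in> set (be a) ==> j < length Q0"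
  and bucket_key: "!!a j. j \<in> set (be a) ==> a \<in> set (kf (Q0 ! j))"
  and sound: "sound_set st kf [p] V"
begin

definition extends :: "nat list list => nat list list => bool" where
 "extends Q Q' \<longleftrightarrow> (EX zs. Q' = Q @ zs) & set Q' <= V"

lemma extends_trans: "extends Q Q' ==> extends Q' Q'' ==> extends Q Q''"
 unfolding extends_def by auto

lemma extends_mono: "extends Q Q' ==> set Q <= set Q'"
 unfolding extends_def by auto

definition addr :: "oexp list => nat list" where
 "addr a = map (oeval st x x) a"

text \<open>Monotone in the queue, so what has been achieved for one candidate is not undone by
  later pushes.\<close>

definition finished :: "nat list list => nat => bool" where
 "finished Q j \<longleftrightarrow> (fires st be x (Q0 ! j) p --> map (oeval st x (Q0 ! j)) (result p) \<in> set Q)"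

lemma hrun_candidate:
 assumes R: "rep st L be Q (r, m)" and X: "holds_fact 1 x (r, m)" and E: "extends Q0 Q"
  and a: "a \<in> set (addrs p)" and g: "eqs st x x (guard p)" and j: "r rIdx < length (be (addr a))"
  and P: "!!Q' r' m'. rep st L be Q' (r', m') ==> extends Q Q' ==> frame (r, m) (r', m') ==>
   r' rIdx = r rIdx ==> r' rMin = r rMin ==> finished Q' (be (addr a) ! r rIdx) ==> P 0 (r', m')"
 shows "hrun (candidate L p a) (r, m) P"
 unfolding candidate_def
proof (rule hrun_Then, rule hrun_Assign, rule hrun_Then)
 let ?j = "be (addr a) ! r rIdx"
 have jin: "?j \<in> set (be (addr a))" using j by simp
 hence jl: "?j < length Q0" "addr a \<in> set (kf (Q0 ! ?j))" using bucket_lt bucket_key by auto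
 obtain zs where zs: "Q = Q0 @ zs" "set Q <= V" using E unfolding extends_def by auto
 have jQ: "?j < length Q" "Q ! ?j = Q0 ! ?j" using jl zs by (auto simp: nth_append)
 have yV: "Q0 ! ?j \<in> V" using jQ zs(2) nth_mem by (metis subsetD)
 have "map (heval (r, m)) (map (code 1) a) = addr a"
  using map_heval_code[OF R X X] unfolding addr_def .
 hence ev: "heval (r, m) (Cell (Num 11 # Reg rIdx # map (code 1) a)) = ?j"
  using R j by (simp add: rep_def del: map_map)
 have R0: "rep st L be Q (r(rY := ?j), m)" using R by (intro rep_regs[OF R]) (auto simp: rep_def)
 show "hrun (load 2 rY L) (r(rY := heval (r, m) (Cell (Num 11 # Reg rIdx # map (code 1) a))), m)
  (%n s1. hrun (conds 2 (tests p) (nonempties (needs p) (push L (map (code 2) (result p))))) s1 (%n'. P (0 + (n + n'))))"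
  unfolding ev
 proof (rule hrun_load[OF R0 _ jQ(1)])
 fix r1 assume R1: "rep st L be Q (r1, m)" and "holds_fact 2 (Q ! ?j) (r1, m)"
  and r1: "!!u k. u ~= 2 ==> r1 (rg u k) = (r(rY := ?j)) (rg u k)"
 hence Y: "holds_fact 2 (Q0 ! ?j) (r1, m)" using jQ(2) by simp
 have r1o: "r1 (rg t k) = r (rg t k)" if "t ~= 2" "rg t k ~= rY" for t k using r1[of t k] that by auto
 have X1: "holds_fact 1 x (r1, m)" using X r1o by (simp add: holds_fact_def)
 have F1: "frame (r, m) (r1, m)" using r1o by (simp add: frame_def)
 have skipP: "P 0 (r1, m)" if "~ fires st be x (Q0 ! ?j) p"
  using P[OF R1 _ F1] that r1o zs(2) by (auto simp: extends_def finished_def)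
 show "hrun (conds 2 (tests p) (nonempties (needs p) (push L (map (code 2) (result p))))) (r1, m)
   (%n'. P (0 + (0 + n')))"
 proof (simp, rule hrun_conds[OF R1 X1 Y])
  assume t: "eqs st x (Q0 ! ?j) (tests p)"
  show "hrun (nonempties (needs p) (push L (map (code 2) (result p)))) (r1, m) P"
  proof (rule hrun_nonempties[OF R1 X1 Y])
   assume ne: "ALL c:set (needs p). be (map (oeval st x (Q0 ! ?j)) c) ~= []"
   let ?z = "map (oeval st x (Q0 ! ?j)) (result p)"
   have "EX z:V. map (oeval st x (Q0 ! ?j)) c \<in> set (kf z)" if "c \<in> set (needs p)" for c
   proof -
    from ne that obtain i where i: "i \<in> set (be (map (oeval st x (Q0 ! ?j)) c))"
     using list.set_sel(1) by blast
    hence "Q0 ! i \<in> V" using bucket_lt[OF i] zs by auto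
    thus ?thesis using bucket_key[OF i] by auto
   qed
   hence zV: "?z \<in> V"
    using sound[unfolded sound_set_def, rule_format, of p x "Q0 ! ?j" a] x yV a g jl(2) t
    unfolding addr_def by simp
   have e: "map (heval (r1, m)) (map (code 2) (result p)) = ?z"
    using map_heval_code[OF R1 X1 Y] .
   show "hrun (push L (map (code 2) (result p))) (r1, m) P"
   proof (rule hrun_push[OF R1 L], unfold e)
    show "length (map (code 2) (result p)) = L" by (simp add: len_result)
    show "ALL e:set (map (code 2) (result p)). hregs e Int range (rg 3) = {}"
     using hregs_code[of 2] by fastforce
    fix r' m' assume R': "rep st L be (enqueue Q ?z) (r', m')"
     and r': "ALL q. q \<notin> range (rg 3) Un {rTail, rCnt} --> r' q = r1 q"
    have o: "r' (rg t k) = r1 (rg t k)" if "t ~= 3" "rg t k ~= rTail" "rg t k ~= rCnt" for t k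
     using r'[rule_format, of "rg t k"] that by auto
    show "P 0 (r', m')"
    proof (rule P[OF R'])
     show "extends Q (enqueue Q ?z)" using zs(2) zV by (auto simp: extends_def enqueue_def)
     show "frame (r, m) (r', m')" using F1 o by (auto simp: frame_def)
     show "finished (enqueue Q ?z) ?j" by (auto simp: finished_def enqueue_def)
    qed (use o r1o in auto)
   qed
  next
   assume "~ (ALL c:set (needs p). be (map (oeval st x (Q0 ! ?j)) c) ~= [])"
   thus "P 0 (r1, m)" by (intro skipP) (auto simp: fires_def)
  qed
 next
  assume "~ eqs st x (Q0 ! ?j) (tests p)"
  thus "P 0 (r1, m)" by (intro skipP) (auto simp: fires_def)
 qed
 qed auto
qed

lemma hrun_candidates:
 assumes R: "rep st L be Q (r, m)" and X: "holds_fact 1 x (r, m)" and E: "extends Q0 Q"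
  and a: "set as <= set (addrs p)" and g: "eqs st x x (guard p)"
  and j: "ALL a:set as. r rIdx < length (be (addr a))"
  and P: "!!Q' r' m'. rep st L be Q' (r', m') ==> extends Q Q' ==> frame (r, m) (r', m') ==>
   r' rIdx = r rIdx ==> r' rMin = r rMin ==> ALL a:set as. finished Q' (be (addr a) ! r rIdx) ==> P 0 (r', m')"
 shows "hrun (seqs (map (candidate L p) as)) (r, m) P"
 using assms
proof (induction as arbitrary: Q r m P)
 case Nil
 have "extends Q Q" using Nil(3) by (auto simp: extends_def)
 thus ?case using Nil(1,7) by (auto intro!: hrun_skip)
next
 case (Cons a as)
 show ?case unfolding seqs.simps list.map
 proof (rule hrun_Then, rule hrun_candidate[OF Cons.prems(1-3)])
  fix Q1 r1 m1 assume 1: "rep st L be Q1 (r1, m1)" "extends Q Q1" "frame (r, m) (r1, m1)"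
   "r1 rIdx = r rIdx" "r1 rMin = r rMin" "finished Q1 (be (addr a) ! r rIdx)"
  show "hrun (seqs (map (candidate L p) as)) (r1, m1) (%n'. P (0 + n'))"
  proof (rule Cons.IH[OF 1(1)])
   fix Q' r' m' assume 2: "rep st L be Q' (r', m')" "extends Q1 Q'" "frame (r1, m1) (r', m')"
    "r' rIdx = r1 rIdx" "r' rMin = r1 rMin" "ALL a:set as. finished Q' (be (addr a) ! r1 rIdx)"
   show "P (0 + 0) (r', m')"
    unfolding add_0
   proof (rule Cons.prems(7))
    show "ALL a:set (a # as). finished Q' (be (addr a) ! r rIdx)"
     using 1(4,6) 2(6) extends_mono[OF 2(2)] by (auto simp: finished_def)
    show "extends Q Q'" by (rule extends_trans[OF 1(2) 2(2)])
    show "frame (r, m) (r', m')" by (rule frame_trans[OF 1(3) 2(3)])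
   qed (use 1(4,5) 2(1,4,5) in simp_all)
  next
   show "holds_fact 1 x (r1, m1)" by (rule frame_holds[OF 1(3) Cons.prems(2)])
   show "extends Q0 Q1" by (rule extends_trans[OF Cons.prems(3) 1(2)])
   show "set as <= set (addrs p)" using Cons.prems(4) by simp
   show "ALL a:set as. r1 rIdx < length (be (addr a))" using Cons.prems(6) 1(4) by simp
  qed (rule Cons.prems(5))
 next
  show "a \<in> set (addrs p)" using Cons.prems(4) by simp
  show "r rIdx < length (be (addr a))" using Cons.prems(6) by simp
 qed (rule Cons.prems(5))
qed

lemma hrun_min_counts:
 assumes R: "rep st L be Q (r, m)" and X: "holds_fact 1 x (r, m)"
  and P: "!!r'. rep st L be Q (r', m) ==> frame (r, m) (r', m) ==>
   r' rMin = Min (insert (r rMin) ((%a. length (be (addr a))) ` set as)) ==> P 0 (r', m)"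
 shows "hrun (min_counts as) (r, m) P"
 using assms
proof (induction as arbitrary: r P)
 case Nil
 thus ?case by (auto intro!: hrun_skip)
next
 case (Cons a as)
 let ?e = "Cell (Num 10 # map (code 1) a)"
 have "map (heval (r, m)) (map (code 1) a) = addr a"
  using map_heval_code[OF Cons.prems(1,2,2)] unfolding addr_def .
 hence ev: "heval (r, m) ?e = length (be (addr a))"
  using Cons.prems(1) by (simp add: rep_def del: map_map)
 let ?c = "length (be (addr a))"
 let ?r = "r(rMin := min (r rMin) ?c)"
 have *: "hrun (min_counts as) (?r, m) (%n'. P (0 + n'))"
 proof (rule Cons.IH)
  show "rep st L be Q (?r, m)" using Cons.prems(1) by (intro rep_regs[OF Cons.prems(1)]) (auto simp: rep_def)
  show "holds_fact 1 x (?r, m)" using Cons.prems(2) by (simp add: holds_fact_def)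
  fix r' assume 2: "rep st L be Q (r', m)" "frame (?r, m) (r', m)"
   "r' rMin = Min (insert (?r rMin) ((%a. length (be (addr a))) ` set as))"
  show "P (0 + 0) (r', m)" unfolding add_0
  proof (rule Cons.prems(3)[OF 2(1)])
   show "frame (r, m) (r', m)" using 2(2) by (simp add: frame_def)
   have "Min (insert (min a b) S) = Min (insert a (insert b S))" if "finite S" for a b :: nat and S
    by (cases "S = {}") (auto simp: that min.assoc)
   thus "r' rMin = Min (insert (r rMin) ((%a. length (be (addr a))) ` set (a # as)))"
    using 2(3) by simp
  qed
 qed
 show ?case unfolding min_counts.simps
 proof (rule hrun_Then, rule hrun_Cond)
  assume "hholds (r, m) (HLess ?e (Reg rMin))"
  hence "?c < r rMin" using ev by (simp del: heval.simps(4))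
  hence "r(rMin := heval (r, m) ?e) = ?r" unfolding ev by simp
  thus "hrun (Assign rMin ?e) (r, m) (%n s1. hrun (min_counts as) s1 (%n'. P (n + n')))"
   using * by (intro hrun_Assign) simp
 next
  assume "~ hholds (r, m) (HLess ?e (Reg rMin))"
  hence "~ ?c < r rMin" using ev by (simp del: heval.simps(4))
  hence "?r = r" by (auto simp: fun_eq_iff)
  thus "hrun skip (r, m) (%n s1. hrun (min_counts as) s1 (%n'. P (n + n')))"
   using * by (intro hrun_skip) simp
 qed
qed

text \<open>All buckets have at least \<open>rMin\<close> entries, so position \<open>rIdx\<close>
  exists in each of them while the loop runs. The rounds left, \<open>rMin - rIdx\<close>, serve
  both as induction measure and as iteration count.\<close>

lemma hrun_scan:
 assumes R: "rep st L be Q (r, m)" and X: "holds_fact 1 x (r, m)" and E: "extends Q0 Q"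
  and g: "eqs st x x (guard p)" and min: "ALL a:set (addrs p). r rMin <= length (be (addr a))"
  and idx: "r rIdx <= r rMin"
  and don: "ALL a:set (addrs p). ALL i<r rIdx. finished Q (be (addr a) ! i)"
  and P: "!!Q' r' m'. rep st L be Q' (r', m') ==> extends Q Q' ==> frame (r, m) (r', m') ==>
   ALL a:set (addrs p). ALL i<r rMin. finished Q' (be (addr a) ! i) ==> P (r rMin - r rIdx) (r', m')"
 shows "hrun (scan L p) (r, m) P"
 using assms
proof (induction "r rMin - r rIdx" arbitrary: Q r m P)
 case 0
 hence "~ hholds (r, m) (HLess (Reg rIdx) (Reg rMin))" by simp
 moreover have "P 0 (r, m)"
 proof -
  have "extends Q Q" using 0(4) by (auto simp: extends_def)
  thus ?thesis using 0(9)[OF 0(2)] 0(1,7,8) by simp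
 qed
 ultimately show ?case unfolding scan_def by (rule hrun_Loop_false)
next
 case (Suc d)
 hence lt: "r rIdx < r rMin" by linarith
 show ?case unfolding scan_def
 proof (rule hrun_Loop_true, simp add: lt, rule hrun_Then, rule hrun_candidates[OF Suc.prems(1-3) _ Suc.prems(4)])
  show "ALL a:set (addrs p). r rIdx < length (be (addr a))" using lt Suc.prems(5) by fastforce
  fix Q1 r1 m1 assume 1: "rep st L be Q1 (r1, m1)" "extends Q Q1" "frame (r, m) (r1, m1)"
   "r1 rIdx = r rIdx" "r1 rMin = r rMin" "ALL a:set (addrs p). finished Q1 (be (addr a) ! r rIdx)"
  let ?r = "r1(rIdx := Suc (r rIdx))"
  have "hrun (scan L p) (?r, m1) (%n'. P (Suc n'))"
  proof (rule Suc.hyps(1))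
   show "d = ?r rMin - ?r rIdx" using Suc.hyps(2) 1(5) by simp
   show "rep st L be Q1 (?r, m1)" using 1(1) by (intro rep_regs[OF 1(1)]) (auto simp: rep_def)
   show "holds_fact 1 x (?r, m1)" using frame_holds[OF 1(3) Suc.prems(2)] by (simp add: holds_fact_def)
   show "extends Q0 Q1" using extends_trans[OF Suc.prems(3) 1(2)] .
   show "ALL a:set (addrs p). ?r rMin <= length (be (addr a))" using Suc.prems(5) 1(5) by simp
   show "?r rIdx <= ?r rMin" using lt 1(5) by simp
   show "ALL a:set (addrs p). ALL i<?r rIdx. finished Q1 (be (addr a) ! i)"
    using Suc.prems(7) 1(6) extends_mono[OF 1(2)] by (auto simp: less_Suc_eq finished_def)
   fix Q' r' m' assume 2: "rep st L be Q' (r', m')" "extends Q1 Q'" "frame (?r, m1) (r', m')"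
    "ALL a:set (addrs p). ALL i<?r rMin. finished Q' (be (addr a) ! i)"
   have "P (r rMin - r rIdx) (r', m')"
   proof (rule Suc.prems(8)[OF 2(1)])
    show "extends Q Q'" using extends_trans 1(2) 2(2) by blast
    show "frame (r, m) (r', m')" using 1(3) 2(3) by (simp add: frame_def)
   qed (use 2(4) 1(5) in simp)
   moreover have "r rMin - r rIdx = Suc (?r rMin - ?r rIdx)" using lt 1(5) by simp
   ultimately show "P (Suc (?r rMin - ?r rIdx)) (r', m')" by simp
  qed (use Suc.prems in auto)
  thus "hrun (Assign rIdx (Succ (Reg rIdx))) (r1, m1)
    (%n' s2. hrun (Loop (HLess (Reg rIdx) (Reg rMin))
     (Then (seqs (map (candidate L p) (addrs p))) (Assign rIdx (Succ (Reg rIdx))))) s2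
      (%n'a s2. P (Suc (0 + n' + n'a)) s2))"
   unfolding scan_def[symmetric] using 1(4) by (intro hrun_Assign) simp
 qed (use Suc.prems in auto)
qed

lemma hrun_op:
 assumes R: "rep st L be Q (r, m)" and X: "holds_fact 1 x (r, m)" and E: "extends Q0 Q"
  and ne: "addrs p ~= []"
  and P: "!!n Q' r' m'. rep st L be Q' (r', m') ==> extends Q Q' ==> frame (r, m) (r', m') ==>
   (eqs st x x (guard p) ==> (EX a:set (addrs p). ALL j:set (be (addr a)). finished Q' j) &
     n = Min ((%a. length (be (addr a))) ` set (addrs p))) ==>
   (~ eqs st x x (guard p) ==> n = 0) ==> P n (r', m')"
 shows "hrun (op_code L p) (r, m) P"
 unfolding op_code_def
proof (rule hrun_conds[OF R X X])
 assume "~ eqs st x x (guard p)"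
 moreover have "extends Q Q" using E by (auto simp: extends_def)
 ultimately show "P 0 (r, m)" using P[OF R] by simp
next
 assume g: "eqs st x x (guard p)"
 obtain a0 as where as: "addrs p = a0 # as" using ne by (cases "addrs p") auto
 let ?e = "Cell (Num 10 # map (code 1) (hd (addrs p)))"
 have "map (heval (r, m)) (map (code 1) a0) = addr a0"
  using map_heval_code[OF R X X] unfolding addr_def .
 hence ev: "heval (r, m) ?e = length (be (addr a0))"
  using R as by (simp add: rep_def del: map_map)
 let ?r = "r(rMin := length (be (addr a0)))"
 have R1: "rep st L be Q (?r, m)" using R by (intro rep_regs[OF R]) (auto simp: rep_def)
 have X1: "holds_fact 1 x (?r, m)" using X by (simp add: holds_fact_def)
 let ?M = "Min ((%a. length (be (addr a))) ` set (addrs p))"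
 show "hrun (Then (Assign rMin ?e)
   (Then (min_counts (tl (addrs p))) (Then (Assign rIdx (Num 0)) (scan L p)))) (r, m) P"
 proof (rule hrun_Then, rule hrun_Assign, unfold ev, rule hrun_Then, rule hrun_min_counts[OF R1 X1],
   rule hrun_Then, rule hrun_Assign)
  fix r1 assume 1: "rep st L be Q (r1, m)" "frame (?r, m) (r1, m)"
   "r1 rMin = Min (insert (?r rMin) ((%a. length (be (addr a))) ` set (tl (addrs p))))"
  have M: "r1 rMin = ?M" using 1(3) as by simp
  let ?r2 = "r1(rIdx := heval (r1, m) (Num 0))"
  show "hrun (scan L p) (?r2, m)
     (%n' s2. P (0 + (0 + (0 + n'))) s2)"
  proof (rule hrun_scan)
   show "rep st L be Q (?r2, m)" using 1(1) by (intro rep_regs[OF 1(1)]) (auto simp: rep_def)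
   show "holds_fact 1 x (?r2, m)" using frame_holds[OF 1(2) X1] by (simp add: holds_fact_def)
   show "ALL a:set (addrs p). ?r2 rMin <= length (be (addr a))" using M by simp
   fix Q' r' m' assume 2: "rep st L be Q' (r', m')" "extends Q Q'" "frame (?r2, m) (r', m')"
    "ALL a:set (addrs p). ALL i<?r2 rMin. finished Q' (be (addr a) ! i)"
   show "P (0 + (0 + (0 + (?r2 rMin - ?r2 rIdx)))) (r', m')"
   proof (simp, rule P[OF 2(1,2)])
    show "frame (r, m) (r', m')" using 1(2) 2(3) by (simp add: frame_def)
    have "?M \<in> (%a. length (be (addr a))) ` set (addrs p)" using ne by (intro Min_in) auto
    \<comment> \<open>A bucket of minimal length has been scanned to its end when the index reaches
      the minimum.\<close>
    then obtain a where a: "a \<in> set (addrs p)" "length (be (addr a)) = ?M" by auto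
    have "ALL j:set (be (addr a)). finished Q' j"
    proof
     fix j assume "j \<in> set (be (addr a))"
     then obtain i where "i < ?M" "j = be (addr a) ! i" using a(2) by (metis in_set_conv_nth)
     thus "finished Q' j" using 2(4) a(1) M by simp
    qed
    thus "(EX a:set (addrs p). ALL j:set (be (addr a)). finished Q' j) & r1 rMin = ?M"
     using a M by auto
   qed (use g in auto)
  qed (use E g in auto)
 qed
qed

end

subsection \<open>The main loop\<close>

fun append_code :: "((oexp \<times> oexp) list \<times> oexp list) list => hcom" where
 "append_code [] = skip"
| "append_code ((g, a) # ks) = Then (conds 1 g
   (Then (Put (Num 11 # Cell (Num 10 # map (code 1) a) # map (code 1) a) (Reg rHead))
      (Put (Num 10 # map (code 1) a) (Succ (Cell (Num 10 # map (code 1) a)))))) (append_code ks)"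

definition add_entry :: "nat => nat list => (nat list => nat list) => nat list => nat list" where
 "add_entry h a be = be(a := be a @ [h])"

text \<open>Filing must not enter a position twice in one bucket, which is why the keys of a fact
  are required to be distinct.\<close>

lemma fold_add_entry:
 "distinct as ==> fold (add_entry h) as be = (%a. be a @ (if a \<in> set as then [h] else []))"
 by (induction as arbitrary: be) (auto simp: add_entry_def fun_eq_iff)

lemma bucket_Suc:
 "bucket kf Q (Suc h) = (%a. bucket kf Q h a @ (if a \<in> set (kf (Q ! h)) then [h] else []))"
 by (auto simp: bucket_def fun_eq_iff)

lemma keys_Cons: "keys st ((g, a) # ks) x =
  (if eqs st x x g then map (oeval st x x) a # keys st ks x else keys st ks x)"
 by (simp add: keys_def)

lemma set_bucket: "j \<in> set (bucket kf Q h a) \<longleftrightarrow> j < h & a \<in> set (kf (Q ! j))"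
 by (auto simp: bucket_def)

lemma rep_append:
 assumes R: "rep st L be Q (r, m)"
 shows "rep st L (add_entry h a be) Q (r, m(11 # m (10 # a) # a := h, 10 # a := Suc (m (10 # a))))"
proof -
 have "m (10 # a) = length (be a)" using R by (simp add: rep_def)
 thus ?thesis using R unfolding rep_def add_entry_def
  by (auto simp: nth_append less_Suc_eq)
qed

lemma hrun_append_code:
 assumes "rep st L be Q (r, m)" "holds_fact 1 x (r, m)"
  and "!!m'. rep st L (fold (add_entry (r rHead)) (keys st ks x) be) Q (r, m') ==> P 0 (r, m')"
 shows "hrun (append_code ks) (r, m) P"
 using assms
proof (induction ks arbitrary: be m P)
 case Nil
 thus ?case by (auto intro!: hrun_skip simp: keys_def)
next
 case (Cons k ks)
 obtain g a where k: "k = (g, a)" by (cases k)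
 let ?A = "map (code 1) a" and ?a = "map (oeval st x x) a"
 have ev: "map (heval (r, m)) ?A = ?a" by (rule map_heval_code[OF Cons.prems(1,2,2)])
 show ?case unfolding k append_code.simps
 proof (rule hrun_Then, rule hrun_conds[OF Cons.prems(1,2,2)])
  assume "~ eqs st x x g"
  thus "hrun (append_code ks) (r, m) (%n'. P (0 + n'))"
   using Cons.prems(3) unfolding k keys_Cons by (intro Cons.IH[OF Cons.prems(1,2)]) simp
 next
  assume g: "eqs st x x g"
  let ?m1 = "m(11 # m (10 # ?a) # ?a := r rHead)"
  let ?m = "m(11 # m (10 # ?a) # ?a := r rHead, 10 # ?a := Suc (m (10 # ?a)))"
  have R1: "rep st L (add_entry (r rHead) ?a be) Q (r, ?m)"
   by (rule rep_append[OF Cons.prems(1)])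
  have e1: "map (heval (r, m)) (Num 11 # Cell (Num 10 # ?A) # ?A) = 11 # m (10 # ?a) # ?a"
   using ev by (simp del: map_map)
  define m1 where "m1 = ?m1"
  have m1: "m1 (c # b) = m (c # b)" if "c ~= 11" for c b using that by (simp add: m1_def)
  \<comment> \<open>Addresses read only the static arrays 0 and 7, so they evaluate alike after the
    write to array 11.\<close>
  have "heval (r, m1) (code 1 e) = heval (r, m) (code 1 e)" for e
  proof (induction e)
   case (Static b es)
   hence E: "map (heval (r, m1)) (map (code 1) es) = map (heval (r, m)) (map (code 1) es)" by simp
   have "heval (r, m1) (code 1 (Static b es)) = m1 ((if b then 7 else 0) # map (heval (r, m1)) (map (code 1) es))"
    by simp
   also have "... = m ((if b then 7 else 0) # map (heval (r, m)) (map (code 1) es))"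
    unfolding E by (rule m1) simp
   finally show ?case by simp
  qed auto
  hence "map (heval (r, m1)) ?A = map (heval (r, m)) ?A" by simp
  hence ev1: "map (heval (r, ?m1)) ?A = ?a" unfolding ev m1_def .
  show "hrun (Then (Put (Num 11 # Cell (Num 10 # ?A) # ?A) (Reg rHead))
      (Put (Num 10 # ?A) (Succ (Cell (Num 10 # ?A))))) (r, m)
    (%n s1. hrun (append_code ks) s1 (%n'. P (n + n')))"
  proof (rule hrun_Then, rule hrun_Put, unfold e1, rule hrun_Put)
   have e: "map (heval (r, m(11 # m (10 # ?a) # ?a := heval (r, m) (Reg rHead)))) (Num 10 # ?A) = 10 # ?a"
    using ev1 by (simp del: map_map)
   have e': "heval (r, m(11 # m (10 # ?a) # ?a := heval (r, m) (Reg rHead))) (Succ (Cell (Num 10 # ?A))) = Suc (m (10 # ?a))"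
    using ev1 by (simp del: map_map)
   show "hrun (append_code ks) (r, m(11 # m (10 # ?a) # ?a := heval (r, m) (Reg rHead),
     map (heval (r, m(11 # m (10 # ?a) # ?a := heval (r, m) (Reg rHead)))) (Num 10 # ?A) :=
     heval (r, m(11 # m (10 # ?a) # ?a := heval (r, m) (Reg rHead))) (Succ (Cell (Num 10 # ?A)))))
     (%n'. P (0 + 0 + n'))"
    unfolding e e'
   proof (simp, rule Cons.IH)
    show "rep st L (add_entry (r rHead) ?a be) Q (r, ?m)" by (rule R1)
    show "holds_fact 1 x (r, ?m)" using Cons.prems(2) by (simp add: holds_fact_def)
    fix m' assume "rep st L (fold (add_entry (r rHead)) (keys st ks x) (add_entry (r rHead) ?a be)) Q (r, m')"
    thus "P 0 (r, m')" using Cons.prems(3) g unfolding k keys_Cons by simp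
   qed
  qed
 qed
qed

definition visit :: "((oexp \<times> oexp) list \<times> oexp list) list => nat => eop list => hcom" where
 "visit ks L ops = Then (append_code ks) (Then (seqs (map (op_code L) ops)) (Assign rHead (Succ (Reg rHead))))"

definition engine :: "nat => ((oexp \<times> oexp) list \<times> oexp list) list => eop list => hcom" where
 "engine L ks ops = Loop (HLess (Reg rHead) (Reg rTail)) (Then (load 1 rHead L) (visit ks L ops))"

lemma card_bucket_le:
 assumes "distinct Q" "set Q <= V" "finite V" "h <= length Q"
 shows "length (bucket kf Q h a) <= card {y \<in> V. a \<in> set (kf y)}"
proof -
 have "length (bucket kf Q h a) = card (set (bucket kf Q h a))"
  by (rule distinct_card[symmetric]) (simp add: bucket_def)
 also have "... = card ((!) Q ` set (bucket kf Q h a))"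
  by (rule card_image[symmetric]) (use assms in \<open>auto simp: inj_on_def bucket_def nth_eq_iff_index_eq\<close>)
 also have "... <= card {y \<in> V. a \<in> set (kf y)}"
  by (rule card_mono) (use assms nth_mem in \<open>fastforce simp: bucket_def\<close>)+
 finally show ?thesis .
qed

text \<open>Buckets are frozen at time \<open>h\<close> while the queue only grows, so an operation
  that has been completed stays completed during the next ones.\<close>

lemma hrun_ops:
 assumes R: "rep st L (bucket kf Q0 h) Q (r, m)" and X: "holds_fact 1 x (r, m)"
  and Q: "EX zs. Q = Q0 @ zs" "set Q <= V" and V: "finite V" "x \<in> V" and L: "4 <= L"
  and h: "h <= length Q0" and S: "sound_set st kf ops V"
  and ops: "ALL p:set ops. length (result p) = L & addrs p ~= []"
  and P: "!!n Q' r' m'. rep st L (bucket kf Q0 h) Q' (r', m') ==> EX zs. Q' = Q @ zs ==> set Q' <= V ==>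
   frame (r, m) (r', m') ==>
   ALL p:set ops. eqs st x x (guard p) --> (EX a:set (addrs p). ALL j:set (bucket kf Q0 h (map (oeval st x x) a)).
     fires st (bucket kf Q0 h) x (Q0 ! j) p --> map (oeval st x (Q0 ! j)) (result p) \<in> set Q') ==>
   n <= (SUM p<-ops. op_cost st kf V x p) ==> P n (r', m')"
 shows "hrun (seqs (map (op_code L) ops)) (r, m) P"
 using R X Q S ops P
proof (induction ops arbitrary: Q r m P)
 case Nil
 thus ?case by (auto intro!: hrun_skip)
next
 case (Cons p ops)
 let ?be = "bucket kf Q0 h"
 have S: "sound_set st kf [p] V" "sound_set st kf ops V"
  using Cons.prems(5) by (auto simp: sound_set_def)
 have d0: "distinct Q0" "set Q0 <= V" using Cons.prems(1,3,4) by (auto simp: rep_def)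
 interpret engine_step st L ?be p x V kf Q0
 proof
  show "length (result p) = L" using Cons.prems(6) by simp
 qed (use L V h S(1) in \<open>auto simp: bucket_def\<close>)
 have E: "extends Q0 Q" using Cons.prems(3,4) by (simp add: extends_def)
 show ?case unfolding seqs.simps list.map
 proof (rule hrun_Then, rule hrun_op[OF Cons.prems(1,2) E])
  show "addrs p ~= []" using Cons.prems(6) by simp
  fix n1 Q1 r1 m1 assume 1: "rep st L ?be Q1 (r1, m1)" "extends Q Q1" "frame (r, m) (r1, m1)"
   "eqs st x x (guard p) ==> (EX a:set (addrs p). ALL j:set (?be (addr a)). finished Q1 j) &
     n1 = Min ((%a. length (?be (addr a))) ` set (addrs p))" "~ eqs st x x (guard p) ==> n1 = 0"
  have E1: "extends Q0 Q1" by (rule extends_trans[OF E 1(2)])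
  have c: "n1 <= op_cost st kf V x p"
  proof (cases "eqs st x x (guard p)")
   case True
   let ?c = "%a. card {y \<in> V. addr a \<in> set (kf y)}"
   have ne: "addrs p ~= []" using Cons.prems(6) by simp
   have "Min (?c ` set (addrs p)) \<in> ?c ` set (addrs p)" using ne by (intro Min_in) auto
   then obtain a where a: "a \<in> set (addrs p)" "Min (?c ` set (addrs p)) = ?c a" by auto
   have "n1 <= length (?be (addr a))" using 1(4)[OF True] a(1) by simp
   also have "... <= ?c a" by (rule card_bucket_le[OF d0 V(1) h])
   finally show ?thesis using True a(2) by (simp add: op_cost_def addr_def)
  qed (use 1(5) in simp)
  show "hrun (seqs (map (op_code L) ops)) (r1, m1) (%n'. P (n1 + n'))"
  proof (rule Cons.IH[OF 1(1)])
   show "holds_fact 1 x (r1, m1)" by (rule frame_holds[OF 1(3) Cons.prems(2)])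
   show "EX zs. Q1 = Q0 @ zs" "set Q1 <= V" using E1 by (auto simp: extends_def)
   fix n' Q' r' m' assume 2: "rep st L ?be Q' (r', m')" "EX zs. Q' = Q1 @ zs" "set Q' <= V"
    "frame (r1, m1) (r', m')" 
    "ALL p:set ops. eqs st x x (guard p) --> (EX a:set (addrs p). ALL j:set (?be (map (oeval st x x) a)).
     fires st ?be x (Q0 ! j) p --> map (oeval st x (Q0 ! j)) (result p) \<in> set Q')"
    "n' <= (SUM p<-ops. op_cost st kf V x p)"
   have sub: "set Q1 <= set Q'" using 2(2) by auto
   show "P (n1 + n') (r', m')"
   proof (rule Cons.prems(7)[OF 2(1)])
    show "EX zs. Q' = Q @ zs" using 1(2) 2(2) by (auto simp: extends_def)
    show "set Q' <= V" by (rule 2(3))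
    show "frame (r, m) (r', m')" by (rule frame_trans[OF 1(3) 2(4)])
    have "eqs st x x (guard p) ==> (EX a:set (addrs p). ALL j:set (?be (map (oeval st x x) a)).
     fires st ?be x (Q0 ! j) p --> map (oeval st x (Q0 ! j)) (result p) \<in> set Q')"
     using 1(4) sub unfolding finished_def addr_def by blast
    thus "ALL p:set (p # ops). eqs st x x (guard p) --> (EX a:set (addrs p). ALL j:set (?be (map (oeval st x x) a)).
     fires st ?be x (Q0 ! j) p --> map (oeval st x (Q0 ! j)) (result p) \<in> set Q')"
     using 2(5) by simp
    show "n1 + n' <= (SUM p<-p # ops. op_cost st kf V x p)" using c 2(6) by simp
   qed
  qed (use S Cons.prems(6) in auto)
 qed
qed

lemma bucket_append: "h <= length Q ==> bucket kf (Q @ zs) h = bucket kf Q h"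
 by (auto simp: bucket_def fun_eq_iff nth_append intro!: filter_cong)

lemma closed_upto_append:
 assumes "closed_upto st kf ops Q h" "h <= length Q"
 shows "closed_upto st kf ops (Q @ zs) h"
 unfolding closed_upto_def
proof (intro allI impI ballI)
 fix k p assume k: "k < h" "p \<in> set ops" "eqs st ((Q @ zs) ! k) ((Q @ zs) ! k) (guard p)"
 have kl: "k < length Q" using k assms by simp
 have b: "bucket kf (Q @ zs) (Suc k) = bucket kf Q (Suc k)" using kl by (intro bucket_append) simp
 have q: "(Q @ zs) ! j = Q ! j" if "j \<in> set (bucket kf Q (Suc k) a)" for j a
  using that kl by (simp add: set_bucket nth_append)
 have q': "(Q @ zs) ! k = Q ! k" using kl by (simp add: nth_append)
 obtain a where "a \<in> set (addrs p)" "ALL j:set (bucket kf Q (Suc k) (map (oeval st (Q ! k) (Q ! k)) a)).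
    fires st (bucket kf Q (Suc k)) (Q ! k) (Q ! j) p -->
     map (oeval st (Q ! k) (Q ! j)) (result p) \<in> set Q"
  using assms(1) k unfolding closed_upto_def q' by blast
 thus "EX a:set (addrs p). ALL j:set (bucket kf (Q @ zs) (Suc k) (map (oeval st ((Q @ zs) ! k) ((Q @ zs) ! k)) a)).
    fires st (bucket kf (Q @ zs) (Suc k)) ((Q @ zs) ! k) ((Q @ zs) ! j) p -->
     map (oeval st ((Q @ zs) ! k) ((Q @ zs) ! j)) (result p) \<in> set (Q @ zs)"
  unfolding b q' using q by (intro bexI[of _ a]) auto
qed

text \<open>The queue has no duplicates and stays inside the finite set \<open>V\<close>, so
  \<open>card V - h\<close> decreases with every pop. Starting from an arbitrary \<open>h\<close>
  allows the engine to be resumed after new facts have been appended to a closed queue.\<close>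

lemma hrun_engine:
 assumes R: "rep st L (bucket (keys st ks) Q h) Q (r, m)" and H: "r rHead = h" "h <= length Q"
  and Q: "set Q <= V" and V: "finite V" and L: "4 <= L" and S: "sound_set st (keys st ks) ops V"
  and ops: "ALL p:set ops. length (result p) = L & addrs p ~= []"
  and D: "ALL x:V. distinct (keys st ks x)" and C: "closed_upto st (keys st ks) ops Q h"
  and P: "!!n Q' r' m'. rep st L (bucket (keys st ks) Q' (length Q')) Q' (r', m') ==> r' rHead = length Q' ==>
   EX zs. Q' = Q @ zs ==> set Q' <= V ==> closed_upto st (keys st ks) ops Q' (length Q') ==>
   n <= (\<Sum>k=h..<length Q'. 1 + (SUM p<-ops. op_cost st (keys st ks) V (Q' ! k) p)) ==> P n (r', m')"
 shows "hrun (engine L ks ops) (r, m) P"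
 using R H Q C P
proof (induction "card V - h" arbitrary: h Q r m P rule: less_induct)
 case less
 let ?kf = "keys st ks"
 have dQ: "distinct Q" and tail: "r rTail = length Q" using less.prems(1) by (auto simp: rep_def)
 show ?case
 proof (cases "h < length Q")
  case False
  hence "h = length Q" using less.prems(3) by simp
  hence "P 0 (r, m)" using less.prems by auto
  moreover have "~ hholds (r, m) (HLess (Reg rHead) (Reg rTail))" using False less.prems(2) tail by simp
  ultimately show ?thesis unfolding engine_def by (intro hrun_Loop_false)
 next
  case True
  let ?x = "Q ! h"
  have xV: "?x \<in> V" using True less.prems(4) by auto
  have cV: "length Q <= card V" using dQ less.prems(4) V by (metis card_mono distinct_card)
  show ?thesis unfolding engine_def
  proof (rule hrun_Loop_true, simp add: True less.prems(2) tail, rule hrun_Then, rule hrun_load[OF less.prems(1,2) True])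
   fix r1 assume R1: "rep st L (bucket ?kf Q h) Q (r1, m)" and X: "holds_fact 1 ?x (r1, m)"
    and r1o: "!!t k. t ~= 1 ==> r1 (rg t k) = r (rg t k)"
   have h1: "r1 rHead = h" using r1o less.prems(2) by simp
   have b: "fold (add_entry (r1 rHead)) (?kf ?x) (bucket ?kf Q h) = bucket ?kf Q (Suc h)"
    using D xV by (simp add: fold_add_entry bucket_Suc h1)
   show "hrun (visit ks L ops) (r1, m) (%n' s2. hrun (Loop (HLess (Reg rHead) (Reg rTail)) (Then (load 1 rHead L) (visit ks L ops)))
      s2 (%n'a s2. P (Suc (0 + n' + n'a)) s2))"
    unfolding engine_def[symmetric] unfolding visit_def
   proof (rule hrun_Then, rule hrun_append_code[OF R1 X], unfold b, rule hrun_Then, rule hrun_ops)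
    fix m2 assume R2: "rep st L (bucket ?kf Q (Suc h)) Q (r1, m2)"
    show "rep st L (bucket ?kf Q (Suc h)) Q (r1, m2)" by (rule R2)
    show "holds_fact 1 ?x (r1, m2)" using X by (simp add: holds_fact_def)
    fix n Q' r' m' assume 2: "rep st L (bucket ?kf Q (Suc h)) Q' (r', m')" "EX zs. Q' = Q @ zs" "set Q' <= V"
     "frame (r1, m2) (r', m')"
     "ALL p:set ops. eqs st ?x ?x (guard p) --> (EX a:set (addrs p). ALL j:set (bucket ?kf Q (Suc h) (map (oeval st ?x ?x) a)).
      fires st (bucket ?kf Q (Suc h)) ?x (Q ! j) p --> map (oeval st ?x (Q ! j)) (result p) \<in> set Q')"
     "n <= (SUM p<-ops. op_cost st ?kf V ?x p)"
    obtain zs where zs: "Q' = Q @ zs" using 2(2) by blast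
    have b': "bucket ?kf Q' (Suc h) = bucket ?kf Q (Suc h)" using zs True by (simp add: bucket_append)
    have x': "Q' ! h = ?x" using zs True by (simp add: nth_append)
    have C1: "closed_upto st ?kf ops Q' (Suc h)"
     unfolding closed_upto_def less_Suc_eq
    proof (intro allI impI ballI, elim disjE)
     fix k p assume k: "k < h" and p: "p \<in> set ops" "eqs st (Q' ! k) (Q' ! k) (guard p)"
     thus "EX a:set (addrs p). ALL j:set (bucket ?kf Q' (Suc k) (map (oeval st (Q' ! k) (Q' ! k)) a)).
       fires st (bucket ?kf Q' (Suc k)) (Q' ! k) (Q' ! j) p -->
       map (oeval st (Q' ! k) (Q' ! j)) (result p) \<in> set Q'"
      using closed_upto_append[OF less.prems(5,3), of zs] unfolding zs[symmetric] closed_upto_def by blast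
    next
     fix k p assume k: "k = h" and p: "p \<in> set ops" "eqs st (Q' ! k) (Q' ! k) (guard p)"
     have "Q' ! j = Q ! j" if "j \<in> set (bucket ?kf Q (Suc h) a)" for j a
      using that zs True by (simp add: set_bucket nth_append)
     thus "EX a:set (addrs p). ALL j:set (bucket ?kf Q' (Suc k) (map (oeval st (Q' ! k) (Q' ! k)) a)).
       fires st (bucket ?kf Q' (Suc k)) (Q' ! k) (Q' ! j) p -->
       map (oeval st (Q' ! k) (Q' ! j)) (result p) \<in> set Q'"
      using 2(5) p unfolding k b' x' by (metis (no_types, lifting))
    qed
    let ?r = "r'(rHead := Suc h)"
    have hh: "r' rHead = h" using 2(4) h1 by (simp add: frame_def)
    have "hrun (engine L ks ops) (?r, m') (%n'. P (Suc (n + n')))"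
    proof (rule less.hyps)
     show "card V - Suc h < card V - h" using True cV by linarith
     show "rep st L (bucket ?kf Q' (Suc h)) Q' (?r, m')" unfolding b'
      using 2(1) by (intro rep_regs[OF 2(1)]) (auto simp: rep_def)
     show "Suc h <= length Q'" using zs True by simp
     fix n' Q'' r'' m'' assume 3: "rep st L (bucket ?kf Q'' (length Q'')) Q'' (r'', m'')" "r'' rHead = length Q''"
      "EX zs. Q'' = Q' @ zs" "set Q'' <= V" "closed_upto st ?kf ops Q'' (length Q'')"
      "n' <= (\<Sum>k=Suc h..<length Q''. 1 + (SUM p<-ops. op_cost st ?kf V (Q'' ! k) p))"
     have hl: "h < length Q''" "Q'' ! h = ?x" using 3(3) zs True by (auto simp: nth_append)
     show "P (Suc (n + n')) (r'', m'')"
     proof (rule less.prems(6)[OF 3(1,2) _ 3(4,5)])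
      show "EX zs. Q'' = Q @ zs" using zs 3(3) by auto
      show "Suc (n + n') <= (\<Sum>k=h..<length Q''. 1 + (SUM p<-ops. op_cost st ?kf V (Q'' ! k) p))"
       using 3(6) 2(6) hl by (simp add: sum.atLeast_Suc_lessThan)
     qed
    qed (use 2(3) C1 in auto)
    thus "hrun (Assign rHead (Succ (Reg rHead))) (r', m')
     (%n' s2. hrun (engine L ks ops) s2 (%n'a s2. P (Suc (0 + (0 + (n + n')) + n'a)) s2))"
     using hh by (intro hrun_Assign) simp
   qed (use xV V L S ops True less.prems(4) in auto)
  qed simp_all
 qed
qed


section \<open>The AGM-type bound, by induction on the variables\<close>

section \<open>Counting consistent assignments\<close>

text \<open>Summing \<open>ln z <= z - 1\<close> at \<open>z = q i / ?A\<close>, where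
  \<open>?A\<close> is the weighted mean, shows that the weighted sum of these logarithms is at most
  0.\<close>

lemma weighted_am_gm:
 fixes y q :: "'i => real"
 assumes "finite I" "!!i. i \<in> I ==> 0 <= y i" "(SUM i:I. y i) = 1" "!!i. i \<in> I ==> 0 < q i"
 shows "(PROD i:I. q i powr y i) <= (SUM i:I. y i * q i)"
proof -
 let ?A = "SUM i:I. y i * q i"
 have "EX i:I. y i ~= 0" using assms(3) by (metis sum.neutral zero_neq_one)
 then obtain i where i: "i \<in> I" "0 < y i * q i" using assms(2,4) by (metis less_eq_real_def mult_pos_pos)
 have A: "0 < ?A"
  by (rule sum_pos2[OF assms(1) i(1), of "%i. y i * q i"]) (simp_all add: i assms(2) assms(4) less_imp_le)
 have "(SUM i:I. y i * ln (q i / ?A)) <= (SUM i:I. y i * (q i / ?A - 1))"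
  by (rule sum_mono) (use assms(2,4) A in \<open>auto intro!: mult_left_mono ln_le_minus_one\<close>)
 also have "... = ?A / ?A - (SUM i:I. y i)"
  unfolding sum_divide_distrib sum_subtractf[symmetric] by (rule sum.cong) (auto simp: algebra_simps)
 also have "... = 0" using A assms(3) by simp
 finally have *: "(SUM i:I. y i * ln (q i / ?A)) <= 0" .
 have "(SUM i:I. y i * ln (q i / ?A)) = (SUM i:I. y i * ln (q i) - y i * ln ?A)"
  by (rule sum.cong) (use assms(4) A in \<open>auto simp: ln_divide_pos right_diff_distrib\<close>)
 hence "(SUM i:I. y i * ln (q i)) - (SUM i:I. y i) * ln ?A <= 0"
  using * by (simp add: sum_subtractf sum_distrib_right)
 hence "(SUM i:I. y i * ln (q i)) <= ln ?A" using assms(3) by simp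
 moreover have "(PROD i:I. q i powr y i) = exp (SUM i:I. y i * ln (q i))"
  unfolding exp_sum[OF assms(1)] by (rule prod.cong) (use assms(4) in \<open>fastforce simp: powr_def\<close>)+
 ultimately have "(PROD i:I. q i powr y i) <= exp (ln ?A)" by simp
 thus ?thesis using A by simp
qed

text \<open>Since the weights add up to at least (rather than exactly) 1, the factors are first divided
 by their bounds, after which lowering the exponents only increases the product.\<close>

lemma holder_sum_prod:
 fixes b :: "'i => 'a => real"
 assumes I: "finite I" and A: "finite A" and b: "!!i a. i \<in> I ==> a \<in> A ==> 0 < b i a"
  and x: "!!i. i \<in> I ==> 0 <= x i" and s: "1 <= (SUM i:I. x i)"
  and B: "!!i. i \<in> I ==> (SUM a:A. b i a) <= B i"
 shows "(SUM a:A. PROD i:I. b i a powr x i) <= (PROD i:I. B i powr x i)"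
proof (cases "A = {}")
 case True
 thus ?thesis by (simp add: prod_nonneg)
next
 case False
 let ?s = "SUM i:I. x i"
 have B0: "0 < B i" if "i \<in> I" for i
 proof -
  have "0 < (SUM a:A. b i a)" by (rule sum_pos[OF A False]) (rule b[OF that])
  thus ?thesis using B[OF that] by linarith
 qed
 have bB: "b i a <= B i" if "i \<in> I" "a \<in> A" for i a
 proof -
  have "b i a <= (SUM a:A. b i a)"
   by (rule member_le_sum) (use that A b in \<open>auto intro: less_imp_le\<close>)
  thus ?thesis using B[OF that(1)] by linarith
 qed
 have one: "(PROD i:I. (b i a / B i) powr x i) <= (SUM i:I. x i / ?s * (b i a / B i))" if a: "a \<in> A" for a
 proof -
  have "(PROD i:I. (b i a / B i) powr x i) <= (PROD i:I. (b i a / B i) powr (x i / ?s))"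
  proof (rule prod_mono, intro conjI)
   fix i assume i: "i \<in> I"
   have "x i / ?s <= x i" using s x[OF i] by (simp add: divide_le_eq mult_le_cancel_left1)
   thus "(b i a / B i) powr x i <= (b i a / B i) powr (x i / ?s)"
    using b[OF i a] B0[OF i] bB[OF i a] by (intro powr_mono') auto
  qed simp
  also have "... <= (SUM i:I. x i / ?s * (b i a / B i))"
   by (rule weighted_am_gm) (use I s x b a B0 in \<open>auto simp flip: sum_divide_distrib\<close>)
  finally show ?thesis .
 qed
 have "(SUM a:A. PROD i:I. b i a powr x i) = (PROD i:I. B i powr x i) * (SUM a:A. PROD i:I. (b i a / B i) powr x i)"
  unfolding sum_distrib_left prod.distrib[symmetric]
  by (intro sum.cong prod.cong refl) (use b B0 in \<open>force simp: powr_divide less_imp_le\<close>)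
 also have "... <= (PROD i:I. B i powr x i) * 1"
 proof (rule mult_left_mono)
  have "(SUM a:A. PROD i:I. (b i a / B i) powr x i) <= (SUM a:A. SUM i:I. x i / ?s * (b i a / B i))"
   by (rule sum_mono) (rule one)
  also have "... = (SUM i:I. x i / ?s * ((SUM a:A. b i a) / B i))"
   by (subst sum.swap) (simp add: sum_distrib_left sum_divide_distrib)
  also have "... <= (SUM i:I. x i / ?s * 1)"
   by (rule sum_mono, rule mult_left_mono) (use B B0 s x in \<open>auto intro!: divide_nonneg_nonneg\<close>)
  also have "... = 1" using s by (simp flip: sum_divide_distrib)
  finally show "(SUM a:A. PROD i:I. (b i a / B i) powr x i) <= 1" .
 qed (simp add: prod_nonneg)
 finally show ?thesis by simp
qed

text \<open>A tuple of the relation at hyperedge \<open>i\<close> is a function of which only the values on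
 \<open>e i\<close> matter. An assignment on \<open>X\<close> vanishes outside \<open>X\<close>; it is consistent if every
 relation contains a tuple that agrees with it.\<close>

definition matching :: "('i => nat set) => ('i => (nat => nat) set) => nat set => (nat => nat) => 'i => (nat => nat) set" where
 "matching e r X g i = {t \<in> r i. ALL u:e i Int X. t u = g u}"

definition consistent :: "'i set => ('i => nat set) => ('i => (nat => nat) set) => nat set => (nat => nat) set" where
 "consistent I e r X = {g. (ALL u. u \<notin> X --> g u = 0) & (ALL i:I. matching e r X g i ~= {})}"

text \<open>A potential function: at most the product of the relation sizes for
  \<open>X = {}\<close>, at least the number of consistent assignments for every \<open>X\<close>,
  and nonincreasing as covered variables are added.\<close>

definition cover_weight ::
 "'i set => ('i => nat set) => ('i => (nat => nat) set) => ('i => real) => nat set => real" where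
 "cover_weight I e r x X = (SUM g:consistent I e r X. PROD i:I. real (card (matching e r X g i)) powr x i)"

locale relations =
 fixes I :: "'i set" and e :: "'i => nat set" and r :: "'i => (nat => nat) set" and x :: "'i => real"
 assumes fin: "finite I" "!!i. i \<in> I ==> finite (r i)" and x0: "!!i. i \<in> I ==> 0 <= x i"
begin

abbreviation covered :: "nat => bool" where
 "covered v == 1 <= (SUM i:{i:I. v \<in> e i}. x i)"

lemma finite_matching: "i \<in> I ==> finite (matching e r X g i)"
 using fin(2) by (simp add: matching_def)

lemma card_matching_pos: "g \<in> consistent I e r X ==> i \<in> I ==> 1 <= card (matching e r X g i)"
 using finite_matching by (auto simp: consistent_def card_gt_0_iff Suc_le_eq)

lemma finite_consistent:
 assumes "finite X" "!!v. v \<in> X ==> EX i:I. v \<in> e i"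
 shows "finite (consistent I e r X)"
proof (rule finite_subset)
 let ?B = "UN i:I. UN t:r i. t ` X"
 show "finite {g. ALL v. (v \<in> X --> g v \<in> ?B) & (v \<notin> X --> g v = 0)}"
  using fin assms(1) by (intro finite_set_of_finite_funs) auto
 show "consistent I e r X <= {g. ALL v. (v \<in> X --> g v \<in> ?B) & (v \<notin> X --> g v = 0)}"
 proof (intro subsetI CollectI allI conjI impI)
  fix g v assume g: "g \<in> consistent I e r X" and v: "v \<in> X"
  obtain i where i: "i \<in> I" "v \<in> e i" using assms(2)[OF v] by blast
  then obtain t where "t \<in> r i" "ALL u:e i Int X. t u = g u"
   using g unfolding consistent_def matching_def by blast
  thus "g v \<in> ?B" using i v by (intro UN_I[of i] UN_I[of t] image_eqI[of _ _ v]) auto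
 qed (simp add: consistent_def)
qed

lemma covered_edge: "covered v ==> EX i:I. v \<in> e i"
proof (rule ccontr)
 assume "~ (EX i:I. v \<in> e i)"
 hence *: "{i:I. v \<in> e i} = {}" by blast
 assume "covered v"
 thus False unfolding * by simp
qed

lemma matching_insert:
 assumes "v \<notin> e i"
 shows "matching e r (insert v X) (g(v := a)) i = matching e r X g i"
 using assms by (auto simp: matching_def)

text \<open>Assignments on \<open>insert v X\<close> are grouped by their restriction to
  \<open>X\<close>. Within a group, relations without \<open>v\<close> contribute a constant factor;
  in those with \<open>v\<close> the matching tuples fall into disjoint classes by their value at
  \<open>v\<close>, and since the weights of these relations sum to at least 1,
  \<open>holder_sum_prod\<close> applies.\<close>

lemma cover_weight_insert:
 assumes X: "finite X" "!!u. u \<in> insert v X ==> covered u" and v: "v \<notin> X"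
 shows "cover_weight I e r x (insert v X) <= cover_weight I e r x X"
proof -
 let ?C' = "consistent I e r (insert v X)" and ?C = "consistent I e r X"
 let ?F' = "%g. PROD i:I. real (card (matching e r (insert v X) g i)) powr x i"
 let ?F = "%g. PROD i:I. real (card (matching e r X g i)) powr x i"
 have fC': "finite ?C'" and fC: "finite ?C"
  using X covered_edge by (auto intro!: finite_consistent)
 have im: "(%g. g(v := 0)) ` ?C' <= ?C"
  using v by (fastforce simp: consistent_def matching_def)
 have "cover_weight I e r x (insert v X) = (SUM g:?C. SUM g':{g':?C'. g'(v := 0) = g}. ?F' g')"
  unfolding cover_weight_def by (rule sum.group[symmetric, OF fC' fC im])
 also have "... <= (SUM g:?C. ?F g)"
 proof (rule sum_mono)
  fix g assume g: "g \<in> ?C"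
  have gv: "g v = 0" using g v by (simp add: consistent_def)
  let ?G = "{g':?C'. g'(v := 0) = g}"
  let ?S = "{i:I. v \<in> e i}" and ?T = "{i:I. v \<notin> e i}"
  have split: "(PROD i:I. h i) = (PROD i:?T. h i) * (PROD i:?S. h i)" for h :: "'i => real"
  proof -
   have "I = ?T Un ?S" by auto
   hence "(PROD i:I. h i) = (PROD i:?T Un ?S. h i)" by simp
   also have "... = (PROD i:?T. h i) * (PROD i:?S. h i)" using fin by (intro prod.union_disjoint) auto
   finally show ?thesis .
  qed
  have g': "g' = g(v := g' v)" if "g' \<in> ?G" for g' using that by auto
  have T: "matching e r (insert v X) g' i = matching e r X g i" if "g' \<in> ?G" "i \<in> ?T" for g' i
   using matching_insert[of v i X g "g' v"] g'[OF that(1)] that(2) by simp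
  have hol: "(SUM g':?G. PROD i:?S. real (card (matching e r (insert v X) g' i)) powr x i)
    <= (PROD i:?S. real (card (matching e r X g i)) powr x i)"
  proof (rule holder_sum_prod)
   fix i assume i: "i \<in> ?S"
   have "(SUM g':?G. card (matching e r (insert v X) g' i)) = card (UN g':?G. matching e r (insert v X) g' i)"
   proof (rule card_UN_disjoint[symmetric])
    show "ALL g1:?G. ALL g2:?G. g1 ~= g2 --> matching e r (insert v X) g1 i Int matching e r (insert v X) g2 i = {}"
    proof (intro ballI impI)
     fix g1 g2 assume *: "g1 \<in> ?G" "g2 \<in> ?G" "g1 ~= g2"
     have "g1 v ~= g2 v" using g'[OF *(1)] g'[OF *(2)] *(3) by metis
     thus "matching e r (insert v X) g1 i Int matching e r (insert v X) g2 i = {}"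
      using i by (force simp: matching_def)
    qed
   qed (use fC' i finite_matching in auto)
   also have "... <= card (matching e r X g i)"
   proof (rule card_mono)
    have "g' u = g u" if "g' \<in> ?G" "u \<in> X" for g' u using that v by auto
    thus "(UN g':?G. matching e r (insert v X) g' i) <= matching e r X g i"
     by (auto simp: matching_def)
   qed (use finite_matching i in auto)
   finally show "(SUM g':?G. real (card (matching e r (insert v X) g' i))) <= real (card (matching e r X g i))"
    by (simp flip: of_nat_sum)
  qed (use fin fC' x0 X(2) card_matching_pos in \<open>fastforce+\<close>)
  have "(SUM g':?G. ?F' g') = (SUM g':?G. (PROD i:?T. real (card (matching e r X g i)) powr x i) *
    (PROD i:?S. real (card (matching e r (insert v X) g' i)) powr x i))"
   unfolding split by (intro sum.cong refl arg_cong2[of _ _ _ _ "(*)"] prod.cong) (use T in auto)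
  also have "... <= ?F g"
   unfolding split sum_distrib_left[symmetric] by (rule mult_left_mono[OF hol]) (simp add: prod_nonneg)
  finally show "(SUM g':?G. ?F' g') <= ?F g" .
 qed
 finally show ?thesis unfolding cover_weight_def .
qed

lemma cover_weight_le:
 assumes "finite X" "!!u. u \<in> X ==> covered u"
 shows "cover_weight I e r x X <= (PROD i:I. real (card (r i)) powr x i)"
 using assms
proof (induction X rule: finite_induct)
 case empty
 have "consistent I e r {} <= {%_. 0}" by (auto simp: consistent_def)
 hence "cover_weight I e r x {} <= (SUM g:{%_. 0}. PROD i:I. real (card (matching e r {} g i)) powr x i)"
  unfolding cover_weight_def by (intro sum_mono2) (auto intro!: prod_nonneg)
 thus ?case by (simp add: matching_def)
next
 case (insert v X)
 thus ?case using cover_weight_insert[of X v] by force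
qed

text \<open>Every relation has a tuple matching a consistent assignment, so each summand of the
  potential is at least 1.\<close>

lemma card_consistent_le:
 assumes "finite X" "!!u. u \<in> X ==> covered u"
 shows "real (card (consistent I e r X)) <= (PROD i:I. real (card (r i)) powr x i)"
proof -
 have "real (card (consistent I e r X)) = (SUM g:consistent I e r X. 1)" by simp
 also have "... <= cover_weight I e r x X"
  unfolding cover_weight_def
 proof (rule sum_mono)
  fix g assume "g \<in> consistent I e r X"
  thus "1 <= (PROD i:I. real (card (matching e r X g i)) powr x i)"
   using card_matching_pos x0 by (intro prod_ge_1 ge_one_powr_ge_zero) auto
 qed
 also have "... <= (PROD i:I. real (card (r i)) powr x i)" by (rule cover_weight_le[OF assms])
 finally show ?thesis .
qed

text \<open>This is the work of extending each assignment by \<open>v\<close> through its smallest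
  relation. Raising the minimum to the total weight of the relations containing \<open>v\<close>,
  which is at least 1, does not decrease it, and the result is at most the corresponding summand of
  the potential.\<close>

lemma sum_Min_matching_le:
 assumes "finite X" "!!u. u \<in> X ==> covered u" "covered v"
 shows "(SUM g:consistent I e r X. real (Min ((%i. card (matching e r X g i)) ` {i:I. v \<in> e i})))
  <= (PROD i:I. real (card (r i)) powr x i)"
proof -
 have "(SUM g:consistent I e r X. real (Min ((%i. card (matching e r X g i)) ` {i:I. v \<in> e i})))
  <= cover_weight I e r x X"
  unfolding cover_weight_def
 proof (rule sum_mono)
  fix g assume g: "g \<in> consistent I e r X"
  let ?S = "{i:I. v \<in> e i}" and ?c = "%i. card (matching e r X g i)"
  let ?m = "Min (?c ` ?S)"
  have S: "finite ?S" "?S ~= {}" using fin covered_edge[OF assms(3)] by auto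
  have m: "?m <= ?c i" if "i \<in> ?S" for i using that S by auto
  have "?m \<in> ?c ` ?S" using S by (intro Min_in) auto
  hence m1: "1 <= ?m" using card_matching_pos[OF g] by auto
  have "real ?m = real ?m powr 1" using m1 by simp
  also have "... <= real ?m powr (SUM i:?S. x i)" using m1 assms(3) by (intro powr_mono) auto
  also have "... = (PROD i:?S. real ?m powr x i)" using m1 by (intro powr_sum) auto
  also have "... <= (PROD i:?S. real (?c i) powr x i)"
   using m x0 by (intro prod_mono conjI powr_mono2) (auto intro!: powr_mono2)
  also have "... <= (PROD i:I. real (?c i) powr x i)"
   using fin card_matching_pos[OF g] x0 by (intro prod_mono2 ge_one_powr_ge_zero) auto
  finally show "real ?m <= (PROD i:I. real (?c i) powr x i)" .
 qed
 also have "... <= (PROD i:I. real (card (r i)) powr x i)" by (rule cover_weight_le[OF assms(1,2)])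
 finally show ?thesis .
qed

end

text \<open>A bound that holds for every cover passes to the infimum by taking logarithms to base
  \<open>N\<close>. The cases \<open>N = 1\<close> and \<open>b <= 0\<close>, where logarithms fail,
  are settled directly.\<close>

lemma fractional_cover_number_bound:
 assumes N: "1 <= N" and ex: "ALL v:X. EX i:I. v \<in> e i" and fin: "finite I" and c: "0 < c"
  and bound: "!!x. (ALL i:I. 0 <= x i & x i <= 1) ==> (ALL v:X. 1 <= (SUM i:{i:I. v \<in> e i}. x i)) ==>
   b <= c * N powr (SUM i:I. x i)"
 shows "b <= c * N powr fractional_cover_number X I e"
proof -
 let ?S = "{(SUM i:I. x i) | x. (ALL i:I. 0 <= x i & x i <= (1::real)) &
   (ALL v:X. 1 <= (SUM i:{i:I. v \<in> e i}. x i))}"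
 have one: "(ALL i:I. 0 <= (1::real) & (1::real) <= 1) & (ALL v:X. 1 <= (SUM i:{i:I. v \<in> e i}. (1::real)))"
 proof (intro conjI ballI)
  fix v assume "v \<in> X"
  then obtain i where "i \<in> I" "v \<in> e i" using ex by blast
  hence "0 < card {i:I. v \<in> e i}" using fin by (auto simp: card_gt_0_iff)
  thus "1 <= (SUM i:{i:I. v \<in> e i}. (1::real))" by simp
 qed auto
 have "(SUM i:I. (1::real)) \<in> ?S" by (rule CollectI, rule exI[of _ "%_. 1"]) (use one in simp)
 hence ne: "?S ~= {}" by blast
 show ?thesis
 proof (cases "b <= 0 | N = 1")
  case True
  thus ?thesis
  proof
   assume "b <= 0"
   thus ?thesis using c N by (meson less_eq_real_def mult_nonneg_nonneg order.trans powr_ge_zero)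
  next
   assume "N = 1"
   thus ?thesis using bound[of "%_. 1"] one by simp
  qed
 next
  case False
  hence N1: "1 < N" and b: "0 < b" using N by auto
  have "log N (b / c) <= Inf ?S"
  proof (rule cInf_greatest[OF ne])
   fix y assume "y \<in> ?S"
   then obtain x where x: "y = (SUM i:I. x i)" "ALL i:I. 0 <= x i & x i <= 1"
    "ALL v:X. 1 <= (SUM i:{i:I. v \<in> e i}. x i)" by blast
   have "b / c <= N powr y" using bound[OF x(2,3)] c x(1) by (simp add: divide_le_eq mult.commute)
   thus "log N (b / c) <= y" using N1 b c by (simp add: log_le_iff)
  qed
  hence "b / c <= N powr fractional_cover_number X I e"
   unfolding fractional_cover_number_def using N1 b c by (simp add: log_le_iff)
  thus ?thesis using c by (simp add: divide_le_eq mult.commute)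
 qed
qed

lemma fractional_cover_number_ge_one:
 assumes "v \<in> X" "ALL v:X. EX i:I. v \<in> e i" "finite I"
 shows "1 <= fractional_cover_number X I e"
 unfolding fractional_cover_number_def
proof (rule cInf_greatest)
 have "1 <= (SUM i:{i:I. v \<in> e i}. (1::real))" if v: "v \<in> X" for v
 proof -
  obtain i where "i \<in> I" "v \<in> e i" using assms(2) v by blast
  hence "0 < card {i:I. v \<in> e i}" using assms(3) by (auto simp: card_gt_0_iff)
  thus ?thesis by simp
 qed
 thus "{(SUM i:I. x i) | x. (ALL i:I. 0 <= x i & x i <= (1::real)) &
   (ALL v:X. 1 <= (SUM i:{i:I. v \<in> e i}. x i))} ~= {}"
  by (auto intro!: exI[of _ "%_. 1"])
 fix y assume "y \<in> {(SUM i:I. x i) | x. (ALL i:I. 0 <= x i & x i <= (1::real)) &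
   (ALL v:X. 1 <= (SUM i:{i:I. v \<in> e i}. x i))}"
 then obtain x where x: "y = (SUM i:I. x i)" "ALL i:I. 0 <= x i & x i <= 1"
  "ALL v:X. 1 <= (SUM i:{i:I. v \<in> e i}. x i)" by blast
 have "1 <= (SUM i:{i:I. v \<in> e i}. x i)" using x(3) assms(1) by blast
 also have "... <= y" unfolding x(1) by (rule sum_mono2) (use assms(3) x(2) in auto)
 finally show "1 <= y" .
qed


section \<open>The least fixpoint\<close>

lemma mono_immediate_consequence: "mono (immediate_consequence \<Pi> D)"
 unfolding mono_def immediate_consequence_def by blast

lemma least_fixpoint_unfold:
 "least_fixpoint \<Pi> D = immediate_consequence \<Pi> D (least_fixpoint \<Pi> D)"
 unfolding least_fixpoint_def by (rule lfp_unfold[OF mono_immediate_consequence])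

lemma least_fixpoint_base: "x \<in> D ==> x \<in> least_fixpoint \<Pi> D"
 by (subst least_fixpoint_unfold) (simp add: immediate_consequence_def)

lemma least_fixpoint_rule:
 assumes "R \<in> \<Pi>" "ALL A:set (body R). ground_atom th A \<in> least_fixpoint \<Pi> D"
 shows "ground_atom th (head R) \<in> least_fixpoint \<Pi> D"
 by (subst least_fixpoint_unfold) (use assms in \<open>auto simp: immediate_consequence_def\<close>)

lemma least_fixpoint_induct [consumes 1, case_names base rule]:
 assumes "x \<in> least_fixpoint \<Pi> D" and "!!x. x \<in> D ==> P x"
  and "!!R th. R \<in> \<Pi> ==> (!!A. A \<in> set (body R) ==> ground_atom th A \<in> least_fixpoint \<Pi> D & P (ground_atom th A)) ==>
   P (ground_atom th (head R))"
 shows "P x"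
proof -
 have "least_fixpoint \<Pi> D <= {x. P x}"
  unfolding least_fixpoint_def
 proof (rule lfp_induct[OF mono_immediate_consequence], fold least_fixpoint_def)
  show "immediate_consequence \<Pi> D (least_fixpoint \<Pi> D Int {x. P x}) <= {x. P x}"
   unfolding immediate_consequence_def using assms(2,3) by blast
 qed
 thus ?thesis using assms(1) by blast
qed

lemma ground_trm_cong: "(!!v. v \<in> vars_trm t ==> th v = th' v) ==> ground_trm th t = ground_trm th' t"
 by (cases t) auto

lemma ground_atom_cong:
 "(!!v. v \<in> vars_list (snd A) ==> th v = th' v) ==> ground_atom th A = ground_atom th' A"
 unfolding ground_atom_def vars_list_def by (auto intro!: ground_trm_cong)

lemma Var_in_set: "v \<in> vars_list ts \<longleftrightarrow> Var v \<in> set ts"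
proof
 assume "v \<in> vars_list ts"
 then obtain t where "t \<in> set ts" "v \<in> vars_trm t" unfolding vars_list_def by blast
 thus "Var v \<in> set ts" by - (cases t, auto)
qed (force simp: vars_list_def)

lemma ground_atom_inj:
 assumes "ground_atom th A = ground_atom th' A" "v \<in> vars_list (snd A)"
 shows "th v = th' v"
proof -
 have "map (ground_trm th) (snd A) = map (ground_trm th') (snd A)" using assms(1) by (simp add: ground_atom_def)
 hence "ground_trm th (Var v) = ground_trm th' (Var v)"
  using assms(2) Var_in_set by (meson map_eq_conv)
 thus ?thesis by simp
qed

lemma finite_vars_trm: "finite (vars_trm t)"
 by (cases t) auto

lemma finite_vars_list: "finite (vars_list ts)"
 unfolding vars_list_def by (simp add: finite_vars_trm)

section \<open>Reindexing covers\<close>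

text \<open>Weights are transported along \<open>h\<close> in both directions. This makes
  \<open>ew_adornment\<close> invariant under renaming and lets widths be compared between rules
  with isomorphic hypergraphs.\<close>

lemma fractional_cover_number_reindex:
 assumes h: "bij_betw h I I'" and X: "X' = pn ` X"
  and e: "!!i v. i \<in> I ==> v \<in> X ==> v \<in> e i \<longleftrightarrow> pn v \<in> e' (h i)"
 shows "fractional_cover_number X I e = fractional_cover_number X' I' e'"
proof -
 have sub: "(SUM i:{i:I'. pn v \<in> e' i}. x i) = (SUM i:{i:I. v \<in> e i}. x (h i))" if "v \<in> X" for v and x :: "'b => real"
 proof (rule sum.reindex_bij_betw[symmetric])
  have "h ` {i:I. v \<in> e i} = {i:I'. pn v \<in> e' i}"
   using h e that unfolding bij_betw_def by blast
  moreover have "inj_on h {i:I. v \<in> e i}" using h unfolding bij_betw_def by (auto intro: inj_on_subset)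
  ultimately show "bij_betw h {i:I. v \<in> e i} {i:I'. pn v \<in> e' i}" unfolding bij_betw_def by blast
 qed
 let ?P = "%x :: 'a => real. (ALL i:I. 0 <= x i & x i <= 1) & (ALL v:X. 1 <= (SUM i:{i:I. v \<in> e i}. x i))"
 let ?P' = "%x :: 'b => real. (ALL i:I'. 0 <= x i & x i <= 1) & (ALL v:X'. 1 <= (SUM i:{i:I'. v \<in> e' i}. x i))"
 have "{(SUM i:I. x i) | x. ?P x} = {(SUM i:I'. x i) | x. ?P' x}"
 proof (intro subset_antisym subsetI)
  fix y assume "y \<in> {(SUM i:I'. x i) | x. ?P' x}"
  then obtain x where x: "y = (SUM i:I'. x i)" "?P' x" by blast
  have "y = (SUM i:I. x (h i))" unfolding x(1) by (rule sum.reindex_bij_betw[OF h, symmetric])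
  moreover have "?P (%i. x (h i))" using x(2) sub[of _ x] h unfolding X bij_betw_def by auto
  ultimately show "y \<in> {(SUM i:I. x i) | x. ?P x}" by blast
 next
  fix y assume "y \<in> {(SUM i:I. x i) | x. ?P x}"
  then obtain x where x: "y = (SUM i:I. x i)" "?P x" by blast
  define x' where "x' = x \<circ> inv_into I h"
  have x': "x' (h i) = x i" if "i \<in> I" for i using h that unfolding x'_def bij_betw_def by simp
  have "y = (SUM i:I. x' (h i))" unfolding x(1) by (rule sum.cong) (auto simp: x')
  hence "y = (SUM i:I'. x' i)" by (simp add: sum.reindex_bij_betw[OF h])
  moreover have "?P' x'"
  proof (intro conjI ballI)
   fix i assume "i \<in> I'"
   then obtain j where j: "j \<in> I" "i = h j" using h unfolding bij_betw_def by blast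
   thus "0 <= x' i" "x' i <= 1" using x(2) x' by auto
  next
   fix v assume "v \<in> X'"
   then obtain u where u: "u \<in> X" "v = pn u" unfolding X by blast
   have "(SUM i:{i:I'. v \<in> e' i}. x' i) = (SUM i:{i:I. u \<in> e i}. x i)"
    unfolding u(2) sub[OF u(1)] by (rule sum.cong) (auto simp: x')
   thus "1 <= (SUM i:{i:I'. v \<in> e' i}. x' i)" using x(2) u(1) by simp
  qed
  ultimately show "y \<in> {(SUM i:I'. x i) | x. ?P' x}" by blast
 qed
 thus ?thesis unfolding fractional_cover_number_def by simp
qed

text \<open>\<open>variant\<close> asks for a permutation of all variables. The two finite sets left
  over inside the union of \<open>A\<close> and its image have equal size, so they can be matched;
  everything outside the union is fixed.\<close>

lemma extend_to_bij:
 fixes f :: "nat => nat"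
 assumes "finite A" "inj_on f A"
 obtains pn where "bij pn" "!!a. a \<in> A ==> pn a = f a"
proof -
 let ?W = "A Un f ` A"
 have "card (?W - A) = card (?W - f ` A)"
  using assms by (simp add: card_Diff_subset card_image)
 then obtain h where h: "bij_betw h (?W - A) (?W - f ` A)"
  using assms(1) by (metis finite_Diff finite_UnI finite_imageI finite_same_card_bij)
 define pn where "pn x = (if x \<in> A then f x else if x \<in> ?W then h x else x)" for x
 have 1: "bij_betw pn A (f ` A)"
  using inj_on_imp_bij_betw[OF assms(2)] by (rule bij_betw_cong[THEN iffD1, rotated]) (simp add: pn_def)
 have 2: "bij_betw pn (?W - A) (?W - f ` A)"
  using h by (rule bij_betw_cong[THEN iffD1, rotated]) (auto simp: pn_def)
 have 3: "bij_betw pn (- ?W) (- ?W)"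
  using bij_betw_id by (rule bij_betw_cong[THEN iffD1, rotated]) (auto simp: pn_def)
 have "bij_betw pn (A Un (?W - A)) (f ` A Un (?W - f ` A))" by (rule bij_betw_combine[OF 1 2]) blast
 hence "bij_betw pn ((A Un (?W - A)) Un - ?W) ((f ` A Un (?W - f ` A)) Un - ?W)"
  by (rule bij_betw_combine[OF _ 3]) blast
 moreover have "(A Un (?W - A)) Un - ?W = UNIV" "(f ` A Un (?W - f ` A)) Un - ?W = UNIV" by blast+
 ultimately have "bij pn" by simp
 thus thesis by (rule that) (simp add: pn_def)
qed

section \<open>Unification of flat terms\<close>

text \<open>Without function symbols, the classes of the relation ``equal under every unifier'' contain
 at most one constant; an mgu maps each variable to the constant or to the least variable of its
 class.\<close>

lemma mgu_exists:
 assumes "unifier th0 ps"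
 shows "EX si. mgu si ps"
proof -
 define eqv where "eqv s t \<longleftrightarrow> (ALL th. unifier th ps --> subst_trm th s = subst_trm th t)" for s t
 define si where "si x = (if EX c. eqv (Var x) (Cst c) then Cst (SOME c. eqv (Var x) (Cst c))
   else Var (LEAST y. eqv (Var x) (Var y)))" for x
 have eqv_si: "eqv (Var x) (si x)" for x
 proof (cases "EX c. eqv (Var x) (Cst c)")
  case True
  thus ?thesis unfolding si_def using someI_ex[OF True] by simp
 next
  case False
  have "eqv (Var x) (Var (LEAST y. eqv (Var x) (Var y)))" by (rule LeastI[of _ x]) (simp add: eqv_def)
  thus ?thesis using False unfolding si_def by simp
 qed
 \<comment> \<open>The given unifier \<open>th0\<close> enters here: it prevents two different
   constants from falling into one class.\<close>
 have cst: "c = c'" if "eqv (Cst c) (Cst c')" for c c'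
  using that assms unfolding eqv_def by force
 have eq: "subst_trm si s = subst_trm si t" if st: "eqv s t" for s t
 proof -
  have tr: "eqv s u \<longleftrightarrow> eqv t u" for u using st unfolding eqv_def by auto
  have c: "subst_trm si u = (if EX c. eqv u (Cst c) then Cst (SOME c. eqv u (Cst c))
   else Var (LEAST y. eqv u (Var y)))" for u
  proof (cases u)
   case (Cst d)
   have "eqv (Cst d) (Cst d)" by (simp add: eqv_def)
   moreover have "(SOME c. eqv (Cst d) (Cst c)) = d"
    using cst \<open>eqv (Cst d) (Cst d)\<close> by (intro some_equality) auto
   ultimately show ?thesis using Cst by auto
  qed (simp add: si_def)
  show ?thesis unfolding c tr ..
 qed
 have "mgu si ps"
  unfolding mgu_def
 proof (intro conjI allI impI)
  show "unifier si ps"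
   unfolding unifier_def
  proof (clarify)
   fix ss ts assume st: "(ss, ts) \<in> set ps"
   have len: "length ss = length ts"
    using assms st unfolding unifier_def subst_list_def by (auto dest!: bspec[OF _ st] map_eq_imp_length_eq)
   have "subst_trm si (ss ! k) = subst_trm si (ts ! k)" if k: "k < length ss" for k
   proof (rule eq, unfold eqv_def, intro allI impI)
    fix th assume "unifier th ps"
    hence "subst_list th ss = subst_list th ts" using st unfolding unifier_def by blast
    hence "subst_list th ss ! k = subst_list th ts ! k" by simp
    thus "subst_trm th (ss ! k) = subst_trm th (ts ! k)" using k len by (simp add: subst_list_def)
   qed
   thus "subst_list si ss = subst_list si ts"
    using len unfolding subst_list_def by (intro nth_equalityI) auto
  qed
  fix th assume "unifier th ps"
  thus "EX ta. ALL x. th x = subst_trm ta (si x)"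
   using eqv_si unfolding eqv_def by (metis subst_trm.simps(1))
 qed
 thus ?thesis by blast
qed

definition consts_list :: "trm list => nat set" where
 "consts_list ts = {c. Cst c \<in> set ts}"

text \<open>A constant outside \<open>C\<close> cannot be forced by the equations: replacing all
  such constants by a variable in the values of \<open>si\<close> gives another unifier, which would
  have to factor through \<open>si\<close> although no substitution moves the constant
  \<open>c\<close>.\<close>

lemma mgu_consts:
 assumes "mgu si ps" and C: "!!ss ts. (ss, ts) \<in> set ps ==> consts_list ss <= C & consts_list ts <= C"
  and x: "si x = Cst c"
 shows "c \<in> C"
proof (rule ccontr)
 assume c: "c \<notin> C"
 define f where "f t = (case t of Var y => Var y | Cst d => if d \<in> C then Cst d else Var 0)" for t
 have s: "subst_list (f \<circ> si) ts = map f (subst_list si ts)" if "consts_list ts <= C" for ts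
  unfolding subst_list_def
 proof (simp, intro ballI)
  fix t assume "t \<in> set ts"
  thus "subst_trm (f \<circ> si) t = f (subst_trm si t)"
   using that by - (cases t, auto simp: f_def consts_list_def)
 qed
 have "unifier (f \<circ> si) ps"
  using assms(1) C unfolding mgu_def unifier_def by (auto simp: s)
 then obtain ta where "ALL x. (f \<circ> si) x = subst_trm ta (si x)" using assms(1) unfolding mgu_def by blast
 hence "(f \<circ> si) x = subst_trm ta (si x)" by blast
 thus False using x c by (simp add: f_def)
qed

section \<open>Variants\<close>

definition rename :: "(nat => nat) => adornment => adornment" where
 "rename pn ro = Adornment (ad_pred ro) (subst_list (Var \<circ> pn) (ad_args ro)) (subst_body (Var \<circ> pn) (ad_body ro))"

lemma variant_iff: "variant ro ro' \<longleftrightarrow> (EX pn. bij pn & ro' = rename pn ro)"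
 unfolding variant_def rename_def ..

lemma subst_trm_comp: "subst_trm ta (subst_trm si t) = subst_trm (subst_trm ta \<circ> si) t"
 by (cases t) auto

lemma subst_trm_Var [simp]: "subst_trm Var t = t"
 by (cases t) auto

lemma rename_rename: "rename pn' (rename pn ro) = rename (pn' \<circ> pn) ro"
proof -
 have s: "subst_trm (Var \<circ> pn') \<circ> subst_trm (Var \<circ> pn) = subst_trm (Var \<circ> (pn' \<circ> pn))"
  by (rule ext) (simp add: subst_trm_comp comp_def)
 have "map_option (subst_trm (Var \<circ> pn')) \<circ> map_option (subst_trm (Var \<circ> pn)) = map_option (subst_trm (Var \<circ> (pn' \<circ> pn)))"
  by (simp add: s option.map_comp[symmetric] fun_eq_iff option.map_comp)
 thus ?thesis
  unfolding rename_def subst_list_def subst_body_def by (simp add: s image_image case_prod_beta)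
qed

lemma rename_id [simp]: "rename id ro = ro"
proof -
 have "subst_trm (Var \<circ> id) = id" by (rule ext) simp
 thus ?thesis unfolding rename_def subst_list_def subst_body_def by (simp add: case_prod_beta option.map_id0)
qed

lemma variant_refl: "variant ro ro"
 unfolding variant_iff by (intro exI[of _ id]) simp

lemma variant_trans: "variant ro ro' ==> variant ro' ro'' ==> variant ro ro''"
 unfolding variant_iff using rename_rename bij_comp by metis

lemma variant_sym: "variant ro ro' ==> variant ro' ro"
proof -
 assume "variant ro ro'"
 then obtain pn where p: "bij pn" "ro' = rename pn ro" unfolding variant_iff by blast
 have "rename (inv pn) ro' = ro"
  unfolding p(2) rename_rename using p(1) by (simp add: bij_is_inj)
 thus ?thesis unfolding variant_iff using bij_imp_bij_inv[OF p(1)] by metis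
qed

lemma variant_class:
 assumes "variant ro ro'"
 shows "{(ro, ro'). variant ro ro'} `` {ro} = {(ro, ro'). variant ro ro'} `` {ro'}"
 using assms variant_sym variant_trans by blast

lemma vars_rename:
 "vars_list (ad_args (rename pn ro)) = pn ` vars_list (ad_args ro)"
proof -
 have "vars_trm (subst_trm (Var \<circ> pn) t) = pn ` vars_trm t" for t by (cases t) auto
 thus ?thesis unfolding rename_def vars_list_def subst_list_def by auto
qed

definition rename_masked :: "(nat => nat) => masked_atom => masked_atom" where
 "rename_masked pn A = (fst A, map (map_option (subst_trm (Var \<circ> pn))) (snd A))"

lemma body_rename: "ad_body (rename pn ro) = rename_masked pn ` ad_body ro"
 unfolding rename_def subst_body_def rename_masked_def by (auto simp: case_prod_beta)

lemma vars_masked_iff: "v \<in> vars_masked A \<longleftrightarrow> Some (Var v) \<in> set (snd A)"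
proof
 assume "v \<in> vars_masked A"
 then obtain t where "Some t \<in> set (snd A)" "v \<in> vars_trm t" unfolding vars_masked_def by blast
 thus "Some (Var v) \<in> set (snd A)" by - (cases t, auto)
qed (force simp: vars_masked_def)

lemma vars_rename_masked: "vars_masked (rename_masked pn A) = pn ` vars_masked A"
proof (intro set_eqI iffI)
 fix v assume "v \<in> vars_masked (rename_masked pn A)"
 then obtain u where u: "u \<in> set (snd A)" "Some (Var v) = map_option (subst_trm (Var \<circ> pn)) u"
  unfolding vars_masked_iff rename_masked_def by auto
 then obtain t where "u = Some t" "Var v = subst_trm (Var \<circ> pn) t" by - (cases u, auto)
 thus "v \<in> pn ` vars_masked A" using u by - (cases t, auto simp: vars_masked_iff)
next
 fix v assume "v \<in> pn ` vars_masked A"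
 thus "v \<in> vars_masked (rename_masked pn A)"
  unfolding vars_masked_iff rename_masked_def by (force simp: image_iff vars_masked_iff)
qed

lemma inj_rename_masked: "inj pn ==> inj (rename_masked pn)"
proof -
 assume i: "inj pn"
 have "inj (subst_trm (Var \<circ> pn))"
 proof (rule injI)
  fix s t assume "subst_trm (Var \<circ> pn) s = subst_trm (Var \<circ> pn) t"
  thus "s = t" using i by (cases s; cases t) (auto dest: injD)
 qed
 hence "inj (map (map_option (subst_trm (Var \<circ> pn))))" by (intro inj_mapI option.inj_map)
 thus ?thesis unfolding rename_masked_def by (intro injI) (auto dest: injD simp: prod_eq_iff)
qed

lemma ew_variant:
 assumes "variant ro ro'"
 shows "ew_adornment ro = ew_adornment ro'"
proof -
 obtain pn where p: "bij pn" "ro' = rename pn ro" using assms unfolding variant_iff by blast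
 have i: "inj pn" using p(1) by (rule bij_is_inj)
 show ?thesis
  unfolding ew_adornment_def p(2) vars_rename body_rename
 proof (rule fractional_cover_number_reindex[where pn = pn and h = "rename_masked pn"])
  show "bij_betw (rename_masked pn) (ad_body ro) (rename_masked pn ` ad_body ro)"
   using inj_rename_masked[OF i] by (auto intro: inj_on_imp_bij_betw inj_on_subset)
 qed (use i in \<open>auto simp: vars_rename_masked inj_image_mem_iff\<close>)
qed

section \<open>Invariants of the adorned program and its finiteness up to renaming\<close>

section \<open>Adornments\<close>

definition mask_atoms :: "trm list => masked_atom set => masked_atom set" where
 "mask_atoms ss B = (%(e, us). (e, map (mask ss) us)) ` B"

lemma g_out_body_subset: "ad_body (g_out q ss B) <= mask_atoms ss B"
 unfolding g_out_def mask_atoms_def by (auto simp: Let_def)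

text \<open>The atom with the most unmasked positions among those containing \<open>v\<close> is not removed.\<close>

lemma g_out_covers:
 assumes fin: "finite B" and v: "v \<in> vars_list ss" and ex: "EX A:B. v \<in> vars_masked A"
 shows "EX A:ad_body (g_out q ss B). v \<in> vars_masked A"
proof -
 let ?B' = "mask_atoms ss B"
 define S where "S = {A \<in> ?B'. Some (Var v) \<in> set (snd A)}"
 define n where "n A = length (filter (%u. u ~= None) (snd A))" for A :: masked_atom
 have finS: "finite S" using fin unfolding S_def mask_atoms_def by simp
 obtain e us where A: "(e, us) \<in> B" "Some (Var v) \<in> set us"
  using ex unfolding vars_masked_iff by force
 have "mask ss (Some (Var v)) = Some (Var v)" using v by (simp add: mask_def Var_in_set)
 hence "Some (Var v) \<in> set (map (mask ss) us)" using A(2) by (metis image_eqI image_set)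
 hence neS: "S ~= {}" using A(1) unfolding S_def mask_atoms_def by force
 have "Max (n ` S) \<in> n ` S" using finS neS by (intro Max_in) auto
 then obtain A0 where A0': "A0 \<in> S" "n A0 = Max (n ` S)" by auto
 hence A0: "A0 \<in> S" "!!A. A \<in> S ==> n A <= n A0" using finS by auto
 obtain e0 us0 where e0: "A0 = (e0, us0)" by (cases A0)
 have "~ (EX us'. (e0, us') \<in> ?B' & us' ~= us0 & list_all2 (%u u'. u = u' | u = None) us0 us')"
 proof
  assume "EX us'. (e0, us') \<in> ?B' & us' ~= us0 & list_all2 (%u u'. u = u' | u = None) us0 us'"
  then obtain us' where us': "(e0, us') \<in> ?B'" "us' ~= us0" "list_all2 (%u u'. u = u' | u = None) us0 us'" by blast
  obtain i where i: "i < length us0" "us0 ! i = Some (Var v)"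
   using A0(1) unfolding S_def e0 by (auto simp: in_set_conv_nth)
  hence "us' ! i = Some (Var v)" using list_all2_nthD[OF us'(3) i(1)] by simp
  hence mem: "Some (Var v) \<in> set us'"
   using i(1) list_all2_lengthD[OF us'(3)] by (metis nth_mem)
  have "length (filter (%u. u ~= None) us0) <= length (filter (%u. u ~= None) us') &
    (us' ~= us0 --> length (filter (%u. u ~= None) us0) < length (filter (%u. u ~= None) us'))"
   using us'(3) by (induction rule: list_all2_induct) auto
  hence "n (e0, us0) < n (e0, us')" using us'(2) by (simp add: n_def)
  moreover have "(e0, us') \<in> S" using us'(1) mem by (simp add: S_def)
  ultimately show False using A0(2) e0 by force
 qed
 hence "A0 \<in> ad_body (g_out q ss B)"
  using A0(1) unfolding g_out_def S_def mask_atoms_def e0 by (auto simp: Let_def)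
 thus ?thesis using A0(1) unfolding S_def vars_masked_iff by blast
qed

lemma idb_body: "q \<in> idb \<Pi> \<longleftrightarrow> (EX R:\<Pi>. fst (head R) = q & body R ~= [])"
 unfolding idb_def by blast

definition program_consts :: "program => nat set" where
 "program_consts \<Pi> = (UN R:\<Pi>. UN A:set (rule_atoms R). consts_list (snd A))"

definition edb_shapes :: "program => (nat \<times> nat) set" where
 "edb_shapes \<Pi> = (UN R:\<Pi>. (%A. (fst A, length (snd A))) ` set (edb_atoms \<Pi> R))"

text \<open>Coverage of the head variables guarantees that covers exist; predicates, arities,
  constants and body entries drawn from the program and from the head leave finitely many adornments
  up to renaming.\<close>

definition good_adornment :: "program => adornment => bool" where
 "good_adornment \<Pi> ro \<longleftrightarrow> finite (ad_body ro) & (ALL v:vars_list (ad_args ro). EX A:ad_body ro. v \<in> vars_masked A) &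
   (EX R:\<Pi>. ad_pred ro = fst (head R) & length (ad_args ro) = length (snd (head R))) &
   consts_list (ad_args ro) <= program_consts \<Pi> &
   (ALL (e, us):ad_body ro. (e, length us) \<in> edb_shapes \<Pi> & set us <= insert None (Some ` set (ad_args ro))) &
   (vars_list (ad_args ro) ~= {} --> ad_pred ro \<in> idb \<Pi>)"

lemma good_adornmentI:
 assumes "finite (ad_body ro)" "!!v. v \<in> vars_list (ad_args ro) ==> EX A:ad_body ro. v \<in> vars_masked A"
  "R \<in> \<Pi>" "ad_pred ro = fst (head R)" "length (ad_args ro) = length (snd (head R))"
  "consts_list (ad_args ro) <= program_consts \<Pi>"
  "!!e us. (e, us) \<in> ad_body ro ==> (e, length us) \<in> edb_shapes \<Pi>"
  "!!e us. (e, us) \<in> ad_body ro ==> set us <= insert None (Some ` set (ad_args ro))"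
  "vars_list (ad_args ro) ~= {} ==> ad_pred ro \<in> idb \<Pi>"
 shows "good_adornment \<Pi> ro"
 using assms unfolding good_adornment_def by blast

lemma good_adornmentD:
 assumes "good_adornment \<Pi> ro"
 shows "finite (ad_body ro)" "!!v. v \<in> vars_list (ad_args ro) ==> EX A:ad_body ro. v \<in> vars_masked A"
  "EX R:\<Pi>. ad_pred ro = fst (head R) & length (ad_args ro) = length (snd (head R))"
  "consts_list (ad_args ro) <= program_consts \<Pi>"
  "!!e us. (e, us) \<in> ad_body ro ==> (e, length us) \<in> edb_shapes \<Pi>"
  "!!e us. (e, us) \<in> ad_body ro ==> set us <= insert None (Some ` set (ad_args ro))"
  "vars_list (ad_args ro) ~= {} ==> ad_pred ro \<in> idb \<Pi>"
 using assms unfolding good_adornment_def by blast+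

lemma subst_list_Var_consts: "consts_list (subst_list (Var \<circ> pn) ts) = consts_list ts"
proof -
 have "Cst c = subst_trm (Var \<circ> pn) t \<longleftrightarrow> t = Cst c" for c t by (cases t) auto
 thus ?thesis unfolding consts_list_def subst_list_def by (auto simp: image_iff)
qed

lemma good_adornment_rename:
 assumes "good_adornment \<Pi> ro"
 shows "good_adornment \<Pi> (rename pn ro)"
proof -
 have b: "ad_body (rename pn ro) = rename_masked pn ` ad_body ro" by (rule body_rename)
 have a: "ad_args (rename pn ro) = subst_list (Var \<circ> pn) (ad_args ro)" "ad_pred (rename pn ro) = ad_pred ro"
  by (simp_all add: rename_def)
 note g = good_adornmentD[OF assms]
 obtain R where R: "R \<in> \<Pi>" "ad_pred ro = fst (head R)" "length (ad_args ro) = length (snd (head R))"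
  using g(3) by blast
 have us0: "EX us0. (e, us0) \<in> ad_body ro & us = map (map_option (subst_trm (Var \<circ> pn))) us0"
  if eu: "(e, us) \<in> ad_body (rename pn ro)" for e us
 proof -
  obtain A0 where A0: "A0 \<in> ad_body ro" "(e, us) = rename_masked pn A0" using eu unfolding b by blast
  thus ?thesis by (intro exI[of _ "snd A0"]) (simp add: rename_masked_def)
 qed
 show ?thesis
 proof (rule good_adornmentI[OF _ _ R(1)])
  show "finite (ad_body (rename pn ro))" unfolding b using g(1) by simp
  show "EX A:ad_body (rename pn ro). v \<in> vars_masked A" if v: "v \<in> vars_list (ad_args (rename pn ro))" for v
  proof -
   obtain u where u: "u \<in> vars_list (ad_args ro)" "v = pn u" using v unfolding vars_rename by blast
   then obtain A where "A \<in> ad_body ro" "u \<in> vars_masked A" using g(2) by blast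
   thus ?thesis unfolding b u(2) using vars_rename_masked by blast
  qed
  show "(e, length us) \<in> edb_shapes \<Pi>" if "(e, us) \<in> ad_body (rename pn ro)" for e us
   using us0[OF that] g(5) by auto
  show "set us <= insert None (Some ` set (ad_args (rename pn ro)))" if "(e, us) \<in> ad_body (rename pn ro)" for e us
  proof -
   obtain us0 where "(e, us0) \<in> ad_body ro" "us = map (map_option (subst_trm (Var \<circ> pn))) us0"
    using us0[OF \<open>(e, us) \<in> ad_body (rename pn ro)\<close>] by blast
   thus ?thesis using g(6)[of e us0] unfolding a subst_list_def by fastforce
  qed
  show "ad_pred (rename pn ro) \<in> idb \<Pi>" if "vars_list (ad_args (rename pn ro)) ~= {}"
  proof -
   have "vars_list (ad_args ro) ~= {}" using that by (simp add: vars_rename)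
   thus ?thesis by (simp add: g(7) a(2))
  qed
  show "consts_list (ad_args (rename pn ro)) <= program_consts \<Pi>"
   unfolding a subst_list_Var_consts by (rule g(4))
  show "ad_pred (rename pn ro) = fst (head R)" unfolding a by (rule R(2))
  show "length (ad_args (rename pn ro)) = length (snd (head R))" unfolding a subst_list_def length_map by (rule R(3))
 qed
qed

lemma vars_subst_list: "v \<in> vars_list (subst_list si ts) \<longleftrightarrow> (EX x:vars_list ts. si x = Var v)"
proof -
 have "Var v = subst_trm si t \<longleftrightarrow> (EX x:vars_trm t. si x = Var v)" for t by (cases t) auto
 thus ?thesis unfolding Var_in_set[of v] unfolding subst_list_def vars_list_def by (auto simp: image_iff)
qed

lemma vars_head_body:
 assumes "datalog_program \<Pi>" "R \<in> \<Pi>" "x \<in> vars_list (snd (head R))"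
 shows "EX A:set (body R). x \<in> vars_list (snd A)"
 using assms unfolding datalog_program_def by blast

definition pre_body :: "program => rule => (nat => trm) => adornment list => masked_atom set" where
 "pre_body \<Pi> R si ros = (UN ro':set ros. subst_body si (ad_body ro')) Un
   (%(e, ts). (e, map Some ts)) ` set (map (%(e, ts). (e, subst_list si ts)) (edb_atoms \<Pi> R))"

lemma good_adornments:
 assumes dp: "datalog_program \<Pi>" and r: "r \<in> adorned_program \<Pi>"
 shows "good_adornment \<Pi> (fst (ar_head r))"
 using r
proof induction
 case (adorn R ros ros' si ss \<E> ro)
 let ?B = "pre_body \<Pi> R si ros'" and ?q = "fst (head R)"
 have ro: "ro = g_out ?q ss ?B" using adorn.hyps unfolding pre_body_def by simp
 have ss: "ss = subst_list si (snd (head R))" by fact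
 have R: "R \<in> \<Pi>" by fact
 have good': "good_adornment \<Pi> ro'" if r': "ro' \<in> set ros'" for ro'
 proof -
  obtain i where i: "i < length ros" "ro' = ros' ! i" using r' adorn.hyps(3) by (auto simp: in_set_conv_nth)
  from adorn.IH(1)[rule_format, OF i(1)] have "good_adornment \<Pi> (ros ! i)" by auto
  moreover from adorn.hyps(4)[rule_format, OF i(1)] have "variant (ros ! i) ro'" unfolding i(2) ..
  ultimately have "good_adornment \<Pi> (ros ! i)" "variant (ros ! i) ro'" by auto
  thus ?thesis using good_adornment_rename unfolding variant_iff by blast
 qed
 have args: "ad_args ro = ss" "ad_pred ro = ?q" unfolding ro g_out_def by (simp_all add: Let_def)
 have len: "length (idb_atoms \<Pi> R) = length ros'" using adorn.hyps by simp
 let ?ps = "zip (map snd (idb_atoms \<Pi> R)) (map ad_args ros')"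
 have mgu: "mgu si ?ps" by fact
 have fin: "finite ?B" unfolding pre_body_def subst_body_def using good_adornmentD(1)[OF good'] by auto
 have csts: "c \<in> program_consts \<Pi>" if "si x = Cst c" for x c
 proof (rule mgu_consts[OF mgu _ that])
  fix us ts assume st: "(us, ts) \<in> set ?ps"
  have "us \<in> snd ` set (body R)" using set_zip_leftD[OF st] unfolding idb_atoms_def by auto
  moreover have "consts_list ts <= program_consts \<Pi>"
   using set_zip_rightD[OF st] good_adornmentD(4)[OF good'] by auto
  ultimately show "consts_list us <= program_consts \<Pi> & consts_list ts <= program_consts \<Pi>"
   using R unfolding program_consts_def rule_atoms_def by auto
 qed
 \<comment> \<open>A variable of the instantiated head stems from a rule variable, which by range
   restriction occurs in some body atom. In an IDB atom, the unifier identifies its image with that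
   of a head variable of the adornment, covered by the induction hypothesis.\<close>
 have cov: "EX A:?B. v \<in> vars_masked A" if v: "v \<in> vars_list ss" for v
 proof -
  obtain x where x: "x \<in> vars_list (snd (head R))" "si x = Var v" using v unfolding ss vars_subst_list by blast
  obtain A where A: "A \<in> set (body R)" "x \<in> vars_list (snd A)" using vars_head_body[OF dp R x(1)] by blast
  show ?thesis
  proof (cases "fst A \<in> idb \<Pi>")
   case False
   hence "A \<in> set (edb_atoms \<Pi> R)" using A by (simp add: edb_atoms_def)
   hence "(fst A, map Some (subst_list si (snd A))) \<in> ?B" unfolding pre_body_def by force
   moreover have "v \<in> vars_masked (fst A, map Some (subst_list si (snd A)))"
    using A(2) x(2) vars_subst_list[of v si "snd A"] Var_in_set[of v "subst_list si (snd A)"] unfolding vars_masked_iff by auto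
   ultimately show ?thesis by blast
  next
   case True
   hence "A \<in> set (idb_atoms \<Pi> R)" using A by (simp add: idb_atoms_def)
   then obtain i where i: "i < length ros'" "idb_atoms \<Pi> R ! i = A" using len by (metis in_set_conv_nth)
   have "(snd A, ad_args (ros' ! i)) \<in> set ?ps" using i len by (force simp: set_zip)
   hence "subst_list si (snd A) = subst_list si (ad_args (ros' ! i))" using mgu unfolding mgu_def unifier_def by blast
   moreover have "v \<in> vars_list (subst_list si (snd A))" using A(2) x(2) by (auto simp: vars_subst_list)
   ultimately obtain y where y: "y \<in> vars_list (ad_args (ros' ! i))" "si y = Var v" using vars_subst_list by auto
   have i': "ros' ! i \<in> set ros'" using i by simp
   obtain A' where A': "A' \<in> ad_body (ros' ! i)" "y \<in> vars_masked A'"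
    using good_adornmentD(2)[OF good'[OF i'] y(1)] by blast
   let ?A = "(fst A', map (map_option (subst_trm si)) (snd A'))"
   have "?A \<in> subst_body si (ad_body (ros' ! i))" using A'(1) unfolding subst_body_def by (force simp: case_prod_beta)
   hence "?A \<in> ?B" using i' unfolding pre_body_def by blast
   moreover have "v \<in> vars_masked ?A"
    using A'(2) y(2) unfolding vars_masked_iff by (force simp: image_iff)
   ultimately show ?thesis by blast
  qed
 qed
 have "ALL v:vars_list (ad_args ro). EX A:ad_body ro. v \<in> vars_masked A"
  unfolding args unfolding ro using g_out_covers[OF fin] cov by blast
 moreover have "finite (ad_body ro)"
  by (rule finite_subset[OF g_out_body_subset[of ?q ss ?B, folded ro]]) (simp add: mask_atoms_def fin)
 moreover have "ad_pred ro = fst (head R)" "length (ad_args ro) = length (snd (head R))"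
  unfolding args ss by (auto simp: subst_list_def)
 moreover have "consts_list (ad_args ro) <= program_consts \<Pi>"
 proof
  fix c assume "c \<in> consts_list (ad_args ro)"
  then obtain t where t: "t \<in> set (snd (head R))" "subst_trm si t = Cst c"
   unfolding args ss consts_list_def subst_list_def by force
  show "c \<in> program_consts \<Pi>"
  proof (cases t)
   case (Var x)
   thus ?thesis using csts t by simp
  next
   case (Cst d)
   thus ?thesis using t R unfolding program_consts_def rule_atoms_def consts_list_def by fastforce
  qed
 qed
 moreover have "(e, length us) \<in> edb_shapes \<Pi> & set us <= insert None (Some ` set (ad_args ro))"
  if "(e, us) \<in> ad_body ro" for e us
 proof -
  have "(e, us) \<in> mask_atoms ss ?B" using that g_out_body_subset unfolding ro by blast
  then obtain us0 where us0: "(e, us0) \<in> ?B" "us = map (mask ss) us0" unfolding mask_atoms_def by auto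
  have "(e, length us0) \<in> edb_shapes \<Pi>"
   using us0(1) unfolding pre_body_def
  proof
   assume "(e, us0) \<in> (UN ro':set ros'. subst_body si (ad_body ro'))"
   thus ?thesis using good_adornmentD(5)[OF good'] unfolding subst_body_def by fastforce
  next
   assume "(e, us0) \<in> (%(e, ts). (e, map Some ts)) ` set (map (%(e, ts). (e, subst_list si ts)) (edb_atoms \<Pi> R))"
   then obtain ts where "(e, ts) \<in> set (edb_atoms \<Pi> R)" "us0 = map Some (subst_list si ts)" by auto
   thus ?thesis using R unfolding edb_shapes_def subst_list_def by force
  qed
  moreover have "set us <= insert None (Some ` set ss)"
   unfolding us0(2) mask_def by (auto split: option.splits)
  ultimately show ?thesis using us0(2) args by simp
 qed
 moreover have "ad_pred ro \<in> idb \<Pi>" if ne: "vars_list (ad_args ro) ~= {}"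
 proof -
  obtain v where "v \<in> vars_list ss" using ne args by blast
  then obtain x where "x \<in> vars_list (snd (head R))" unfolding ss vars_subst_list by blast
  hence "body R ~= []" using vars_head_body[OF dp R] by fastforce
  thus ?thesis unfolding args idb_body using R by blast
 qed
 ultimately have "good_adornment \<Pi> ro" by (intro good_adornmentI[OF _ _ R]) blast+
 thus ?case by simp
qed

text \<open>The head variables are numbered consecutively by a renaming. Since a body mentions only
  head arguments, the whole adornment then ranges over a finite set.\<close>

lemma finite_adornment_classes:
 assumes dp: "datalog_program \<Pi>"
 obtains F where "finite F" "!!ro. ro \<in> adornments \<Pi> ==> EX ro0:F. variant ro ro0"
proof -
 have fin: "finite \<Pi>" using dp unfolding datalog_program_def by blast
 define M where "M = Max (insert 0 ((%R. length (snd (head R))) ` \<Pi>))"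
 have M: "length (snd (head R)) <= M" if "R \<in> \<Pi>" for R unfolding M_def using that fin by auto
 have fC: "finite (consts_list ts)" for ts
  by (rule finite_subset[of _ "(%t. case t of Cst c => c | _ => 0) ` set ts"]) (force simp: consts_list_def image_iff)+
 have finC: "finite (program_consts \<Pi>)" unfolding program_consts_def using fin fC by auto
 define T where "T = Var ` {..<M} Un Cst ` program_consts \<Pi>"
 have finT: "finite T" unfolding T_def using finC by simp
 define Args where "Args = {ts. set ts <= T & length ts <= M}"
 have finArgs: "finite Args" unfolding Args_def by (rule finite_lists_length_le[OF finT])
 define At where "At = (UN (e, n):edb_shapes \<Pi>. (%us. (e, us)) ` {us. set us <= insert None (Some ` T) & length us = n})"
 have "finite (edb_shapes \<Pi>)" unfolding edb_shapes_def using fin by auto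
 hence finAt: "finite At" unfolding At_def using finT by (auto intro!: finite_lists_length_eq)
 define F where "F = (%(q, ts, B). Adornment q ts B) ` ((%R. fst (head R)) ` \<Pi> \<times> Args \<times> Pow At)"
 have finF: "finite F" unfolding F_def using fin finArgs finAt by auto
 have "EX ro0:F. variant ro ro0" if ro: "ro \<in> adornments \<Pi>" for ro
 proof -
  have g: "good_adornment \<Pi> ro" using good_adornments[OF dp] ro unfolding adornments_def by blast
  obtain R where R: "R \<in> \<Pi>" "ad_pred ro = fst (head R)" "length (ad_args ro) = length (snd (head R))"
   using good_adornmentD(3)[OF g] by blast
  let ?X = "vars_list (ad_args ro)"
  have "Var ` ?X <= set (ad_args ro)" using Var_in_set by blast
  hence "card (Var ` ?X) <= length (ad_args ro)" by (meson List.finite_set card_length card_mono le_trans)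
  hence cX: "card ?X <= M" using M[OF R(1)] R(3) by (simp add: card_image inj_on_def)
  obtain f where f: "bij_betw f ?X {0..<card ?X}" using ex_bij_betw_finite_nat[OF finite_vars_list] by blast
  obtain pn where p: "bij pn" "!!a. a \<in> ?X ==> pn a = f a"
   using extend_to_bij[OF finite_vars_list bij_betw_imp_inj_on[OF f]] by blast
  let ?ro = "rename pn ro"
  have g': "good_adornment \<Pi> ?ro" by (rule good_adornment_rename[OF g])
  have aT: "set (ad_args ?ro) <= T"
  proof
   fix t assume t: "t \<in> set (ad_args ?ro)"
   show "t \<in> T"
   proof (cases t)
    case (Var v)
    hence "v \<in> vars_list (ad_args ?ro)" using t by (simp add: Var_in_set)
    hence "v \<in> f ` ?X" unfolding vars_rename using p(2) by auto
    hence "v < card ?X" using bij_betw_imp_surj_on[OF f] by simp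
    thus ?thesis using Var cX unfolding T_def by simp
   next
    case (Cst c)
    thus ?thesis using t good_adornmentD(4)[OF g'] unfolding T_def consts_list_def by blast
   qed
  qed
  have "length (ad_args ?ro) <= M" using M[OF R(1)] R(3) by (simp add: rename_def subst_list_def)
  hence "ad_args ?ro \<in> Args" unfolding Args_def using aT by simp
  moreover have "ad_body ?ro <= At"
  proof
   fix A assume A: "A \<in> ad_body ?ro"
   obtain e us where eu: "A = (e, us)" by (cases A)
   have "(e, length us) \<in> edb_shapes \<Pi>" "set us <= insert None (Some ` T)"
    using good_adornmentD(5,6)[OF g'] A aT unfolding eu by blast+
   thus "A \<in> At" unfolding At_def eu by blast
  qed
  moreover have "ad_pred ?ro \<in> (%R. fst (head R)) ` \<Pi>" using R by (simp add: rename_def)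
  ultimately have "?ro \<in> F" unfolding F_def
   by (intro image_eqI[of _ _ "(ad_pred ?ro, ad_args ?ro, ad_body ?ro)"]) auto
  thus ?thesis using p(1) unfolding variant_iff by blast
 qed
 with finF show thesis by (rule that)
qed

definition pred_adornments :: "program => nat => adornment set" where
 "pred_adornments \<Pi> q = {ro \<in> adornments \<Pi>. ad_pred ro = q}"

abbreviation variants :: "(adornment \<times> adornment) set" where
 "variants == {(ro, ro'). variant ro ro'}"

lemma finite_classes:
 assumes "datalog_program \<Pi>"
 shows "finite (pred_adornments \<Pi> q // variants)"
proof -
 obtain F where F: "finite F" "!!ro. ro \<in> adornments \<Pi> ==> EX ro0:F. variant ro ro0"
  using finite_adornment_classes[OF assms] by blast
 have "pred_adornments \<Pi> q // variants <= (%ro. variants `` {ro}) ` F"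
 proof
  fix X assume "X \<in> pred_adornments \<Pi> q // variants"
  then obtain ro where ro: "ro \<in> adornments \<Pi>" "X = variants `` {ro}" unfolding quotient_def pred_adornments_def by blast
  obtain ro0 where "ro0 \<in> F" "variant ro ro0" using F(2)[OF ro(1)] by blast
  thus "X \<in> (%ro. variants `` {ro}) ` F" unfolding ro(2) using variant_class by (intro image_eqI[of _ _ ro0])
 qed
 thus ?thesis using F(1) finite_surj by blast
qed

lemma finite_ew:
 assumes "datalog_program \<Pi>"
 shows "finite (ew_adornment ` adornments \<Pi>)"
proof -
 obtain F where F: "finite F" "!!ro. ro \<in> adornments \<Pi> ==> EX ro0:F. variant ro ro0"
  using finite_adornment_classes[OF assms] by blast
 have "ew_adornment ` adornments \<Pi> <= ew_adornment ` F" using F(2) ew_variant by blast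
 thus ?thesis using F(1) finite_surj by blast
qed

lemma finite_idb: "finite \<Pi> ==> finite (idb \<Pi>)"
 by (rule finite_subset[of _ "(%R. fst (head R)) ` \<Pi>"]) (auto simp: idb_def)

lemma card_classes_le:
 assumes "datalog_program \<Pi>" "q \<in> idb \<Pi>"
 shows "card (pred_adornments \<Pi> q // variants) <= adornment_count \<Pi>"
proof -
 have "finite (idb \<Pi>)" using assms(1) finite_idb unfolding datalog_program_def by blast
 thus ?thesis unfolding adornment_count_def pred_adornments_def using assms(2) by (intro Max_ge) auto
qed

lemma ew_adornment_le:
 assumes "datalog_program \<Pi>" "ro \<in> adornments \<Pi>"
 shows "ew_adornment ro <= ew \<Pi>"
 unfolding ew_def using finite_ew[OF assms(1)] assms(2) by (intro Max_ge) auto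

text \<open>A positive maximum is attained by an adornment with a head variable, and covering a
  single variable already costs 1. The predicate of that adornment is IDB, so
  \<open>adornment_count\<close> sees it as well.\<close>

lemma ew_ge_one:
 assumes dp: "datalog_program \<Pi>" and ew: "0 < ew \<Pi>"
 shows "1 <= ew \<Pi>" "1 <= adornment_count \<Pi>" "EX R:\<Pi>. vars_list (snd (head R)) ~= {}"
proof -
 have "ew \<Pi> \<in> insert 0 (ew_adornment ` adornments \<Pi>)"
  unfolding ew_def using finite_ew[OF dp] by (intro Max_in) auto
 then obtain ro where ro: "ro \<in> adornments \<Pi>" "ew \<Pi> = ew_adornment ro" using ew by auto
 have g: "good_adornment \<Pi> ro" using good_adornments[OF dp] ro(1) unfolding adornments_def by blast
 have ne: "vars_list (ad_args ro) ~= {}"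
 proof
  assume e: "vars_list (ad_args ro) = {}"
  have "ew_adornment ro <= 0"
   unfolding ew_adornment_def fractional_cover_number_def e
   by (rule cInf_lower) (auto intro!: exI[of _ "%_. 0"] bdd_belowI[of _ 0] sum_nonneg)
  thus False using ew ro(2) by simp
 qed
 then obtain v where v: "v \<in> vars_list (ad_args ro)" by blast
 have "1 <= ew_adornment ro"
  unfolding ew_adornment_def
  by (rule fractional_cover_number_ge_one[OF v]) (use good_adornmentD(1,2)[OF g] in auto)
 thus "1 <= ew \<Pi>" using ro(2) by simp
 have q: "ad_pred ro \<in> idb \<Pi>" using good_adornmentD(7)[OF g ne] .
 have "variants `` {ro} \<in> pred_adornments \<Pi> (ad_pred ro) // variants"
  using ro(1) unfolding pred_adornments_def by (intro quotientI) simp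
 hence "0 < card (pred_adornments \<Pi> (ad_pred ro) // variants)"
  using finite_classes[OF dp] by (auto simp: card_gt_0_iff)
 thus "1 <= adornment_count \<Pi>" using card_classes_le[OF dp q] by linarith
 obtain r where r: "r \<in> adorned_program \<Pi>" "ro = fst (ar_head r)" using ro(1) unfolding adornments_def by blast
 from r(1) show "EX R:\<Pi>. vars_list (snd (head R)) ~= {}"
 proof cases
  case (adorn R ros ros' si ss \<E> ro')
  have "ad_args ro = ss" unfolding r(2) adorn(1) using adorn by (simp add: g_out_def Let_def)
  then obtain v where "v \<in> vars_list (subst_list si (snd (head R)))" using ne adorn by auto
  hence "vars_list (snd (head R)) ~= {}" unfolding vars_subst_list by blast
  thus ?thesis using adorn(2) by blast
 qed
qed

section \<open>Size of the IDB relations\<close>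

text \<open>\<open>None\<close> matches any component. Restricting to EDB predicates keeps the
  relation of every masked atom within the size bound \<open>N\<close>.\<close>

definition matched :: "program => fact set => (nat => nat) => masked_atom => bool" where
 "matched \<Pi> M th A \<longleftrightarrow> fst A \<in> edb \<Pi> &
   (EX t. (fst A, t) \<in> M & list_all2 (%u c. ALL s. u = Some s --> c = ground_trm th s) (snd A) t)"

definition instances :: "program => fact set => adornment => nat list set" where
 "instances \<Pi> M ro = {map (ground_trm th) (ad_args ro) | th. ALL A:ad_body ro. matched \<Pi> M th A}"

lemma ground_subst: "ground_trm th (subst_trm si t) = ground_trm (ground_trm th \<circ> si) t"
 by (cases t) auto

lemma matched_subst:
 "matched \<Pi> M th (e, map (map_option (subst_trm si)) us) \<longleftrightarrow> matched \<Pi> M (ground_trm th \<circ> si) (e, us)"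
proof -
 have "(ALL s. map_option (subst_trm si) u = Some s --> c = ground_trm th s) \<longleftrightarrow>
   (ALL s. u = Some s --> c = ground_trm (ground_trm th \<circ> si) s)" for u c
  by (cases u) (auto simp: ground_subst)
 thus ?thesis unfolding matched_def by (simp add: list_all2_map1)
qed

lemma matched_mask:
 assumes "matched \<Pi> M th (e, us)"
 shows "matched \<Pi> M th (e, map (mask ss) us)"
proof -
 have *: "(ALL s. u = Some s --> c = ground_trm th s) ==> (ALL s. mask ss u = Some s --> c = ground_trm th s)" for u c
  by (auto simp: mask_def split: option.splits if_splits)
 obtain t where t: "(e, t) \<in> M" "list_all2 (%u c. ALL s. u = Some s --> c = ground_trm th s) us t" "e \<in> edb \<Pi>"
  using assms unfolding matched_def by auto
 have "list_all2 (%u c. ALL s. u = Some s --> c = ground_trm th s) (map (mask ss) us) t"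
  unfolding list_all2_map1 using t(2) by (rule list_all2_mono) (rule *)
 thus ?thesis using t unfolding matched_def by auto
qed

lemma instances_rename:
 assumes "bij pn"
 shows "instances \<Pi> M ro <= instances \<Pi> M (rename pn ro)"
proof
 fix t assume "t \<in> instances \<Pi> M ro"
 then obtain th where t: "t = map (ground_trm th) (ad_args ro)" "ALL A:ad_body ro. matched \<Pi> M th A"
  unfolding instances_def by blast
 let ?th = "th \<circ> inv pn"
 have c: "ground_trm ?th \<circ> (Var \<circ> pn) = th" using assms by (auto simp: fun_eq_iff bij_is_inj)
 have "t = map (ground_trm ?th) (ad_args (rename pn ro))"
  unfolding t(1) rename_def subst_list_def by (simp add: ground_subst c)
 moreover have "ALL A:ad_body (rename pn ro). matched \<Pi> M ?th A"
  unfolding body_rename rename_masked_def using t(2) by (auto simp: matched_subst c)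
 ultimately show "t \<in> instances \<Pi> M (rename pn ro)" unfolding instances_def by blast
qed

lemma instances_variant: "variant ro ro' ==> instances \<Pi> M ro <= instances \<Pi> M ro'"
 unfolding variant_iff using instances_rename by blast

text \<open>The counting bound applied to the adornment itself: hyperedges are the masked atoms, and
  an assignment on one of them is determined by any tuple it matches, so each relation has at most
  \<open>N\<close> elements.\<close>

lemma card_instances_le:
 assumes g: "good_adornment \<Pi> ro" and N: "1 <= N"
  and M: "!!p. p \<in> edb \<Pi> ==> finite {t. (p, t) \<in> M} & card {t. (p, t) \<in> M} <= N"
 shows "finite (instances \<Pi> M ro)" "real (card (instances \<Pi> M ro)) <= real N powr ew_adornment ro"
proof -
 let ?I = "ad_body ro" and ?X = "vars_list (ad_args ro)"
 define r where "r A = {g. (ALL v. v \<notin> vars_masked A --> g v = 0) & matched \<Pi> M g A}" for A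
 note gD = good_adornmentD[OF g]
 have r: "finite (r A)" "card (r A) <= N" for A
 proof -
  let ?T = "{t. (fst A, t) \<in> M}"
  define f where "f g = (SOME t. (fst A, t) \<in> M &
    list_all2 (%u c. ALL s. u = Some s --> c = ground_trm g s) (snd A) t)" for g
  have f: "(fst A, f g) \<in> M & list_all2 (%u c. ALL s. u = Some s --> c = ground_trm g s) (snd A) (f g)"
   if "g \<in> r A" for g
   using that unfolding r_def matched_def f_def by (intro someI_ex[of "%t. (fst A, t) \<in> M &
    list_all2 (%u c. ALL s. u = Some s --> c = ground_trm g s) (snd A) t"]) blast
  have inj: "inj_on f (r A)"
  proof (rule inj_onI, rule ext)
   fix g g' v assume gg: "g \<in> r A" "g' \<in> r A" "f g = f g'"
   show "g v = g' v"
   proof (cases "v \<in> vars_masked A")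
    case True
    then obtain k where k: "k < length (snd A)" "snd A ! k = Some (Var v)"
     unfolding vars_masked_iff by (auto simp: in_set_conv_nth)
    have "f g ! k = g v" "f g' ! k = g' v"
     using f[OF gg(1)] f[OF gg(2)] k unfolding list_all2_conv_all_nth by auto
    thus ?thesis using gg(3) by simp
   qed (use gg in \<open>simp add: r_def\<close>)
  qed
  have im: "f ` r A <= ?T" using f by blast
  show "finite (r A)"
  proof (cases "fst A \<in> edb \<Pi>")
   case True
   thus ?thesis using M inj im finite_subset finite_imageD by metis
  next
   case False
   hence "r A = {}" by (simp add: r_def matched_def)
   thus ?thesis by simp
  qed
  show "card (r A) <= N"
  proof (cases "fst A \<in> edb \<Pi>")
   case True
   have "card (r A) <= card ?T" by (rule card_inj_on_le[OF inj im]) (use M True in blast)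
   thus ?thesis using M[OF True] by linarith
  next
   case False
   hence "r A = {}" by (simp add: r_def matched_def)
   thus ?thesis by simp
  qed
 qed
 let ?C = "consistent ?I vars_masked r ?X"
 have sub: "instances \<Pi> M ro <= (%g. map (ground_trm g) (ad_args ro)) ` ?C"
 proof
  fix t assume "t \<in> instances \<Pi> M ro"
  then obtain th where t: "t = map (ground_trm th) (ad_args ro)" "ALL A:?I. matched \<Pi> M th A"
   unfolding instances_def by blast
  define g where "g v = (if v \<in> ?X then th v else 0)" for v
  have "t = map (ground_trm g) (ad_args ro)"
   unfolding t(1) g_def by (auto intro!: ground_trm_cong simp: vars_list_def)
  moreover have "matching vars_masked r ?X g A ~= {}" if A: "A \<in> ?I" for A
  proof -
   define ta where "ta v = (if v \<in> vars_masked A then th v else 0)" for v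
   have "matched \<Pi> M ta A"
   proof -
    obtain t where t: "(fst A, t) \<in> M" "list_all2 (%u c. ALL s. u = Some s --> c = ground_trm th s) (snd A) t"
     "fst A \<in> edb \<Pi>" using \<open>ALL A:?I. matched \<Pi> M th A\<close> A unfolding matched_def by blast
    have "ground_trm ta s = ground_trm th s" if "Some s \<in> set (snd A)" for s
     using that by (intro ground_trm_cong) (auto simp: ta_def vars_masked_def)
    hence "list_all2 (%u c. ALL s. u = Some s --> c = ground_trm ta s) (snd A) t"
     using t(2) unfolding list_all2_conv_all_nth by (metis nth_mem)
    thus ?thesis using t unfolding matched_def by blast
   qed
   hence "ta \<in> r A" unfolding r_def ta_def by simp
   hence "ta \<in> matching vars_masked r ?X g A" unfolding matching_def ta_def g_def by simp
   thus ?thesis by blast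
  qed
  ultimately show "t \<in> (%g. map (ground_trm g) (ad_args ro)) ` ?C"
   unfolding consistent_def g_def by auto
 qed
 have "relations ?I r (%_. 0)" by unfold_locales (use gD(1) r in auto)
 hence finC: "finite ?C"
  by (rule relations.finite_consistent) (use gD(2) finite_vars_list in auto)
 thus "finite (instances \<Pi> M ro)" using sub finite_surj by blast
 have cI: "real (card (instances \<Pi> M ro)) <= real (card ?C)"
  using surj_card_le[OF finC sub] by simp
 have "real (card (instances \<Pi> M ro)) <= 1 * real N powr fractional_cover_number ?X ?I vars_masked"
 proof (rule fractional_cover_number_bound)
  fix x :: "masked_atom => real" assume x: "ALL i:?I. 0 <= x i & x i <= 1"
   "ALL v:?X. 1 <= (SUM i:{i:?I. v \<in> vars_masked i}. x i)"
  interpret relations ?I vars_masked r x by unfold_locales (use gD(1) r x in auto)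
  note cI
  also have "real (card ?C) <= (PROD i:?I. real (card (r i)) powr x i)"
   by (rule card_consistent_le) (use finite_vars_list x(2) in auto)
  also have "... <= (PROD i:?I. real N powr x i)"
   using r x(1) by (intro prod_mono conjI powr_mono2) auto
  also have "... = real N powr (SUM i:?I. x i)" using N by (intro powr_sum[symmetric]) auto
  finally show "real (card (instances \<Pi> M ro)) <= 1 * real N powr (SUM i:?I. x i)" by simp
 qed (use N gD(1,2) in auto)
 thus "real (card (instances \<Pi> M ro)) <= real N powr ew_adornment ro"
  unfolding ew_adornment_def by simp
qed

lemma ground_list_eq: "subst_list (Cst \<circ> Th) ts = map (Cst \<circ> ground_trm Th) ts"
proof -
 have "subst_trm (Cst \<circ> Th) t = Cst (ground_trm Th t)" for t by (cases t) auto
 thus ?thesis unfolding subst_list_def by simp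
qed

lemma fresh_variant:
 assumes "finite W" "finite (vars_adornment ro)"
 obtains ro' where "variant ro ro'" "vars_adornment ro' Int W = {}"
proof -
 define m where "m = Suc (Max (insert 0 W))"
 have m: "w < m" if "w \<in> W" for w unfolding m_def using that assms(1) by (simp add: less_Suc_eq_le)
 have "inj_on (%v. v + m) (vars_adornment ro)" by (simp add: inj_on_def)
 then obtain pn where p: "bij pn" "!!v. v \<in> vars_adornment ro ==> pn v = v + m"
  using extend_to_bij[OF assms(2)] by metis
 have "vars_adornment (rename pn ro) = pn ` vars_adornment ro"
  unfolding vars_adornment_def vars_rename body_rename by (auto simp: vars_rename_masked)
 hence "vars_adornment (rename pn ro) Int W = {}" using p(2) m by fastforce
 thus thesis using that[of "rename pn ro"] p(1) unfolding variant_iff by blast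
qed

lemma finite_vars_adornment: "good_adornment \<Pi> ro ==> finite (vars_adornment ro)"
proof -
 assume "good_adornment \<Pi> ro"
 moreover have "finite (vars_masked A)" for A
  by (rule finite_subset[of _ "(%u. case u of Some (Var v) => v | _ => 0) ` set (snd A)"])
   (force simp: vars_masked_iff image_iff)+
 ultimately show ?thesis unfolding vars_adornment_def using finite_vars_list by (auto simp: good_adornment_def)
qed

lemma finite_vars_rule: "finite (vars_rule R)"
 unfolding vars_rule_def using finite_vars_list by auto

text \<open>A derivation step instantiates an mgu: the valuations of the rule and of the adornment of the
 IDB atom together form a unifier.\<close>

lemma derived_instance:
 assumes dp: "datalog_program \<Pi>" and lin: "linear_program \<Pi>" and db: "db_instance \<Pi> D"
  and x: "x \<in> least_fixpoint \<Pi> D" and q: "fst x \<in> idb \<Pi>"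
 shows "EX ro:pred_adornments \<Pi> (fst x). snd x \<in> instances \<Pi> (least_fixpoint \<Pi> D) ro"
 using x q
proof (induction rule: least_fixpoint_induct)
 case (base x)
 hence "fst x \<in> edb \<Pi>" using db unfolding db_instance_def by blast
 thus ?case using base unfolding edb_def by blast
next
 case (rule R th)
 let ?M = "least_fixpoint \<Pi> D"
 note R = \<open>R \<in> \<Pi>\<close>
 have body: "ground_atom th A \<in> ?M" if "A \<in> set (body R)" for A using rule.IH[OF that] by blast
 have "EX ros ros' th'. length ros = length (idb_atoms \<Pi> R) & length ros' = length ros &
   (ALL i<length ros. ad_pred (ros ! i) = fst (idb_atoms \<Pi> R ! i) &
    (EX r. r \<in> adorned_program \<Pi> & fst (ar_head r) = ros ! i)) &
   (ALL i<length ros. variant (ros ! i) (ros' ! i) & vars_adornment (ros' ! i) Int vars_rule R = {}) &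
   (ALL i<length ros. ALL j<i. vars_adornment (ros' ! i) Int vars_adornment (ros' ! j) = {}) &
   (ALL i<length ros. map (ground_trm th) (snd (idb_atoms \<Pi> R ! i)) = map (ground_trm th') (ad_args (ros' ! i)) &
    (ALL A:ad_body (ros' ! i). matched \<Pi> ?M th' A))"
 proof (cases "idb_atoms \<Pi> R")
  case Nil
  thus ?thesis by (intro exI[of _ "[]"] exI[of _ th]) simp
 next
  case (Cons A As)
  hence A: "idb_atoms \<Pi> R = [A]" using lin R unfolding linear_program_def by (metis le_zero_eq length_0_conv length_Cons not_less_eq_eq One_nat_def)
  have "A \<in> set (idb_atoms \<Pi> R)" using A by simp
  hence AB: "A \<in> set (body R)" "fst A \<in> idb \<Pi>" unfolding idb_atoms_def by auto
  hence "fst (ground_atom th A) \<in> idb \<Pi>" by (simp add: ground_atom_def)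
  then obtain ro where ro: "ro \<in> pred_adornments \<Pi> (fst A)" "map (ground_trm th) (snd A) \<in> instances \<Pi> ?M ro"
   using rule.IH[OF AB(1)] by (auto simp: ground_atom_def)
  have ad: "ro \<in> adornments \<Pi>" "ad_pred ro = fst A" using ro(1) unfolding pred_adornments_def by auto
  then obtain r where r: "r \<in> adorned_program \<Pi>" "fst (ar_head r) = ro" unfolding adornments_def by blast
  have g: "good_adornment \<Pi> ro" using good_adornments[OF dp r(1)] r(2) by simp
  obtain ro' where ro': "variant ro ro'" "vars_adornment ro' Int vars_rule R = {}"
   by (rule fresh_variant[OF finite_vars_rule finite_vars_adornment[OF g]])
  obtain th' where "map (ground_trm th) (snd A) = map (ground_trm th') (ad_args ro')"
    "ALL A:ad_body ro'. matched \<Pi> ?M th' A"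
   using ro(2) instances_variant[OF ro'(1)] unfolding instances_def by blast
  thus ?thesis using A ad r ro'
   by (intro exI[of _ "[ro]"] exI[of _ "[ro']"] exI[of _ th']) auto
 qed
 then obtain ros ros' th' where len: "length ros = length (idb_atoms \<Pi> R)" "length ros' = length ros"
  and ad: "ALL i<length ros. ad_pred (ros ! i) = fst (idb_atoms \<Pi> R ! i) &
    (EX r. r \<in> adorned_program \<Pi> & fst (ar_head r) = ros ! i)"
  and var: "ALL i<length ros. variant (ros ! i) (ros' ! i) & vars_adornment (ros' ! i) Int vars_rule R = {}"
  and disj: "ALL i<length ros. ALL j<i. vars_adornment (ros' ! i) Int vars_adornment (ros' ! j) = {}"
  and inst: "ALL i<length ros. map (ground_trm th) (snd (idb_atoms \<Pi> R ! i)) = map (ground_trm th') (ad_args (ros' ! i)) &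
    (ALL A:ad_body (ros' ! i). matched \<Pi> ?M th' A)"
  by (elim exE conjE) (rule that)
 \<comment> \<open>The renamed adornments share no variables with the rule, so the two valuations
   can be merged.\<close>
 define Th where "Th v = (if v \<in> vars_rule R then th v else th' v)" for v
 have ThR: "map (ground_trm Th) (snd A) = map (ground_trm th) (snd A)" if "A \<in> set (rule_atoms R)" for A
  using that by (auto intro!: ground_trm_cong simp: Th_def vars_rule_def vars_list_def)
 have Thi: "Th v = th' v" if "i < length ros" "v \<in> vars_adornment (ros' ! i)" for i v
  using var that unfolding Th_def by auto
 let ?ps = "zip (map snd (idb_atoms \<Pi> R)) (map ad_args ros')"
 have uni: "unifier (Cst \<circ> Th) ?ps"
  unfolding unifier_def
 proof clarify
  fix us ts assume "(us, ts) \<in> set ?ps"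
  then obtain i where i: "i < length ros" "us = snd (idb_atoms \<Pi> R ! i)" "ts = ad_args (ros' ! i)"
   using len by (auto simp: set_zip)
  have "idb_atoms \<Pi> R ! i \<in> set (idb_atoms \<Pi> R)" using i(1) len by simp
  hence "idb_atoms \<Pi> R ! i \<in> set (rule_atoms R)" unfolding idb_atoms_def rule_atoms_def by auto
  hence "map (ground_trm Th) us = map (ground_trm th) us" using ThR i(2) by blast
  also have "... = map (ground_trm th') ts" using inst i by blast
  also have "... = map (ground_trm Th) ts"
  proof (rule map_cong[OF refl], rule ground_trm_cong)
   fix s v assume "s \<in> set ts" "v \<in> vars_trm s"
   hence "v \<in> vars_adornment (ros' ! i)" using i(3) by (auto simp: vars_adornment_def vars_list_def)
   thus "th' v = Th v" using Thi[OF i(1)] by simp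
  qed
  finally have "map Cst (map (ground_trm Th) us) = map Cst (map (ground_trm Th) ts)" by (rule arg_cong)
  thus "subst_list (Cst \<circ> Th) us = subst_list (Cst \<circ> Th) ts" unfolding ground_list_eq by simp
 qed
 obtain si where si: "mgu si ?ps" using mgu_exists[OF uni] by blast
 then obtain ta where ta: "!!x. (Cst \<circ> Th) x = subst_trm ta (si x)" using uni unfolding mgu_def by blast
 \<comment> \<open>The ground unifier factors through the mgu, and \<open>ta\<close> is read as a
   valuation. The default 0 concerns only variables that are no value of \<open>si\<close>.\<close>
 define \<phi> where "\<phi> y = (case ta y of Cst c => c | Var _ => 0)" for y
 have \<phi>: "ground_trm \<phi> \<circ> si = Th"
 proof
  fix x show "(ground_trm \<phi> \<circ> si) x = Th x"
   using ta[of x] by (cases "si x") (auto simp: \<phi>_def split: trm.splits)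
 qed
 let ?ss = "subst_list si (snd (head R))"
 let ?ro = "g_out (fst (head R)) ?ss (pre_body \<Pi> R si ros')"
 have "Adorned_Rule (?ro, ?ss) (zip ros (map (subst_list si \<circ> snd) (idb_atoms \<Pi> R)))
   (map (%(e, ts). (e, subst_list si ts)) (edb_atoms \<Pi> R)) \<in> adorned_program \<Pi>"
  by (rule adorned_program.adorn[OF R len(1) len(2) ad var disj si refl refl]) (simp add: pre_body_def)
 hence "?ro \<in> adornments \<Pi>" unfolding adornments_def by force
 hence "?ro \<in> pred_adornments \<Pi> (fst (head R))" unfolding pred_adornments_def by (simp add: g_out_def Let_def)
 moreover have "map (ground_trm th) (snd (head R)) \<in> instances \<Pi> ?M ?ro"
 proof -
  have "map (ground_trm th) (snd (head R)) = map (ground_trm Th) (snd (head R))"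
   using ThR[of "head R"] by (simp add: rule_atoms_def)
  also have "... = map (ground_trm \<phi>) (ad_args ?ro)"
   by (simp add: g_out_def Let_def subst_list_def ground_subst \<phi>)
  finally have 1: "map (ground_trm th) (snd (head R)) = map (ground_trm \<phi>) (ad_args ?ro)" .
  have pre: "matched \<Pi> ?M \<phi> (e, us)" if eu: "(e, us) \<in> pre_body \<Pi> R si ros'" for e us
   using eu unfolding pre_body_def
  proof
   assume "(e, us) \<in> (UN ro':set ros'. subst_body si (ad_body ro'))"
   then obtain i us0 where i: "i < length ros" "(e, us0) \<in> ad_body (ros' ! i)" "us = map (map_option (subst_trm si)) us0"
    using len unfolding subst_body_def by (auto simp: in_set_conv_nth)
   have m: "matched \<Pi> ?M th' (e, us0)" using inst i by blast
   have "ground_trm Th s = ground_trm th' s" if "Some s \<in> set us0" for s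
    using Thi[OF i(1)] i(2) that
    by (intro ground_trm_cong) (force simp: vars_adornment_def vars_masked_def)
   hence "matched \<Pi> ?M Th (e, us0)"
    using m unfolding matched_def list_all2_conv_all_nth by (auto) (metis nth_mem)
   thus ?thesis unfolding i(3) matched_subst \<phi> .
  next
   assume "(e, us) \<in> (%(e, ts). (e, map Some ts)) ` set (map (%(e, ts). (e, subst_list si ts)) (edb_atoms \<Pi> R))"
   then obtain ts where ts: "(e, ts) \<in> set (edb_atoms \<Pi> R)" "us = map Some (subst_list si ts)" by auto
   hence b: "(e, ts) \<in> set (body R)" "e \<notin> idb \<Pi>" by (auto simp: edb_atoms_def)
   hence e: "e \<in> edb \<Pi>" using R unfolding edb_def preds_def rule_atoms_def by force
   have E: "map (ground_trm Th) ts = map (ground_trm th) ts"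
    using ThR[of "(e, ts)"] b by (simp add: rule_atoms_def)
   have "(e, map (ground_trm Th) ts) \<in> ?M" unfolding E using body[OF b(1)] by (simp add: ground_atom_def)
   moreover have "list_all2 (%u c. ALL s. u = Some s --> c = ground_trm \<phi> s) us (map (ground_trm Th) ts)"
    unfolding ts(2) subst_list_def list_all2_conv_all_nth by (simp add: ground_subst \<phi>)
   ultimately show ?thesis unfolding matched_def using e by auto
  qed
  have "ALL A:ad_body ?ro. matched \<Pi> ?M \<phi> A"
  proof
   fix A assume "A \<in> ad_body ?ro"
   hence "A \<in> mask_atoms ?ss (pre_body \<Pi> R si ros')" using g_out_body_subset by blast
   then obtain e us where "(e, us) \<in> pre_body \<Pi> R si ros'" "A = (e, map (mask ?ss) us)"
    unfolding mask_atoms_def by auto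
   thus "matched \<Pi> ?M \<phi> A" using matched_mask[OF pre] by simp
  qed
  thus ?thesis unfolding instances_def 1 by blast
 qed
 ultimately show ?case by (auto simp: ground_atom_def)
qed

lemma finite_derived_edb:
 assumes dp: "datalog_program \<Pi>" and db: "db_instance \<Pi> D" and p: "p \<notin> idb \<Pi>"
 shows "finite (derived_relation \<Pi> D p)"
proof (rule finite_subset)
 let ?S = "{t. (p, t) \<in> D} Un (%R. map (ground_trm (%_. 0)) (snd (head R))) ` \<Pi>"
 show "derived_relation \<Pi> D p <= ?S"
 proof
  fix t assume "t \<in> derived_relation \<Pi> D p"
  hence "(p, t) \<in> immediate_consequence \<Pi> D (least_fixpoint \<Pi> D)"
   unfolding derived_relation_def by (simp flip: least_fixpoint_unfold)
  then consider "(p, t) \<in> D" | R th where "R \<in> \<Pi>" "(p, t) = ground_atom th (head R)"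
   unfolding immediate_consequence_def by blast
  thus "t \<in> ?S"
  proof cases
   case (2 R th)
   hence "body R = []" using p unfolding idb_body ground_atom_def by auto
   hence "vars_list (snd (head R)) = {}" using vars_head_body[OF dp 2(1)] by fastforce
   hence "ground_atom th (head R) = ground_atom (%_. 0) (head R)" by (intro ground_atom_cong) simp
   hence "t = map (ground_trm (%_. 0)) (snd (head R))" using 2(2) unfolding ground_atom_def by simp
   thus ?thesis using 2(1) by blast
  qed simp
 qed
 have "finite D" "finite \<Pi>" using dp db unfolding datalog_program_def db_instance_def by blast+
 moreover have "{t. (p, t) \<in> D} <= snd ` D" by force
 ultimately show "finite ?S" by (meson finite_UnI finite_imageI finite_subset)
qed

text \<open>Variants have the same instances, so the relation is covered by one representative per
  renaming class, and there are at most \<open>adornment_count\<close> classes.\<close>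

theorem card_derived_idb_le:
 assumes dp: "datalog_program \<Pi>" and lin: "linear_program \<Pi>" and db: "db_instance \<Pi> D"
  and ew: "0 < ew \<Pi>" and N: "1 <= N" and M: "ALL p:edb \<Pi>. card (derived_relation \<Pi> D p) <= N"
  and q: "q \<in> idb \<Pi>"
 shows "finite (derived_relation \<Pi> D q)"
  "real (card (derived_relation \<Pi> D q)) <= real (adornment_count \<Pi>) * real N powr ew \<Pi>"
proof -
 let ?M = "least_fixpoint \<Pi> D" and ?Q = "pred_adornments \<Pi> q // variants"
 have finQ: "finite ?Q" by (rule finite_classes[OF dp])
 define rp where "rp X = (SOME ro. ro \<in> pred_adornments \<Pi> q & ro \<in> X)" for X
 have rp: "rp X \<in> pred_adornments \<Pi> q & rp X \<in> X" if X: "X \<in> ?Q" for X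
 proof -
  obtain ro where "ro \<in> pred_adornments \<Pi> q" "X = variants `` {ro}" using X by (rule quotientE)
  hence "ro \<in> pred_adornments \<Pi> q & ro \<in> X" using variant_refl by blast
  thus ?thesis unfolding rp_def by (rule someI)
 qed
 have sub: "derived_relation \<Pi> D q <= (UN X:?Q. instances \<Pi> ?M (rp X))"
 proof
  fix t assume "t \<in> derived_relation \<Pi> D q"
  then obtain ro where ro: "ro \<in> pred_adornments \<Pi> q" "t \<in> instances \<Pi> ?M ro"
   using derived_instance[OF dp lin db, of "(q, t)"] q unfolding derived_relation_def by auto
  have X: "variants `` {ro} \<in> ?Q" using ro(1) by (rule quotientI)
  have "rp (variants `` {ro}) \<in> variants `` {ro}" using rp[OF X] by (rule conjunct2)
  hence "variant ro (rp (variants `` {ro}))" by simp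
  hence "t \<in> instances \<Pi> ?M (rp (variants `` {ro}))" using ro(2) instances_variant by blast
  thus "t \<in> (UN X:?Q. instances \<Pi> ?M (rp X))" using X by (rule UN_I[rotated])
 qed
 have bd: "finite (instances \<Pi> ?M (rp X))" "real (card (instances \<Pi> ?M (rp X))) <= real N powr ew \<Pi>"
  if X: "X \<in> ?Q" for X
 proof -
  have ad: "rp X \<in> adornments \<Pi>" using conjunct1[OF rp[OF X]] unfolding pred_adornments_def by simp
  from ad obtain r where "r \<in> adorned_program \<Pi>" "rp X = fst (ar_head r)" unfolding adornments_def by blast
  hence g: "good_adornment \<Pi> (rp X)" using good_adornments[OF dp] by simp
  have M': "finite {t. (p, t) \<in> ?M} & card {t. (p, t) \<in> ?M} <= N" if "p \<in> edb \<Pi>" for p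
  proof -
   have "p \<notin> idb \<Pi>" using that unfolding edb_def by blast
   thus ?thesis using finite_derived_edb[OF dp db] M that unfolding derived_relation_def by blast
  qed
  show "finite (instances \<Pi> ?M (rp X))" by (rule card_instances_le(1)[OF g N M'])
  have "real (card (instances \<Pi> ?M (rp X))) <= real N powr ew_adornment (rp X)"
   by (rule card_instances_le(2)[OF g N M'])
  also have "... <= real N powr ew \<Pi>" using ew_adornment_le[OF dp ad] N by (intro powr_mono) auto
  finally show "real (card (instances \<Pi> ?M (rp X))) <= real N powr ew \<Pi>" .
 qed
 have finU: "finite (UN X:?Q. instances \<Pi> ?M (rp X))" using finQ bd(1) by blast
 thus "finite (derived_relation \<Pi> D q)" using sub finite_subset by blast
 have "real (card (derived_relation \<Pi> D q)) <= real (card (UN X:?Q. instances \<Pi> ?M (rp X)))"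
  using card_mono[OF finU sub] by simp
 also have "... <= (SUM X:?Q. real (card (instances \<Pi> ?M (rp X))))"
  using card_UN_le[OF finQ, of "%X. instances \<Pi> ?M (rp X)"] by (simp flip: of_nat_sum)
 also have "... <= (SUM X:?Q. real N powr ew \<Pi>)" by (rule sum_mono) (rule bd(2))
 also have "... = real (card ?Q) * real N powr ew \<Pi>" by simp
 also have "... <= real (adornment_count \<Pi>) * real N powr ew \<Pi>"
  using card_classes_le[OF dp q] by (intro mult_right_mono) auto
 finally show "real (card (derived_relation \<Pi> D q)) <= real (adornment_count \<Pi>) * real N powr ew \<Pi>" .
qed


section \<open>Query plans from decompositions\<close>

text \<open>A label \<open>(Y, Z)\<close> stands for a relation of assignments on the variables \<open>Y\<close> that
 extend to the variables \<open>Z\<close> so that all atoms with variables in \<open>Z\<close> hold. \<open>Fs\<close> are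
 the variable sets of the atoms, \<open>V\<close> all variables, \<open>B\<close> the variables of the IDB atom,
 \<open>Out\<close> those of the head; \<open>ok Y\<close> says that \<open>Y\<close> lies in a bag. The four predicates
 below are local conditions under which one such relation can be computed from others.\<close>

definition is_label :: "nat set => nat set => nat set => bool" where
 "is_label V Y Z \<longleftrightarrow> Y <= Z & Z <= V"

text \<open>An atom completed by \<open>v\<close> must lie within the retained variables
  \<open>insert v Y\<close>, so that it can be checked on the assignment at hand. Variables of the
  IDB atom are excluded because extensions are read off the other atoms; they are bound at the
  root.\<close>

definition ext_ok where
 "ext_ok Fs V B ok Y Z v \<longleftrightarrow> is_label V Y Z & v \<in> V & v \<notin> Z & v \<notin> B & ok (insert v Y) &
   (ALL F:Fs. v \<in> F --> F <= insert v Z --> F <= insert v Y)"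

text \<open>The common part of \<open>Z\<close> and \<open>Z'\<close> lies in \<open>Y'\<close>,
  where both extensions agree, and no atom straddles the two sides; hence the extensions can be
  glued.\<close>

definition semijoin_ok where
 "semijoin_ok Fs V ok Y Z Y' Z' \<longleftrightarrow> is_label V Y Z & is_label V Y' Z' & ok Y & Y' <= Y & Z Int Z' <= Y' &
   (ALL F:Fs. F <= Z Un Z' --> F <= Z | F <= Z')"

text \<open>An enumeration step: the first extension already covers all of \<open>V\<close>, and its
  part on \<open>Z'\<close> is exchanged for another one. Atoms not inside \<open>Z'\<close> touch
  it only in \<open>Y\<close> and do not notice. As both domains stay within \<open>Out\<close>, the
  results are bounded by the head relation rather than by a bag.\<close>

definition join_ok where
 "join_ok Fs V Out Y Y' Z' \<longleftrightarrow> is_label V Y V & is_label V Y' Z' & Y Un Y' <= Out & Y Int Z' <= Y' &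
   (ALL F:Fs. F <= Z' | F Int Z' <= Y)"

definition weaken_ok where
 "weaken_ok V ok Y Z Y' Z' \<longleftrightarrow> is_label V Y Z & Y' <= Y & Z' <= Z & Y' <= Z' & ok Y'"

inductive reach :: "nat set set => nat set => nat set => nat set => (nat set => bool) => nat set => nat set => bool"
 for Fs V B Out ok where
 reach_root: "reach Fs V B Out ok B B"
| reach_ext: "reach Fs V B Out ok Y Z ==> ext_ok Fs V B ok Y Z v ==> reach Fs V B Out ok (insert v Y) (insert v Z)"
| reach_semijoin: "reach Fs V B Out ok Y Z ==> reach Fs V B Out ok Y' Z' ==> semijoin_ok Fs V ok Y Z Y' Z' ==>
  reach Fs V B Out ok Y (Z Un Z')"
| reach_join: "reach Fs V B Out ok Y V ==> reach Fs V B Out ok Y' Z' ==> join_ok Fs V Out Y Y' Z' ==>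
  reach Fs V B Out ok (Y Un Y') V"
| reach_weaken: "reach Fs V B Out ok Y Z ==> weaken_ok V ok Y Z Y' Z' ==> reach Fs V B Out ok Y' Z'"

subsection \<open>Connected sets in trees\<close>

definition steps_in :: "nat set => nat set set => (nat \<times> nat) set" where
 "steps_in S E = {(a, b). a \<in> S & b \<in> S & {a, b} \<in> E}"

lemma path_in_rtrancl: "path_in S E u xs v ==> (u, v) \<in> (steps_in S E)\<^sup>*"
proof (induction xs arbitrary: u)
 case (Cons x xs)
 show ?case
 proof (cases xs)
  case Nil
  thus ?thesis using Cons.prems by (auto simp: path_in_def)
 next
  case (Cons y ys)
  have "path_in S E y xs v" "(u, y) \<in> steps_in S E"
   using Cons.prems Cons by (auto simp: path_in_def steps_in_def)
  thus ?thesis using Cons.IH by (meson converse_rtrancl_into_rtrancl)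
 qed
qed (simp add: path_in_def)

lemma rtrancl_path_in: "(u, v) \<in> (steps_in S E)\<^sup>* ==> u \<in> S ==> EX xs. path_in S E u xs v"
proof (induction rule: rtrancl_induct)
 case base
 thus ?case by (intro exI[of _ "[u]"]) (simp add: path_in_def)
next
 case (step b c)
 then obtain xs where xs: "path_in S E u xs b" by blast
 have bc: "c \<in> S" "{b, c} \<in> E" using step by (auto simp: steps_in_def)
 show ?case
 proof (cases "c \<in> set xs")
  case True
  then obtain ys zs where "xs = (ys @ [c]) @ zs" by (metis append.assoc append_Cons append_Nil split_list)
  hence "path_in S E u (ys @ [c]) c"
   using xs unfolding path_in_def by (auto simp: successively_append_iff hd_append)
  thus ?thesis by blast
 next
  case False
  have "path_in S E u (xs @ [c]) c"
   using xs bc False unfolding path_in_def by (auto simp: successively_append_iff)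
  thus ?thesis by blast
 qed
qed

lemma connected_in_iff: "connected_in S E \<longleftrightarrow> (ALL u:S. ALL v:S. (u, v) \<in> (steps_in S E)\<^sup>*)"
 unfolding connected_in_def using path_in_rtrancl rtrancl_path_in by blast

lemma steps_in_mono: "S <= S' ==> (u, v) \<in> (steps_in S E)\<^sup>* ==> (u, v) \<in> (steps_in S' E)\<^sup>*"
 by (rule subsetD[OF rtrancl_mono]) (auto simp: steps_in_def)

lemma sym_steps_in: "(u, v) \<in> (steps_in S E)\<^sup>* ==> (v, u) \<in> (steps_in S E)\<^sup>*"
 by (rule symD[OF sym_rtrancl]) (auto simp: steps_in_def sym_def insert_commute)

text \<open>The gate of a connected set \<open>A\<close> as seen from \<open>p\<close> is the first node of \<open>A\<close> on the
 way from \<open>p\<close>; every connected set that joins \<open>p\<close> to \<open>A\<close> contains it.\<close>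

lemma tree_gate:
 assumes T: "is_tree VT E" and A: "connected_in A E" "A <= VT" "A ~= {}" and p: "p \<in> VT"
 obtains g where "g \<in> A"
  "!!C. connected_in C E ==> C <= VT ==> p \<in> C ==> C Int A ~= {} ==> g \<in> C"
proof -
 obtain a where a: "a \<in> A" using A(3) by blast
 obtain xs where xs: "path_in VT E p xs a" using T p a A(2) unfolding is_tree_def by blast
 have "EX x:set xs. x \<in> A" using xs a unfolding path_in_def by (metis last_in_set)
 from split_list_first_prop[OF this]
 obtain ys g zs where g: "xs = ys @ g # zs" "g \<in> A" "ALL y:set ys. y \<notin> A" by blast
 have "g \<in> C" if C: "connected_in C E" "C <= VT" "p \<in> C" "C Int A ~= {}" for C
 proof -
  obtain c where c: "c \<in> C" "c \<in> A" using C(4) by blast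
  obtain ws where ws: "path_in A E g ws c" using A(1) g(2) c(2) unfolding connected_in_def by blast
  obtain us where us: "path_in C E p us c" using C(1,3) c(1) unfolding connected_in_def by blast
  obtain ws' where ws': "ws = g # ws'" using ws unfolding path_in_def by (cases ws) auto
  have "path_in VT E p (ys @ ws) c"
  proof -
   have "hd (ys @ ws) = p" using xs ws' unfolding path_in_def g(1) by (cases ys) auto
   moreover have "distinct (ys @ ws)" using xs ws g(3) unfolding path_in_def g(1) by auto
   moreover have "successively (%a b. {a, b} \<in> E) (ys @ ws)"
    using xs ws unfolding path_in_def g(1) ws' by (auto simp: successively_append_iff)
   moreover have "set (ys @ ws) <= VT" using xs ws A(2) unfolding path_in_def g(1) by auto
   moreover have "last (ys @ ws) = c" using ws unfolding path_in_def by simp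
   ultimately show ?thesis using ws' unfolding path_in_def by simp
  qed
  moreover have "path_in VT E p us c" using us C(2) unfolding path_in_def by auto
  moreover have "c \<in> VT" using c A(2) by blast
  moreover have "EX! xs. path_in VT E p xs c" using T p \<open>c \<in> VT\<close> unfolding is_tree_def by simp
  ultimately have "us = ys @ ws" by blast
  thus ?thesis using us ws' unfolding path_in_def by auto
 qed
 with g(2) show thesis by (rule that)
qed

section \<open>Components, neighbourhoods and gates: from a tree to a sequence of local
  steps\<close>

subsection \<open>Every decomposition yields a plan\<close>

locale decomposition =
 fixes Fs :: "nat set set" and V B Out :: "nat set" and VT :: "nat set" and E :: "nat set set"
  and ch :: "nat => nat set" and S :: "nat set"
 assumes tree: "is_tree VT E" and V: "V = (UN p:VT. ch p)" "finite V"
  and edge: "!!F. F \<in> Fs ==> EX p:VT. F <= ch p"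
  and conn: "!!v. v \<in> V ==> connected_in {p:VT. v \<in> ch p} E"
  and S: "S ~= {}" "S <= VT" "connected_in S E" "(UN p:S. ch p) = Out"
  and B: "EX p:VT. B <= ch p"
begin

definition in_bag :: "nat set => bool" where
 "in_bag Y \<longleftrightarrow> (EX p:VT. Y <= ch p)"

abbreviation "rch == reach Fs V B Out in_bag"

definition nbrs :: "nat set => nat set" where
 "nbrs U = (UN F:{F:Fs. F Int U ~= {}}. F) - U"

definition bags :: "nat set => nat set" where
 "bags U = {p:VT. ch p Int U ~= {}}"

definition separated :: "nat set => nat set => bool" where
 "separated U W \<longleftrightarrow> (ALL F:Fs. F Int U = {} | F Int W = {})"

lemma edge_nbrs: "F \<in> Fs ==> F Int U ~= {} ==> F <= U Un nbrs U"
 unfolding nbrs_def by blast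

lemma nbrs_remove: "nbrs (U - {v}) <= insert v (nbrs U)"
 unfolding nbrs_def by blast

lemma in_bag_subset: "in_bag Y ==> Y' <= Y ==> in_bag Y'"
 unfolding in_bag_def by blast

lemma in_bag_V: "in_bag Y ==> Y <= V"
 unfolding in_bag_def V by blast

lemma edge_V: "F \<in> Fs ==> F <= V"
 using edge unfolding V by blast

lemma Out_V: "Out <= V"
 using S unfolding V by blast

text \<open>Consider the variables of \<open>U\<close> none of whose bags is reachable from
  \<open>A\<close>. They are separated from the rest of \<open>U\<close>, since an atom containing
  both kinds would have a reachable bag; so by the hypothesis they have a bag in \<open>A\<close>,
  which is impossible.\<close>

lemma connected_bags:
 assumes A: "connected_in A E" "A <= VT" "A ~= {}" and U: "U <= V"
  and *: "!!W. W <= U ==> W ~= {} ==> separated W (U - W) ==> bags W Int A ~= {}"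
 shows "connected_in (A Un bags U) E"
proof -
 let ?M = "A Un bags U"
 obtain a where a: "a \<in> A" using A(3) by blast
 define R where "R = {q. (a, q) \<in> (steps_in ?M E)\<^sup>*}"
 have AR: "A <= R" using A(1) a steps_in_mono[of A ?M] unfolding R_def connected_in_iff by blast
 let ?C = "%v. {p:VT. v \<in> ch p}"
 have CR: "?C v <= R" if v: "v \<in> U" "?C v Int R ~= {}" for v
 proof
  fix q assume q: "q \<in> ?C v"
  obtain q' where q': "q' \<in> ?C v" "q' \<in> R" using v(2) by blast
  have "(q', q) \<in> (steps_in (?C v) E)\<^sup>*" using conn[of v] q q'(1) v(1) U unfolding connected_in_iff by blast
  moreover have "?C v <= ?M" using v(1) unfolding bags_def by blast
  ultimately have "(q', q) \<in> (steps_in ?M E)\<^sup>*" by (rule steps_in_mono[rotated])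
  thus "q \<in> R" using q'(2) unfolding R_def by auto
 qed
 define W where "W = {v \<in> U. ?C v Int R = {}}"
 have "W = {}"
 proof (rule ccontr)
  assume "W ~= {}"
  moreover have "separated W (U - W)"
   unfolding separated_def
  proof (rule ballI, rule ccontr)
   fix F assume F: "F \<in> Fs" "~ (F Int W = {} | F Int (U - W) = {})"
   then obtain u w where uw: "u \<in> F" "u \<in> U - W" "w \<in> F" "w \<in> W" by blast
   obtain q where q: "q \<in> VT" "F <= ch q" using edge[OF F(1)] by blast
   have "q \<in> R" using CR[of u] uw q unfolding W_def by blast
   thus False using uw q unfolding W_def by blast
  qed
  ultimately have "bags W Int A ~= {}" using *[of W] unfolding W_def by blast
  thus False using AR unfolding W_def bags_def by blast
 qed
 hence "?M <= R" using AR CR unfolding W_def bags_def by blast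
 thus ?thesis unfolding connected_in_iff
  by (metis (no_types, lifting) R_def mem_Collect_eq rtrancl_trans subsetD sym_steps_in)
qed

text \<open>Connectedness of \<open>U\<close> in the primal graph of \<open>Fs\<close>, in which two
  variables are adjacent when some atom contains both; \<open>nbrs U\<close> is the neighbourhood of
  \<open>U\<close> there.\<close>

definition unsplit :: "nat set => bool" where
 "unsplit U \<longleftrightarrow> (ALL W. W <= U --> W ~= {} --> separated W (U - W) --> W = U)"

text \<open>The bags meeting a connected \<open>U\<close> form a connected set. The bags of any
  neighbour of \<open>U\<close> are connected, include \<open>p\<close> and meet this set, so the
  gate \<open>g\<close> from \<open>p\<close> contains every neighbour, and also some
  \<open>v\<close> of \<open>U\<close>. If \<open>p\<close> lies in \<open>S\<close> and
  \<open>U\<close> has an output variable, the same argument with \<open>S\<close> puts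
  \<open>g\<close> into \<open>S\<close>.\<close>

lemma gate_unsplit:
 assumes U: "unsplit U" "U ~= {}" "U <= V" and p: "p \<in> VT" "nbrs U <= ch p"
 obtains g v where "g \<in> VT" "nbrs U <= ch g" "v \<in> ch g" "v \<in> U" "p \<in> S ==> U Int Out ~= {} ==> g \<in> S"
proof -
 obtain u where u: "u \<in> U" using U(2) by blast
 let ?A = "{p:VT. u \<in> ch p}"
 have uV: "u \<in> V" using u U(3) by blast
 have ne: "?A ~= {}" using uV unfolding V by blast
 have "connected_in (?A Un bags U) E"
 proof (rule connected_bags[OF conn[OF uV] _ ne U(3)])
  fix W assume "W <= U" "W ~= {}" "separated W (U - W)"
  hence "W = U" using U(1) unfolding unsplit_def by blast
  thus "bags W Int ?A ~= {}" using ne u unfolding bags_def by blast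
 qed blast
 moreover have "?A Un bags U = bags U" using u unfolding bags_def by blast
 ultimately have c: "connected_in (bags U) E" by simp
 have ne': "bags U ~= {}" "bags U <= VT" using ne u unfolding bags_def by blast+
 obtain g where g: "g \<in> bags U"
  "!!C. connected_in C E ==> C <= VT ==> p \<in> C ==> C Int bags U ~= {} ==> g \<in> C"
  using tree_gate[OF tree c ne'(2,1) p(1)] by blast
 have n: "nbrs U <= ch g"
 proof
  fix n assume n: "n \<in> nbrs U"
  then obtain F where F: "F \<in> Fs" "F Int U ~= {}" "n \<in> F" unfolding nbrs_def by blast
  then obtain q where q: "q \<in> VT" "F <= ch q" using edge by blast
  have "g \<in> {p:VT. n \<in> ch p}"
  proof (rule g(2))
   show "connected_in {p:VT. n \<in> ch p} E" using conn edge_V[OF F(1)] F(3) by blast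
   show "{p:VT. n \<in> ch p} Int bags U ~= {}" using q F unfolding bags_def by blast
  qed (use p n in auto)
  thus "n \<in> ch g" by blast
 qed
 obtain v where v: "v \<in> ch g" "v \<in> U" using g(1) unfolding bags_def by blast
 have "g \<in> S" if "p \<in> S" "U Int Out ~= {}"
 proof (rule g(2)[OF S(3,2) that(1)])
  show "S Int bags U ~= {}" using that(2) S(2) unfolding S(4)[symmetric] bags_def by blast
 qed
 thus thesis using that[of g v] g(1) n v unfolding bags_def by blast
qed

lemma reach_V: "rch Y Z ==> is_label V Y Z"
proof (induction rule: reach.induct)
 case reach_root
 thus ?case using B unfolding is_label_def V by blast
qed (auto simp: is_label_def ext_ok_def semijoin_ok_def join_ok_def weaken_ok_def)

lemma rch_weaken:
 assumes "rch Y Z" "Y' <= Y" "Z' <= Z" "Y' <= Z'" "in_bag Y'"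
 shows "rch Y' Z'"
 using reach_weaken[OF assms(1)] assms reach_V[OF assms(1)] by (simp add: weaken_ok_def)

lemma rch_ext:
 assumes "rch Y Z" "in_bag (insert v Y)" "v \<notin> Z" "v \<notin> B"
  "!!F. F \<in> Fs ==> v \<in> F ==> F <= insert v Z ==> F <= insert v Y"
 shows "rch (insert v Y) (insert v Z)"
 using reach_ext[OF assms(1)] assms reach_V[OF assms(1)] in_bag_V[OF assms(2)] by (simp add: ext_ok_def)

lemma rch_semijoin:
 assumes "rch Y Z" "rch Y' Z'" "in_bag Y" "Y' <= Y" "Z Int Z' <= Y'"
  "!!F. F \<in> Fs ==> F <= Z Un Z' ==> F <= Z | F <= Z'"
 shows "rch Y (Z Un Z')"
 using reach_semijoin[OF assms(1,2)] assms reach_V[OF assms(1)] reach_V[OF assms(2)] by (simp add: semijoin_ok_def)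

text \<open>Parts of \<open>U\<close> that share no atom are treated separately and combined by a
  semijoin. For a connected \<open>U\<close>, there may be no bag containing \<open>K\<close> and a
  new variable together, so the plan drops to \<open>nbrs U\<close>, which a gate holds together
  with some \<open>v\<close> of \<open>U\<close>; the remaining variables follow by induction, and
  the result is semijoined back to \<open>K\<close>.\<close>

lemma rch_sat:
 assumes "rch K K" "nbrs U <= K" "K Int U = {}" "in_bag K" "U Int B = {}" "U <= V"
 shows "rch K (K Un U)"
 using assms
proof (induction "card U" arbitrary: U K rule: less_induct)
 case less
 note K = less.prems
 have fU: "finite U" using K(6) V(2) finite_subset by blast
 consider "U = {}" | W where "W <= U" "W ~= {}" "separated W (U - W)" "W ~= U" | "unsplit U" "U ~= {}"
  unfolding unsplit_def by blast
 thus ?case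
 proof cases
  case 1
  thus ?thesis using K(1) by simp
 next
  case (2 W)
  let ?W = "U - W"
  have sub: "nbrs W <= K" "nbrs ?W <= K"
   using K(2) 2 unfolding separated_def nbrs_def by blast+
  have "card W < card U" "card ?W < card U"
   using 2 fU by (auto intro!: psubset_card_mono)
  hence r: "rch K (K Un W)" "rch K (K Un ?W)"
   using less.hyps[of W K] less.hyps[of ?W K] K 2(1) sub by blast+
  have "rch K ((K Un W) Un (K Un ?W))"
  proof (rule rch_semijoin[OF r K(4)])
   show "!!F. F \<in> Fs ==> F <= (K Un W) Un (K Un ?W) ==> F <= K Un W | F <= K Un ?W"
    using 2(3) unfolding separated_def by blast
  qed (use K(3) in blast)+
  moreover have "(K Un W) Un (K Un ?W) = K Un U" using 2(1) by blast
  ultimately show ?thesis by simp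
 next
  case 3
  let ?N = "nbrs U"
  obtain p where p: "p \<in> VT" "K <= ch p" using K(4) unfolding in_bag_def by blast
  have Np: "?N <= ch p" using p(2) K(2) by blast
  obtain g v where g: "g \<in> VT" "?N <= ch g" "v \<in> ch g" "v \<in> U"
   by (rule gate_unsplit[OF 3 K(6) p(1) Np], rule that) blast+
  have bag: "in_bag (insert v ?N)" using g unfolding in_bag_def by blast
  have N: "rch ?N ?N" using rch_weaken[OF K(1,2,2)] in_bag_subset[OF K(4,2)] by blast
  have vN: "v \<notin> ?N" using g(4) unfolding nbrs_def by blast
  have 1: "rch (insert v ?N) (insert v ?N)"
   by (rule rch_ext[OF N bag vN]) (use g(4) K(5) in blast)+
  have "rch (insert v ?N) (insert v ?N Un (U - {v}))"
  proof (rule less.hyps[OF _ 1])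
   show "card (U - {v}) < card U" using fU g(4) by (meson card_Diff1_less)
   show "insert v ?N Int (U - {v}) = {}" unfolding nbrs_def by blast
  qed (use nbrs_remove bag K(5,6) in auto)
  moreover have "insert v ?N Un (U - {v}) = ?N Un U" using g(4) by blast
  ultimately have "rch (insert v ?N) (?N Un U)" by simp
  hence 2: "rch ?N (?N Un U)"
   by (rule rch_weaken) (use in_bag_subset[OF bag] in auto)
  have "rch K (K Un (?N Un U))"
  proof (rule rch_semijoin[OF K(1) 2 K(4,2)])
   show "!!F. F \<in> Fs ==> F <= K Un (?N Un U) ==> F <= K | F <= ?N Un U"
    using edge_nbrs[of _ U] K(2) by blast
  qed (use K(3) in blast)
  moreover have "K Un (?N Un U) = K Un U" using K(2) by blast
  ultimately show ?thesis by simp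
 qed
qed

text \<open>The output variables in \<open>U\<close> are enumerated one by one. The gate stays in
  \<open>S\<close>, so its new variable \<open>v\<close> belongs to \<open>Out\<close>;
  \<open>rch_sat\<close> supplies the relation on \<open>insert v (nbrs U)\<close> that is validated
  on \<open>U\<close>, which is the second argument of the join.\<close>

lemma rch_enum:
 assumes "rch Y V" "Y <= Out" "nbrs U <= Y" "U Int Y = {}" "rch (nbrs U) (nbrs U)"
  "g \<in> S" "nbrs U <= ch g" "U Int B = {}" "U <= V"
 shows "rch (Y Un (U Int Out)) V"
 using assms
proof (induction "card U" arbitrary: U Y g rule: less_induct)
 case less
 note K = less.prems
 have fU: "finite U" using K(9) V(2) finite_subset by blast
 have bagN: "in_bag (nbrs U)" using K(6,7) S(2) unfolding in_bag_def by blast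
 consider "U Int Out = {}" | W where "W <= U" "W ~= {}" "separated W (U - W)" "W ~= U"
  | "unsplit U" "U ~= {}" "U Int Out ~= {}"
  unfolding unsplit_def by blast
 thus ?case
 proof cases
  case 1
  thus ?thesis using K(1) by simp
 next
  case (2 W)
  let ?W = "U - W"
  have sub: "nbrs W <= nbrs U" "nbrs ?W <= nbrs U"
   using 2 unfolding separated_def nbrs_def by blast+
  have c: "card W < card U" "card ?W < card U"
   using 2 fU by (auto intro!: psubset_card_mono)
  have N: "rch (nbrs W) (nbrs W)" "rch (nbrs ?W) (nbrs ?W)"
   using rch_weaken[OF K(5)] in_bag_subset[OF bagN] sub by blast+
  have 1: "rch (Y Un (W Int Out)) V"
   by (rule less.hyps[OF c(1) K(1,2) _ _ N(1) K(6)]) (use K 2(1) sub in blast)+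
  have "rch ((Y Un (W Int Out)) Un (?W Int Out)) V"
   by (rule less.hyps[OF c(2) 1 _ _ _ N(2) K(6)]) (use K 2(1) sub in blast)+
  moreover have "(Y Un (W Int Out)) Un (?W Int Out) = Y Un (U Int Out)" using 2(1) by blast
  ultimately show ?thesis by simp
 next
  case 3
  let ?N = "nbrs U"
  have gV: "g \<in> VT" using K(6) S(2) by blast
  obtain g' v where g': "g' \<in> VT" "?N <= ch g'" "v \<in> ch g'" "v \<in> U" "g \<in> S ==> U Int Out ~= {} ==> g' \<in> S"
   by (rule gate_unsplit[OF 3(1,2) K(9) gV K(7)], rule that) blast+
  note g = g'(1-4) g'(5)[OF K(6) 3(3)]
  have vO: "v \<in> Out" using g(3,5) S(4) by blast
  have bag: "in_bag (insert v ?N)" using g unfolding in_bag_def by blast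
  have vN: "v \<notin> ?N" using g(4) unfolding nbrs_def by blast
  have 1: "rch (insert v ?N) (insert v ?N)"
   by (rule rch_ext[OF K(5) bag vN]) (use g(4) K(8) in blast)+
  have "rch (insert v ?N) (insert v ?N Un (U - {v}))"
  proof (rule rch_sat[OF 1])
   show "insert v ?N Int (U - {v}) = {}" unfolding nbrs_def by blast
  qed (use nbrs_remove bag K(8,9) in auto)
  moreover have "insert v ?N Un (U - {v}) = ?N Un U" using g(4) by blast
  ultimately have 2: "rch (insert v ?N) (?N Un U)" by simp
  have "rch (Y Un insert v ?N) V"
  proof (rule reach_join[OF K(1) 2])
   have "F <= ?N Un U | F Int (?N Un U) <= Y" if "F \<in> Fs" for F
    using edge_nbrs[OF that, of U] K(3) by blast
   thus "join_ok Fs V Out Y (insert v ?N) (?N Un U)"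
    using reach_V[OF K(1)] reach_V[OF 2] K(2,3,4) vO unfolding join_ok_def by blast
  qed
  moreover have "Y Un insert v ?N = insert v Y" using K(3) by blast
  ultimately have 3: "rch (insert v Y) V" by simp
  have bag': "in_bag (nbrs (U - {v}))" using in_bag_subset[OF bag nbrs_remove] .
  have "rch (insert v Y Un ((U - {v}) Int Out)) V"
  proof (rule less.hyps[OF _ 3])
   show "card (U - {v}) < card U" using fU g(4) by (meson card_Diff1_less)
   show "rch (nbrs (U - {v})) (nbrs (U - {v}))"
    by (rule rch_weaken[OF 1 nbrs_remove nbrs_remove _ bag']) simp
   show "g' \<in> S" by (rule g(5))
   show "nbrs (U - {v}) <= ch g'" using nbrs_remove g(2,3) by blast
   show "nbrs (U - {v}) <= insert v Y" using nbrs_remove K(3) by blast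
  qed (use K vO in blast)+
  moreover have "insert v Y Un ((U - {v}) Int Out) = Y Un (U Int Out)" using g(4) vO by blast
  ultimately show ?thesis by simp
 qed
qed

text \<open>\<open>U\<close> holds the variables not yet accounted for. Parts of it without output
  variables are absorbed by \<open>rch_sat\<close>. Once every remaining part has one, the bags of
  \<open>U\<close> and the subtree \<open>S\<close> form a connected set; its gate either lies in
  \<open>S\<close>, where enumeration begins, or offers a variable of \<open>U\<close> to extend
  by.\<close>

lemma rch_path:
 assumes "rch K (V - U)" "nbrs U <= K" "in_bag K" "Out - U <= K" "U Int B = {}" "U <= V"
 shows "rch Out V"
 using assms
proof (induction "card U" arbitrary: U K rule: less_induct)
 case less
 note K = less.prems
 have fU: "finite U" using K(6) V(2) finite_subset by blast
 have KU: "K Int U = {}" and KV: "K <= V - U" using reach_V[OF K(1)] unfolding is_label_def by blast+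
 have KK: "rch K K" by (rule rch_weaken[OF K(1) _ KV]) (use K(3) in auto)
 consider W where "W <= U" "W ~= {}" "separated W (U - W)" "W Int Out = {}" | "U = {}"
  | "!!W. W <= U ==> W ~= {} ==> separated W (U - W) ==> W Int Out ~= {}"
  by blast
 thus ?case
 proof cases
  case (1 W)
  have sub: "nbrs W <= K" "nbrs (U - W) <= K"
   using K(2) 1 unfolding separated_def nbrs_def by blast+
  have r: "rch K (K Un W)"
   by (rule rch_sat[OF KK sub(1)]) (use KU 1 K in auto)
  have "rch K ((V - U) Un (K Un W))"
  proof (rule rch_semijoin[OF K(1) r K(3)])
   show "!!F. F \<in> Fs ==> F <= (V - U) Un (K Un W) ==> F <= V - U | F <= K Un W"
    using edge_nbrs[of _ W] sub(1) KV by blast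
  qed (use 1(1) KV in blast)+
  moreover have "(V - U) Un (K Un W) = V - (U - W)" using 1(1) K(6) KV by blast
  ultimately have "rch K (V - (U - W))" by simp
  moreover have "card (U - W) < card U" using 1 fU by (intro psubset_card_mono) auto
  ultimately show ?thesis using less.hyps[of "U - W" K] sub(2) K 1(4) by blast
 next
  case 2
  show ?thesis by (rule rch_weaken[OF K(1)]) (use 2 K in_bag_subset Out_V in auto)
 next
  case 3
  let ?A = "S Un bags U"
  have "connected_in ?A E"
  proof (rule connected_bags[OF S(3,2,1) K(6)])
   fix W assume "W <= U" "W ~= {}" "separated W (U - W)"
   hence "W Int Out ~= {}" by (rule 3)
   thus "bags W Int S ~= {}" using S(2) unfolding S(4)[symmetric] bags_def by blast
  qed
  moreover obtain p where p: "p \<in> VT" "K <= ch p" using K(3) unfolding in_bag_def by blast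
  ultimately obtain g where g: "g \<in> ?A"
   "!!C. connected_in C E ==> C <= VT ==> p \<in> C ==> C Int ?A ~= {} ==> g \<in> C"
   using tree_gate[OF tree, of ?A p] S(1,2) unfolding bags_def by blast
  \<comment> \<open>The variables that still matter: each occurs in the current bag
    \<open>ch p\<close> and in a bag of \<open>?A\<close>, hence in the gate.\<close>
  define K' where "K' = nbrs U Un (Out - U)"
  have K'K: "K' <= K" using K(2,4) unfolding K'_def by blast
  have K'g: "K' <= ch g"
  proof
   fix n assume n: "n \<in> K'"
   hence nV: "n \<in> V" using K'K KV by blast
   have "{p:VT. n \<in> ch p} Int ?A ~= {}"
   proof (cases "n \<in> Out")
    case True
    thus ?thesis using S(2) unfolding S(4)[symmetric] by blast
   next
    case False
    then obtain F where F: "F \<in> Fs" "F Int U ~= {}" "n \<in> F" using n unfolding K'_def nbrs_def by blast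
    then obtain q where "q \<in> VT" "F <= ch q" using edge by blast
    thus ?thesis using F unfolding bags_def by blast
   qed
   hence "g \<in> {p:VT. n \<in> ch p}"
    using g(2)[OF conn[OF nV]] p n K'K by blast
   thus "n \<in> ch g" by blast
  qed
  have gV: "g \<in> VT" using g(1) S(2) unfolding bags_def by blast
  have bagK': "in_bag K'" using in_bag_subset[OF K(3) K'K] .
  have r: "rch K' (V - U)" by (rule rch_weaken[OF K(1) K'K _ _ bagK']) (use KV K'K in auto)
  show ?thesis
  proof (cases "g \<in> S")
   case False
   then obtain v where v: "v \<in> ch g" "v \<in> U" using g(1) unfolding bags_def by blast
   have bag: "in_bag (insert v K')" using K'g v gV unfolding in_bag_def by blast
   have "rch (insert v K') (insert v (V - U))"
   proof (rule rch_ext[OF r bag])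
    fix F assume F: "F \<in> Fs" "v \<in> F" "F <= insert v (V - U)"
    thus "F <= insert v K'" using edge_nbrs[OF F(1), of U] v(2) unfolding K'_def by blast
   qed (use v K(5) in auto)
   moreover have "insert v (V - U) = V - (U - {v})" using v(2) K(6) by blast
   ultimately have r': "rch (insert v K') (V - (U - {v}))" by simp
   show ?thesis
   proof (rule less.hyps[OF _ r'])
    show "card (U - {v}) < card U" using fU v(2) by (meson card_Diff1_less)
    show "nbrs (U - {v}) <= insert v K'" using nbrs_remove unfolding K'_def by blast
   qed (use bag K(5,6) in \<open>auto simp: K'_def\<close>)
  next
   case True
   have K'O: "K' <= Out" using K'g True S(4) by blast
   have K'U: "K' Int U = {}" using K'K KU by blast
   have N: "nbrs U <= K'" unfolding K'_def by blast
   have KK': "rch K' K'" by (rule rch_weaken[OF KK K'K K'K _ bagK']) simp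
   have s: "rch K' (K' Un U)" by (rule rch_sat[OF KK' N K'U bagK' K(5,6)])
   have "rch K' ((V - U) Un (K' Un U))"
   proof (rule rch_semijoin[OF r s bagK'])
    show "!!F. F \<in> Fs ==> F <= (V - U) Un (K' Un U) ==> F <= V - U | F <= K' Un U"
     using edge_nbrs[of _ U] N edge_V by blast
   qed auto
   moreover have "(V - U) Un (K' Un U) = V" using K(6) KV K'K by blast
   ultimately have rV: "rch K' V" by simp
   have "rch (K' Un (U Int Out)) V"
   proof (rule rch_enum[OF rV K'O N _ _ True])
    show "rch (nbrs U) (nbrs U)"
     by (rule rch_weaken[OF KK' N N]) (use in_bag_subset[OF bagK' N] in auto)
   qed (use K'U N K'g K(5,6) in auto)
   moreover have "K' Un (U Int Out) = Out" using K'O unfolding K'_def by blast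
   ultimately show ?thesis by simp
  qed
 qed
qed

text \<open>The walk starts at the IDB atom, with everything outside \<open>B\<close> still
  unaccounted for.\<close>

theorem reach_Out: "reach Fs V B Out in_bag Out V"
proof (rule rch_path)
 have "B <= V" using B unfolding V by blast
 hence "V - (V - B) = B" by blast
 thus "rch B (V - (V - B))" using reach_root by simp
 show "nbrs (V - B) <= B" using edge_V unfolding nbrs_def by blast
 show "in_bag B" using B unfolding in_bag_def .
qed (use Out_V in blast)+

end


section \<open>Optimal decompositions\<close>

lemma rule_edges_finite: "finite (rule_edges R)" "finite (rule_vertices R)"
 unfolding rule_vertices_def rule_edges_def using finite_vars_list by auto

lemma free_connex_decompositionD:
 assumes "free_connex_decomposition R V E ch La"
 shows "is_tree V E" "(UN p:V. ch p) = rule_vertices R" "!!p. p \<in> V ==> La p <= rule_edges R"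
  "!!e. e \<in> rule_edges R ==> EX p:V. e <= ch p"
  "!!v. v \<in> rule_vertices R ==> connected_in {p:V. v \<in> ch p} E"
  "!!p. p \<in> V ==> ch p <= \<Union>(La p)"
  "EX S. S ~= {} & S <= V & connected_in S E & (UN p:S. ch p) = rule_out R"
 using assms unfolding free_connex_decomposition_def by simp_all

lemma two_node_tree: "is_tree {0, 1} {{0, 1}}"
proof -
 have ex: "EX! xs. path_in {0, 1} {{0, 1}} u xs v" if uv: "u \<in> {0, 1}" "v \<in> {0, 1}" for u v :: nat
 proof (rule ex1I[of _ "if u = v then [u] else [u, v]"])
  show "path_in {0, 1} {{0, 1}} u (if u = v then [u] else [u, v]) v"
   using uv by (auto simp: path_in_def)
  fix xs assume p: "path_in {0, 1} {{0, 1}} u xs v"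
  hence d: "distinct xs" "set xs <= {0, 1}" "xs ~= []" "hd xs = u" "last xs = v" unfolding path_in_def by auto
  have "length xs = card (set xs)" using d(1) by (simp add: distinct_card)
  also have "... <= card {0, 1 :: nat}" using d(2) by (intro card_mono) auto
  finally have "length xs <= 2" by simp
  moreover obtain a ys where xs: "xs = a # ys" using d(3) by (cases xs) auto
  ultimately have ys: "length ys <= 1" by simp
  show "xs = (if u = v then [u] else [u, v])"
  proof (cases ys)
   case Nil
   thus ?thesis using d xs by simp
  next
   case (Cons b zs)
   thus ?thesis using d xs ys by simp
  qed
 qed
 show ?thesis unfolding is_tree_def
 by (use conjI ballI ex subsetI CollectI exI in \<open>auto\<close>)
qed

text \<open>One node carries the output variables and serves as the subtree, the other carries all
  vertices.\<close>

lemma decomposition_exists: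
 assumes "rule_out R <= rule_vertices R"
 shows "EX V E ch La. free_connex_decomposition R V E ch La"
proof (intro exI)
 let ?ch = "%p::nat. if p = 0 then rule_out R else rule_vertices R"
 have single: "connected_in {p} E" for p :: nat and E
  unfolding connected_in_iff by blast
 have both: "connected_in {0, 1} {{0, 1}}"
  unfolding connected_in_def
 by (use ballI two_node_tree conjE bspec ex1_implies_ex in \<open>auto simp: is_tree_def\<close>)
 have "connected_in {p \<in> {0, 1}. v \<in> ?ch p} {{0, 1}}" if "v \<in> rule_vertices R" for v
 proof (cases "v \<in> rule_out R")
  case True
  hence "{p \<in> {0, 1}. v \<in> ?ch p} = {0, 1}" using that by auto
  thus ?thesis using both by simp
 next
  case False
  hence "{p \<in> {0, 1}. v \<in> ?ch p} = {1}" using that by auto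
  thus ?thesis using single by simp
 qed
 moreover have "e <= rule_vertices R" if "e \<in> rule_edges R" for e
  using that unfolding rule_vertices_def by blast
 ultimately show "free_connex_decomposition R {0, 1} {{0, 1}} ?ch (%_. rule_edges R)"
  unfolding free_connex_decomposition_def
 proof (intro conjI)
  show "(UN p:{0, 1}. ?ch p) = rule_vertices R" using assms by auto
  show "ALL p:{0, 1}. ?ch p <= \<Union> (rule_edges R)" using assms unfolding rule_vertices_def by auto
  show "EX S. S ~= {} & S <= {0, 1} & connected_in S {{0, 1}} & (UN p:S. ?ch p) = rule_out R"
   using single by (intro exI[of _ "{0}"]) simp
 qed (use two_node_tree in auto)
qed

definition widths :: "rule => real set" where
 "widths R = {decomposition_width V La | V E ch La. free_connex_decomposition R V E ch La}"

lemma width_attained: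
 assumes "free_connex_decomposition R V E ch La"
 shows "EX L<=rule_edges R. decomposition_width V La = fractional_cover_number (\<Union>L) L id"
  "!!p. p \<in> V ==> fractional_cover_number (\<Union>(La p)) (La p) id <= decomposition_width V La"
proof -
 have V: "finite V" "V ~= {}" using free_connex_decompositionD(1)[OF assms] unfolding is_tree_def by simp_all
 let ?f = "%p. fractional_cover_number (\<Union>(La p)) (La p) id"
 have "Max (?f ` V) \<in> ?f ` V" using V by (intro Max_in) auto
 then obtain p where p: "p \<in> V" "Max (?f ` V) = ?f p" by auto
 thus "EX L<=rule_edges R. decomposition_width V La = fractional_cover_number (\<Union>L) L id"
  unfolding decomposition_width_def using free_connex_decompositionD(3)[OF assms p(1)] by blast
 show "?f p <= decomposition_width V La" if "p \<in> V" for p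
  unfolding decomposition_width_def using V that by (intro Max_ge) auto
qed

lemma widths_finite: "finite (widths R)"
proof (rule finite_subset)
 show "widths R <= (%L. fractional_cover_number (\<Union>L) L id) ` Pow (rule_edges R)"
 unfolding widths_def by (use width_attained in \<open>blast\<close>)
qed (use rule_edges_finite in simp)

lemma fcghw_rule_eq: "fcghw_rule R = Inf (widths R)"
 unfolding fcghw_rule_def widths_def ..

lemma optimal_decomposition:
 assumes "rule_out R <= rule_vertices R"
 shows "EX V E ch La. free_connex_decomposition R V E ch La &
  (ALL p:V. fractional_cover_number (\<Union>(La p)) (La p) id <= fcghw_rule R)"
proof -
 have ne: "widths R ~= {}" using decomposition_exists[OF assms] unfolding widths_def by blast
 have "fcghw_rule R \<in> widths R"
  unfolding fcghw_rule_eq cInf_eq_Min[OF widths_finite ne] by (rule Min_in[OF widths_finite ne])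
 then obtain V E ch La where d: "free_connex_decomposition R V E ch La" "fcghw_rule R = decomposition_width V La"
  unfolding widths_def by blast
 thus ?thesis using width_attained(2)[OF d(1)] d by metis
qed

lemma fcghw_rule_le: "finite \<Pi> ==> R \<in> \<Pi> ==> fcghw_rule R <= fcghw \<Pi>"
 unfolding fcghw_def by (intro Max_ge) auto

lemma fcghw_rule_ge_one:
 assumes "rule_out R <= rule_vertices R" "rule_vertices R ~= {}"
 shows "1 <= fcghw_rule R"
proof -
 obtain V E ch La where d: "free_connex_decomposition R V E ch La"
  "ALL p:V. fractional_cover_number (\<Union>(La p)) (La p) id <= fcghw_rule R"
  using optimal_decomposition[OF assms(1)] by blast
 obtain v where "v \<in> rule_vertices R" using assms(2) by blast
 then obtain p where p: "p \<in> V" "v \<in> ch p" using free_connex_decompositionD(2)[OF d(1)] by blast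
 hence v: "v \<in> \<Union>(La p)" and L: "La p <= rule_edges R" using free_connex_decompositionD(3,6)[OF d(1) p(1)] by blast+
 have "1 <= fractional_cover_number (\<Union>(La p)) (La p) id"
  by (rule fractional_cover_number_ge_one[OF v]) (use finite_subset[OF L rule_edges_finite(1)] in auto)
 thus ?thesis using d(2) p(1) by force
qed

text \<open>Only the hypergraph enters, so predicate symbols and constants may change along with the
  variable names; this relates a rule to the canonical rule of its shape.\<close>

lemma decomposition_image:
 assumes d: "free_connex_decomposition R V E ch La" and f: "inj_on f (rule_vertices R)"
  and edges: "rule_edges R' = (`) f ` rule_edges R" and out: "rule_out R' = f ` rule_out R"
 shows "free_connex_decomposition R' V E (%p. f ` ch p) (%p. (`) f ` La p)"
  "decomposition_width V (%p. (`) f ` La p) = decomposition_width V La"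
proof -
 note D = free_connex_decompositionD[OF d]
 have vert: "rule_vertices R' = f ` rule_vertices R" unfolding rule_vertices_def edges by blast
 have ch: "ch p <= rule_vertices R" if "p \<in> V" for p using D(2) that by blast
 have conn: "connected_in {p:V. v \<in> f ` ch p} E" if v: "v \<in> f ` rule_vertices R" for v
 proof -
  obtain u where u: "u \<in> rule_vertices R" "v = f u" using v by blast
  have "v \<in> f ` ch p \<longleftrightarrow> u \<in> ch p" if "p \<in> V" for p
   unfolding u(2) by (rule inj_on_image_mem_iff[OF f u(1) ch[OF that]])
  hence "{p:V. v \<in> f ` ch p} = {p:V. u \<in> ch p}" by blast
  thus ?thesis using D(5)[OF u(1)] by simp
 qed
 show "free_connex_decomposition R' V E (%p. f ` ch p) (%p. (`) f ` La p)"
  unfolding free_connex_decomposition_def vert edges out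
 proof (intro conjI)
  show "is_tree V E" by (rule D(1))
  show "(UN p:V. f ` ch p) = f ` rule_vertices R" unfolding D(2)[symmetric] by blast
  show "ALL p:V. (`) f ` La p <= (`) f ` rule_edges R" using D(3) by blast
  show "ALL e:(`) f ` rule_edges R. EX p:V. e <= f ` ch p" 
  by (use D bexI image_mono in \<open>fastforce\<close>)
  show "ALL v:f ` rule_vertices R. connected_in {p \<in> V. v \<in> f ` ch p} E" using conn by blast
  show "ALL p:V. f ` ch p <= \<Union> ((`) f ` La p)"
   unfolding image_Union[symmetric] using D(6) by (intro ballI image_mono)
  obtain S where S: "S ~= {}" "S <= V" "connected_in S E" "(UN p:S. ch p) = rule_out R" using D(7) by auto
  have "(UN p:S. f ` ch p) = f ` rule_out R" unfolding S(4)[symmetric] by blast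
  thus "EX S. S ~= {} & S <= V & connected_in S E & (UN p:S. f ` ch p) = f ` rule_out R"
   using S by auto
 qed
 have "fractional_cover_number (\<Union>((`) f ` La p)) ((`) f ` La p) id = fractional_cover_number (\<Union>(La p)) (La p) id"
  if p: "p \<in> V" for p
 proof (rule fractional_cover_number_reindex[where pn = f and h = "(`) f", symmetric])
  have L: "\<Union>(La p) <= rule_vertices R" using D(3)[OF p] unfolding rule_vertices_def by blast
  have "inj_on ((`) f) (La p)"
  proof (rule inj_onI)
   fix a b assume "a \<in> La p" "b \<in> La p" "f ` a = f ` b"
   moreover have "a <= rule_vertices R" "b <= rule_vertices R" using L calculation by auto
   ultimately show "a = b" using inj_on_image_eq_iff[OF f, of a b] by simp
  qed
  thus "bij_betw ((`) f) (La p) ((`) f ` La p)" by (rule inj_on_imp_bij_betw)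
  show "v \<in> id i \<longleftrightarrow> f v \<in> id (f ` i)" if "i \<in> La p" "v \<in> \<Union>(La p)" for i v
   using inj_on_image_mem_iff[OF f, of v i] L that by auto
 qed auto
 thus "decomposition_width V (%p. (`) f ` La p) = decomposition_width V La"
  unfolding decomposition_width_def by (intro arg_cong[of _ _ Max] image_cong) auto
qed

lemma fcghw_rule_image:
 assumes "inj_on f (rule_vertices R)" "rule_edges R' = (`) f ` rule_edges R" "rule_out R' = f ` rule_out R"
  and "rule_out R <= rule_vertices R"
 shows "fcghw_rule R' <= fcghw_rule R"
proof -
 have "widths R <= widths R'"
 proof
  fix w assume "w \<in> widths R"
  then obtain V E ch La where d: "free_connex_decomposition R V E ch La" "w = decomposition_width V La"
   unfolding widths_def by auto
  have "w = decomposition_width V (%p. (`) f ` La p)"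
   unfolding d(2) by (rule decomposition_image(2)[OF d(1) assms(1-3), symmetric])
  thus "w \<in> widths R'" unfolding widths_def using decomposition_image(1)[OF d(1) assms(1-3)] by blast
 qed
 moreover have "widths R ~= {}" using decomposition_exists[OF assms(4)] unfolding widths_def by blast
 ultimately show ?thesis
  unfolding fcghw_rule_eq by (intro cInf_superset_mono bdd_below_finite widths_finite)
qed

definition in_some_bag :: "nat set => (nat => nat set) => nat set => bool" where
 "in_some_bag V ch Y \<longleftrightarrow> (EX p:V. Y <= ch p)"

lemma decomposition_reach:
 assumes d: "free_connex_decomposition R V E ch La" and B: "B = {} | B \<in> rule_edges R"
 shows "reach (rule_edges R) (rule_vertices R) B (rule_out R) (in_some_bag V ch) (rule_out R) (rule_vertices R)"
proof -
 note D = free_connex_decompositionD[OF d]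
 obtain S where S: "S ~= {}" "S <= V" "connected_in S E" "(UN p:S. ch p) = rule_out R" using D(7) by auto
 interpret decomposition "rule_edges R" "rule_vertices R" B "rule_out R" V E ch S
 proof
  show "EX p:V. B <= ch p" using B D(4) S(1,2) by blast
  show "rule_vertices R = (UN p:V. ch p)" by (rule D(2)[symmetric])
 qed (use D(1,4,5) S rule_edges_finite in auto)
 have "in_bag = in_some_bag V ch" unfolding in_bag_def in_some_bag_def by blast
 thus ?thesis using reach_Out by simp
qed


section \<open>Rules of the engine\<close>

text \<open>A shape is a rule up to the choice of its predicate symbols, constants and variable names:
 the argument lists of the head and of the body atoms, with variables below \<open>W\<close> and all
 constants replaced by 0, and the index of the IDB atom (0 if there is none). Engine facts:
 \<open>[0, p, 0, t]\<close> a tuple \<open>t\<close> of the predicate \<open>p\<close>; \<open>[1, i, l, g]\<close> an assignment \<open>g\<close> in the relation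
 labelled \<open>l\<close> of rule \<open>i\<close>; \<open>[2, i, a]\<close> the existence of atom \<open>a\<close> of rule \<open>i\<close>; \<open>[3, i]\<close> a fact
 that starts the evaluation of rule \<open>i\<close>. Assignments are 0 outside their domain.\<close>

type_synonym shape = "trm list list \<times> nat"

definition aux :: "nat => nat => nat => (nat => nat) => nat list" where
 "aux W i l g = [1, i, l] @ map g [0..<W]"

definition orig :: "nat => nat => nat list => nat list" where
 "orig W p t = [0, p, 0] @ map (nth_or_0 t) [0..<W]"

definition rule_fact :: "nat => nat => nat => nat list" where
 "rule_fact W i a = [2, i, a] @ replicate W 0"

definition seed :: "nat => nat => nat list" where
 "seed W i = [3, i, 0] @ replicate W 0"

text \<open>An assignment is filed under its restriction to every set \<open>S\<close>, with the
  code of \<open>S\<close> in the address. A join on any set of shared variables is then a bucket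
  lookup, at the price of \<open>2 ^ W\<close> keys per fact.\<close>

definition bucket_addr :: "nat => nat => nat => nat set => (nat => nat) => nat list" where
 "bucket_addr W i l S g = [1, i, l, set_encode S] @ map (%k. if k \<in> S then g k else 0) [0..<W]"

definition aux_exps :: "nat => oexp => nat => (nat => oexp) => oexp list" where
 "aux_exps W ie l src = [Lit 1, ie, Lit l] @ map src [0..<W]"

definition addr_exps :: "nat => oexp => nat => nat set => (nat => oexp) => oexp list" where
 "addr_exps W ie l S src = [Lit 1, ie, Lit l, Lit (set_encode S)] @
   map (%k. if k \<in> S then src k else Lit 0) [0..<W]"

definition subset_list :: "nat => nat set list" where
 "subset_list W = map set (subseqs [0..<W])"

lemma subset_list: "set (subset_list W) = Pow {..<W}" "distinct (subset_list W)"
 unfolding subset_list_def using subseqs_powset[of "[0..<W]"] distinct_set_subseqs[of "[0..<W]"]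
 by (auto simp: atLeast0LessThan)

text \<open>Assignments are filed under all variable sets, rule facts under the predicate of their
  atom as read from the program, seeds under their rule. Tuples have no keys, since no rule looks
  them up as partners.\<close>

definition key_specs :: "nat => ((oexp \<times> oexp) list \<times> oexp list) list" where
 "key_specs W = map (%S. ([(XArg 0, Lit 1)], [Lit 1, XArg 1, XArg 2, Lit (set_encode S)] @
    map (%k. if k \<in> S then XArg (3 + k) else Lit 0) [0..<W])) (subset_list W) @
   [([(XArg 0, Lit 2)], [Lit 2, Static False [XArg 1, XArg 2]]), ([(XArg 0, Lit 3)], [Lit 3, XArg 1])]"

text \<open>Odd by construction; the even label \<open>2 * a\<close> is reserved for the EDB atom
  \<open>a\<close>.\<close>

definition pair_label :: "nat set => nat set => nat" where
 "pair_label Y Z = Suc (2 * prod_encode (set_encode Y, set_encode Z))"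

lemma pair_label_eq: "finite Y ==> finite Z ==> finite Y' ==> finite Z' ==>
  pair_label Y Z = pair_label Y' Z' \<longleftrightarrow> Y = Y' & Z = Z'"
 unfolding pair_label_def by (simp add: prod_encode_eq set_encode_eq)

lemma pair_label_odd: "pair_label Y Z ~= 2 * a"
 unfolding pair_label_def by presburger

definition avars :: "trm list list => nat => nat set" where
 "avars tss a = vars_list (tss ! a)"

definition body_vars :: "trm list list => nat set" where
 "body_vars tss = (UN a:{1..<length tss}. avars tss a)"

definition body_edges :: "trm list list => nat set set" where
 "body_edges tss = avars tss ` {1..<length tss}"

definition idb_vars :: "shape => nat set" where
 "idb_vars h = (if snd h = 0 then {} else avars (fst h) (snd h))"

text \<open>Predicate 0 is a placeholder: the width depends on the argument lists only.\<close>

definition canonical_rule :: "trm list list => rule" where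
 "canonical_rule tss = Rule (0, tss ! 0) (map (Pair 0) (tl tss))"

definition best_decomposition :: "trm list list => nat set \<times> nat set set \<times> (nat => nat set) \<times> (nat => nat set set)" where
 "best_decomposition tss = (SOME (V, E, ch, La). free_connex_decomposition (canonical_rule tss) V E ch La &
   (ALL p:V. fractional_cover_number (\<Union>(La p)) (La p) id <= fcghw_rule (canonical_rule tss)))"

definition bag_ok :: "trm list list => nat set => bool" where
 "bag_ok tss = (case best_decomposition tss of (V, E, ch, La) => in_some_bag V ch)"

definition first_pos :: "trm list => nat => nat" where
 "first_pos ts v = (LEAST k. k < length ts & ts ! k = Var v)"

definition val_src :: "trm list => nat => oexp" where
 "val_src ts v = (if v \<in> vars_list ts then XArg (3 + first_pos ts v) else Lit 0)"

text \<open>A tuple matches an atom if repeated variables agree with their first occurrence and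
  constants with the program text; the latter are read from memory because shapes forget
  them.\<close>

definition match_tests :: "trm list list => nat => (oexp \<times> oexp) list" where
 "match_tests tss a = map (%k. (XArg (3 + k), case tss ! a ! k of Var v => XArg (3 + first_pos (tss ! a) v)
   | Cst _ => Static False [YArg 1, Lit a, Lit k, Lit 1])) [0..<length (tss ! a)]"

text \<open>For each EDB atom, the bucket of its assignments that agree with the current one on the
  shared variables. Their nonemptiness is the condition in \<open>consistent\<close>. The IDB atom
  is left out, its relation being still incomplete.\<close>

definition need_list :: "nat => shape => nat set => oexp => (nat => oexp) => oexp list list" where
 "need_list W h Y ie src = map (%a. addr_exps W ie (2 * a) (avars (fst h) a Int Y) src)
   (filter (%a. a ~= snd h) [1..<length (fst h)])"

text \<open>Here \<open>x\<close> is a tuple and \<open>y\<close> a rule fact naming an occurrence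
  of its predicate; cell \<open>[7, i]\<close> tells the shape of rule \<open>i\<close>. The same
  form serves EDB atoms and, with another label and with needs, the IDB atom.\<close>

definition conv_op :: "nat => nat => trm list list => nat => nat => oexp list list => eop" where
 "conv_op W d tss a l cs = Op [(XArg 0, Lit 0)] [[Lit 2, XArg 1]]
   ([(YArg 2, Lit a), (Static True [YArg 1], Lit d)] @ match_tests tss a) cs
   (aux_exps W (YArg 1) l (val_src (tss ! a)))"

definition seed_op :: "nat => nat => shape => eop" where
 "seed_op W d h = Op [(XArg 0, Lit 3), (Static True [XArg 1], Lit d)] [[Lit 3, XArg 1]] []
   (need_list W h {} (XArg 1) (%_. Lit 0)) (aux_exps W (XArg 1) (pair_label {} {}) (%_. Lit 0))"

definition label_guard :: "nat => nat => (oexp \<times> oexp) list" where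
 "label_guard d l = [(XArg 0, Lit 1), (XArg 2, Lit l), (Static True [XArg 1], Lit d)]"

text \<open>There is one address per atom containing \<open>v\<close>; by \<open>ext_ok\<close> none
  of them is the IDB atom. Scanning the smallest of these buckets gives the minimum in
  \<open>sum_Min_matching_le\<close>, and \<open>needs\<close> verifies the candidate against the
  other atoms.\<close>

definition ext_op :: "nat => nat => shape => nat set => nat set => nat => eop" where
 "ext_op W d h Y Z v = (let src = %k. if k = v then YArg (3 + v) else XArg (3 + k) in
   Op (label_guard d (pair_label Y Z))
    (map (%a. addr_exps W (XArg 1) (2 * a) (avars (fst h) a Int Y) (%k. XArg (3 + k)))
     (filter (%a. v \<in> avars (fst h) a) [1..<length (fst h)]))
    [] (need_list W h (insert v Y) (XArg 1) src)
    (aux_exps W (XArg 1) (pair_label (insert v Y) (insert v Z)) src))"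

definition join_cond :: "shape => nat set => nat set => nat set => nat set => nat set => bool" where
 "join_cond h Y Z Y' Z' Z3 \<longleftrightarrow>
   semijoin_ok (body_edges (fst h)) (body_vars (fst h)) (bag_ok (fst h)) Y Z Y' Z' & Z3 = Z Un Z' |
   join_ok (body_edges (fst h)) (body_vars (fst h)) (avars (fst h) 0) Y Y' Z' &
    Z = body_vars (fst h) & Z3 = body_vars (fst h)"

definition join_op :: "nat => nat => nat set => nat set => nat set => nat set => nat set => eop" where
 "join_op W d Y Z Y' Z' Z3 = Op (label_guard d (pair_label Y Z))
   [addr_exps W (XArg 1) (pair_label Y' Z') (Y Int Y') (%k. XArg (3 + k))] [] []
   (aux_exps W (XArg 1) (pair_label (Y Un Y') Z3) (%k. if k \<in> Y then XArg (3 + k) else YArg (3 + k)))"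

text \<open>Rules with a single premise still have to scan a bucket; keyed by the full domain
  \<open>Y\<close>, this one contains only the fact itself.\<close>

definition self_addr :: "nat => nat set => nat set => oexp list" where
 "self_addr W Y Z = addr_exps W (XArg 1) (pair_label Y Z) Y (%k. XArg (3 + k))"

definition weaken_op :: "nat => nat => nat set => nat set => nat set => nat set => eop" where
 "weaken_op W d Y Z Y' Z' = Op (label_guard d (pair_label Y Z)) [self_addr W Y Z] [] []
   (aux_exps W (XArg 1) (pair_label Y' Z') (%k. if k \<in> Y' then XArg (3 + k) else Lit 0))"

definition out_op :: "nat => nat => trm list list => eop" where
 "out_op W d tss = Op (label_guard d (pair_label (avars tss 0) (body_vars tss)))
   [self_addr W (avars tss 0) (body_vars tss)] [] []
   ([Lit 0, Static False [XArg 1, Lit 0], Lit 0] @ map (%k. if k < length (tss ! 0) then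
    (case tss ! 0 ! k of Var v => XArg (3 + v) | Cst _ => Static False [XArg 1, Lit 0, Lit k, Lit 1])
    else Lit 0) [0..<W])"

text \<open>Joins are listed in both orders because a pair is tried when its later member is popped,
  and either member may come later.\<close>

inductive is_op :: "nat => nat => shape => eop => bool" for W d h where
 op_atom: "1 <= a ==> a < length (fst h) ==> a ~= snd h ==> is_op W d h (conv_op W d (fst h) a (2 * a) [])"
| op_root: "bag_ok (fst h) (idb_vars h) ==> snd h ~= 0 ==> is_op W d h (conv_op W d (fst h) (snd h)
  (pair_label (idb_vars h) (idb_vars h)) (need_list W h (idb_vars h) (YArg 1) (val_src (fst h ! snd h))))"
| op_seed: "bag_ok (fst h) (idb_vars h) ==> snd h = 0 ==> is_op W d h (seed_op W d h)"
| op_ext: "Y <= {..<W} ==> Z <= {..<W} ==> v < W ==>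
  ext_ok (body_edges (fst h)) (body_vars (fst h)) (idb_vars h) (bag_ok (fst h)) Y Z v ==> is_op W d h (ext_op W d h Y Z v)"
| op_join: "Y <= {..<W} ==> Z <= {..<W} ==> Y' <= {..<W} ==> Z' <= {..<W} ==> Z3 <= {..<W} ==>
  join_cond h Y Z Y' Z' Z3 | join_cond h Y' Z' Y Z Z3 ==> is_op W d h (join_op W d Y Z Y' Z' Z3)"
| op_weaken: "Y <= {..<W} ==> Z <= {..<W} ==> Y' <= {..<W} ==> Z' <= {..<W} ==>
  weaken_ok (body_vars (fst h)) (bag_ok (fst h)) Y Z Y' Z' ==> is_op W d h (weaken_op W d Y Z Y' Z')"
| op_out: "is_op W d h (out_op W d (fst h))"

lemma finite_is_op: "finite {p. is_op W d h p}"
proof (rule finite_subset)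
 let ?P = "Pow {..<W}"
 let ?A = "(%a. conv_op W d (fst h) a (2 * a) []) ` {..<length (fst h)}"
 let ?R = "{conv_op W d (fst h) (snd h) (pair_label (idb_vars h) (idb_vars h))
   (need_list W h (idb_vars h) (YArg 1) (val_src (fst h ! snd h))), seed_op W d h, out_op W d (fst h)}"
 let ?E = "(%(Y, Z, v). ext_op W d h Y Z v) ` (?P \<times> ?P \<times> {..<W})"
 let ?J = "(%(Y, Z, Y', Z', Z3). join_op W d Y Z Y' Z' Z3) ` (?P \<times> ?P \<times> ?P \<times> ?P \<times> ?P)"
 let ?K = "(%(Y, Z, Y', Z'). weaken_op W d Y Z Y' Z') ` (?P \<times> ?P \<times> ?P \<times> ?P)"
 show "{p. is_op W d h p} <= ?A Un ?R Un ?E Un ?J Un ?K"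
 proof
  fix p assume "p \<in> {p. is_op W d h p}"
  hence "is_op W d h p" by simp
  thus "p \<in> ?A Un ?R Un ?E Un ?J Un ?K"
  proof cases
   case (op_atom a)
   hence "p \<in> ?A" by auto
   thus ?thesis by simp
  next
   case (op_ext Y Z v)
   hence "p \<in> ?E" by (intro image_eqI[of _ _ "(Y, Z, v)"]) auto
   thus ?thesis by simp
  next
   case (op_join Y Z Y' Z' Z3)
   hence "p \<in> ?J" by (intro image_eqI[of _ _ "(Y, Z, Y', Z', Z3)"]) auto
   thus ?thesis by simp
  next
   case (op_weaken Y Z Y' Z')
   hence "p \<in> ?K" by (intro image_eqI[of _ _ "(Y, Z, Y', Z')"]) auto
   thus ?thesis by simp
  qed simp_all
 qed
 show "finite (?A Un ?R Un ?E Un ?J Un ?K)" by (intro finite_UnI finite_imageI finite_cartesian_product) auto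
qed

definition all_ops :: "nat => shape list => eop list" where
 "all_ops W hs = (SOME l. set l = (UN d<length hs. {p. is_op W d (hs ! d) p}))"

lemma set_all_ops: "p \<in> set (all_ops W hs) \<longleftrightarrow> (EX d<length hs. is_op W d (hs ! d) p)"
proof -
 have "finite (UN d<length hs. {p. is_op W d (hs ! d) p})" using finite_is_op by (intro finite_UN_I) auto
 from finite_list[OF this] obtain l where l: "set l = (UN d<length hs. {p. is_op W d (hs ! d) p})" ..
 have "set (all_ops W hs) = (UN d<length hs. {p. is_op W d (hs ! d) p})"
  unfolding all_ops_def by (rule someI[of _ l]) (rule l)
 thus ?thesis by blast
qed

lemma length_results: "p \<in> set (all_ops W hs) ==> length (result p) = W + 3"
 unfolding set_all_ops by (auto elim!: is_op.cases
   simp: conv_op_def seed_op_def ext_op_def join_op_def weaken_op_def out_op_def aux_exps_def Let_def)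

section \<open>Evaluating expressions\<close>

lemma aux_simps [simp]:
 "nth_or_0 (aux W i l g) 0 = 1" "nth_or_0 (aux W i l g) (Suc 0) = i" "nth_or_0 (aux W i l g) 2 = l"
 "aux W i l g ! 0 = 1" "aux W i l g ! Suc 0 = i" "aux W i l g ! 2 = l" "length (aux W i l g) = W + 3"
 by (simp_all add: aux_def nth_or_0_def)

lemma orig_simps [simp]:
 "nth_or_0 (orig W p t) 0 = 0" "nth_or_0 (orig W p t) (Suc 0) = p" "nth_or_0 (orig W p t) 2 = 0"
 "orig W p t ! 0 = 0" "orig W p t ! Suc 0 = p" "length (orig W p t) = W + 3"
 by (simp_all add: orig_def nth_or_0_def)

lemma rule_fact_simps [simp]:
 "nth_or_0 (rule_fact W i a) 0 = 2" "nth_or_0 (rule_fact W i a) (Suc 0) = i" "nth_or_0 (rule_fact W i a) 2 = a"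
 "rule_fact W i a ! 0 = 2" "length (rule_fact W i a) = W + 3"
 by (simp_all add: rule_fact_def nth_or_0_def)

lemma seed_simps [simp]:
 "nth_or_0 (seed W i) 0 = 3" "nth_or_0 (seed W i) (Suc 0) = i" "seed W i ! 0 = 3" "length (seed W i) = W + 3"
 by (simp_all add: seed_def nth_or_0_def)

lemma nth_aux: "ALL k>=W. g k = 0 ==> nth_or_0 (aux W i l g) (3 + k) = g k"
 by (auto simp: aux_def nth_or_0_def nth_append not_less)

lemma nth_orig: "length t <= W ==> nth_or_0 (orig W p t) (3 + k) = nth_or_0 t k"
 by (auto simp: orig_def nth_or_0_def nth_append)

lemma bucket_addr_eq:
 assumes "S <= {..<W}" "S' <= {..<W}"
 shows "bucket_addr W i l S g = bucket_addr W i' l' S' g' \<longleftrightarrow> i = i' & l = l' & S = S' & (ALL k:S. g k = g' k)"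
proof -
 have "finite S" "finite S'" using assms finite_subset by blast+
 hence "set_encode S = set_encode S' \<longleftrightarrow> S = S'" by (rule set_encode_eq)
 thus ?thesis using assms unfolding bucket_addr_def by auto
qed

lemma eval_aux_exps:
 assumes "!!k. k < W ==> oeval st x y (src k) = g k"
 shows "map (oeval st x y) (aux_exps W ie l src) = aux W (oeval st x y ie) l g"
 unfolding aux_exps_def aux_def using assms by simp

lemma eval_addr_exps:
 assumes "!!k. k \<in> S ==> k < W ==> oeval st x y (src k) = g k"
 shows "map (oeval st x y) (addr_exps W ie l S src) = bucket_addr W (oeval st x y ie) l S g"
 unfolding addr_exps_def bucket_addr_def using assms by simp

lemma keys_aux:
 assumes "ALL k>=W. g k = 0"
 shows "keys st (key_specs W) (aux W i l g) = map (%S. bucket_addr W i l S g) (subset_list W)"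
proof -
 have *: "eqs st (aux W i l g) (aux W i l g) [(XArg 0, Lit n)] \<longleftrightarrow> n = 1" for n
  by (auto simp: eqs_def)
 show ?thesis
  unfolding keys_def key_specs_def
  by (simp add: * filter_map comp_def bucket_addr_def nth_aux[OF assms] if_distrib[of "oeval st _ _"] cong: if_cong)
qed

lemma keys_rule_fact: "keys st (key_specs W) (rule_fact W i a) = [[2, st [0, i, a]]]"
proof -
 have *: "eqs st (rule_fact W i a) (rule_fact W i a) [(XArg 0, Lit n)] \<longleftrightarrow> n = 2" for n
  by (auto simp: eqs_def)
 show ?thesis unfolding keys_def key_specs_def by (simp add: * filter_map comp_def)
qed

lemma keys_seed: "keys st (key_specs W) (seed W i) = [[3, i]]"
proof -
 have *: "eqs st (seed W i) (seed W i) [(XArg 0, Lit n)] \<longleftrightarrow> n = 3" for n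
  by (auto simp: eqs_def)
 show ?thesis unfolding keys_def key_specs_def by (simp add: * filter_map comp_def)
qed

lemma keys_orig: "keys st (key_specs W) (orig W p t) = []"
proof -
 have *: "eqs st (orig W p t) (orig W p t) [(XArg 0, Lit n)] \<longleftrightarrow> n = 0" for n
  by (auto simp: eqs_def)
 show ?thesis unfolding keys_def key_specs_def by (simp add: * filter_map comp_def)
qed

lemma distinct_keys_aux:
 assumes "ALL k>=W. g k = 0"
 shows "distinct (keys st (key_specs W) (aux W i l g))"
 unfolding keys_aux[OF assms] using subset_list[of W]
 by (auto simp: distinct_map inj_on_def bucket_addr_eq)

lemma first_pos:
 assumes "v \<in> vars_list ts"
 shows "first_pos ts v < length ts" "ts ! first_pos ts v = Var v"
proof -
 obtain k where "k < length ts & ts ! k = Var v" using assms unfolding Var_in_set by (metis in_set_conv_nth)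
 hence "first_pos ts v < length ts & ts ! first_pos ts v = Var v" unfolding first_pos_def by (rule LeastI)
 thus "first_pos ts v < length ts" "ts ! first_pos ts v = Var v" by auto
qed

section \<open>Meaning of the engine facts\<close>

definition ren_trm :: "(nat => nat) => trm => trm" where
 "ren_trm f t = (case t of Var x => Var (f x) | Cst c => Cst 0)"

lemma ren_trm_simps [simp]: "ren_trm f (Var x) = Var (f x)" "ren_trm f (Cst c) = Cst 0"
 by (simp_all add: ren_trm_def)

lemma vars_ren: "vars_list (map (ren_trm f) ts) = f ` vars_list ts"
proof -
 have "vars_trm (ren_trm f t) = f ` vars_trm t" for t by (cases t) auto
 thus ?thesis unfolding vars_list_def by auto
qed

abbreviation cut :: "nat set => (nat => nat) => nat => nat" where
 "cut Y g == %v. if v \<in> Y then g v else 0"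

text \<open>\<open>sid i\<close> is the index in \<open>hs\<close> of the shape of rule
  \<open>i\<close>, recorded in cell \<open>[7, i]\<close>; \<open>fm i\<close> renames its
  variables into those of the shape. The second component of a shape is the position of the IDB
  atom, where 0, the position of the head, means that there is none.\<close>

locale evaluation =
 fixes Rs :: "rule list" and D :: "fact set" and W :: nat and hs :: "shape list" and sid :: "nat => nat"
  and fm :: "nat => nat => nat" and st :: mem
 assumes dp: "datalog_program (set Rs)" and lin: "linear_program (set Rs)" and db: "db_instance (set Rs) D"
  and arity: "!!i A. i < length Rs ==> A \<in> set (rule_atoms (Rs ! i)) ==> length (snd A) <= W"
  and sid: "!!i. i < length Rs ==> sid i < length hs & st [7, i] = sid i"
  and shape: "!!i. i < length Rs ==> fst (hs ! sid i) = map (%A. map (ren_trm (fm i)) (snd A)) (rule_atoms (Rs ! i))"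
  and fm: "!!i. i < length Rs ==> inj_on (fm i) (vars_rule (Rs ! i)) & fm i ` vars_rule (Rs ! i) <= {..<W}"
  and idb_index: "!!i. i < length Rs ==> snd (hs ! sid i) < length (rule_atoms (Rs ! i)) &
    (ALL a:{1..<length (rule_atoms (Rs ! i))}. fst (rule_atoms (Rs ! i) ! a) \<in> idb (set Rs) \<longleftrightarrow> a = snd (hs ! sid i))"
  and st_pred: "!!i a. i < length Rs ==> a < length (rule_atoms (Rs ! i)) ==> st [0, i, a] = fst (rule_atoms (Rs ! i) ! a)"
  and st_name: "!!i a k. i < length Rs ==> a < length (rule_atoms (Rs ! i)) ==> k < length (snd (rule_atoms (Rs ! i) ! a)) ==>
    st [0, i, a, k, 1] = trm_name (snd (rule_atoms (Rs ! i) ! a) ! k)"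
begin

abbreviation "LF == least_fixpoint (set Rs) D"
abbreviation "kf == keys st (key_specs W)"
abbreviation "atm i a == rule_atoms (Rs ! i) ! a"
abbreviation "sh i == hs ! sid i"
abbreviation "tss i == fst (hs ! sid i)"
abbreviation "ei i == snd (hs ! sid i)"
abbreviation "lab i Y Z g == aux W i (pair_label Y Z) g"
abbreviation "natoms i == length (rule_atoms (Rs ! i))"
abbreviation "rel == derived_relation (set Rs) D"
abbreviation "bvars i == body_vars (tss i)"
abbreviation "ev x y == map (oeval st x y)"
abbreviation "vars i a == avars (fst (hs ! sid i)) a"

definition batoms :: "nat => nat set" where
 "batoms i = {1..<natoms i}"

lemma length_tss: "i < length Rs ==> length (tss i) = natoms i"
 using shape by simp

lemma tss_nth: "i < length Rs ==> a < natoms i ==> tss i ! a = map (ren_trm (fm i)) (snd (atm i a))"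
 using shape by simp

lemma rule_atoms_pos: "0 < length (rule_atoms R)"
 by (simp add: rule_atoms_def)

lemma vars_eq: "i < length Rs ==> a < natoms i ==> vars i a = fm i ` vars_list (snd (atm i a))"
 unfolding avars_def by (simp add: tss_nth vars_ren)

lemma atom_vars_rule: "a < length (rule_atoms R) ==> vars_list (snd (rule_atoms R ! a)) <= vars_rule R"
 unfolding vars_rule_def by (meson UN_upper nth_mem)

lemma vars_W: "i < length Rs ==> a < natoms i ==> vars i a <= {..<W}"
proof -
 assume i: "i < length Rs" and a: "a < natoms i"
 have "fm i ` vars_list (snd (atm i a)) <= fm i ` vars_rule (Rs ! i)" by (rule image_mono[OF atom_vars_rule[OF a]])
 thus ?thesis unfolding vars_eq[OF i a] using fm[OF i] by (meson subset_trans)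
qed

lemma body_vars_eq: "i < length Rs ==> bvars i = (UN a:batoms i. vars i a)"
 unfolding body_vars_def batoms_def by (simp add: length_tss)

lemma body_edges_eq: "i < length Rs ==> body_edges (tss i) = vars i ` batoms i"
 unfolding body_edges_def batoms_def by (simp add: length_tss)

lemma body_vars_W: "i < length Rs ==> bvars i <= {..<W}"
 using body_vars_eq vars_W unfolding batoms_def by fastforce

lemma batoms_lt: "a \<in> batoms i ==> a < natoms i"
 unfolding batoms_def by simp

lemma batoms_body: "A \<in> set (body (Rs ! i)) \<longleftrightarrow> (EX a:batoms i. A = atm i a)"
proof
 assume "A \<in> set (body (Rs ! i))"
 then obtain k where "k < length (body (Rs ! i))" "A = body (Rs ! i) ! k" by (metis in_set_conv_nth)
 thus "EX a:batoms i. A = atm i a" unfolding batoms_def rule_atoms_def by (intro bexI[of _ "Suc k"]) auto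
next
 assume "EX a:batoms i. A = atm i a"
 then obtain a where "a \<in> batoms i" "A = atm i a" by blast
 thus "A \<in> set (body (Rs ! i))" unfolding batoms_def rule_atoms_def by (cases a) auto
qed

lemma out_vars: "i < length Rs ==> vars i 0 <= bvars i"
proof
 fix v assume i: "i < length Rs" and v: "v \<in> vars i 0"
 then obtain x where x: "x \<in> vars_list (snd (head (Rs ! i)))" "v = fm i x"
  using vars_eq[OF i rule_atoms_pos] by (auto simp: rule_atoms_def)
 obtain A where A: "A \<in> set (body (Rs ! i))" "x \<in> vars_list (snd A)"
  using vars_head_body[OF dp _ x(1)] i by auto
 obtain a where a: "a \<in> batoms i" "A = atm i a" using A(1) unfolding batoms_body by blast
 have "v \<in> vars i a" unfolding vars_eq[OF i batoms_lt[OF a(1)]] using A(2) a(2) x(2) by simp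
 thus "v \<in> bvars i" unfolding body_vars_eq[OF i] using a(1) by (rule UN_I[rotated])
qed

lemma idb_vars_cases: "i < length Rs ==> ei i = 0 & idb_vars (sh i) = {} | ei i \<in> batoms i & idb_vars (sh i) = vars i (ei i)"
 using idb_index[of i] unfolding idb_vars_def batoms_def by auto

lemma idb_vars_body: "i < length Rs ==> idb_vars (sh i) <= bvars i"
 using idb_vars_cases body_vars_eq by fastforce

definition sat :: "nat => nat => (nat => nat) => bool" where
 "sat i a th \<longleftrightarrow> ground_atom (th \<circ> fm i) (atm i a) \<in> LF"

lemma sat_cong:
 assumes "i < length Rs" "a < natoms i" "!!v. v \<in> vars i a ==> th v = th' v"
 shows "sat i a th \<longleftrightarrow> sat i a th'"
proof -
 have "ground_atom (th \<circ> fm i) (atm i a) = ground_atom (th' \<circ> fm i) (atm i a)"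
  by (rule ground_atom_cong) (use assms vars_eq in simp)
 thus ?thesis unfolding sat_def by simp
qed

lemma sat_agree:
 assumes "sat i a th" "i < length Rs" "a < natoms i" "!!v. v \<in> vars i a ==> th' v = th v"
 shows "sat i a th'"
 using sat_cong[OF assms(2,3), of th' th] assms(1,4) by blast

definition Rel :: "nat => nat => (nat => nat) set" where
 "Rel i a = {g. (ALL v. v \<notin> vars i a --> g v = 0) & sat i a g}"

text \<open>The extension \<open>th\<close> is the meaning of the label. Consistency with all body
  atoms, also with those not inside \<open>Z\<close>, is imposed in addition because
  \<open>card_consistent_le\<close> bounds exactly such assignments.\<close>

definition valid :: "nat => nat set => nat set => (nat => nat) set" where
 "valid i Y Z = {g \<in> consistent (batoms i) (vars i) (Rel i) Y.
   EX th. (ALL v:Y. th v = g v) & (ALL a:batoms i. vars i a <= Z --> sat i a th)}"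

text \<open>The two kinds of labels whose relations can be bounded: \<open>Y\<close> within a bag,
  or \<open>Y\<close> within the head with every atom satisfied.\<close>

definition typed :: "nat => nat set => nat set => bool" where
 "typed i Y Z \<longleftrightarrow> is_label (bvars i) Y Z & (bag_ok (tss i) Y | Y <= vars i 0 & Z = bvars i)"

definition Vorig :: "nat list set" where
 "Vorig = {orig W p t | p t. (p, t) \<in> LF & length t <= W}"

definition Vrule :: "nat list set" where
 "Vrule = {rule_fact W i a | i a. i < length Rs & a \<in> batoms i}"

definition Vseed :: "nat list set" where
 "Vseed = {seed W i | i. i < length Rs}"

definition Vatom :: "nat list set" where
 "Vatom = {aux W i (2 * a) g | i a g. i < length Rs & a \<in> batoms i & a ~= ei i & g \<in> Rel i a}"

definition Vlab :: "nat list set" where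
 "Vlab = {lab i Y Z g | i Y Z g. i < length Rs & typed i Y Z & g \<in> valid i Y Z}"

text \<open>An upper estimate of everything the engine may derive; soundness, termination and cost
  all refer to this set.\<close>

definition Vall :: "nat list set" where
 "Vall = Vorig Un Vrule Un Vseed Un Vatom Un Vlab"

lemma Rel_zero: "i < length Rs ==> a < natoms i ==> g \<in> Rel i a ==> ALL k>=W. g k = 0"
 using vars_W[of i a] unfolding Rel_def by fastforce

lemma typed_W: "i < length Rs ==> typed i Y Z ==> Y <= {..<W} & Z <= {..<W} & Y <= Z"
 using body_vars_W unfolding typed_def is_label_def by blast

lemma fin_W: "Y <= {..<W} ==> finite Y" for Y :: "nat set"
 using finite_subset by blast

lemma valid_zero: "i < length Rs ==> typed i Y Z ==> g \<in> valid i Y Z ==> ALL k>=W. g k = 0"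
proof (intro allI impI)
 fix k assume "i < length Rs" "typed i Y Z" and g: "g \<in> valid i Y Z" and k: "W <= k"
 hence "k \<notin> Y" using typed_W[of i Y Z] by auto
 thus "g k = 0" using g unfolding valid_def consistent_def by simp
qed

lemma pair_label_inj:
 assumes "pair_label Y Z = pair_label Y' Z'" "Y <= {..<W}" "Z <= {..<W}" "Y' <= {..<W}" "Z' <= {..<W}"
 shows "Y = Y' & Z = Z'"
 using assms(1) pair_label_eq[OF assms(2-5)[THEN fin_W]] by simp

lemma Vall_key_aux:
 assumes z: "z \<in> Vall" and S: "S <= {..<W}" and k: "bucket_addr W i l S g \<in> set (kf z)"
 obtains (atom) a g' where "l = 2 * a" "i < length Rs" "a \<in> batoms i" "a ~= ei i" "g' \<in> Rel i a" "z = aux W i l g'" "ALL v:S. g' v = g v"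
 | (label) Y Z g' where "l = pair_label Y Z" "i < length Rs" "typed i Y Z" "g' \<in> valid i Y Z" "z = aux W i l g'" "ALL v:S. g' v = g v"
proof -
 have hd: "bucket_addr W i l S g ~= [2, x]" "bucket_addr W i l S g ~= [3, x]" for x by (simp_all add: bucket_addr_def)
 have key: "i' = i & l' = l & (ALL v:S. g' v = g v)"
  if z': "z = aux W i' l' g'" "ALL k>=W. g' k = 0" for i' l' g'
 proof -
  obtain S' where "S' <= {..<W}" "bucket_addr W i l S g = bucket_addr W i' l' S' g'"
   using k unfolding z'(1) keys_aux[OF z'(2)] by (auto simp: subset_list(1))
  thus ?thesis using bucket_addr_eq[OF S] by metis
 qed
 from z consider "z \<in> Vorig" | "z \<in> Vrule" | "z \<in> Vseed" | "z \<in> Vatom" | "z \<in> Vlab" unfolding Vall_def by blast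
 thus thesis
 proof cases
  case 1
  thus ?thesis using k unfolding Vorig_def by (auto simp: keys_orig)
 next
  case 2
  thus ?thesis using k hd unfolding Vrule_def by (auto simp: keys_rule_fact)
 next
  case 3
  thus ?thesis using k hd unfolding Vseed_def by (auto simp: keys_seed)
 next
  case 4
  then obtain i' a g' where g': "z = aux W i' (2 * a) g'" "i' < length Rs" "a \<in> batoms i'" "a ~= ei i'" "g' \<in> Rel i' a"
   unfolding Vatom_def by blast
  have "i' = i & 2 * a = l & (ALL v:S. g' v = g v)"
   by (rule key[OF g'(1) Rel_zero[OF g'(2) batoms_lt[OF g'(3)] g'(5)]])
  thus ?thesis using atom[of a g'] g' by simp
 next
  case 5
  then obtain i' Y Z g' where g': "z = lab i' Y Z g'" "i' < length Rs" "typed i' Y Z" "g' \<in> valid i' Y Z"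
   unfolding Vlab_def by blast
  have "i' = i & pair_label Y Z = l & (ALL v:S. g' v = g v)"
   by (rule key[OF g'(1) valid_zero[OF g'(2-4)]])
  thus ?thesis using label[of Y Z g'] g' by simp
 qed
qed

lemma Vall_key_atom:
 assumes "z \<in> Vall" "S <= {..<W}" "bucket_addr W i (2 * a) S g \<in> set (kf z)"
 obtains g' where "i < length Rs" "a \<in> batoms i" "a ~= ei i" "g' \<in> Rel i a" "z = aux W i (2 * a) g'" "ALL v:S. g' v = g v"
 using assms
proof (cases rule: Vall_key_aux)
 case (atom a' g')
 thus ?thesis using that[of g'] by simp
next
 case (label Y Z g')
 thus ?thesis using pair_label_odd by metis
qed

lemma Vall_key_label:
 assumes "z \<in> Vall" "S <= {..<W}" "bucket_addr W i (pair_label Y Z) S g \<in> set (kf z)" "Y <= {..<W}" "Z <= {..<W}"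
 obtains g' where "i < length Rs" "typed i Y Z" "g' \<in> valid i Y Z" "z = lab i Y Z g'" "ALL v:S. g' v = g v"
 using assms(1-3)
proof (cases rule: Vall_key_aux)
 case (atom a' g')
 thus ?thesis using pair_label_odd by metis
next
 case (label Y' Z' g')
 hence "Y = Y' & Z = Z'" using typed_W[OF label(2,3)] assms(4,5) by (intro pair_label_inj) auto
 thus ?thesis using that[of g'] label by simp
qed

lemma Vall_rule_key:
 assumes "z \<in> Vall" "[2, p] \<in> set (kf z)"
 obtains i a where "i < length Rs" "a \<in> batoms i" "z = rule_fact W i a" "fst (atm i a) = p"
proof -
 have hd: "[2, p] \<notin> set (kf (aux W i l g))" if "ALL k>=W. g k = 0" for i l g
  unfolding keys_aux[OF that] by (auto simp: bucket_addr_def)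
 from assms(1) consider "z \<in> Vorig" | "z \<in> Vrule" | "z \<in> Vseed" | "z \<in> Vatom" | "z \<in> Vlab" unfolding Vall_def by blast
 thus thesis
 proof cases
  case 1
  thus ?thesis using assms(2) unfolding Vorig_def by (auto simp: keys_orig)
 next
  case 2
  then obtain i a where ia: "i < length Rs" "a \<in> batoms i" "z = rule_fact W i a" unfolding Vrule_def by blast
  hence "p = st [0, i, a]" using assms(2) by (simp add: keys_rule_fact)
  thus ?thesis using that ia st_pred[OF ia(1) batoms_lt[OF ia(2)]] by simp
 next
  case 3
  thus ?thesis using assms(2) unfolding Vseed_def by (auto simp: keys_seed)
 next
  case 4
  then obtain i a g where g: "z = aux W i (2 * a) g" "ALL k>=W. g k = 0" unfolding Vatom_def using Rel_zero batoms_lt by blast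
  thus ?thesis using assms(2) hd[OF g(2)] by simp
 next
  case 5
  then obtain i l g where g: "z = aux W i l g" "ALL k>=W. g k = 0" unfolding Vlab_def using valid_zero by blast
  thus ?thesis using assms(2) hd[OF g(2)] by simp
 qed
qed

lemma Vall_kind:
 assumes "z \<in> Vall"
 shows "z ! 0 = 0 ==> z \<in> Vorig" "z ! 0 = 1 ==> z \<in> Vatom Un Vlab" "z ! 0 = 3 ==> z \<in> Vseed" "length z = W + 3"
 using assms unfolding Vall_def Vorig_def Vrule_def Vseed_def Vatom_def Vlab_def by auto

lemma Vall_label_guard:
 assumes x: "x \<in> Vall" and g: "eqs st x x (label_guard d (pair_label Y Z))" and W: "Y <= {..<W}" "Z <= {..<W}"
 obtains i g where "x = lab i Y Z g" "i < length Rs" "sid i = d" "typed i Y Z" "g \<in> valid i Y Z" "ALL k>=W. g k = 0"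
proof -
 have e: "nth_or_0 x 0 = 1" "nth_or_0 x 2 = pair_label Y Z" "st [7, nth_or_0 x (Suc 0)] = d"
  using g unfolding eqs_def label_guard_def by auto
 have "x ! 0 = 1" using e(1) unfolding nth_or_0_def by (auto split: if_splits)
 hence "x \<in> Vatom Un Vlab" using Vall_kind(2)[OF x] by blast
 thus thesis
 proof
  assume "x \<in> Vatom"
  then obtain i a g where "x = aux W i (2 * a) g" unfolding Vatom_def by blast
  thus ?thesis using e(2) pair_label_odd[of Y Z a] by simp
 next
  assume "x \<in> Vlab"
  then obtain i Y' Z' g where i: "x = lab i Y' Z' g" "i < length Rs" "typed i Y' Z'" "g \<in> valid i Y' Z'"
   unfolding Vlab_def by blast
  hence "pair_label Y' Z' = pair_label Y Z" using e(2) by simp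
  hence "Y' = Y & Z' = Z" using typed_W[OF i(2,3)] W by (intro pair_label_inj) auto
  moreover have "sid i = d" using e(3) i(1) sid[OF i(2)] by simp
  ultimately show ?thesis using that[of i g] i valid_zero[OF i(2-4)] by simp
 qed
qed

subsection \<open>Soundness of the rules\<close>

lemma LF_arity:
 assumes "x \<in> LF" "i < length Rs" "a < natoms i" "fst (atm i a) = fst x"
 shows "length (snd x) = length (snd (atm i a))"
 using assms
proof (induction arbitrary: i a rule: least_fixpoint_induct)
 case (base x)
 have *: "ALL (p, t):D. ALL R:set Rs. ALL A:set (rule_atoms R). fst A = p --> length (snd A) = length t"
  using db unfolding db_instance_def by (elim conjE)
 have "ALL R:set Rs. ALL A:set (rule_atoms R). fst A = fst x --> length (snd A) = length (snd x)"
  using bspec[OF * base(1)] by (simp add: case_prod_beta)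
 moreover have "Rs ! i \<in> set Rs" "atm i a \<in> set (rule_atoms (Rs ! i))" using base(2,3) by auto
 ultimately show ?case using base(4) by simp
next
 case (rule R th)
 obtain ar where ar: "ALL R:set Rs. ALL A:set (rule_atoms R). length (snd A) = ar (fst A)"
  using dp unfolding datalog_program_def by auto
 have "length (snd (head R)) = ar (fst (head R))" using ar rule.hyps by (simp add: rule_atoms_def)
 moreover have "Rs ! i \<in> set Rs" "atm i a \<in> set (rule_atoms (Rs ! i))" using rule.prems by auto
 hence "length (snd (atm i a)) = ar (fst (atm i a))" using ar by blast
 ultimately show ?case using rule.prems(3) by (simp add: ground_atom_def)
qed

lemma LF_length: "(fst (atm i a), t) \<in> LF ==> i < length Rs ==> a < natoms i ==>
  length t = length (snd (atm i a)) & length t <= W"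
 using LF_arity[of "(fst (atm i a), t)" i a] arity[of i "atm i a"] by simp

lemma conv_sat:
 assumes i: "i < length Rs" "a < natoms i" and t: "(fst (atm i a), t) \<in> LF"
  and m: "eqs st (orig W p t) (rule_fact W i a) (match_tests (tss i) a)"
 shows "ground_atom ((%v. nth_or_0 t (first_pos (tss i ! a) v)) \<circ> fm i) (atm i a) = (fst (atm i a), t)"
proof -
 let ?g = "%v. nth_or_0 t (first_pos (tss i ! a) v)"
 note len = LF_length[OF t i]
 have "ground_trm (?g \<circ> fm i) (snd (atm i a) ! k) = t ! k" if k: "k < length t" for k
 proof -
  have tk: "tss i ! a ! k = ren_trm (fm i) (snd (atm i a) ! k)" using tss_nth[OF i] k len by simp
  have k': "k < length (tss i ! a)" using tss_nth[OF i] k len by simp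
  hence e: "oeval st (orig W p t) (rule_fact W i a) (XArg (3 + k)) = oeval st (orig W p t) (rule_fact W i a)
   (case tss i ! a ! k of Var v => XArg (3 + first_pos (tss i ! a) v) | Cst _ => Static False [YArg 1, Lit a, Lit k, Lit 1])"
   using m unfolding eqs_def match_tests_def by simp
  have x: "nth_or_0 (orig W p t) (3 + k) = t ! k" using k len nth_orig[of t W p k] by (simp add: nth_or_0_def)
  show ?thesis
  proof (cases "snd (atm i a) ! k")
   case (Var v)
   hence "nth_or_0 (orig W p t) (3 + k) = nth_or_0 t (first_pos (tss i ! a) (fm i v))"
    using e tk nth_orig[of t W p] len by simp
   thus ?thesis using Var x by simp
  next
   case (Cst c)
   hence "nth_or_0 (orig W p t) (3 + k) = st [0, i, a, k, 1]" using e tk by simp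
   thus ?thesis using Cst x st_name[OF i, of k] k len by simp
  qed
 qed
 hence "map (ground_trm (?g \<circ> fm i)) (snd (atm i a)) = t" using len by (intro nth_equalityI) auto
 thus ?thesis by (simp add: ground_atom_def)
qed

lemma sat_match:
 assumes i: "i < length Rs" "a < natoms i"
  and t: "ground_atom (th \<circ> fm i) (atm i a) = (fst (atm i a), t)" and len: "length t <= W"
 shows "v \<in> vars i a ==> nth_or_0 t (first_pos (tss i ! a) v) = th v"
  "eqs st (orig W p t) (rule_fact W i a) (match_tests (tss i) a)"
proof -
 have t': "t = map (ground_trm (th \<circ> fm i)) (snd (atm i a))" using t by (simp add: ground_atom_def)
 have v: "nth_or_0 t (first_pos (tss i ! a) v) = th v" if v: "v \<in> vars i a" for v
 proof -
  note f = first_pos[OF v[unfolded avars_def]]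
  have l: "first_pos (tss i ! a) v < length (snd (atm i a))" using f(1) tss_nth[OF i] by simp
  hence "ren_trm (fm i) (snd (atm i a) ! first_pos (tss i ! a) v) = Var v" using f(2) tss_nth[OF i] by simp
  then obtain x where "snd (atm i a) ! first_pos (tss i ! a) v = Var x" "fm i x = v"
   by (cases "snd (atm i a) ! first_pos (tss i ! a) v") auto
  thus ?thesis using l unfolding t' nth_or_0_def by simp
 qed
 thus "v \<in> vars i a ==> nth_or_0 t (first_pos (tss i ! a) v) = th v" .
 have "oeval st (orig W p t) (rule_fact W i a) (XArg (3 + k)) = oeval st (orig W p t) (rule_fact W i a)
   (case tss i ! a ! k of Var v => XArg (3 + first_pos (tss i ! a) v) | Cst _ => Static False [YArg 1, Lit a, Lit k, Lit 1])"
  if k: "k < length (tss i ! a)" for k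
 proof -
  have k': "k < length (snd (atm i a))" and tk: "tss i ! a ! k = ren_trm (fm i) (snd (atm i a) ! k)"
   using k tss_nth[OF i] by simp_all
  have x: "nth_or_0 (orig W p t) (3 + k) = ground_trm (th \<circ> fm i) (snd (atm i a) ! k)"
   using k' nth_orig[OF len, of p k] by (simp add: nth_or_0_def t')
  show ?thesis
  proof (cases "snd (atm i a) ! k")
   case (Var y)
   hence "fm i y \<in> vars i a" using k tk unfolding avars_def Var_in_set by (metis nth_mem ren_trm_simps(1))
   thus ?thesis using v Var x tk nth_orig[OF len, of p] by simp
  next
   case (Cst c)
   thus ?thesis using x tk st_name[OF i k'] by simp
  qed
 qed
 thus "eqs st (orig W p t) (rule_fact W i a) (match_tests (tss i) a)"
  unfolding eqs_def match_tests_def by simp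
qed

lemma eval_val_src:
 assumes "length t <= W"
 shows "oeval st (orig W p t) y (val_src ts v) = (if v \<in> vars_list ts then nth_or_0 t (first_pos ts v) else 0)"
 unfolding val_src_def by (simp add: nth_orig[OF assms])

lemma needs_found:
 assumes n: "ALL c:set (need_list W (sh i) Y ie src). EX z:Vall. ev x y c \<in> set (kf z)"
  and ie: "oeval st x y ie = i" and src: "!!k. k \<in> Y ==> k < W ==> oeval st x y (src k) = g k"
  and i: "i < length Rs" and a: "a \<in> batoms i" "a ~= ei i"
 shows "EX t:Rel i a. ALL v:vars i a Int Y. t v = g v"
proof -
 let ?S = "vars i a Int Y"
 have "addr_exps W ie (2 * a) ?S src \<in> set (need_list W (sh i) Y ie src)"
  using a i unfolding need_list_def batoms_def by (auto simp: length_tss)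
 then obtain z where z: "z \<in> Vall" "ev x y (addr_exps W ie (2 * a) ?S src) \<in> set (kf z)" using n by blast
 have "ev x y (addr_exps W ie (2 * a) ?S src) = bucket_addr W i (2 * a) ?S g"
  unfolding ie[symmetric] by (rule eval_addr_exps) (use src in auto)
 hence k: "bucket_addr W i (2 * a) ?S g \<in> set (kf z)" using z(2) by simp
 have S: "?S <= {..<W}" using vars_W[OF i batoms_lt[OF a(1)]] by blast
 show ?thesis by (rule Vall_key_atom[OF z(1) S k]) blast
qed

lemma validI:
 assumes "!!u. u \<notin> Y ==> g u = 0" "!!a. a \<in> batoms i ==> EX t:Rel i a. ALL v:vars i a Int Y. t v = g v"
  "!!v. v \<in> Y ==> th v = g v" "!!a. a \<in> batoms i ==> vars i a <= Z ==> sat i a th"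
 shows "g \<in> valid i Y Z"
 using assms unfolding valid_def consistent_def matching_def by blast

lemma validD:
 assumes "g \<in> valid i Y Z"
 shows "!!u. u \<notin> Y ==> g u = 0" "!!a. a \<in> batoms i ==> EX t:Rel i a. ALL v:vars i a Int Y. t v = g v"
  "EX th. (ALL v:Y. th v = g v) & (ALL a:batoms i. vars i a <= Z --> sat i a th)"
 using assms unfolding valid_def consistent_def matching_def by blast+

lemma RelD: "t \<in> Rel i a ==> sat i a t"
 by (simp add: Rel_def)

lemma sat_Rel: "i < length Rs ==> a < natoms i ==> sat i a th ==>
  (%v. if v \<in> vars i a then th v else 0) \<in> Rel i a"
 unfolding Rel_def using sat_cong[of i a "%v. if v \<in> vars i a then th v else 0" th] by simp

lemma valid_root:
 assumes i: "i < length Rs" and g0: "!!v. v \<notin> idb_vars (sh i) ==> g v = 0"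
  and e: "ei i ~= 0 ==> g \<in> Rel i (ei i)"
  and n: "!!a. a \<in> batoms i ==> a ~= ei i ==> EX t:Rel i a. ALL v:vars i a Int idb_vars (sh i). t v = g v"
 shows "g \<in> valid i (idb_vars (sh i)) (idb_vars (sh i))"
proof -
 have c: "EX t:Rel i a. ALL v:vars i a Int idb_vars (sh i). t v = g v" if a: "a \<in> batoms i" for a
 proof (cases "a = ei i")
  case True
  hence "ei i ~= 0" using a unfolding batoms_def by auto
  thus ?thesis using e True by blast
 qed (use n a in blast)
 show ?thesis
 proof (rule validI[of _ _ _ g])
  fix a assume a: "a \<in> batoms i" "vars i a <= idb_vars (sh i)"
  then obtain t where t: "t \<in> Rel i a" "ALL v:vars i a. t v = g v" using c[OF a(1)] by blast
  thus "sat i a g" using RelD[OF t(1)] sat_cong[OF i batoms_lt[OF a(1)], of t g] by simp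
 qed (use g0 c in auto)
qed

text \<open>The new extension is \<open>th(v := c)\<close>. An atom completed by \<open>v\<close> is
  not the IDB atom and lies inside \<open>insert v Y\<close>, so the assignment found for it agrees
  with the extension on all of its variables.\<close>

lemma valid_ext:
 assumes i: "i < length Rs" and ext: "ext_ok (body_edges (tss i)) (bvars i) (idb_vars (sh i)) (bag_ok (tss i)) Y Z v"
  and g: "g \<in> valid i Y Z"
  and n: "!!a. a \<in> batoms i ==> a ~= ei i ==> EX t:Rel i a. ALL u:vars i a Int insert v Y. t u = (g(v := c)) u"
 shows "g(v := c) \<in> valid i (insert v Y) (insert v Z)"
proof -
 have vB: "v \<notin> idb_vars (sh i)" and vZ: "v \<notin> Z" and YZ: "Y <= Z"
  and F: "!!a. a \<in> batoms i ==> v \<in> vars i a ==> vars i a <= insert v Z ==> vars i a <= insert v Y"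
  using ext unfolding ext_ok_def body_edges_eq[OF i] is_label_def by auto
 have ve: "a ~= ei i" if "a \<in> batoms i" "v \<in> vars i a" for a
  using idb_vars_cases[OF i] vB that unfolding batoms_def by auto
 obtain th where th: "ALL u:Y. th u = g u" "ALL a:batoms i. vars i a <= Z --> sat i a th" using validD(3)[OF g] by blast
 show ?thesis
 proof (rule validI[of _ _ _ "th(v := c)"])
  show "(g(v := c)) u = 0" if "u \<notin> insert v Y" for u using that validD(1)[OF g] by auto
  show "(th(v := c)) u = (g(v := c)) u" if "u \<in> insert v Y" for u using that th(1) by auto
  fix a assume a: "a \<in> batoms i"
  show "EX t:Rel i a. ALL u:vars i a Int insert v Y. t u = (g(v := c)) u"
  proof (cases "v \<in> vars i a")
   case True
   thus ?thesis using n[OF a ve[OF a True]] by blast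
  next
   case False
   obtain t where "t \<in> Rel i a" "ALL u:vars i a Int Y. t u = g u" using validD(2)[OF g a] by blast
   thus ?thesis using False by (intro bexI[of _ t]) auto
  qed
  assume sub: "vars i a <= insert v Z"
  show "sat i a (th(v := c))"
  proof (cases "v \<in> vars i a")
   case True
   have s: "vars i a <= insert v Y" by (rule F[OF a True sub])
   obtain t where t: "t \<in> Rel i a" "ALL u:vars i a Int insert v Y. t u = (g(v := c)) u" using n[OF a ve[OF a True]] by blast
   have "t u = (th(v := c)) u" if "u \<in> vars i a" for u using t(2) that s th(1) by auto
   thus ?thesis using RelD[OF t(1)] sat_cong[OF i batoms_lt[OF a], of t "th(v := c)"] by blast
  next
   case False
   hence "sat i a th" using th(2) a sub by blast
   thus ?thesis by (rule sat_agree[OF _ i batoms_lt[OF a]]) (use False in auto)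
  qed
 qed
qed

lemma join_typed:
 assumes i: "i < length Rs" and j: "join_cond (sh i) Y Z Y' Z' Z3"
 shows "typed i (Y Un Y') Z3" "is_label (bvars i) Y Z" "is_label (bvars i) Y' Z'"
 using j unfolding join_cond_def typed_def semijoin_ok_def join_ok_def is_label_def
 by (auto simp: Un_absorb2)

text \<open>The two extensions are glued: a semijoin keeps \<open>th\<close> on \<open>Z\<close>, an
  enumeration step takes \<open>th'\<close> on \<open>Z'\<close>. Since \<open>g\<close> and
  \<open>g'\<close> agree where their domains meet, every atom sees only one of the two
  extensions.\<close>

lemma valid_join:
 assumes i: "i < length Rs" and j: "join_cond (sh i) Y Z Y' Z' Z3"
  and g: "g \<in> valid i Y Z" and g': "g' \<in> valid i Y' Z'" and eq: "ALL v:Y Int Y'. g v = g' v"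
 shows "(%v. if v \<in> Y then g v else g' v) \<in> valid i (Y Un Y') Z3"
proof -
 obtain th where th: "ALL u:Y. th u = g u" "ALL a:batoms i. vars i a <= Z --> sat i a th" using validD(3)[OF g] by blast
 obtain th' where th': "ALL u:Y'. th' u = g' u" "ALL a:batoms i. vars i a <= Z' --> sat i a th'" using validD(3)[OF g'] by blast
 from j consider (semi) "semijoin_ok (body_edges (tss i)) (bvars i) (bag_ok (tss i)) Y Z Y' Z'" "Z3 = Z Un Z'"
  | (out) "join_ok (body_edges (tss i)) (bvars i) (vars i 0) Y Y' Z'" "Z = bvars i" "Z3 = bvars i"
  unfolding join_cond_def by blast
 thus ?thesis
 proof cases
  case semi
  have Y: "Y' <= Y" "Z Int Z' <= Y'" "Y <= Z" "Y' <= Z'"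
   and F: "!!a. a \<in> batoms i ==> vars i a <= Z Un Z' ==> vars i a <= Z | vars i a <= Z'"
   using semi(1) unfolding semijoin_ok_def is_label_def body_edges_eq[OF i] by auto
  have gg: "(%v. if v \<in> Y then g v else g' v) = g"
  proof
   fix v show "(if v \<in> Y then g v else g' v) = g v"
    using validD(1)[OF g, of v] validD(1)[OF g', of v] Y(1) by auto
  qed
  have YY: "Y Un Y' = Y" using Y(1) by blast
  show ?thesis unfolding gg YY semi(2)
  proof (rule validI[of _ _ _ "%v. if v \<in> Z then th v else th' v"])
   show "(if v \<in> Z then th v else th' v) = g v" if "v \<in> Y" for v using that th(1) Y(3) by auto
   fix a assume a: "a \<in> batoms i" "vars i a <= Z Un Z'"
   from F[OF a] show "sat i a (%v. if v \<in> Z then th v else th' v)"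
   proof
    assume s: "vars i a <= Z"
    hence "sat i a th" using th(2) a(1) by blast
    thus ?thesis by (rule sat_agree[OF _ i batoms_lt[OF a(1)]]) (use s in auto)
   next
    assume s: "vars i a <= Z'"
    hence "sat i a th'" using th'(2) a(1) by blast
    thus ?thesis
    proof (rule sat_agree[OF _ i batoms_lt[OF a(1)]])
     fix v assume "v \<in> vars i a"
     hence "v \<in> Z ==> v \<in> Y'" using s Y(2) by blast
     hence "v \<in> Z ==> th v = th' v" using Y(1) th(1) th'(1) eq by force
     thus "(if v \<in> Z then th v else th' v) = th' v" by simp
    qed
   qed
  qed (use validD[OF g] in auto)
 next
  case out
  have Y: "Y Int Z' <= Y'" "Y' <= Z'"
   and F: "!!a. a \<in> batoms i ==> vars i a <= Z' | vars i a Int Z' <= Y"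
   using out(1) unfolding join_ok_def is_label_def body_edges_eq[OF i] by auto
  let ?g = "%v. if v \<in> Y then g v else g' v" and ?th = "%v. if v \<in> Z' then th' v else th v"
  have thg: "?th v = ?g v" if "v \<in> Y Un Y'" for v
   using that Y th(1) th'(1) eq by auto
  have sat: "sat i a ?th" if a: "a \<in> batoms i" for a
   using F[OF a]
  proof
   assume s: "vars i a <= Z'"
   hence "sat i a th'" using th'(2) a by blast
   thus ?thesis by (rule sat_agree[OF _ i batoms_lt[OF a]]) (use s in auto)
  next
   assume s: "vars i a Int Z' <= Y"
   have "vars i a <= Z" using a unfolding out(2) body_vars_eq[OF i] by blast
   hence "sat i a th" using th(2) a by blast
   thus ?thesis
   proof (rule sat_agree[OF _ i batoms_lt[OF a]])
    fix v assume "v \<in> vars i a"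
    hence "v \<in> Z' ==> v \<in> Y & v \<in> Y'" using s Y(1) by blast
    hence "v \<in> Z' ==> th' v = th v" using th(1) th'(1) eq by force
    thus "?th v = th v" by simp
   qed
  qed
  show ?thesis
  proof (rule validI[of _ _ _ ?th])
   show "?g u = 0" if "u \<notin> Y Un Y'" for u using that validD(1)[OF g'] by auto
   fix a assume a: "a \<in> batoms i"
   show "EX t:Rel i a. ALL v:vars i a Int (Y Un Y'). t v = ?g v"
    by (rule bexI[OF _ sat_Rel[OF i batoms_lt[OF a] sat[OF a]]]) (use thg in auto)
  qed (use thg sat in auto)
 qed
qed

lemma join_typed_sym:
 assumes "i < length Rs" "join_cond (sh i) Y Z Y' Z' Z3 | join_cond (sh i) Y' Z' Y Z Z3"
 shows "typed i (Y Un Y') Z3"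
 using assms join_typed(1) by (metis Un_commute)

lemma valid_join_sym:
 assumes i: "i < length Rs" and j: "join_cond (sh i) Y Z Y' Z' Z3 | join_cond (sh i) Y' Z' Y Z Z3"
  and g: "g \<in> valid i Y Z" "g' \<in> valid i Y' Z'" and eq: "ALL v:Y Int Y'. g v = g' v"
 shows "(%v. if v \<in> Y then g v else g' v) \<in> valid i (Y Un Y') Z3"
 using j
proof
 assume j: "join_cond (sh i) Y' Z' Y Z Z3"
 have "(%v. if v \<in> Y then g v else g' v) = (%v. if v \<in> Y' then g' v else g v)"
  using eq validD(1)[OF g(1)] validD(1)[OF g(2)] by auto
 thus ?thesis using valid_join[OF i j g(2,1)] eq by (simp add: Un_commute)
qed (rule valid_join[OF i _ g eq])

lemma valid_weaken:
 assumes w: "weaken_ok V ok Y Z Y' Z'" and g: "g \<in> valid i Y Z"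
 shows "(cut Y' g) \<in> valid i Y' Z'"
proof -
 have Y: "Y' <= Y" "Z' <= Z" using w unfolding weaken_ok_def by auto
 obtain th where th: "ALL u:Y. th u = g u" "ALL a:batoms i. vars i a <= Z --> sat i a th" using validD(3)[OF g] by blast
 show ?thesis
 proof (rule validI[of _ _ _ th])
  fix a assume "a \<in> batoms i"
  then obtain t where "t \<in> Rel i a" "ALL v:vars i a Int Y. t v = g v" using validD(2)[OF g] by blast
  thus "EX t:Rel i a. ALL v:vars i a Int Y'. t v = (if v \<in> Y' then g v else 0)"
   using Y by (intro bexI[of _ t]) auto
 qed (use th Y in auto)
qed

lemma weaken_typed: "weaken_ok (bvars i) (bag_ok (tss i)) Y Z Y' Z' ==> typed i Y' Z'"
 unfolding weaken_ok_def typed_def is_label_def by blast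

lemma valid_out:
 assumes i: "i < length Rs" and g: "g \<in> valid i (vars i 0) (bvars i)"
 shows "ground_atom (g \<circ> fm i) (head (Rs ! i)) \<in> LF"
proof -
 obtain th where th: "ALL u:vars i 0. th u = g u" "ALL a:batoms i. vars i a <= bvars i --> sat i a th"
  using validD(3)[OF g] by blast
 have "ALL A:set (body (Rs ! i)). ground_atom (th \<circ> fm i) A \<in> LF"
 proof
  fix A assume "A \<in> set (body (Rs ! i))"
  then obtain a where a: "a \<in> batoms i" "A = atm i a" using batoms_body by blast
  have "vars i a <= bvars i" using a(1) body_vars_eq[OF i] by blast
  thus "ground_atom (th \<circ> fm i) A \<in> LF" using th(2) a unfolding sat_def by blast
 qed
 hence "ground_atom (th \<circ> fm i) (head (Rs ! i)) \<in> LF" using i by (intro least_fixpoint_rule) auto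
 moreover have "ground_atom (th \<circ> fm i) (head (Rs ! i)) = ground_atom (g \<circ> fm i) (head (Rs ! i))"
  by (rule ground_atom_cong) (use th(1) vars_eq[OF i rule_atoms_pos] in \<open>auto simp: rule_atoms_def\<close>)
 ultimately show ?thesis by simp
qed

lemma eval_out:
 assumes i: "i < length Rs" and g: "ALL k>=W. g k = 0"
 shows "ev (aux W i l g) y (result (out_op W d (tss i))) =
  orig W (fst (head (Rs ! i))) (snd (ground_atom (g \<circ> fm i) (head (Rs ! i))))"
proof -
 let ?h = "snd (head (Rs ! i))"
 have h: "atm i 0 = head (Rs ! i)" by (simp add: rule_atoms_def)
 have ts: "tss i ! 0 = map (ren_trm (fm i)) ?h" using tss_nth[OF i rule_atoms_pos] h by simp
 have "oeval st (aux W i l g) y (if k < length (tss i ! 0) then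
    (case tss i ! 0 ! k of Var v => XArg (3 + v) | Cst _ => Static False [XArg 1, Lit 0, Lit k, Lit 1])
    else Lit 0) = nth_or_0 (map (ground_trm (g \<circ> fm i)) ?h) k" for k
 proof (cases "k < length ?h")
  case True
  hence "nth_or_0 (map (ground_trm (g \<circ> fm i)) ?h) k = ground_trm (g \<circ> fm i) (?h ! k)" by (simp add: nth_or_0_def)
  thus ?thesis using st_name[OF i rule_atoms_pos, of k] ts h True
   by (cases "?h ! k") (simp_all add: nth_aux[OF g])
 next
  case False
  thus ?thesis using ts by (simp add: nth_or_0_def)
 qed
 thus ?thesis using st_pred[OF i rule_atoms_pos] h
  unfolding out_op_def orig_def ground_atom_def by simp
qed

lemma VallI:
 "(p, t) \<in> LF ==> length t <= W ==> orig W p t \<in> Vall"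
 "i < length Rs ==> a \<in> batoms i ==> rule_fact W i a \<in> Vall"
 "i < length Rs ==> seed W i \<in> Vall"
 "i < length Rs ==> a \<in> batoms i ==> a ~= ei i ==> g \<in> Rel i a ==> aux W i (2 * a) g \<in> Vall"
 "i < length Rs ==> typed i Y Z ==> g \<in> valid i Y Z ==> lab i Y Z g \<in> Vall"
 unfolding Vall_def Vorig_def Vrule_def Vseed_def Vatom_def Vlab_def by blast+

definition conv_val :: "nat => nat => nat list => nat => nat" where
 "conv_val i a t v = (if v \<in> vars i a then nth_or_0 t (first_pos (tss i ! a) v) else 0)"

text \<open>What a successful application amounts to, stated for an arbitrary label and arbitrary
  needs so that EDB and IDB atoms share it.\<close>

lemma conv_applies:
 assumes x: "x \<in> Vall" and y: "y \<in> Vall" and g: "eqs st x x (guard (conv_op W d tt a l cs))"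
  and key: "b \<in> set (addrs (conv_op W d tt a l cs))" "ev x x b \<in> set (kf y)"
  and t: "eqs st x y (tests (conv_op W d tt a l cs))" and tt: "tt = fst (hs ! d)"
 obtains i p t where "i < length Rs" "a \<in> batoms i" "sid i = d" "x = orig W p t" "y = rule_fact W i a" "(p, t) \<in> LF"
  "length t <= W" "p = fst (atm i a)" "conv_val i a t \<in> Rel i a"
  "ev x y (result (conv_op W d tt a l cs)) = aux W i l (conv_val i a t)"
proof -
 have x0: "nth_or_0 x 0 = 0" using g unfolding conv_op_def eqs_def by simp
 hence "x ! 0 = 0" using Vall_kind(4)[OF x] unfolding nth_or_0_def by simp
 then obtain p t where pt: "x = orig W p t" "(p, t) \<in> LF" "length t <= W" using Vall_kind(1)[OF x] unfolding Vorig_def by blast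
 have "ev x x b = [2, p]" using key(1) pt(1) unfolding conv_op_def by simp
 then obtain i a' where y': "i < length Rs" "a' \<in> batoms i" "y = rule_fact W i a'" "fst (atm i a') = p"
  using Vall_rule_key[OF y] key(2) by metis
 have tst: "a' = a" "st [7, i] = d" "eqs st x y (match_tests tt a)"
  using t y'(3) unfolding conv_op_def eqs_def by auto
 have d: "sid i = d" using sid[OF y'(1)] tst(2) by simp
 have tti: "tt = tss i" using tt d by simp
 have al: "a < natoms i" using batoms_lt[OF y'(2)] tst(1) by simp
 have LF: "(fst (atm i a), t) \<in> LF" using pt(2) y'(4) tst(1) by simp
 have "ground_atom ((%v. nth_or_0 t (first_pos (tss i ! a) v)) \<circ> fm i) (atm i a) = (fst (atm i a), t)"
  by (rule conv_sat[OF y'(1) al LF]) (use tst(1,3) pt(1) y'(3,4) tti in simp)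
 hence "sat i a (%v. nth_or_0 t (first_pos (tss i ! a) v))" unfolding sat_def using LF by simp
 from sat_Rel[OF y'(1) al this] have rel: "conv_val i a t \<in> Rel i a" unfolding conv_val_def .
 have "ev x y (result (conv_op W d tt a l cs)) = aux W i l (conv_val i a t)"
 proof -
  have "ev x y (aux_exps W (YArg 1) l (val_src (tt ! a))) = aux W (oeval st x y (YArg 1)) l (conv_val i a t)"
   by (rule eval_aux_exps) (simp add: pt(1) eval_val_src[OF pt(3)] conv_val_def tti avars_def)
  thus ?thesis unfolding conv_op_def using y'(3) by simp
 qed
 moreover have "a \<in> batoms i" "y = rule_fact W i a" "p = fst (atm i a)" using y' tst(1) by simp_all
 ultimately show thesis using that[OF y'(1) _ d pt(1) _ pt(2,3) _ rel] by blast
qed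

lemma label_src:
 assumes "ALL k>=W. g k = 0" shows "oeval st (aux W i l g) y (XArg (3 + k)) = g k" 
  "oeval st x (aux W i l g) (YArg (3 + k)) = g k"
 using nth_aux[OF assms] by simp_all

lemma label_addr:
 assumes "ALL k>=W. g k = 0"
 shows "ev (aux W i l g) y (addr_exps W (XArg 1) l' S (%k. XArg (3 + k))) = bucket_addr W i l' S g"
 using eval_addr_exps[of S W st "aux W i l g" y "%k. XArg (3 + k)" g "XArg 1" l'] label_src[OF assms] by simp

lemma ext_result:
 assumes "ALL k>=W. g k = 0" "ALL k>=W. g' k = 0"
 shows "ev (aux W i l g) (aux W i l' g') (result (ext_op W d h Y Z v)) =
  lab i (insert v Y) (insert v Z) (g(v := g' v))"
proof -
 let ?src = "%k. if k = v then YArg (3 + v) else XArg (3 + k)"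
 have "ev (aux W i l g) (aux W i l' g') (aux_exps W (XArg 1) (pair_label (insert v Y) (insert v Z)) ?src)
  = aux W (oeval st (aux W i l g) (aux W i l' g') (XArg 1)) (pair_label (insert v Y) (insert v Z)) (g(v := g' v))"
  by (rule eval_aux_exps) (auto simp: nth_aux assms)
 thus ?thesis unfolding ext_op_def Let_def by simp
qed

lemma join_result:
 assumes "ALL k>=W. g k = 0" "ALL k>=W. g' k = 0"
 shows "ev (aux W i l g) (aux W i l' g') (result (join_op W d Y Z Y' Z' Z3)) =
  lab i (Y Un Y') Z3 (%v. if v \<in> Y then g v else g' v)"
proof -
 have "ev (aux W i l g) (aux W i l' g') (aux_exps W (XArg 1) (pair_label (Y Un Y') Z3) (%k. if k \<in> Y then XArg (3 + k) else YArg (3 + k)))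
  = aux W (oeval st (aux W i l g) (aux W i l' g') (XArg 1)) (pair_label (Y Un Y') Z3) (%v. if v \<in> Y then g v else g' v)"
  by (rule eval_aux_exps) (auto simp: nth_aux assms)
 thus ?thesis unfolding join_op_def by simp
qed

lemma weaken_result:
 assumes "ALL k>=W. g k = 0"
 shows "ev (aux W i l g) y (result (weaken_op W d Y Z Y' Z')) =
   lab i Y' Z' (cut Y' g)"
proof -
 have "ev (aux W i l g) y (aux_exps W (XArg 1) (pair_label Y' Z') (%k. if k \<in> Y' then XArg (3 + k) else Lit 0))
  = aux W (oeval st (aux W i l g) y (XArg 1)) (pair_label Y' Z') (cut Y' g)"
  by (rule eval_aux_exps) (auto simp: nth_aux assms)
 thus ?thesis unfolding weaken_op_def by simp
qed

lemma seed_result: "ev (seed W i) y (result (seed_op W d h)) = lab i {} {} (%_. 0)"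
 unfolding seed_op_def using eval_aux_exps[of W st "seed W i" y "%_. Lit 0" "%_. 0" "XArg 1"] by simp

theorem sound_Vall: "sound_set st kf (all_ops W hs) Vall"
 unfolding sound_set_def
proof (intro ballI impI)
 fix p x y b
 assume "p \<in> set (all_ops W hs)" and x: "x \<in> Vall" and y: "y \<in> Vall" and b: "b \<in> set (addrs p)"
  and g: "eqs st x x (guard p)" and key: "ev x x b \<in> set (kf y)" and t: "eqs st x y (tests p)"
  and n: "ALL c:set (needs p). EX z:Vall. ev x y c \<in> set (kf z)"
 then obtain d where d: "d < length hs" "is_op W d (hs ! d) p" unfolding set_all_ops by blast
 let ?h = "hs ! d"
 from d(2) show "ev x y (result p) \<in> Vall"
 proof cases
  case (op_atom a)
  obtain i q s where *: "i < length Rs" "a \<in> batoms i" "sid i = d" "conv_val i a s \<in> Rel i a"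
   "ev x y (result p) = aux W i (2 * a) (conv_val i a s)"
   by (rule conv_applies[OF x y g[unfolded op_atom(1)] b[unfolded op_atom(1)] key t[unfolded op_atom(1)] refl])
    (simp add: op_atom(1))
  thus ?thesis using VallI(4)[of i a "conv_val i a s"] op_atom by simp
 next
  case op_root
  let ?B = "idb_vars ?h"
  obtain i q s where *: "i < length Rs" "snd ?h \<in> batoms i" "sid i = d" "x = orig W q s" "y = rule_fact W i (snd ?h)"
   "length s <= W" "conv_val i (snd ?h) s \<in> Rel i (snd ?h)"
   "ev x y (result p) = lab i ?B ?B (conv_val i (snd ?h) s)"
   by (rule conv_applies[OF x y g[unfolded op_root(1)] b[unfolded op_root(1)] key t[unfolded op_root(1)] refl])
    (simp add: op_root(1))
  have h: "?h = sh i" using *(3) by simp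
  have B: "?B = vars i (ei i)" using op_root(3) h unfolding idb_vars_def by simp
  have v: "conv_val i (ei i) s \<in> valid i ?B ?B" unfolding h
  proof (rule valid_root[OF *(1)])
   fix a assume a: "a \<in> batoms i" "a ~= ei i"
   show "EX t:Rel i a. ALL v:vars i a Int idb_vars (sh i). t v = conv_val i (ei i) s v"
   proof (rule needs_found[OF _ _ _ *(1) a])
    show "ALL c:set (need_list W (sh i) (idb_vars (sh i)) (YArg 1) (val_src (tss i ! ei i))).
      EX z:Vall. ev x y c \<in> set (kf z)"
     using n unfolding op_root(1) conv_op_def h by simp
    show "oeval st x y (YArg 1) = i" using *(5) by simp
    show "oeval st x y (val_src (tss i ! ei i) k) = conv_val i (ei i) s k" for k
     unfolding *(4) by (simp add: eval_val_src[OF *(6)] conv_val_def avars_def)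
   qed
  qed (use B h *(7) in \<open>auto simp: conv_val_def\<close>)
  have "typed i ?B ?B" using op_root(2) idb_vars_body[OF *(1)] h unfolding typed_def is_label_def by simp
  thus ?thesis using VallI(5)[OF *(1) _ v] *(8) h by simp
 next
  case op_seed
  have "nth_or_0 x 0 = 3" using g unfolding op_seed(1) seed_op_def eqs_def by simp
  hence "x ! 0 = 3" using Vall_kind(4)[OF x] unfolding nth_or_0_def by simp
  then obtain i where i: "x = seed W i" "i < length Rs" using Vall_kind(3)[OF x] unfolding Vseed_def by blast
  have "st [7, i] = d" using g i(1) unfolding op_seed(1) seed_op_def eqs_def by simp
  hence h: "?h = sh i" using sid[OF i(2)] by simp
  have e: "ei i = 0" using op_seed(3) h by simp
  hence B: "idb_vars (sh i) = {}" unfolding idb_vars_def by simp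
  have "(%_. 0) \<in> valid i (idb_vars (sh i)) (idb_vars (sh i))"
  proof (rule valid_root[OF i(2)])
   fix a assume a: "a \<in> batoms i" "a ~= ei i"
   show "EX t:Rel i a. ALL v:vars i a Int idb_vars (sh i). t v = 0"
    unfolding B
   proof (rule needs_found[OF _ _ _ i(2) a])
    show "ALL c:set (need_list W (sh i) {} (XArg 1) (%_. Lit 0)). EX z:Vall. ev x y c \<in> set (kf z)"
     using n unfolding op_seed(1) seed_op_def h by simp
   qed (use i in auto)
  qed (use e in auto)
  moreover have "typed i {} {}" using op_seed(2) B h unfolding typed_def is_label_def by simp
  ultimately show ?thesis using VallI(5)[OF i(2), of "{}" "{}" "%_. 0"] B unfolding op_seed(1) i(1) seed_result by simp
 next
  case (op_ext Y Z v)
  obtain i gx where X: "x = lab i Y Z gx" "i < length Rs" "sid i = d" "typed i Y Z" "gx \<in> valid i Y Z" "ALL k>=W. gx k = 0"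
   using g unfolding op_ext(1) ext_op_def Let_def by (auto elim: Vall_label_guard[OF x _ op_ext(2,3)])
  have h: "?h = sh i" using X(3) by simp
  obtain a where a: "a \<in> batoms i" "v \<in> vars i a" "b = addr_exps W (XArg 1) (2 * a) (vars i a Int Y) (%k. XArg (3 + k))"
   using b unfolding op_ext(1) ext_op_def Let_def h batoms_def by (auto simp: length_tss[OF X(2)])
  have "bucket_addr W i (2 * a) (vars i a Int Y) gx \<in> set (kf y)"
   using key unfolding a(3) X(1) label_addr[OF X(6)] .
  then obtain gy where Y: "y = aux W i (2 * a) gy" "gy \<in> Rel i a"
   using Vall_key_atom[OF y, of "vars i a Int Y" i a gx] op_ext(2) by blast
  have gy0: "ALL k>=W. gy k = 0" by (rule Rel_zero[OF X(2) batoms_lt[OF a(1)] Y(2)])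
  have ext: "ext_ok (body_edges (tss i)) (bvars i) (idb_vars (sh i)) (bag_ok (tss i)) Y Z v"
   using op_ext(5) h by simp
  have "gx(v := gy v) \<in> valid i (insert v Y) (insert v Z)"
  proof (rule valid_ext[OF X(2) ext X(5)])
   fix a' assume a': "a' \<in> batoms i" "a' ~= ei i"
   show "EX t:Rel i a'. ALL u:vars i a' Int insert v Y. t u = (gx(v := gy v)) u"
   proof (rule needs_found[OF _ _ _ X(2) a'])
    show "ALL c:set (need_list W (sh i) (insert v Y) (XArg 1) (%k. if k = v then YArg (3 + v) else XArg (3 + k))).
      EX z:Vall. ev x y c \<in> set (kf z)"
     using n unfolding op_ext(1) ext_op_def Let_def h by simp
   qed (use X Y gy0 in \<open>auto simp: nth_aux\<close>)
  qed
  moreover have "typed i (insert v Y) (insert v Z)"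
   using ext unfolding typed_def ext_ok_def is_label_def by auto
  ultimately show ?thesis unfolding op_ext(1) X(1) Y(1) ext_result[OF X(6) gy0] using VallI(5)[OF X(2)] by blast
 next
  case (op_join Y Z Y' Z' Z3)
  obtain i gx where X: "x = lab i Y Z gx" "i < length Rs" "sid i = d" "gx \<in> valid i Y Z" "ALL k>=W. gx k = 0"
   using g unfolding op_join(1) join_op_def by (auto elim: Vall_label_guard[OF x _ op_join(2,3)])
  have j: "join_cond (sh i) Y Z Y' Z' Z3 | join_cond (sh i) Y' Z' Y Z Z3" using op_join(7) X(3) by simp
  have "bucket_addr W i (pair_label Y' Z') (Y Int Y') gx \<in> set (kf y)"
   using key b unfolding op_join(1) join_op_def X(1) using label_addr[OF X(5)] by simp
  then obtain gy where Y: "typed i Y' Z'" "gy \<in> valid i Y' Z'" "y = lab i Y' Z' gy" "ALL v:Y Int Y'. gx v = gy v"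
   using Vall_key_label[OF y, of "Y Int Y'" i Y' Z' gx] op_join(2,4,5) by (metis inf.coboundedI1)
  show ?thesis unfolding op_join(1) X(1) Y(3) join_result[OF X(5) valid_zero[OF X(2) Y(1,2)]]
   using VallI(5)[OF X(2) join_typed_sym[OF X(2) j] valid_join_sym[OF X(2) j X(4) Y(2,4)]] .
 next
  case (op_weaken Y Z Y' Z')
  obtain i gx where X: "x = lab i Y Z gx" "i < length Rs" "sid i = d" "gx \<in> valid i Y Z" "ALL k>=W. gx k = 0"
   using g unfolding op_weaken(1) weaken_op_def by (auto elim: Vall_label_guard[OF x _ op_weaken(2,3)])
  have w: "weaken_ok (bvars i) (bag_ok (tss i)) Y Z Y' Z'" using op_weaken(6) X(3) by simp
  show ?thesis unfolding op_weaken(1) X(1) weaken_result[OF X(5)]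
   by (rule VallI(5)[OF X(2) weaken_typed[OF w] valid_weaken[OF w X(4)]])
 next
  case op_out
  \<comment> \<open>This operation is listed without bounds on its variable sets; they follow from
    the guard, which forces the shape to be that of an actual rule.\<close>
  have tt: "avars (fst ?h) 0 <= {..<W} & body_vars (fst ?h) <= {..<W}"
  proof -
   have "st [7, nth_or_0 x 1] = d" and x0: "nth_or_0 x 0 = 1" using g unfolding op_out out_op_def label_guard_def eqs_def by auto
   moreover have "x \<in> Vatom Un Vlab" using x0 Vall_kind(2,4)[OF x] unfolding nth_or_0_def by auto
   then obtain i l gx where "x = aux W i l gx" "i < length Rs" unfolding Vatom_def Vlab_def by blast
   ultimately have "?h = sh i & i < length Rs" using sid by simp
   thus ?thesis using vars_W[OF _ rule_atoms_pos] body_vars_W by simp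
  qed
  hence tt1: "avars (fst ?h) 0 <= {..<W}" and tt2: "body_vars (fst ?h) <= {..<W}" by auto
  obtain i gx where X: "x = lab i (avars (fst ?h) 0) (body_vars (fst ?h)) gx" "i < length Rs" "sid i = d"
    "gx \<in> valid i (avars (fst ?h) 0) (body_vars (fst ?h))" "ALL k>=W. gx k = 0"
   using g unfolding op_out out_op_def by (auto elim: Vall_label_guard[OF x _ tt1 tt2])
  have h: "?h = sh i" using X(3) by simp
  have LF: "ground_atom (gx \<circ> fm i) (head (Rs ! i)) \<in> LF" by (rule valid_out[OF X(2) X(4)[unfolded h]])
  have e: "ev x y (result p) = orig W (fst (head (Rs ! i))) (snd (ground_atom (gx \<circ> fm i) (head (Rs ! i))))"
   unfolding op_out X(1) h by (rule eval_out[OF X(2,5)])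
  have len: "length (snd (ground_atom (gx \<circ> fm i) (head (Rs ! i)))) <= W"
   using arity[OF X(2), of "head (Rs ! i)"] by (simp add: ground_atom_def rule_atoms_def)
  show ?thesis unfolding e by (rule VallI(1)[OF _ len]) (use LF in \<open>simp add: ground_atom_def\<close>)
 qed
qed

end


subsection \<open>Completeness of the rules\<close>

context evaluation
begin


lemma canonical_rule_eqs:
 assumes i: "i < length Rs"
 shows "rule_edges (canonical_rule (tss i)) = body_edges (tss i)"
  "rule_vertices (canonical_rule (tss i)) = bvars i"
  "rule_out (canonical_rule (tss i)) = vars i 0"
proof -
 let ?ts = "tss i"
 have "set (tl ?ts) = (%a. ?ts ! a) ` {1..<length ?ts}"
 proof (intro set_eqI iffI)
  fix u assume "u \<in> set (tl ?ts)"
  then obtain k where "k < length (tl ?ts)" "u = tl ?ts ! k" by (metis in_set_conv_nth)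
  thus "u \<in> (%a. ?ts ! a) ` {1..<length ?ts}" by (intro image_eqI[of _ _ "Suc k"]) (auto simp: nth_tl)
 next
  fix u assume "u \<in> (%a. ?ts ! a) ` {1..<length ?ts}"
  then obtain a where "1 <= a" "a < length ?ts" "u = ?ts ! a" by auto
  hence "u = tl ?ts ! (a - 1)" "a - 1 < length (tl ?ts)" by (auto simp: nth_tl)
  thus "u \<in> set (tl ?ts)" by simp
 qed
 thus e: "rule_edges (canonical_rule ?ts) = body_edges ?ts"
  unfolding rule_edges_def canonical_rule_def body_edges_def avars_def by (simp add: image_image)
 thus "rule_vertices (canonical_rule ?ts) = body_vars ?ts"
  unfolding rule_vertices_def body_edges_def body_vars_def by simp
 show "rule_out (canonical_rule ?ts) = vars i 0"
  unfolding rule_out_def canonical_rule_def avars_def by simp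
qed

lemma best_decomposition:
 assumes i: "i < length Rs"
 obtains V E ch La where "free_connex_decomposition (canonical_rule (tss i)) V E ch La"
  "!!p. p \<in> V ==> fractional_cover_number (\<Union>(La p)) (La p) id <= fcghw_rule (canonical_rule (tss i))"
  "bag_ok (tss i) = in_some_bag V ch"
proof -
 let ?P = "%(V, E, ch, La). free_connex_decomposition (canonical_rule (tss i)) V E ch La &
   (ALL p:V. fractional_cover_number (\<Union>(La p)) (La p) id <= fcghw_rule (canonical_rule (tss i)))"
 obtain V E ch La where "?P (V, E, ch, La)"
  using optimal_decomposition[of "canonical_rule (tss i)"] out_vars[OF i] canonical_rule_eqs[OF i] by auto
 hence "?P (best_decomposition (tss i))" unfolding best_decomposition_def by (rule someI)
 thus thesis
  by (cases "best_decomposition (tss i)") (auto intro: that simp: bag_ok_def)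
qed

lemma reach_plan:
 assumes i: "i < length Rs"
 shows "reach (body_edges (tss i)) (bvars i) (idb_vars (sh i)) (vars i 0) (bag_ok (tss i)) (vars i 0) (bvars i)"
  "bag_ok (tss i) (idb_vars (sh i))"
proof -
 obtain V E ch La where d: "free_connex_decomposition (canonical_rule (tss i)) V E ch La" "bag_ok (tss i) = in_some_bag V ch"
  using best_decomposition[OF i] by metis
 have B: "idb_vars (sh i) = {} | idb_vars (sh i) \<in> rule_edges (canonical_rule (tss i))"
  using idb_vars_cases[OF i] unfolding canonical_rule_eqs[OF i] body_edges_eq[OF i] by auto
 show "reach (body_edges (tss i)) (bvars i) (idb_vars (sh i)) (vars i 0) (bag_ok (tss i)) (vars i 0) (bvars i)"
  using decomposition_reach[OF d(1) B] unfolding canonical_rule_eqs[OF i] d(2) .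
 have "V ~= {}" using free_connex_decompositionD(1)[OF d(1)] unfolding is_tree_def by (elim conjE)
 thus "bag_ok (tss i) (idb_vars (sh i))"
  using B free_connex_decompositionD(4)[OF d(1), of "idb_vars (sh i)"] unfolding d(2) in_some_bag_def by auto
qed

text \<open>The engine has exhausted one bucket without telling which, so a suitable partner must be
  found under every address.\<close>

lemma closed_fire:
 assumes C: "closed_upto st kf (all_ops W hs) Q (length Q)" and k: "k < length Q" and p: "p \<in> set (all_ops W hs)"
  and g: "eqs st (Q ! k) (Q ! k) (guard p)"
  and f: "!!b. b \<in> set (addrs p) ==> EX j<=k. ev (Q ! k) (Q ! k) b \<in> set (kf (Q ! j)) &
   eqs st (Q ! k) (Q ! j) (tests p) &
   (ALL c:set (needs p). EX j'<=k. ev (Q ! k) (Q ! j) c \<in> set (kf (Q ! j'))) &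
   ev (Q ! k) (Q ! j) (result p) = z"
 shows "z \<in> set Q"
proof -
 obtain b where b: "b \<in> set (addrs p)" "ALL j:set (bucket kf Q (Suc k) (ev (Q ! k) (Q ! k) b)).
    fires st (bucket kf Q (Suc k)) (Q ! k) (Q ! j) p --> ev (Q ! k) (Q ! j) (result p) \<in> set Q"
  using C k p g unfolding closed_upto_def by blast
 obtain j where j: "j <= k" "ev (Q ! k) (Q ! k) b \<in> set (kf (Q ! j))" "eqs st (Q ! k) (Q ! j) (tests p)"
   "ALL c:set (needs p). EX j'<=k. ev (Q ! k) (Q ! j) c \<in> set (kf (Q ! j'))"
   "ev (Q ! k) (Q ! j) (result p) = z"
  using f[OF b(1)] by blast
 have "bucket kf Q (Suc k) (ev (Q ! k) (Q ! j) c) ~= []" if c: "c \<in> set (needs p)" for c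
 proof -
  obtain j' where "j' <= k" "ev (Q ! k) (Q ! j) c \<in> set (kf (Q ! j'))" using j(4) c by blast
  hence "j' \<in> set (bucket kf Q (Suc k) (ev (Q ! k) (Q ! j) c))" by (simp add: set_bucket)
  thus ?thesis by auto
 qed
 hence "fires st (bucket kf Q (Suc k)) (Q ! k) (Q ! j) p" using j(3) unfolding fires_def by blast
 moreover have "j \<in> set (bucket kf Q (Suc k) (ev (Q ! k) (Q ! k) b))" using j(1,2) by (simp add: set_bucket)
 ultimately show ?thesis using b(2) j(5) by blast
qed

lemma closed_fire1:
 assumes "closed_upto st kf (all_ops W hs) Q (length Q)" "k < length Q" "p \<in> set (all_ops W hs)" "eqs st (Q ! k) (Q ! k) (guard p)"
  and "addrs p = [b]" "j <= k" "ev (Q ! k) (Q ! k) b \<in> set (kf (Q ! j))" "eqs st (Q ! k) (Q ! j) (tests p)"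
  and "!!c. c \<in> set (needs p) ==> EX j'<=k. ev (Q ! k) (Q ! j) c \<in> set (kf (Q ! j'))"
  and "ev (Q ! k) (Q ! j) (result p) = z"
 shows "z \<in> set Q"
 by (rule closed_fire[OF assms(1-4)]) (use assms(5-) in auto)

lemma op_in: "i < length Rs ==> is_op W (sid i) (sh i) p ==> p \<in> set (all_ops W hs)"
 unfolding set_all_ops using sid by blast

lemma label_guard_holds: "i < length Rs ==> eqs st (aux W i l g) (aux W i l g) (label_guard (sid i) l)"
 using sid[of i] by (simp add: eqs_def label_guard_def)

lemma key_holds:
 assumes "ALL k>=W. g' k = 0" "S <= {..<W}" "ALL v:S. g v = g' v"
 shows "bucket_addr W i l S g \<in> set (kf (aux W i l g'))"
 unfolding keys_aux[OF assms(1)] using assms subset_list(1) bucket_addr_eq[OF assms(2,2)] by (auto intro!: image_eqI[of _ _ S])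

lemma conv_fires:
 assumes C: "closed_upto st kf (all_ops W hs) Q (length Q)" and i: "i < length Rs" "a \<in> batoms i"
  and p: "conv_op W (sid i) (tss i) a l cs \<in> set (all_ops W hs)"
  and t: "ground_atom (th \<circ> fm i) (atm i a) = (fst (atm i a), t)" and len: "length t <= W"
  and k: "k < length Q" "Q ! k = orig W (fst (atm i a)) t" and j: "j <= k" "Q ! j = rule_fact W i a"
  and n: "ALL c:set cs. EX j'<=k. ev (Q ! k) (Q ! j) c \<in> set (kf (Q ! j'))"
 shows "aux W i l (%v. if v \<in> vars i a then th v else 0) \<in> set Q"
proof (rule closed_fire1[OF C k(1) p _ _ j(1)])
 note sm = sat_match[OF i(1) batoms_lt[OF i(2)] t len]
 have "ev (Q ! k) (Q ! j) (aux_exps W (YArg 1) l (val_src (tss i ! a))) =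
   aux W (oeval st (Q ! k) (Q ! j) (YArg 1)) l (%v. if v \<in> vars i a then th v else 0)"
  unfolding k(2) by (rule eval_aux_exps) (use sm(1) in \<open>simp add: eval_val_src[OF len] avars_def\<close>)
 thus "ev (Q ! k) (Q ! j) (result (conv_op W (sid i) (tss i) a l cs)) =
   aux W i l (%v. if v \<in> vars i a then th v else 0)" unfolding conv_op_def j(2) by simp
 show "eqs st (Q ! k) (Q ! j) (tests (conv_op W (sid i) (tss i) a l cs))"
  using sm(2)[of "fst (atm i a)"] sid[OF i(1)] unfolding conv_op_def k(2) j(2) eqs_def by auto
 show "ev (Q ! k) (Q ! k) [Lit 2, XArg 1] \<in> set (kf (Q ! j))"
  unfolding j(2) k(2) keys_rule_fact using st_pred[OF i(1) batoms_lt[OF i(2)]] by simp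
qed (use n k(2) in \<open>auto simp: conv_op_def eqs_def\<close>)

text \<open>The facts that can exist before the seeds are pushed. Facts with a pair label are
  absent, since the first of them for a rule arises from a seed or from an IDB tuple.\<close>

definition stage1 :: "nat list set" where
 "stage1 = {orig W p t | p t. p \<notin> idb (set Rs)} Un Vrule Un Vatom"

definition body_preds :: "nat set" where
 "body_preds = {fst A | R A. R \<in> set Rs & A \<in> set (body R)}"

lemma restrict_zero: "Y <= {..<W} ==> ALL k>=W. (cut Y th) k = (0::nat)"
 by auto

lemma stage1_head:
 assumes "x \<in> stage1"
 shows "x ! 0 = 0 & x ! 1 \<notin> idb (set Rs) | x ! 0 = 2 | x ! 0 = 1 & (EX a. x ! 2 = 2 * a)"
 using assms unfolding stage1_def Vrule_def Vatom_def by auto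

lemma stage1_cases:
 "lab i Y Z g \<notin> stage1"
 "seed W i \<notin> stage1" "p \<in> idb (set Rs) ==> orig W p t \<notin> stage1"
 using stage1_head[of "lab i Y Z g"] stage1_head[of "seed W i"] stage1_head[of "orig W p t"]
 by (auto simp: pair_label_odd)

lemma edb_fact:
 assumes "(p, t) \<in> LF" "p \<notin> idb (set Rs)"
 shows "(p, t) \<in> D | (EX R:set Rs. body R = [] & (p, t) = ground_atom (%_. 0) (head R))"
proof -
 have "(p, t) \<in> immediate_consequence (set Rs) D LF" using assms(1) by (simp flip: least_fixpoint_unfold)
 then consider "(p, t) \<in> D" | R th where "R \<in> set Rs" "(p, t) = ground_atom th (head R)"
  unfolding immediate_consequence_def by blast
 thus ?thesis
 proof cases
  case (2 R th)
  hence b: "body R = []" using assms(2) unfolding idb_body ground_atom_def by auto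
  hence "vars_list (snd (head R)) = {}" using vars_head_body[OF dp 2(1)] by fastforce
  hence "ground_atom th (head R) = ground_atom (%_. 0) (head R)" by (intro ground_atom_cong) simp
  thus ?thesis using 2 b by auto
 qed simp
qed

end

text \<open>\<open>Q1\<close> is the queue after the first run and \<open>Q\<close> the queue after
  the second; the first \<open>n0\<close> entries of \<open>Q1\<close> are the rule facts.\<close>

locale evaluation_run = evaluation +
 fixes Q1 Q :: "nat list list" and n0 :: nat
 assumes C1: "closed_upto st kf (all_ops W hs) Q1 (length Q1)" and C: "closed_upto st kf (all_ops W hs) Q (length Q)"
  and Q: "EX zs. Q = Q1 @ zs" and Q1: "set Q1 <= stage1" and QV: "set Q <= Vall"
  and rules_first: "n0 <= length Q1" "!!j. j < n0 ==> Q1 ! j \<in> Vrule"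
   "!!i a. i < length Rs ==> a \<in> batoms i ==> EX j<n0. Q1 ! j = rule_fact W i a"
  and edb_facts: "!!p t. (p, t) \<in> D ==> p \<in> body_preds ==> orig W p t \<in> set Q1"
   "!!R. R \<in> set Rs ==> body R = [] ==> fst (head R) \<notin> idb (set Rs) ==>
    orig W (fst (head R)) (snd (ground_atom (%_. 0) (head R))) \<in> set Q1"
  and seeds: "!!i. i < length Rs ==> seed W i \<in> set Q"
begin

lemma Q_nth: "j < length Q1 ==> Q ! j = Q1 ! j" "length Q1 <= length Q"
 using Q by (auto simp: nth_append)

text \<open>Facts outside \<open>stage1\<close> are popped after the first run, when all EDB atoms
  have been evaluated and filed.\<close>

lemma late:
 assumes "x \<in> set Q" "x \<notin> stage1"
 obtains k where "k < length Q" "length Q1 <= k" "Q ! k = x"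
proof -
 obtain k where k: "k < length Q" "Q ! k = x" using assms(1) by (metis in_set_conv_nth)
 have "~ k < length Q1" using k Q1 assms(2) Q_nth(1) nth_mem by fastforce
 thus thesis using that k by simp
qed

lemma edb_orig:
 assumes "(p, t) \<in> LF" "p \<notin> idb (set Rs)" "p \<in> body_preds"
 shows "orig W p t \<in> set Q1"
 using edb_fact[OF assms(1,2)]
proof
 assume "(p, t) \<in> D"
 thus ?thesis using edb_facts(1) assms(3) by blast
next
 assume "EX R:set Rs. body R = [] & (p, t) = ground_atom (%_. 0) (head R)"
 then obtain R where R: "R \<in> set Rs" "body R = []" "(p, t) = ground_atom (%_. 0) (head R)" by blast
 hence "p = fst (head R)" "t = snd (ground_atom (%_. 0) (head R))" by (auto simp: ground_atom_def)
 thus ?thesis using edb_facts(2)[OF R(1,2)] assms(2) by simp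
qed

text \<open>Rule facts precede all tuples, so every occurrence of a predicate is on file whenever
  one of its tuples is popped.\<close>

lemma rule_fact_early:
 assumes "i < length Rs" "a \<in> batoms i" "k < length Q1" "Q1 ! k = orig W p t"
 obtains j where "j <= k" "Q1 ! j = rule_fact W i a"
proof -
 obtain j where j: "j < n0" "Q1 ! j = rule_fact W i a" using rules_first(3)[OF assms(1,2)] by blast
 have "orig W p t \<notin> Vrule"
 proof
  assume "orig W p t \<in> Vrule"
  then obtain i a where "orig W p t = rule_fact W i a" unfolding Vrule_def by blast
  hence "orig W p t ! 0 = rule_fact W i a ! 0" by simp
  thus False by simp
 qed
 hence "~ k < n0" using rules_first(2) assms(4) by metis
 thus thesis using that[of j] j by simp
qed

lemma atoms_complete:
 assumes i: "i < length Rs" and a: "a \<in> batoms i" "a ~= ei i" and s: "sat i a th"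
 shows "EX j<length Q1. Q ! j = aux W i (2 * a) (%v. if v \<in> vars i a then th v else 0)"
proof -
 define t where "t = snd (ground_atom (th \<circ> fm i) (atm i a))"
 have t: "ground_atom (th \<circ> fm i) (atm i a) = (fst (atm i a), t)" by (simp add: t_def ground_atom_def)
 have LF: "(fst (atm i a), t) \<in> LF" using s t unfolding sat_def by simp
 have "a \<in> {1..<natoms i}" using a(1) unfolding batoms_def .
 hence p: "fst (atm i a) \<notin> idb (set Rs)" using idb_index[OF i] a(2) by blast
 have "atm i a \<in> set (body (Rs ! i))" using a(1) batoms_body by blast
 hence "fst (atm i a) \<in> body_preds" unfolding body_preds_def using nth_mem[OF i] by blast
 from edb_orig[OF LF p this] obtain k where k: "k < length Q1" "Q1 ! k = orig W (fst (atm i a)) t" by (metis in_set_conv_nth)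
 obtain j where j: "j <= k" "Q1 ! j = rule_fact W i a" using rule_fact_early[OF i a(1) k] by blast
 have al: "1 <= a" "a < length (tss i)" using a(1) length_tss[OF i] unfolding batoms_def by auto
 have len: "length t <= W" using LF_length[OF LF i batoms_lt[OF a(1)]] by blast
 have "aux W i (2 * a) (%v. if v \<in> vars i a then th v else 0) \<in> set Q1"
  by (rule conv_fires[OF C1 i a(1) op_in[OF i op_atom[OF al a(2)]] t len k j]) simp
 then obtain j where "j < length Q1" "Q1 ! j = aux W i (2 * a) (%v. if v \<in> vars i a then th v else 0)"
  unfolding in_set_conv_nth by blast
 thus ?thesis using Q_nth(1)[of j] by auto
qed

text \<open>The required EDB assignments lie in the prefix \<open>Q1\<close> and are thus filed
  before position \<open>k\<close>.\<close>

lemma needs_complete: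
 assumes i: "i < length Rs" and s: "!!a. a \<in> batoms i ==> sat i a th" and k: "length Q1 <= k"
  and ie: "oeval st x y ie = i" and src: "!!u. u \<in> Y ==> u < W ==> oeval st x y (src u) = th u"
  and c: "c \<in> set (need_list W (sh i) Y ie src)"
 shows "EX j'<=k. ev x y c \<in> set (kf (Q ! j'))"
proof -
 obtain a where a: "a \<in> batoms i" "a ~= ei i" "c = addr_exps W ie (2 * a) (vars i a Int Y) src"
  using c unfolding need_list_def batoms_def by (auto simp: length_tss[OF i])
 let ?g = "%v. if v \<in> vars i a then th v else 0"
 obtain j where j: "j < length Q1" "Q ! j = aux W i (2 * a) ?g" using atoms_complete[OF i a(1,2) s[OF a(1)]] by blast
 have vW: "vars i a <= {..<W}" by (rule vars_W[OF i batoms_lt[OF a(1)]])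
 have "ev x y c = bucket_addr W (oeval st x y ie) (2 * a) (vars i a Int Y) th"
  unfolding a(3) by (rule eval_addr_exps) (use src in auto)
 moreover have "bucket_addr W i (2 * a) (vars i a Int Y) th \<in> set (kf (Q ! j))"
  unfolding j(2) by (rule key_holds[OF restrict_zero[OF vW]]) (use vW in auto)
 ultimately show ?thesis using j(1) k ie by (intro exI[of _ j]) auto
qed

lemma labels_join:
 assumes i: "i < length Rs" and k: "k < length Q" "Q ! k = lab i Y Z (cut Y th)"
  and k': "k' <= k" "Q ! k' = lab i Y' Z' (cut Y' th)"
  and j: "join_cond (sh i) Y Z Y' Z' Z3 | join_cond (sh i) Y' Z' Y Z Z3"
 shows "lab i (Y Un Y') Z3 (%v. if v \<in> Y Un Y' then th v else 0) \<in> set Q"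
proof -
 have "is_label (bvars i) Y Z & is_label (bvars i) Y' Z'"
  using j join_typed(2,3)[OF i] by blast
 hence YW: "Y <= {..<W}" "Z <= {..<W}" "Y' <= {..<W}" "Z' <= {..<W}" "Z3 <= {..<W}"
  using typed_W[OF i join_typed_sym[OF i j]] body_vars_W[OF i] unfolding is_label_def by auto
 note g0 = restrict_zero[OF YW(1), of th] restrict_zero[OF YW(3), of th]
 let ?p = "join_op W (sid i) Y Z Y' Z' Z3" and ?g = "%v. if v \<in> Y then th v else 0"
 show ?thesis
 proof (rule closed_fire1[OF C k(1) op_in[OF i op_join[OF YW j]] _ _ k'(1)])
  show "ev (Q ! k) (Q ! k) (addr_exps W (XArg 1) (pair_label Y' Z') (Y Int Y') (%k. XArg (3 + k))) \<in> set (kf (Q ! k'))"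
   unfolding k(2) k'(2) label_addr[OF g0(1)] by (rule key_holds[OF g0(2)]) (use YW in auto)
  have "(%v. if v \<in> Y then ?g v else if v \<in> Y' then th v else 0) = (%v. if v \<in> Y Un Y' then th v else 0)" by auto
  thus "ev (Q ! k) (Q ! k') (result ?p) = lab i (Y Un Y') Z3 (%v. if v \<in> Y Un Y' then th v else 0)"
   unfolding k(2) k'(2) join_result[OF g0] by simp
 qed (use label_guard_holds[OF i] k(2) in \<open>auto simp: join_op_def eqs_def\<close>)
qed

text \<open>Whichever of the two facts is popped later finds the other one filed.\<close>

lemma labels_join':
 assumes i: "i < length Rs" and x: "lab i Y Z (cut Y th) \<in> set Q"
  and y: "lab i Y' Z' (cut Y' th) \<in> set Q"
  and j: "join_cond (sh i) Y Z Y' Z' Z3"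
 shows "lab i (Y Un Y') Z3 (%v. if v \<in> Y Un Y' then th v else 0) \<in> set Q"
proof -
 obtain k k' where k: "k < length Q" "Q ! k = lab i Y Z (cut Y th)"
  "k' < length Q" "Q ! k' = lab i Y' Z' (cut Y' th)"
  using x y unfolding in_set_conv_nth by blast
 show ?thesis
 proof (cases "k' <= k")
  case False
  thus ?thesis using labels_join[OF i k(3,4) _ k(2), of Z3] j unfolding Un_commute[of Y' Y] by simp
 qed (use labels_join[OF i k(1,2) _ k(4)] j in blast)
qed

text \<open>For a fixed valuation \<open>th\<close> satisfying the whole body, the restrictions of
  \<open>th\<close> follow the plan: each step of \<open>reach\<close> is matched by an engine rule
  applied to facts that are themselves restrictions of \<open>th\<close>.\<close>

lemma labels_complete:
 assumes i: "i < length Rs" and s: "!!a. a \<in> batoms i ==> sat i a th"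
  and e: "ei i ~= 0 ==> orig W (fst (atm i (ei i))) (snd (ground_atom (th \<circ> fm i) (atm i (ei i)))) \<in> set Q"
  and r: "reach (body_edges (tss i)) (bvars i) (idb_vars (sh i)) (vars i 0) (bag_ok (tss i)) Y Z"
 shows "lab i Y Z (cut Y th) \<in> set Q"
 using r
proof (induction rule: reach.induct)
 case reach_root
 let ?B = "idb_vars (sh i)"
 from idb_vars_cases[OF i] show ?case
 proof
  assume 0: "ei i = 0 & ?B = {}"
  obtain k where k: "k < length Q" "length Q1 <= k" "Q ! k = seed W i" by (rule late[OF seeds[OF i] stage1_cases(2)])
  have p: "seed_op W (sid i) (sh i) \<in> set (all_ops W hs)"
   by (rule op_in[OF i]) (rule op_seed, use reach_plan(2)[OF i] 0 in auto)
  have "lab i {} {} (%_. 0) \<in> set Q"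
  proof (rule closed_fire1[OF C k(1) p _ _ order_refl])
   fix c assume "c \<in> set (needs (seed_op W (sid i) (sh i)))"
   thus "EX j'<=k. ev (Q ! k) (Q ! k) c \<in> set (kf (Q ! j'))"
    by (intro needs_complete[OF i s k(2), where ie = "XArg 1" and Y = "{}" and src = "%_. Lit 0"])
     (use k(3) in \<open>auto simp: seed_op_def\<close>)
  next
   show "ev (Q ! k) (Q ! k) (result (seed_op W (sid i) (sh i))) = lab i {} {} (%_. 0)"
    unfolding k(3) by (rule seed_result)
  qed (use sid[OF i] k(3) in \<open>auto simp: seed_op_def eqs_def keys_seed\<close>)
  thus ?thesis using 0 by simp
 next
  assume B: "ei i \<in> batoms i & ?B = vars i (ei i)"
  let ?a = "ei i"
  have e0: "?a ~= 0" and a: "?a \<in> batoms i" using B unfolding batoms_def by auto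
  define t where "t = snd (ground_atom (th \<circ> fm i) (atm i ?a))"
  have t: "ground_atom (th \<circ> fm i) (atm i ?a) = (fst (atm i ?a), t)" by (simp add: t_def ground_atom_def)
  have LF: "(fst (atm i ?a), t) \<in> LF" using s[OF a] t unfolding sat_def by simp
  have "?a \<in> {1..<natoms i}" using a unfolding batoms_def .
  hence idb: "fst (atm i ?a) \<in> idb (set Rs)" using idb_index[OF i] by blast
  have len: "length t <= W" using LF_length[OF LF i batoms_lt[OF a]] by blast
  obtain k where k: "k < length Q" "length Q1 <= k" "Q ! k = orig W (fst (atm i ?a)) t"
   using late[OF e[OF e0] stage1_cases(3)[OF idb]] unfolding t_def by blast
  obtain j where j: "j < n0" "Q1 ! j = rule_fact W i ?a" using rules_first(3)[OF i a] by blast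
  have j': "j <= k" "Q ! j = rule_fact W i ?a" using j rules_first(1) k(2) Q_nth(1)[of j] by auto
  have p: "conv_op W (sid i) (tss i) ?a (pair_label ?B ?B) (need_list W (sh i) ?B (YArg 1) (val_src (tss i ! ?a))) \<in> set (all_ops W hs)"
   by (rule op_in[OF i]) (rule op_root[OF reach_plan(2)[OF i] e0])
  have "lab i ?B ?B (%v. if v \<in> vars i ?a then th v else 0) \<in> set Q"
  proof (rule conv_fires[OF C i a p t len k(1,3) j'], rule ballI)
   fix c assume c: "c \<in> set (need_list W (sh i) ?B (YArg 1) (val_src (tss i ! ?a)))"
   show "EX j'<=k. ev (Q ! k) (Q ! j) c \<in> set (kf (Q ! j'))"
   proof (rule needs_complete[OF i s k(2) _ _ c])
    show "oeval st (Q ! k) (Q ! j) (YArg 1) = i" unfolding j'(2) by simp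
    fix u assume u: "u \<in> ?B"
    thus "oeval st (Q ! k) (Q ! j) (val_src (tss i ! ?a) u) = th u"
     unfolding k(3) eval_val_src[OF len] using sat_match(1)[OF i batoms_lt[OF a] t len, of u] B by (auto simp: avars_def)
   qed
  qed
  thus ?thesis using B by simp
 qed
next
 case (reach_ext Y Z v)
 let ?g = "%v. if v \<in> Y then th v else 0"
 let ?p = "ext_op W (sid i) (sh i) Y Z v"
 note ext = \<open>ext_ok _ _ _ _ Y Z v\<close>
 have lab: "is_label (bvars i) Y Z" "v < W" "v \<notin> Y"
  using ext body_vars_W[OF i] unfolding ext_ok_def is_label_def by auto
 have YW: "Y <= {..<W}" "Z <= {..<W}" using lab(1) body_vars_W[OF i] unfolding is_label_def by auto
 obtain k where k: "k < length Q" "length Q1 <= k" "Q ! k = lab i Y Z ?g" by (rule late[OF reach_ext.IH stage1_cases(1)])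
 have p: "?p \<in> set (all_ops W hs)" by (rule op_in[OF i]) (rule op_ext[OF YW lab(2) ext])
 note g0 = restrict_zero[OF YW(1), of th]
 have new: "?g(v := th v) = (%u. if u \<in> insert v Y then th u else 0)" by auto
 show ?case
 proof (rule closed_fire[OF C k(1) p])
  show "eqs st (Q ! k) (Q ! k) (guard ?p)"
   unfolding k(3) ext_op_def Let_def using label_guard_holds[OF i] by simp
  \<comment> \<open>Whichever atom containing \<open>v\<close> provides the scanned bucket, the
    restriction of \<open>th\<close> to that atom is in it and leads to the same result.\<close>
  fix b assume "b \<in> set (addrs ?p)"
  then obtain a where a: "a \<in> batoms i" "v \<in> vars i a" "b = addr_exps W (XArg 1) (2 * a) (vars i a Int Y) (%k. XArg (3 + k))"
   unfolding ext_op_def Let_def batoms_def by (auto simp: length_tss[OF i])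
  have "v \<notin> idb_vars (sh i)" using ext unfolding ext_ok_def by blast
  hence ae: "a ~= ei i" using a(1,2) idb_vars_cases[OF i] unfolding batoms_def by auto
  let ?t = "%u. if u \<in> vars i a then th u else 0"
  obtain j where j: "j < length Q1" "Q ! j = aux W i (2 * a) ?t" using atoms_complete[OF i a(1) ae s[OF a(1)]] by blast
  have aW: "vars i a <= {..<W}" by (rule vars_W[OF i batoms_lt[OF a(1)]])
  have "ev (Q ! k) (Q ! k) b = bucket_addr W i (2 * a) (vars i a Int Y) ?g"
   unfolding a(3) k(3) by (rule label_addr[OF g0])
  hence "ev (Q ! k) (Q ! k) b \<in> set (kf (Q ! j))"
   unfolding j(2) using key_holds[OF restrict_zero[OF aW], of "vars i a Int Y" ?g] aW by auto
  moreover have "eqs st (Q ! k) (Q ! j) (tests ?p)" by (simp add: ext_op_def Let_def eqs_def)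
  moreover have "EX j'<=k. ev (Q ! k) (Q ! j) c \<in> set (kf (Q ! j'))" if "c \<in> set (needs ?p)" for c
  proof (rule needs_complete[OF i s k(2), where ie = "XArg 1" and Y = "insert v Y" and
     src = "%k. if k = v then YArg (3 + v) else XArg (3 + k)"])
   show "c \<in> set (need_list W (sh i) (insert v Y) (XArg 1) (%k. if k = v then YArg (3 + v) else XArg (3 + k)))"
    using that by (simp add: ext_op_def Let_def)
   fix u assume "u \<in> insert v Y"
   thus "oeval st (Q ! k) (Q ! j) (if u = v then YArg (3 + v) else XArg (3 + u)) = th u"
    unfolding k(3) j(2) using a(2) by (auto simp: nth_aux[OF g0] nth_aux[OF restrict_zero[OF aW]])
  next
   show "oeval st (Q ! k) (Q ! j) (XArg 1) = i" unfolding k(3) by simp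
  qed
  moreover have "ev (Q ! k) (Q ! j) (result ?p) =
    lab i (insert v Y) (insert v Z) (%u. if u \<in> insert v Y then th u else 0)"
   unfolding k(3) j(2) ext_result[OF g0 restrict_zero[OF aW]] using a(2) new by simp
  ultimately show "EX j<=k. ev (Q ! k) (Q ! k) b \<in> set (kf (Q ! j)) & eqs st (Q ! k) (Q ! j) (tests ?p) &
    (ALL c:set (needs ?p). EX j'<=k. ev (Q ! k) (Q ! j) c \<in> set (kf (Q ! j'))) &
    ev (Q ! k) (Q ! j) (result ?p) =
    lab i (insert v Y) (insert v Z) (%u. if u \<in> insert v Y then th u else 0)"
   using j(1) k(2) by (intro exI[of _ j]) simp
 qed
next
 case (reach_weaken Y Z Y' Z')
 let ?g = "%v. if v \<in> Y then th v else 0"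
 let ?p = "weaken_op W (sid i) Y Z Y' Z'"
 note w = \<open>weaken_ok _ _ Y Z Y' Z'\<close>
 have YW: "Y <= {..<W}" "Z <= {..<W}" "Y' <= {..<W}" "Z' <= {..<W}" and sub: "Y' <= Y"
  using w body_vars_W[OF i] unfolding weaken_ok_def is_label_def by auto
 obtain k where k: "k < length Q" "Q ! k = lab i Y Z ?g" using reach_weaken.IH by (metis in_set_conv_nth)
 have p: "?p \<in> set (all_ops W hs)" by (rule op_in[OF i]) (rule op_weaken[OF YW w])
 note g0 = restrict_zero[OF YW(1), of th]
 show ?case
 proof (rule closed_fire1[OF C k(1) p _ _ order_refl])
  show "ev (Q ! k) (Q ! k) (self_addr W Y Z) \<in> set (kf (Q ! k))"
   unfolding k(2) self_addr_def label_addr[OF g0] by (rule key_holds[OF g0 YW(1)]) simp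
  show "ev (Q ! k) (Q ! k) (result ?p) = lab i Y' Z' (cut Y' th)"
   unfolding k(2) weaken_result[OF g0] using sub by (intro arg_cong[of _ _ "aux W i (pair_label Y' Z')"] ext) auto
 qed (use label_guard_holds[OF i] k(2) in \<open>auto simp: weaken_op_def eqs_def\<close>)
next
 case (reach_semijoin Y Z Y' Z')
 have "join_cond (sh i) Y Z Y' Z' (Z Un Z')" using reach_semijoin(3) unfolding join_cond_def by blast
 moreover have "Y Un Y' = Y" using reach_semijoin(3) unfolding semijoin_ok_def by blast
 ultimately show ?case using labels_join'[OF i reach_semijoin.IH] by simp
next
 case (reach_join Y Y' Z')
 have "join_cond (sh i) Y (bvars i) Y' Z' (bvars i)" using reach_join(3) unfolding join_cond_def by blast
 thus ?case using labels_join'[OF i reach_join.IH] by simp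
qed

theorem LF_complete:
 assumes "(p, t) \<in> LF" "p \<in> idb (set Rs) | p \<in> body_preds"
 shows "orig W p t \<in> set Q"
proof -
 have "fst x \<in> idb (set Rs) | fst x \<in> body_preds ==> orig W (fst x) (snd x) \<in> set Q" if "x \<in> LF" for x
  using that
 proof (induction rule: least_fixpoint_induct)
  case (base x)
  have "fst x \<notin> idb (set Rs)" using base(1) db unfolding db_instance_def edb_def by blast
  hence "orig W (fst x) (snd x) \<in> set Q1" using edb_facts(1)[of "fst x" "snd x"] base by simp
  thus ?case using Q by auto
 next
  case (rule R th)
  let ?x = "ground_atom th (head R)"
  have RL: "R \<in> set Rs" and body: "!!A. A \<in> set (body R) ==> ground_atom th A \<in> LF" using rule by auto
  have xLF: "?x \<in> LF" using least_fixpoint_rule[OF RL] body by blast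
  show ?case
  proof (cases "fst ?x \<in> idb (set Rs)")
   case False
   hence "orig W (fst ?x) (snd ?x) \<in> set Q1" using edb_orig[of "fst ?x" "snd ?x"] xLF rule.prems by simp
   thus ?thesis using Q by auto
  next
   case True
   obtain i where i: "i < length Rs" "R = Rs ! i" using RL by (metis in_set_conv_nth)
   \<comment> \<open>The valuation is transported to the variable names of the shape.\<close>
   let ?th = "th \<circ> inv_into (vars_rule R) (fm i)"
   have inv: "(?th \<circ> fm i) v = th v" if "v \<in> vars_rule R" for v
    using fm[OF i(1)] that i(2) by (simp add: inv_into_f_f)
   have gr: "ground_atom (?th \<circ> fm i) (atm i a) = ground_atom th (atm i a)" if "a < natoms i" for a
    by (rule ground_atom_cong) (use inv atom_vars_rule[OF that] i(2) in blast)
   have s: "sat i a ?th" if "a \<in> batoms i" for a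
   proof -
    have "atm i a \<in> set (body R)" unfolding i(2) batoms_body using that by blast
    thus ?thesis unfolding sat_def gr[OF batoms_lt[OF that]] by (rule body)
   qed
   have e: "orig W (fst (atm i (ei i))) (snd (ground_atom (?th \<circ> fm i) (atm i (ei i)))) \<in> set Q" if e0: "ei i ~= 0"
   proof -
    have a: "ei i \<in> batoms i" using idb_vars_cases[OF i(1)] e0 by blast
    hence A: "atm i (ei i) \<in> set (body R)" using batoms_body i(2) by blast
    hence "fst (atm i (ei i)) \<in> body_preds" unfolding body_preds_def using RL by blast
    thus ?thesis using rule.IH[OF A] unfolding gr[OF batoms_lt[OF a]] by (simp add: ground_atom_def)
   qed
   let ?g = "%v. if v \<in> vars i 0 then ?th v else 0"
   let ?l = "pair_label (vars i 0) (bvars i)"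
   have "aux W i ?l ?g \<in> set Q"
   proof (rule labels_complete[OF i(1)])
    show "sat i a ?th" if "a \<in> batoms i" for a using that by (rule s)
    show "orig W (fst (atm i (ei i))) (snd (ground_atom (?th \<circ> fm i) (atm i (ei i)))) \<in> set Q" if "ei i ~= 0"
     using that by (rule e)
   qed (rule reach_plan(1)[OF i(1)])
   then obtain k where k: "k < length Q" "Q ! k = aux W i ?l ?g" unfolding in_set_conv_nth by blast
   have OW: "vars i 0 <= {..<W}" by (rule vars_W[OF i(1) rule_atoms_pos])
   note g0 = restrict_zero[OF OW, of ?th]
   let ?p = "out_op W (sid i) (tss i)"
   have p: "?p \<in> set (all_ops W hs)" by (rule op_in[OF i(1)]) (rule op_out)
   have hd: "head (Rs ! i) = atm i 0" by (simp add: rule_atoms_def)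
   have "orig W (fst (head (Rs ! i))) (snd (ground_atom (?g \<circ> fm i) (head (Rs ! i)))) \<in> set Q"
   proof (rule closed_fire1[OF C k(1) p _ _ order_refl])
    show "ev (Q ! k) (Q ! k) (self_addr W (vars i 0) (bvars i)) \<in> set (kf (Q ! k))"
     unfolding k(2) self_addr_def label_addr[OF g0] by (rule key_holds[OF g0 OW]) simp
    show "ev (Q ! k) (Q ! k) (result ?p) = orig W (fst (head (Rs ! i))) (snd (ground_atom (?g \<circ> fm i) (head (Rs ! i))))"
     unfolding k(2) by (rule eval_out[OF i(1) g0])
   qed (use label_guard_holds[OF i(1)] k(2) in \<open>auto simp: out_op_def eqs_def\<close>)
   moreover have e2: "ground_atom (?g \<circ> fm i) (head (Rs ! i)) = ?x"
   proof -
    have "ground_atom (?g \<circ> fm i) (head (Rs ! i)) = ground_atom (?th \<circ> fm i) (head (Rs ! i))"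
     by (rule ground_atom_cong) (use vars_eq[OF i(1) rule_atoms_pos] hd in auto)
    also have "... = ?x" using gr[OF rule_atoms_pos] hd i(2) by simp
    finally show ?thesis .
   qed
   moreover have "fst (head (Rs ! i)) = fst ?x" unfolding i(2) ground_atom_def by simp
   ultimately show ?thesis by simp
  qed
 qed
 from this[OF assms(1)] assms(2) show ?thesis by simp
qed

end


section \<open>Amortised cost: partners scanned against results produced\<close>

section \<open>Cost of the evaluation\<close>

lemma sum_image_bound:
 fixes h :: "'b => nat"
 assumes "finite I" "S <= k ` I"
 shows "sum h S <= (SUM x:I. h (k x))"
proof -
 have "sum h S <= sum h (k ` I)" using assms by (intro sum_mono2) auto
 also have "... <= (SUM x:I. h (k x))" using sum_image_le[OF assms(1), of h k] by (simp add: comp_def)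
 finally show ?thesis .
qed

text \<open>Double counting of the pairs \<open>(x, y)\<close> with \<open>y\<close> in
  \<open>F x\<close>.\<close>

lemma sum_card_fibres:
 assumes "finite A" "finite B" "!!x. x \<in> A ==> F x <= B" "!!y. y \<in> B ==> real (card {x \<in> A. y \<in> F x}) <= c"
 shows "real (SUM x:A. card (F x)) <= real (card B) * c"
proof -
 have "(SUM x:A. card (F x)) = (SUM x:A. SUM y:B. of_bool (y \<in> F x))"
 proof (rule sum.cong[OF refl])
  fix x assume "x \<in> A"
  hence "F x = {y:B. y \<in> F x}" using assms(3) by blast
  thus "card (F x) = (SUM y:B. of_bool (y \<in> F x))" using assms(2) by (simp add: Int_def)
 qed
 also have "... = (SUM y:B. SUM x:A. of_bool (y \<in> F x))" by (rule sum.swap)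
 also have "... = (SUM y:B. card {x:A. y \<in> F x})" using assms(1) by (simp add: Int_def)
 finally have "real (SUM x:A. card (F x)) = (SUM y:B. real (card {x:A. y \<in> F x}))" by simp
 also have "... <= real (card B) * c" by (rule sum_bounded_above) (rule assms(4))
 finally show ?thesis .
qed

lemma card_UN_bound:
 assumes "finite I" "!!i. i \<in> I ==> finite (F i)" "!!i. i \<in> I ==> real (card (F i)) <= c"
 shows "finite (UN i:I. F i)" "real (card (UN i:I. F i)) <= real (card I) * c"
proof -
 show "finite (UN i:I. F i)" using assms by blast
 have "real (card (UN i:I. F i)) <= real (SUM i:I. card (F i))" using card_UN_le[OF assms(1)] by (rule of_nat_mono)
 also have "... = (SUM i:I. real (card (F i)))" by (rule of_nat_sum)
 also have "... <= real (card I) * c" by (rule sum_bounded_above) (rule assms(3))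
 finally show "real (card (UN i:I. F i)) <= real (card I) * c" .
qed

lemma sum_sum_list: "(SUM x:A. SUM p<-ps. c x p) = (SUM p<-ps. SUM x:A. c x p)" for c :: "'a => 'b => nat"
 by (induction ps) (simp_all add: sum.distrib)

lemma op_cost_mono:
 assumes "V <= V'" "finite V'" "addrs p ~= []"
 shows "op_cost st kf V x p <= op_cost st kf V' x p"
proof -
 have "Min ((%a. card {y \<in> V. map (oeval st x x) a \<in> set (kf y)}) ` set (addrs p)) <= card {y \<in> V'. map (oeval st x x) a \<in> set (kf y)}"
  if "a \<in> set (addrs p)" for a
 proof -
  have "Min ((%a. card {y \<in> V. map (oeval st x x) a \<in> set (kf y)}) ` set (addrs p)) <= card {y \<in> V. map (oeval st x x) a \<in> set (kf y)}"
   using that by (intro Min_le) auto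
  also have "... <= card {y \<in> V'. map (oeval st x x) a \<in> set (kf y)}" using assms(1,2) by (intro card_mono) auto
  finally show ?thesis .
 qed
 thus ?thesis unfolding op_cost_def using assms(3) by simp
qed

lemma op_cost_single: "addrs p = [a] ==> op_cost st kf V x p =
  (if eqs st x x (guard p) then card {y \<in> V. map (oeval st x x) a \<in> set (kf y)} else 0)"
 by (simp add: op_cost_def)

lemma addrs_nonempty: "p \<in> set (all_ops W hs) ==> addrs p ~= []"
 unfolding set_all_ops
proof (elim exE conjE)
 fix d assume "is_op W d (hs ! d) p"
 thus ?thesis
 proof cases
  case (op_ext Y Z v)
  then obtain a where "a \<in> {1..<length (fst (hs ! d))}" "v \<in> avars (fst (hs ! d)) a"
   unfolding ext_ok_def body_vars_def by blast
  thus ?thesis unfolding op_ext(1) ext_op_def Let_def by (auto simp: filter_empty_conv)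
 qed (simp_all add: conv_op_def seed_op_def join_op_def weaken_op_def out_op_def)
qed

context evaluation
begin

abbreviation "cost == op_cost st kf Vall"

text \<open>The root rule needs an IDB tuple, the seed rule a seed, and every rule with a label
  guard a fact with a pair label; none of these is in \<open>stage1\<close>, so only the conversion
  of EDB atoms remains.\<close>

lemma stage1_sound: "sound_set st kf (all_ops W hs) (Vall Int stage1)"
 unfolding sound_set_def
proof (intro ballI impI, rule IntI)
 fix p x y b
 assume p: "p \<in> set (all_ops W hs)" and x: "x \<in> Vall Int stage1" and y: "y \<in> Vall Int stage1" and b: "b \<in> set (addrs p)"
  and g: "eqs st x x (guard p)" and key: "ev x x b \<in> set (kf y)" and t: "eqs st x y (tests p)"
  and n: "ALL c:set (needs p). EX z:Vall Int stage1. ev x y c \<in> set (kf z)"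
 show z: "ev x y (result p) \<in> Vall"
  using sound_Vall p x y b g key t n unfolding sound_set_def by blast
 have len: "length x = W + 3" using Vall_kind(4) x by blast
 have no_label: False if "eqs st x x (label_guard d (pair_label Y Z))" for d Y Z
 proof -
  have "x ! 0 = 1" "x ! 2 = pair_label Y Z" using that len unfolding eqs_def label_guard_def by (auto simp: nth_or_0_def)
  thus False using stage1_head[of x] x by (auto simp: pair_label_odd)
 qed
 obtain d where d: "d < length hs" "is_op W d (hs ! d) p" using p unfolding set_all_ops by blast
 from d(2) show "ev x y (result p) \<in> stage1"
 proof cases
  case (op_atom a)
  have h: "ev x y (result p) ! 0 = 1" "ev x y (result p) ! 2 = 2 * a"
   unfolding op_atom(1) conv_op_def aux_exps_def by simp_all
  hence "ev x y (result p) \<in> Vatom Un Vlab" using Vall_kind(2)[OF z] by blast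
  thus ?thesis using h(2) pair_label_odd unfolding stage1_def Vlab_def by (auto simp del: nth_map)
 next
  case op_root
  obtain i q s where "i < length Rs" "snd (hs ! d) \<in> batoms i" "sid i = d" "x = orig W q s" "q = fst (atm i (snd (hs ! d)))"
   by (rule conv_applies[OF _ _ g[unfolded op_root(1)] b[unfolded op_root(1)] key t[unfolded op_root(1)] refl])
    (use x y in \<open>simp_all add: op_root(1)\<close>)
  hence "q \<in> idb (set Rs) & x = orig W q s" using idb_index[of i] unfolding batoms_def by blast
  thus ?thesis using stage1_cases(3) x by blast
 next
  case op_seed
  have "x ! 0 = 3" using g len unfolding op_seed(1) seed_op_def eqs_def by (simp add: nth_or_0_def)
  thus ?thesis using stage1_head[of x] x by auto
 qed (use g in \<open>auto simp: ext_op_def Let_def join_op_def weaken_op_def out_op_def dest: no_label\<close>)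
qed

end

locale evaluation_cost = evaluation +
 fixes N :: nat
 assumes ew: "0 < ew (set Rs)" and N: "1 <= N"
  and edb_card: "ALL p:edb (set Rs). card (rel p) <= N"
begin

definition idb_bound :: real where
 "idb_bound = real (adornment_count (set Rs)) * real N powr ew (set Rs)"

definition label_bound :: real where
 "label_bound = real (adornment_count (set Rs)) * real N powr (ew (set Rs) + fcghw (set Rs) - 1)"

lemma count_ge_one: "1 <= real (adornment_count (set Rs))"
 using ew_ge_one(2)[OF dp ew] by simp

lemma fcghw_ge_one: "1 <= fcghw (set Rs)"
proof -
 obtain R where R: "R \<in> set Rs" "vars_list (snd (head R)) ~= {}" using ew_ge_one(3)[OF dp ew] by blast
 have "rule_out R <= rule_vertices R"
  unfolding rule_out_def rule_vertices_def rule_edges_def using vars_head_body[OF dp R(1)] by blast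
 hence "1 <= fcghw_rule R" using R(2) by (intro fcghw_rule_ge_one) (auto simp: rule_out_def)
 also have "... <= fcghw (set Rs)" using R(1) by (intro fcghw_rule_le) auto
 finally show ?thesis .
qed

lemma idb_le_label: "idb_bound <= label_bound"
 unfolding idb_bound_def label_bound_def using fcghw_ge_one N by (intro mult_left_mono powr_mono) auto

lemma N_le_idb: "real N <= idb_bound"
proof -
 have "1 * real N powr 1 <= idb_bound"
  unfolding idb_bound_def using count_ge_one ew_ge_one(1)[OF dp ew] N by (intro mult_mono powr_mono) auto
 thus ?thesis using N by simp
qed

lemma one_le_label: "1 <= label_bound"
 using N_le_idb idb_le_label N by linarith

lemma relation_card:
 assumes "p \<in> preds (set Rs)"
 shows "finite (rel p)" "real (card (rel p)) <= idb_bound"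
proof -
 have "finite (rel p) & real (card (rel p)) <= idb_bound"
 proof (cases "p \<in> idb (set Rs)")
  case True
  thus ?thesis using card_derived_idb_le[OF dp lin db ew N edb_card] unfolding idb_bound_def by blast
 next
  case False
  hence "card (rel p) <= N" using edb_card assms unfolding edb_def by blast
  thus ?thesis using finite_derived_edb[OF dp db False] N_le_idb by linarith
 qed
 thus "finite (rel p)" "real (card (rel p)) <= idb_bound" by auto
qed

lemma atom_pred: "i < length Rs ==> a < natoms i ==> fst (atm i a) \<in> preds (set Rs)"
 unfolding preds_def by (meson UN_I imageI nth_mem)

lemma Rel_card:
 assumes i: "i < length Rs" "a < natoms i"
 shows "finite (Rel i a)" "card (Rel i a) <= card (rel (fst (atm i a)))"
proof -
 let ?h = "%g. snd (ground_atom (g \<circ> fm i) (atm i a))"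
 have im: "?h ` Rel i a <= rel (fst (atm i a))"
  unfolding Rel_def sat_def derived_relation_def by (auto simp: ground_atom_def)
 have inj: "inj_on ?h (Rel i a)"
 proof (rule inj_onI, rule ext)
  fix g g' v assume g: "g \<in> Rel i a" "g' \<in> Rel i a" and e: "?h g = ?h g'"
  show "g v = g' v"
  proof (cases "v \<in> vars i a")
   case True
   then obtain x where x: "x \<in> vars_list (snd (atm i a))" "v = fm i x" unfolding vars_eq[OF i] by blast
   have "ground_atom (g \<circ> fm i) (atm i a) = ground_atom (g' \<circ> fm i) (atm i a)" using e by (simp add: ground_atom_def)
   from ground_atom_inj[OF this x(1)] show ?thesis using x(2) by simp
  qed (use g in \<open>simp add: Rel_def\<close>)
 qed
 note fin = relation_card(1)[OF atom_pred[OF i]]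
 show "finite (Rel i a)" by (rule finite_imageD[OF finite_subset[OF im fin] inj])
 show "card (Rel i a) <= card (rel (fst (atm i a)))" by (rule card_inj_on_le[OF inj im fin])
qed

lemma finite_batoms: "finite (batoms i)"
 by (simp add: batoms_def)

lemma relations_Rel: "i < length Rs ==> (!!a. a \<in> batoms i ==> 0 <= x a) ==> relations (batoms i) (Rel i) x"
 using Rel_card(1) batoms_lt finite_batoms by unfold_locales auto

lemma fcghw_shape_le:
 assumes i: "i < length Rs"
 shows "fcghw_rule (canonical_rule (tss i)) <= fcghw (set Rs)"
proof -
 have RL: "Rs ! i \<in> set Rs" using i by simp
 have out: "rule_out (Rs ! i) <= rule_vertices (Rs ! i)"
  unfolding rule_out_def rule_vertices_def rule_edges_def using vars_head_body[OF dp RL] by blast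
 have "rule_vertices (Rs ! i) <= vars_rule (Rs ! i)"
  unfolding rule_vertices_def rule_edges_def vars_rule_def rule_atoms_def by auto
 hence inj: "inj_on (fm i) (rule_vertices (Rs ! i))" using fm[OF i] inj_on_subset by blast
 have "set (body (Rs ! i)) = atm i ` batoms i" using batoms_body[of _ i] by blast
 hence "(`) (fm i) ` rule_edges (Rs ! i) = (%a. fm i ` vars_list (snd (atm i a))) ` batoms i"
  unfolding rule_edges_def by (simp add: image_image)
 also have "... = rule_edges (canonical_rule (tss i))"
  unfolding canonical_rule_eqs[OF i] body_edges_eq[OF i] using vars_eq[OF i batoms_lt] by (intro image_cong) auto
 finally have e: "rule_edges (canonical_rule (tss i)) = (`) (fm i) ` rule_edges (Rs ! i)" ..
 have o: "rule_out (canonical_rule (tss i)) = fm i ` rule_out (Rs ! i)"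
  using canonical_rule_eqs(3)[OF i] vars_eq[OF i rule_atoms_pos] by (simp add: rule_out_def rule_atoms_def)
 have "fcghw_rule (canonical_rule (tss i)) <= fcghw_rule (Rs ! i)" by (rule fcghw_rule_image[OF inj e o out])
 also have "... <= fcghw (set Rs)" using RL by (intro fcghw_rule_le) auto
 finally show ?thesis .
qed

text \<open>The IDB relation has at most \<open>?c * N\<close> elements, so it counts as an EDB
  relation times the surplus \<open>?c\<close>.\<close>

lemma Rel_powr_le:
 assumes i: "i < length Rs" and a: "a \<in> batoms i" and x: "0 <= x" "x <= 1"
 shows "real (card (Rel i a)) powr x <=
  (if a = ei i then real (adornment_count (set Rs)) * real N powr (ew (set Rs) - 1) else 1) * real N powr x"
proof -
 have c: "card (Rel i a) <= card (rel (fst (atm i a)))" by (rule Rel_card(2)[OF i batoms_lt[OF a]])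
 have pr: "fst (atm i a) \<in> preds (set Rs)" by (rule atom_pred[OF i batoms_lt[OF a]])
 show ?thesis
 proof (cases "a = ei i")
  case True
  let ?c = "real (adornment_count (set Rs)) * real N powr (ew (set Rs) - 1)"
  have c1: "1 <= ?c"
   using mult_mono[OF count_ge_one ge_one_powr_ge_zero[of "real N" "ew (set Rs) - 1"]] ew_ge_one(1)[OF dp ew] N by simp
  have "real N powr (ew (set Rs) - 1) * real N powr 1 = real N powr ew (set Rs)" unfolding powr_add[symmetric] by simp
  hence "idb_bound = ?c * real N" unfolding idb_bound_def using N by (simp add: mult.assoc)
  hence "real (card (Rel i a)) <= ?c * real N" using c relation_card(2)[OF pr] by linarith
  hence "real (card (Rel i a)) powr x <= (?c * real N) powr x" using x by (intro powr_mono2) auto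
  also have "... = ?c powr x * real N powr x" using c1 by (intro powr_mult) 
  \<comment> \<open>The surplus enters at most once because the weight \<open>x\<close> does not
    exceed 1.\<close>
  also have "... <= ?c powr 1 * real N powr x" using c1 x by (intro mult_right_mono powr_mono) auto
  finally show ?thesis using True c1 by (auto simp: powr_one)
 next
  case False
  have "a \<in> {1..<natoms i}" using a unfolding batoms_def .
  hence "fst (atm i a) \<in> edb (set Rs)" using idb_index[OF i] False pr unfolding edb_def by blast
  hence "real (card (Rel i a)) <= real N" using c edb_card by (meson le_trans of_nat_le_iff)
  thus ?thesis using False x by (simp add: powr_mono2)
 qed
qed

text \<open>A cover by the hyperedges \<open>La p\<close> becomes a weighting of atoms by charging
  each hyperedge to one atom with that variable set. At most one atom is IDB, so the surplus
  \<open>c\<close> appears at most once.\<close>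

lemma bag_bound:
 assumes i: "i < length Rs" and Y: "bag_ok (tss i) Y"
  and b: "!!x. relations (batoms i) (Rel i) x ==> (!!v. v \<in> Y ==> 1 <= (SUM a:{a:batoms i. v \<in> vars i a}. x a)) ==>
   b <= (PROD a:batoms i. real (card (Rel i a)) powr x a)"
 shows "b <= label_bound"
proof -
 obtain V E ch La where d: "free_connex_decomposition (canonical_rule (tss i)) V E ch La"
   "!!p. p \<in> V ==> fractional_cover_number (\<Union>(La p)) (La p) id <= fcghw_rule (canonical_rule (tss i))"
   "bag_ok (tss i) = in_some_bag V ch"
  using best_decomposition[OF i] by metis
 obtain p where p: "p \<in> V" "Y <= ch p" using Y unfolding d(3) in_some_bag_def by blast
 have L: "La p <= vars i ` batoms i" "Y <= \<Union>(La p)"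
  using free_connex_decompositionD(3,6)[OF d(1) p(1)] p(2) unfolding canonical_rule_eqs[OF i] body_edges_eq[OF i] by auto
 define c where "c = real (adornment_count (set Rs)) * real N powr (ew (set Rs) - 1)"
 have c0: "0 < c" unfolding c_def using count_ge_one N by auto
 have c1: "1 <= c"
  unfolding c_def using mult_mono[OF count_ge_one ge_one_powr_ge_zero[of "real N" "ew (set Rs) - 1"]] ew_ge_one(1)[OF dp ew] N by simp
 define rp where "rp F = (SOME a. a \<in> batoms i & vars i a = F)" for F
 have rp: "rp F \<in> batoms i & vars i (rp F) = F" if F: "F \<in> La p" for F
  unfolding rp_def by (rule someI_ex) (use L(1) F in auto)
 have rpi: "inj_on rp (La p)" by (rule inj_on_inverseI[of _ "vars i"]) (use rp in auto)
 have finL: "finite (La p)" by (rule finite_subset[OF L(1) finite_imageI[OF finite_batoms]])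
 have "b <= c * real N powr fractional_cover_number (\<Union>(La p)) (La p) id"
 proof (rule fractional_cover_number_bound[OF _ _ finL c0])
  fix y :: "nat set => real"
  assume y: "ALL F:La p. 0 <= y F & y F <= 1" "ALL v:\<Union>(La p). 1 <= (SUM F:{F:La p. v \<in> id F}. y F)"
  define x where "x a = (if a \<in> rp ` La p then y (vars i a) else 0)" for a
  have x01: "0 <= x a" "x a <= 1" for a using y(1) rp unfolding x_def by auto
  have sumx: "(SUM a:{a:batoms i. P (vars i a)}. x a) = (SUM F:{F:La p. P F}. y F)" for P
  proof -
   have "(SUM F:{F:La p. P F}. y F) = (SUM F:{F:La p. P F}. x (rp F))"
    using rp by (intro sum.cong) (auto simp: x_def)
   also have "... = sum x (rp ` {F:La p. P F})"
    using inj_on_subset[OF rpi, of "{F:La p. P F}"] by (simp add: sum.reindex)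
   also have "... = (SUM a:{a:batoms i. P (vars i a)}. x a)"
    using rp finite_batoms by (intro sum.mono_neutral_left) (auto simp: x_def)
   finally show ?thesis ..
  qed
  have "b <= (PROD a:batoms i. real (card (Rel i a)) powr x a)"
  proof (intro b relations_Rel[OF i] x01(1))
   fix v assume "v \<in> Y"
   thus "1 <= (SUM a:{a:batoms i. v \<in> vars i a}. x a)" using y(2) L(2) unfolding sumx[of "%F. v \<in> F"] by auto
  qed
  also have "... <= (PROD a:batoms i. (if a = ei i then c else 1) * real N powr x a)"
   unfolding c_def using Rel_powr_le[OF i] x01 by (intro prod_mono) auto
  also have "... = (PROD a:batoms i. if a = ei i then c else 1) * real N powr (SUM a:batoms i. x a)"
   using N by (simp add: prod.distrib powr_sum)
  also have "(PROD a:batoms i. if a = ei i then c else 1) <= c"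
   using c1 finite_batoms by (simp add: prod.delta)
  finally show "b <= c * real N powr (SUM F:La p. y F)"
   using sumx[of "%_. True"] by (simp add: mult_right_mono)
 qed (use N in auto)
 also have "... <= c * real N powr fcghw (set Rs)"
  using d(2)[OF p(1)] fcghw_shape_le[OF i] c0 N by (intro mult_left_mono powr_mono) auto
 also have "... = label_bound"
  unfolding c_def label_bound_def by (simp add: powr_add[symmetric] algebra_simps)
 finally show ?thesis .
qed

text \<open>Within a bag the counting bound applies. Otherwise \<open>Y\<close> consists of head
  variables and all atoms are satisfied, so each assignment is determined by a derived head
  tuple.\<close>

lemma valid_card:
 assumes i: "i < length Rs" and Y: "typed i Y Z"
 shows "finite (valid i Y Z)" "real (card (valid i Y Z)) <= label_bound"
proof -
 have sub: "valid i Y Z <= consistent (batoms i) (vars i) (Rel i) Y" unfolding valid_def by blast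
 have YW: "Y <= {..<W}" and YZ: "Y <= bvars i" using typed_W[OF i Y] Y unfolding typed_def is_label_def by auto
 interpret r0: relations "batoms i" "vars i" "Rel i" "%_. 0" by (rule relations_Rel[OF i]) simp
 have fc: "finite (consistent (batoms i) (vars i) (Rel i) Y)"
  by (rule r0.finite_consistent[OF fin_W[OF YW]]) (use YZ body_vars_eq[OF i] in auto)
 thus fin: "finite (valid i Y Z)" using sub by (rule finite_subset[rotated])
 show "real (card (valid i Y Z)) <= label_bound"
 proof (cases "bag_ok (tss i) Y")
  case True
  show ?thesis
  proof (rule bag_bound[OF i True])
   fix x assume x: "relations (batoms i) (Rel i) x" "!!v. v \<in> Y ==> 1 <= (SUM a:{a:batoms i. v \<in> vars i a}. x a)"
   have "real (card (valid i Y Z)) <= real (card (consistent (batoms i) (vars i) (Rel i) Y))"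
    using card_mono[OF fc sub] by simp
   also have "... <= (PROD a:batoms i. real (card (Rel i a)) powr x a)"
    by (rule relations.card_consistent_le[OF x(1) fin_W[OF YW] x(2)])
   finally show "real (card (valid i Y Z)) <= (PROD a:batoms i. real (card (Rel i a)) powr x a)" .
  qed
 next
  case False
  hence Yo: "Y <= vars i 0" and Z: "Z = bvars i" using Y unfolding typed_def by auto
  have "EX th. (ALL v:Y. th v = g v) & ground_atom (th \<circ> fm i) (head (Rs ! i)) \<in> LF" if g: "g \<in> valid i Y Z" for g
  proof -
   obtain th where th: "ALL u:Y. th u = g u" "ALL a:batoms i. vars i a <= Z --> sat i a th" using validD(3)[OF g] by blast
   have "ground_atom (th \<circ> fm i) A \<in> LF" if A: "A \<in> set (body (Rs ! i))" for A
   proof -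
    obtain a where a: "a \<in> batoms i" "A = atm i a" using A batoms_body[of A i] by blast
    have "vars i a <= Z" unfolding Z body_vars_eq[OF i] using a(1) by blast
    thus ?thesis using th(2) a unfolding sat_def by blast
   qed
   hence "ground_atom (th \<circ> fm i) (head (Rs ! i)) \<in> LF" using i by (intro least_fixpoint_rule) auto
   thus ?thesis using th(1) by blast
  qed
  then obtain Th where Th: "!!g. g \<in> valid i Y Z ==> (ALL v:Y. Th g v = g v) & ground_atom (Th g \<circ> fm i) (head (Rs ! i)) \<in> LF"
   by metis
  let ?h = "%g. snd (ground_atom (Th g \<circ> fm i) (head (Rs ! i)))" and ?p = "fst (head (Rs ! i))"
  have im: "?h ` valid i Y Z <= rel ?p"
   unfolding derived_relation_def using Th by (fastforce simp: ground_atom_def)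
  have inj: "inj_on ?h (valid i Y Z)"
  proof (rule inj_onI, rule ext)
   fix g g' v assume g: "g \<in> valid i Y Z" "g' \<in> valid i Y Z" and e: "?h g = ?h g'"
   show "g v = g' v"
   proof (cases "v \<in> Y")
    case True
    then obtain x where x: "x \<in> vars_list (snd (head (Rs ! i)))" "v = fm i x"
     using Yo vars_eq[OF i rule_atoms_pos] by (auto simp: rule_atoms_def)
    have "ground_atom (Th g \<circ> fm i) (head (Rs ! i)) = ground_atom (Th g' \<circ> fm i) (head (Rs ! i))"
     using e by (simp add: ground_atom_def)
    from ground_atom_inj[OF this x(1)] show ?thesis using x(2) True Th[OF g(1)] Th[OF g(2)] by simp
   qed (use validD(1)[OF g(1)] validD(1)[OF g(2)] in simp)
  qed
  have p: "?p \<in> preds (set Rs)" using atom_pred[OF i rule_atoms_pos] by (simp add: rule_atoms_def)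
  have "card (valid i Y Z) <= card (rel ?p)" by (rule card_inj_on_le[OF inj im relation_card(1)[OF p]])
  thus ?thesis using relation_card(2)[OF p] idb_le_label by linarith
 qed
qed

lemma LF_preds:
 assumes "(q, t) \<in> LF"
 shows "q \<in> preds (set Rs)"
proof -
 have "(q, t) \<in> immediate_consequence (set Rs) D LF" using assms by (simp flip: least_fixpoint_unfold)
 then consider "(q, t) \<in> D" | R th where "R \<in> set Rs" "(q, t) = ground_atom th (head R)"
  unfolding immediate_consequence_def by blast
 thus ?thesis
 proof cases
  case 1
  thus ?thesis using db unfolding db_instance_def edb_def by force
 next
  case 2
  thus ?thesis unfolding preds_def rule_atoms_def ground_atom_def by auto
 qed
qed

definition atoms :: "(nat \<times> nat) set" where
 "atoms = Sigma {..<length Rs} (%i. {..<natoms i})"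

text \<open>Bounds the number of atoms of any rule through the list of shapes, hence independently
  of the program.\<close>

definition width_const :: nat where
 "width_const = (SUM h<-hs. length (fst h))"

lemma atoms_card: "finite atoms" "card atoms <= length Rs * width_const"
proof -
 show "finite atoms" unfolding atoms_def by auto
 have "natoms i <= width_const" if i: "i < length Rs" for i
  unfolding width_const_def length_tss[OF i, symmetric] by (rule member_le_sum_list) (use sid[OF i] in auto)
 hence "(SUM i<length Rs. natoms i) <= length Rs * width_const"
  using sum_bounded_above[of "{..<length Rs}" "%i. natoms i" width_const] by simp
 thus "card atoms <= length Rs * width_const" unfolding atoms_def by simp
qed

lemma preds_atoms: "preds (set Rs) = (%(i, a). fst (atm i a)) ` atoms"
 unfolding preds_def atoms_def by (auto simp: set_conv_nth image_iff) force+

lemma preds_card: "finite (preds (set Rs))" "real (card (preds (set Rs))) <= real (length Rs * width_const)"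
proof -
 show "finite (preds (set Rs))" unfolding preds_atoms using atoms_card(1) by (rule finite_imageI)
 have "card (preds (set Rs)) <= length Rs * width_const"
  unfolding preds_atoms by (rule order_trans[OF card_image_le[OF atoms_card(1)] atoms_card(2)])
 thus "real (card (preds (set Rs))) <= real (length Rs * width_const)" by (rule of_nat_mono)
qed

definition tuples :: "nat => nat list set" where
 "tuples p = {x \<in> Vall. x ! 0 = 0 & x ! 1 = p}"

lemma tuples_card:
 "p \<in> preds (set Rs) ==> finite (tuples p)" "p \<in> preds (set Rs) ==> real (card (tuples p)) <= idb_bound"
 "Vorig = (UN p:preds (set Rs). tuples p)"
proof -
 have sub: "tuples p <= orig W p ` rel p" for p
 proof
  fix x assume "x \<in> tuples p"
  hence "x \<in> Vorig" "x ! 1 = p" using Vall_kind(1) unfolding tuples_def by auto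
  thus "x \<in> orig W p ` rel p" unfolding Vorig_def derived_relation_def by auto
 qed
 show "Vorig = (UN p:preds (set Rs). tuples p)"
 proof (intro equalityI subsetI)
  fix x assume x: "x \<in> Vorig"
  hence "x \<in> Vall" unfolding Vall_def by blast
  thus "x \<in> (UN p:preds (set Rs). tuples p)" using x LF_preds unfolding Vorig_def tuples_def by auto
 qed (use Vall_kind(1) in \<open>auto simp: tuples_def\<close>)
 assume p: "p \<in> preds (set Rs)"
 note r = relation_card[OF p]
 show "finite (tuples p)" by (rule finite_subset[OF sub finite_imageI[OF r(1)]])
 show "real (card (tuples p)) <= idb_bound" using surj_card_le[OF r(1) sub] r(2) by linarith
qed

text \<open>Reduces the cost of an operation guarded by one label to its cost within a single
  program rule; each rule of shape \<open>d\<close> contributes at most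
  \<open>label_bound\<close>.\<close>

lemma label_cost:
 assumes g: "guard p = label_guard d (pair_label Y Z)" and W: "Y <= {..<W}" "Z <= {..<W}"
  and c: "!!i. i < length Rs ==> sid i = d ==> typed i Y Z ==>
   real (SUM g:valid i Y Z. cost (lab i Y Z g) p) <= label_bound" and fin: "finite Vall"
 shows "real (SUM x:Vall. cost x p) <= real (length Rs) * label_bound"
proof -
 let ?I = "{i. i < length Rs & sid i = d & typed i Y Z}"
 let ?k = "%(i, g). lab i Y Z g"
 have fI: "finite ?I" by simp
 have fS: "finite (Sigma ?I (%i. valid i Y Z))" using valid_card(1) by auto
 have "(SUM x:Vall. cost x p) = (SUM x:{x:Vall. eqs st x x (guard p)}. cost x p)"
  using fin by (intro sum.mono_neutral_right) (auto simp: op_cost_def)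
 also have "... <= (SUM z:Sigma ?I (%i. valid i Y Z). cost (?k z) p)"
 proof (rule sum_image_bound[OF fS], rule subsetI)
  fix x assume "x \<in> {x:Vall. eqs st x x (guard p)}"
  hence x: "x \<in> Vall" "eqs st x x (label_guard d (pair_label Y Z))" using g by auto
  obtain i h where "x = lab i Y Z h" "i < length Rs" "sid i = d" "typed i Y Z" "h \<in> valid i Y Z"
   by (rule Vall_label_guard[OF x W])
  thus "x \<in> ?k ` Sigma ?I (%i. valid i Y Z)" by (intro image_eqI[of _ _ "(i, h)"]) auto
 qed
 also have "... = (SUM i:?I. SUM g:valid i Y Z. cost (lab i Y Z g) p)"
  using valid_card(1) by (subst sum.Sigma) (auto simp: case_prod_unfold)
 finally have "real (SUM x:Vall. cost x p) <=
   real (SUM i:?I. SUM g:valid i Y Z. cost (lab i Y Z g) p)"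
  by (rule of_nat_mono)
 also have "... = (SUM i:?I. real (SUM g:valid i Y Z. cost (lab i Y Z g) p))"
  by (rule of_nat_sum)
 also have "... <= real (card ?I) * label_bound" by (rule sum_bounded_above) (use c in auto)
 also have "... <= real (length Rs) * label_bound"
  using card_mono[of "{..<length Rs}" ?I] one_le_label by (intro mult_right_mono) auto
 finally show ?thesis .
qed

lemma self_cost:
 assumes p: "guard p = label_guard d (pair_label Y Z)" "addrs p = [self_addr W Y Z]"
  and W: "Y <= {..<W}" "Z <= {..<W}" and fin: "finite Vall"
 shows "real (SUM x:Vall. cost x p) <= real (length Rs) * label_bound"
proof (rule label_cost[OF p(1) W _ fin])
 fix i assume i: "i < length Rs" "typed i Y Z"
 have "cost (lab i Y Z g) p <= 1" if g: "g \<in> valid i Y Z" for g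
 proof -
  note g0 = valid_zero[OF i g]
  have "{y \<in> Vall. ev (lab i Y Z g) (lab i Y Z g) (self_addr W Y Z) \<in> set (kf y)}
   <= {lab i Y Z g}"
  proof (intro subsetI)
   fix y assume "y \<in> {y \<in> Vall. ev (lab i Y Z g) (lab i Y Z g) (self_addr W Y Z) \<in> set (kf y)}"
   hence y: "y \<in> Vall" "bucket_addr W i (pair_label Y Z) Y g \<in> set (kf y)"
    unfolding self_addr_def label_addr[OF g0] by auto
   obtain h where h: "h \<in> valid i Y Z" "y = lab i Y Z h" "ALL v:Y. h v = g v"
    by (rule Vall_key_label[OF y(1) W(1) y(2) W])
   have "h = g" using validD(1)[OF h(1)] validD(1)[OF g] h(3) by (intro ext) metis
   thus "y \<in> {lab i Y Z g}" using h(2) by simp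
  qed
  from card_mono[OF _ this] show ?thesis unfolding op_cost_single[OF p(2)] by simp
 qed
 hence "(SUM g:valid i Y Z. cost (lab i Y Z g) p) <= card (valid i Y Z)"
  using sum_bounded_above[of "valid i Y Z" "%g. cost (lab i Y Z g) p" 1] by simp
 thus "real (SUM g:valid i Y Z. cost (lab i Y Z g) p) <= label_bound"
  using valid_card(2)[OF i] by linarith
qed

text \<open>Two joined assignments can be recovered from the glued one, since they agree on the
  overlap and vanish outside their domains. The candidates inspected are therefore no more than the
  results, which form a bounded relation.\<close>

lemma join_cost:
 assumes p: "guard p = label_guard d (pair_label Y Z)" "addrs p = [addr_exps W (XArg 1) (pair_label Y' Z') (Y Int Y') (%k. XArg (3 + k))]"
  and W: "Y <= {..<W}" "Z <= {..<W}" "Y' <= {..<W}" "Z' <= {..<W}" and fin: "finite Vall"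
  and j: "!!i. i < length Rs ==> sid i = d ==> typed i (Y Un Y') Z3 &
   (ALL g:valid i Y Z. ALL h:valid i Y' Z'. (ALL v:Y Int Y'. g v = h v) --> (%v. if v \<in> Y then g v else h v) \<in> valid i (Y Un Y') Z3)"
 shows "real (SUM x:Vall. cost x p) <= real (length Rs) * label_bound"
proof (rule label_cost[OF p(1) W(1,2) _ fin])
 fix i assume i: "i < length Rs" "sid i = d" and Y: "typed i Y Z"
 let ?V = "valid i (Y Un Y') Z3"
 let ?F = "%g. {h:valid i Y' Z'. typed i Y' Z' & (ALL v:Y Int Y'. h v = g v)}"
 note j' = j[OF i]
 have fV: "finite ?V" by (rule valid_card(1)[OF i(1)]) (use j' in blast)
 have fF: "finite (?F g)" for g using valid_card(1)[OF i(1), of Y' Z'] by (cases "typed i Y' Z'") auto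
 have "cost (lab i Y Z g) p <= card (?F g)" if g: "g \<in> valid i Y Z" for g
 proof -
  note g0 = valid_zero[OF i(1) Y g]
  have YY: "Y Int Y' <= {..<W}" using W by blast
  have "{y \<in> Vall. bucket_addr W i (pair_label Y' Z') (Y Int Y') g \<in> set (kf y)} <= lab i Y' Z' ` ?F g"
  proof
   fix y assume "y \<in> {y \<in> Vall. bucket_addr W i (pair_label Y' Z') (Y Int Y') g \<in> set (kf y)}"
   hence y: "y \<in> Vall" "bucket_addr W i (pair_label Y' Z') (Y Int Y') g \<in> set (kf y)" by auto
   obtain h where "typed i Y' Z'" "h \<in> valid i Y' Z'" "y = lab i Y' Z' h" "ALL v:Y Int Y'. h v = g v"
    by (rule Vall_key_label[OF y(1) YY y(2) W(3,4)])
   thus "y \<in> lab i Y' Z' ` ?F g" by blast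
  qed
  from card_mono[OF _ this] fF have "card {y \<in> Vall. bucket_addr W i (pair_label Y' Z') (Y Int Y') g \<in> set (kf y)} <= card (?F g)"
   by (meson card_image_le finite_imageI le_trans)
  thus ?thesis unfolding op_cost_single[OF p(2)] label_addr[OF g0] by simp
 qed
 hence "(SUM g:valid i Y Z. cost (lab i Y Z g) p) <= (SUM g:valid i Y Z. card (?F g))"
  by (rule sum_mono)
 also have "... = card (Sigma (valid i Y Z) ?F)" using valid_card(1)[OF i(1) Y] fF by simp
 also have "... <= card ?V"
 proof (rule card_inj_on_le[OF _ _ fV])
  let ?u = "%(g, h). %v. if v \<in> Y then g v else h v"
  show "?u ` Sigma (valid i Y Z) ?F <= ?V" using j' by fastforce
  show "inj_on ?u (Sigma (valid i Y Z) ?F)"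
  proof (rule inj_onI, clarify)
   fix g h g' h' assume e: "(%v. if v \<in> Y then g v else h v) = (%v. if v \<in> Y then g' v else h' v)"
    and g: "g \<in> valid i Y Z" "g' \<in> valid i Y Z" and h: "h \<in> valid i Y' Z'" "h' \<in> valid i Y' Z'"
     "ALL v:Y Int Y'. h v = g v" "ALL v:Y Int Y'. h' v = g' v"
   have gg: "g v = g' v" for v using fun_cong[OF e, of v] validD(1)[OF g(1), of v] validD(1)[OF g(2), of v] by (cases "v \<in> Y") auto
   have "h v = h' v" for v
    using fun_cong[OF e, of v] validD(1)[OF h(1), of v] validD(1)[OF h(2), of v] h(3,4) gg[of v]
    by (cases "v \<in> Y'"; cases "v \<in> Y") auto
   thus "g = g' & h = h'" using gg by blast
  qed
 qed
 finally show "real (SUM g:valid i Y Z. cost (lab i Y Z g) p) <= label_bound"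
  using valid_card(2)[OF i(1) conjunct1[OF j']] by linarith
qed

text \<open>The smallest bucket for an assignment \<open>g\<close> has at most as many entries as
  the smallest set of matching tuples among the atoms containing \<open>v\<close>; summed over all
  \<open>g\<close>, this is bounded through covers of \<open>insert v Y\<close>, which lies in a
  bag.\<close>

lemma ext_cost:
 assumes e: "ext_ok (body_edges (fst (hs ! d))) (body_vars (fst (hs ! d))) (idb_vars (hs ! d)) (bag_ok (fst (hs ! d))) Y Z v"
  and W: "Y <= {..<W}" "Z <= {..<W}" and fin: "finite Vall"
 shows "real (SUM x:Vall. cost x (ext_op W d (hs ! d) Y Z v)) <= real (length Rs) * label_bound"
proof (rule label_cost[OF _ W _ fin])
 let ?p = "ext_op W d (hs ! d) Y Z v"
 show "guard ?p = label_guard d (pair_label Y Z)" by (simp add: ext_op_def Let_def)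
 fix i assume i: "i < length Rs" "sid i = d" and Y: "typed i Y Z"
 note d = i(2)[symmetric]
 have bag: "bag_ok (tss i) (insert v Y)" and vV: "v \<in> bvars i" using e unfolding ext_ok_def d by auto
 let ?A = "{a:batoms i. v \<in> vars i a}"
 have A: "finite ?A" "?A ~= {}" using finite_batoms vV unfolding body_vars_eq[OF i(1)] by auto
 let ?m = "matching (vars i) (Rel i) Y"
 have sub: "valid i Y Z <= consistent (batoms i) (vars i) (Rel i) Y" unfolding valid_def by blast
 interpret r0: relations "batoms i" "vars i" "Rel i" "%_. 0" by (rule relations_Rel[OF i(1)]) simp
 have YV: "Y <= bvars i" using Y unfolding typed_def is_label_def by auto
 have fc: "finite (consistent (batoms i) (vars i) (Rel i) Y)"
  by (rule r0.finite_consistent[OF fin_W[OF W(1)]]) (use YV body_vars_eq[OF i(1)] in auto)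
 have c: "cost (lab i Y Z g) ?p <= Min (card ` ?m g ` ?A)" if g: "g \<in> valid i Y Z" for g
 proof -
  note g0 = valid_zero[OF i(1) Y g]
  let ?x = "lab i Y Z g"
  let ?b = "%a. addr_exps W (XArg 1) (2 * a) (vars i a Int Y) (%k. XArg (3 + k))"
  have addr: "set (addrs ?p) = ?b ` ?A"
   unfolding ext_op_def Let_def d batoms_def by (auto simp: length_tss[OF i(1)])
  have le: "card {y \<in> Vall. ev ?x ?x (?b a) \<in> set (kf y)} <= card (?m g a)" if a: "a \<in> ?A" for a
  proof -
   have s: "vars i a Int Y <= {..<W}" using W by blast
   have fm: "finite (?m g a)" using a r0.finite_matching by blast
   have "{y \<in> Vall. ev ?x ?x (?b a) \<in> set (kf y)} <= aux W i (2 * a) ` ?m g a"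
   proof
    fix y assume "y \<in> {y \<in> Vall. ev ?x ?x (?b a) \<in> set (kf y)}"
    hence y: "y \<in> Vall" "bucket_addr W i (2 * a) (vars i a Int Y) g \<in> set (kf y)"
     unfolding label_addr[OF g0] by auto
    obtain h where "h \<in> Rel i a" "y = aux W i (2 * a) h" "ALL v:vars i a Int Y. h v = g v"
     by (rule Vall_key_atom[OF y(1) s y(2)])
    thus "y \<in> aux W i (2 * a) ` ?m g a" unfolding matching_def by blast
   qed
   from card_mono[OF _ this] fm show ?thesis by (meson card_image_le finite_imageI le_trans)
  qed
  have "cost ?x ?p <= Min ((%b. card {y \<in> Vall. ev ?x ?x b \<in> set (kf y)}) ` (?b ` ?A))"
   unfolding op_cost_def addr by simp
  also have "... <= Min (card ` ?m g ` ?A)"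
  proof (rule Min.boundedI)
   fix n assume "n \<in> card ` ?m g ` ?A"
   then obtain a where a: "a \<in> ?A" "n = card (?m g a)" by blast
   have "Min ((%b. card {y \<in> Vall. ev ?x ?x b \<in> set (kf y)}) ` (?b ` ?A)) <=
     card {y \<in> Vall. ev ?x ?x (?b a) \<in> set (kf y)}"
    by (rule Min_le) (use A a(1) in auto)
   thus "Min ((%b. card {y \<in> Vall. ev ?x ?x b \<in> set (kf y)}) ` (?b ` ?A)) <= n"
    using le[OF a(1)] a(2) by linarith
  qed (use A in auto)
  finally show ?thesis .
 qed
 show "real (SUM g:valid i Y Z. cost (lab i Y Z g) ?p) <= label_bound"
 proof (rule bag_bound[OF i(1) bag])
  fix x assume x: "relations (batoms i) (Rel i) x"
   "!!u. u \<in> insert v Y ==> 1 <= (SUM a:{a:batoms i. u \<in> vars i a}. x a)"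
  have "(SUM g:valid i Y Z. cost (lab i Y Z g) ?p) <= (SUM g:valid i Y Z. Min (card ` ?m g ` ?A))"
   by (rule sum_mono[OF c])
  also have "... <= (SUM g:consistent (batoms i) (vars i) (Rel i) Y. Min (card ` ?m g ` ?A))"
   by (rule sum_mono2[OF fc sub]) simp
  finally have "real (SUM g:valid i Y Z. cost (lab i Y Z g) ?p) <=
    real (SUM g:consistent (batoms i) (vars i) (Rel i) Y. Min (card ` ?m g ` ?A))"
   by (rule of_nat_mono)
  also have "... = (SUM g:consistent (batoms i) (vars i) (Rel i) Y. real (Min (card ` ?m g ` ?A)))"
   by (rule of_nat_sum)
  also have "... <= (PROD a:batoms i. real (card (Rel i a)) powr x a)"
   using relations.sum_Min_matching_le[OF x(1) fin_W[OF W(1)], of "vars i" v] x(2) by (simp add: image_image)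
  finally show "real (SUM g:valid i Y Z. cost (lab i Y Z g) ?p) <=
   (PROD a:batoms i. real (card (Rel i a)) powr x a)" .
 qed
qed

text \<open>The factor counts, per rule: \<open>width_const\<close> each for tuples, rule facts and
  EDB atom assignments, 1 for the seed, and \<open>4 ^ W\<close> for the pairs \<open>(Y, Z)\<close>
  of variable sets.\<close>

lemma Vall_card: "finite Vall" "real (card Vall) <= real (length Rs) * label_bound * real (3 * width_const + 1 + 4 ^ W)"
proof -
 let ?n = "length Rs" and ?w = "real width_const"
 let ?L = "{..<?n} \<times> Pow {..<W} \<times> Pow {..<W}"
 let ?J = "%(i, Y, Z). if typed i Y Z then lab i Y Z ` valid i Y Z else {}"
 let ?A = "%(i, a). aux W i (2 * a) ` Rel i a"
 have O: "finite Vorig" "real (card Vorig) <= real (card (preds (set Rs))) * label_bound"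
 proof -
  note * = card_UN_bound[of "preds (set Rs)" tuples, OF preds_card(1) tuples_card(1,2)]
  show "finite Vorig" unfolding tuples_card(3) by (rule *(1))
  have "real (card Vorig) <= real (card (preds (set Rs))) * idb_bound" unfolding tuples_card(3) by (rule *(2))
  thus "real (card Vorig) <= real (card (preds (set Rs))) * label_bound"
   using mult_left_mono[OF idb_le_label, of "real (card (preds (set Rs)))"] by linarith
 qed
 have R: "Vrule <= (%(i, a). rule_fact W i a) ` atoms" "finite ((%(i, a). rule_fact W i a) ` atoms)"
  unfolding Vrule_def atoms_def batoms_def by auto
 have S: "Vseed <= seed W ` {..<?n}" unfolding Vseed_def by auto
 have A: "Vatom <= (UN z:atoms. ?A z)"
 proof
  fix x assume "x \<in> Vatom"
  then obtain i a g where "i < ?n" "a \<in> batoms i" "g \<in> Rel i a" "x = aux W i (2 * a) g" unfolding Vatom_def by blast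
  thus "x \<in> (UN z:atoms. ?A z)" unfolding atoms_def batoms_def by (intro UN_I[of "(i, a)"]) auto
 qed
 have Ac: "finite (UN z:atoms. ?A z)" "real (card (UN z:atoms. ?A z)) <= real (card atoms) * label_bound"
 proof -
  have *: "finite (?A z) & real (card (?A z)) <= label_bound" if z: "z \<in> atoms" for z
  proof -
   obtain i a where ia: "z = (i, a)" "i < ?n" "a < natoms i" using z unfolding atoms_def by auto
   note R = Rel_card[OF ia(2,3)]
   have "card (?A z) <= card (rel (fst (atm i a)))"
    unfolding ia(1) using card_image_le[OF R(1), of "aux W i (2 * a)"] R(2) by simp
   thus ?thesis using R(1) relation_card(2)[OF atom_pred[OF ia(2,3)]] idb_le_label unfolding ia(1) by auto
  qed
  show "finite (UN z:atoms. ?A z)" "real (card (UN z:atoms. ?A z)) <= real (card atoms) * label_bound"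
   by (rule card_UN_bound[OF atoms_card(1)]; use * in blast)+
 qed
 have J: "Vlab <= (UN z:?L. ?J z)"
 proof
  fix x assume "x \<in> Vlab"
  then obtain i Y Z g where *: "i < ?n" "typed i Y Z" "g \<in> valid i Y Z" "x = lab i Y Z g" unfolding Vlab_def by blast
  thus "x \<in> (UN z:?L. ?J z)" using typed_W[OF *(1,2)] by (intro UN_I[of "(i, Y, Z)"]) auto
 qed
 have Jc: "finite (UN z:?L. ?J z)" "real (card (UN z:?L. ?J z)) <= real (card ?L) * label_bound"
 proof -
  have *: "finite (?J z) & real (card (?J z)) <= label_bound" if z: "z \<in> ?L" for z
  proof -
   obtain i Y Z where ia: "z = (i, Y, Z)" "i < ?n" using z by auto
   show ?thesis
   proof (cases "typed i Y Z")
    case True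
    note R = valid_card[OF ia(2) True]
    have "card (lab i Y Z ` valid i Y Z) <= card (valid i Y Z)" by (rule card_image_le[OF R(1)])
    thus ?thesis unfolding ia(1) using R True by auto
   qed (use ia one_le_label in auto)
  qed
  have "finite ?L" by simp
  thus "finite (UN z:?L. ?J z)" "real (card (UN z:?L. ?J z)) <= real (card ?L) * label_bound"
   by (rule card_UN_bound; use * in blast)+
 qed
 have Lc: "real (card ?L) = real ?n * 4 ^ W"
  by (simp add: card_cartesian_product card_Pow power_mult_distrib[symmetric])
 show "finite Vall" unfolding Vall_def
  using O(1) R S A Ac(1) J Jc(1) finite_subset by (meson finite_UnI finite_imageI finite_lessThan)
 have "card Vall <= card Vorig + card Vrule + card Vseed + card Vatom + card Vlab"
  unfolding Vall_def by (intro order_trans[OF card_Un_le] add_mono card_Un_le order_refl)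
 also have "... <= card Vorig + card atoms + ?n + card (UN z:atoms. ?A z) + card (UN z:?L. ?J z)"
  using card_mono[OF R(2,1)] card_image_le[OF atoms_card(1), of "%(i, a). rule_fact W i a"]
   card_mono[OF _ S] card_image_le[of "{..<?n}" "seed W"] card_mono[OF Ac(1) A] card_mono[OF Jc(1) J]
  by (intro add_mono) (auto intro: order_trans)
 finally have "real (card Vall) <= real (card Vorig + card atoms + ?n + card (UN z:atoms. ?A z) + card (UN z:?L. ?J z))"
  by (rule of_nat_mono)
 also have "... = real (card Vorig) + real (card atoms) + real ?n + real (card (UN z:atoms. ?A z)) + real (card (UN z:?L. ?J z))"
  by (simp only: of_nat_add)
 also have "... <= real (?n * width_const) * label_bound + real (?n * width_const) * label_bound + real ?n * label_bound
   + real (?n * width_const) * label_bound + real ?n * 4 ^ W * label_bound"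
 proof (intro add_mono)
  have T: "0 <= label_bound" using one_le_label by simp
  have n: "real (card atoms) <= real (?n * width_const)" using atoms_card(2) by (rule of_nat_mono)
  show "real (card Vorig) <= real (?n * width_const) * label_bound"
   using O(2) mult_right_mono[OF preds_card(2) T] by linarith
  show "real (card atoms) <= real (?n * width_const) * label_bound"
   using mult_mono[OF n one_le_label] by simp
  show "real ?n <= real ?n * label_bound" using mult_left_mono[OF one_le_label, of "real ?n"] by simp
  show "real (card (UN z:atoms. ?A z)) <= real (?n * width_const) * label_bound"
   using Ac(2) mult_right_mono[OF n T] by linarith
  show "real (card (UN z:?L. ?J z)) <= real ?n * 4 ^ W * label_bound" using Jc(2) unfolding Lc .
 qed
 also have "... = real ?n * label_bound * real (3 * width_const + 1 + 4 ^ W)" by (simp add: algebra_simps)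
 finally show "real (card Vall) <= real ?n * label_bound * real (3 * width_const + 1 + 4 ^ W)" .
qed

text \<open>The pairs inspected consist of a tuple and an occurrence of its predicate; each
  occurrence is met by at most \<open>idb_bound\<close> tuples.\<close>

lemma conv_cost:
 "real (SUM x:Vall. cost x (conv_op W d tt a l cs)) <= real (length Rs) * label_bound * real width_const"
proof -
 let ?A = "{x:Vall. x ! 0 = 0}" and ?F = "%x. {(i, a). (i, a) \<in> atoms & fst (atm i a) = x ! 1}"
 have guard: "x ! 0 = 0 & ev x x [Lit 2, XArg 1] = [2, x ! 1]" if x: "x \<in> Vall" "eqs st x x [(XArg 0, Lit 0)]" for x
  using x(2) Vall_kind(4)[OF x(1)] by (auto simp: eqs_def nth_or_0_def)
 have "(SUM x:Vall. cost x (conv_op W d tt a l cs)) = (SUM x:?A. cost x (conv_op W d tt a l cs))"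
  using guard Vall_card(1) by (intro sum.mono_neutral_right) (auto simp: op_cost_def conv_op_def)
 also have "... <= (SUM x:?A. card (?F x))"
 proof (rule sum_mono)
  fix x assume x: "x \<in> ?A"
  have sub: "{y \<in> Vall. [2, x ! 1] \<in> set (kf y)} <= (%(i, a). rule_fact W i a) ` ?F x"
  proof
   fix y assume "y \<in> {y \<in> Vall. [2, x ! 1] \<in> set (kf y)}"
   hence y: "y \<in> Vall" "[2, x ! 1] \<in> set (kf y)" by auto
   obtain i a where "i < length Rs" "a \<in> batoms i" "y = rule_fact W i a" "fst (atm i a) = x ! 1"
    by (rule Vall_rule_key[OF y])
   thus "y \<in> (%(i, a). rule_fact W i a) ` ?F x"
    unfolding atoms_def batoms_def by (intro image_eqI[of _ _ "(i, a)"]) auto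
  qed
  have F: "finite (?F x)" by (rule finite_subset[OF _ atoms_card(1)]) auto
  have "card {y \<in> Vall. [2, x ! 1] \<in> set (kf y)} <= card (?F x)"
   using card_mono[OF finite_imageI[OF F] sub] card_image_le[OF F, of "%(i, a). rule_fact W i a"] by linarith
  thus "cost x (conv_op W d tt a l cs) <= card (?F x)"
   using guard x by (simp add: op_cost_def conv_op_def)
 qed
 finally have "real (SUM x:Vall. cost x (conv_op W d tt a l cs)) <= real (SUM x:?A. card (?F x))" by (rule of_nat_mono)
 also have "... <= real (card atoms) * idb_bound"
 proof (rule sum_card_fibres)
  fix z assume z: "z \<in> atoms"
  obtain i a where ia: "z = (i, a)" by (cases z)
  have "{x \<in> ?A. z \<in> ?F x} = tuples (fst (atm i a))" using z unfolding ia tuples_def by auto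
  thus "real (card {x \<in> ?A. z \<in> ?F x}) <= idb_bound"
   using tuples_card(2) z unfolding preds_atoms ia by (metis (no_types, lifting) case_prod_conv image_eqI)
 qed (use Vall_card(1) atoms_card(1) in auto)
 also have "... <= real (length Rs * width_const) * label_bound"
  using of_nat_mono[OF atoms_card(2), where 'a = real] idb_le_label N_le_idb N by (intro mult_mono) auto
 finally show ?thesis by (simp add: algebra_simps)
qed

lemma seed_cost: "real (SUM x:Vall. cost x (seed_op W d h)) <= real (length Rs) * label_bound"
proof -
 let ?A = "{x:Vall. x ! 0 = 3}"
 have guard: "x ! 0 = 3 & ev x x [Lit 3, XArg 1] = [3, x ! 1]" if x: "x \<in> Vall" "eqs st x x (guard (seed_op W d h))" for x
  using x(2) Vall_kind(4)[OF x(1)] by (auto simp: eqs_def nth_or_0_def seed_op_def)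
 have sub: "{y \<in> Vall. [3, i] \<in> set (kf y)} <= {seed W i}" for i
 proof
  fix y assume "y \<in> {y \<in> Vall. [3, i] \<in> set (kf y)}"
  hence y: "y \<in> Vall" "[3, i] \<in> set (kf y)" by auto
  have no: "[3, i] \<notin> set (kf (aux W j l g))" if "ALL k>=W. g k = 0" for j l g
   unfolding keys_aux[OF that] by (auto simp: bucket_addr_def)
  have "y \<notin> Vatom" using y(2) no Rel_zero batoms_lt unfolding Vatom_def by blast
  moreover have "y \<notin> Vlab" using y(2) no valid_zero unfolding Vlab_def by blast
  ultimately have "y \<in> Vorig Un Vrule Un Vseed" using y(1) unfolding Vall_def by blast
  thus "y \<in> {seed W i}" using y(2) unfolding Vorig_def Vrule_def Vseed_def
   by (auto simp: keys_orig keys_rule_fact keys_seed)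
 qed
 have "(SUM x:Vall. cost x (seed_op W d h)) = (SUM x:?A. cost x (seed_op W d h))"
  using guard Vall_card(1) by (intro sum.mono_neutral_right) (auto simp: op_cost_def)
 also have "... <= (SUM x:?A. 1)"
 proof (rule sum_mono)
  fix x assume x: "x \<in> ?A"
  have "card {y \<in> Vall. [3, x ! 1] \<in> set (kf y)} <= 1" using card_mono[OF _ sub[of "x ! 1"]] by simp
  moreover have "addrs (seed_op W d h) = [[Lit 3, XArg 1]]" by (simp add: seed_op_def)
  ultimately show "cost x (seed_op W d h) <= 1"
   using guard[of x] x by (cases "eqs st x x (guard (seed_op W d h))") (simp_all add: op_cost_def)
 qed
 also have "... <= card (seed W ` {..<length Rs})"
  using Vall_kind(3) by (simp, intro card_mono) (auto simp: Vseed_def)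
 also have "... <= length Rs" using card_image_le[of "{..<length Rs}" "seed W"] by simp
 finally have "real (SUM x:Vall. cost x (seed_op W d h)) <= real (length Rs)" by (rule of_nat_mono)
 thus ?thesis using mult_left_mono[OF one_le_label, of "real (length Rs)"] by simp
qed

lemma op_total:
 assumes "p \<in> set (all_ops W hs)"
 shows "real (SUM x:Vall. cost x p) <= real (length Rs) * label_bound * real (width_const + 1)"
proof -
 have nT: "0 <= real (length Rs) * label_bound" using one_le_label by simp
 have *: "real (SUM x:Vall. cost x p) <= real (length Rs) * label_bound * real (width_const + 1)"
  if "real (SUM x:Vall. cost x p) <= real (length Rs) * label_bound |
   real (SUM x:Vall. cost x p) <= real (length Rs) * label_bound * real width_const"
  using that
 proof
  assume "real (SUM x:Vall. cost x p) <= real (length Rs) * label_bound"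
  thus ?thesis using mult_left_mono[OF _ nT, of 1 "real (width_const + 1)"] by simp
 next
  assume "real (SUM x:Vall. cost x p) <= real (length Rs) * label_bound * real width_const"
  thus ?thesis using mult_left_mono[OF _ nT, of "real width_const" "real (width_const + 1)"] by simp
 qed
 obtain d where d: "d < length hs" "is_op W d (hs ! d) p" using assms unfolding set_all_ops by blast
 note fin = Vall_card(1)
 from d(2) show ?thesis
 proof cases
  case (op_join Y Z Y' Z' Z3)
  have "real (SUM x:Vall. cost x p) <= real (length Rs) * label_bound"
  proof (rule join_cost[OF _ _ op_join(2-5) fin])
   show "guard p = label_guard d (pair_label Y Z)"
    "addrs p = [addr_exps W (XArg 1) (pair_label Y' Z') (Y Int Y') (%k. XArg (3 + k))]"
    unfolding op_join(1) join_op_def by simp_all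
   fix i assume i: "i < length Rs" "sid i = d"
   hence j: "join_cond (sh i) Y Z Y' Z' Z3 | join_cond (sh i) Y' Z' Y Z Z3" using op_join(7) by simp
   show "typed i (Y Un Y') Z3 & (ALL g:valid i Y Z. ALL h:valid i Y' Z'. (ALL v:Y Int Y'. g v = h v) -->
     (%v. if v \<in> Y then g v else h v) \<in> valid i (Y Un Y') Z3)"
    using join_typed_sym[OF i(1) j] valid_join_sym[OF i(1) j] by blast
  qed
  thus ?thesis by (intro * disjI1)
 next
  case (op_ext Y Z v)
  thus ?thesis using ext_cost[OF op_ext(5,2,3) fin] by (intro * disjI1) simp
 next
  case (op_weaken Y Z Y' Z')
  thus ?thesis using self_cost[OF _ _ op_weaken(2,3) fin, of p d] by (intro * disjI1) (simp add: weaken_op_def)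
 next
  case op_out
  show ?thesis
  proof (cases "EX i<length Rs. sid i = d")
   case True
   then obtain i where i: "i < length Rs" "sid i = d" by blast
   have "avars (fst (hs ! d)) 0 <= {..<W}" "body_vars (fst (hs ! d)) <= {..<W}"
    using vars_W[OF i(1) rule_atoms_pos] body_vars_W[OF i(1)] i(2) by auto
   thus ?thesis using self_cost[OF _ _ _ _ fin, of p d] op_out by (intro * disjI1) (simp add: out_op_def)
  next
   case False
   have "cost x p = 0" if x: "x \<in> Vall" for x
   proof -
    have "~ eqs st x x (guard p)"
    proof
     assume "eqs st x x (guard p)"
     hence e: "nth_or_0 x 0 = 1" "st [7, nth_or_0 x 1] = d" unfolding op_out out_op_def label_guard_def eqs_def by auto
     hence "x \<in> Vatom Un Vlab" using Vall_kind(2,4)[OF x] unfolding nth_or_0_def by auto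
     then obtain i l gx where "x = aux W i l gx" "i < length Rs" unfolding Vatom_def Vlab_def by blast
     thus False using False e(2) sid by auto
    qed
    thus ?thesis by (simp add: op_cost_def)
   qed
   thus ?thesis using one_le_label by simp
  qed
 qed (use conv_cost seed_cost * in auto)
qed

definition run_const :: nat where
 "run_const = 3 * width_const + 1 + 4 ^ W + length (all_ops W hs) * (width_const + 1)"

text \<open>Stated for subsets \<open>V\<close> of \<open>Vall\<close> so that it serves both runs.
  No fact is queued twice, so the sum over the queue is at most a sum over
  \<open>Vall\<close>.\<close>

lemma run_cost:
 assumes Q: "distinct Q" "set Q <= V" and V: "V <= Vall"
 shows "real (\<Sum>k=h..<length Q. 1 + (SUM p<-all_ops W hs. op_cost st kf V (Q ! k) p)) <= real (length Rs) * label_bound * real run_const"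
proof -
 let ?c = "%x. 1 + (SUM p<-all_ops W hs. cost x p)"
 have "(\<Sum>k=h..<length Q. 1 + (SUM p<-all_ops W hs. op_cost st kf V (Q ! k) p)) <= (\<Sum>k=h..<length Q. ?c (Q ! k))"
  by (intro sum_mono add_mono sum_list_mono op_cost_mono[OF V Vall_card(1)]) (auto dest: addrs_nonempty)
 also have "... <= (SUM k<length Q. ?c (Q ! k))" by (intro sum_mono2) auto
 also have "... = (SUM x:set Q. ?c x)"
  using sum.reindex_bij_betw[OF bij_betw_nth[OF Q(1) refl refl], of ?c] by simp
 also have "... <= (SUM x:Vall. ?c x)" using Q(2) V Vall_card(1) by (intro sum_mono2) auto
 also have "... = card Vall + (SUM p<-all_ops W hs. SUM x:Vall. cost x p)"
  by (simp only: sum.distrib sum_sum_list card_eq_sum)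
 finally have 1: "real (\<Sum>k=h..<length Q. 1 + (SUM p<-all_ops W hs. op_cost st kf V (Q ! k) p)) <=
   real (card Vall + (SUM p<-all_ops W hs. SUM x:Vall. cost x p))" by (rule of_nat_mono)
 have "real (SUM p<-ps. SUM x:Vall. cost x p) <= real (length ps) * (real (length Rs) * label_bound * real (width_const + 1))"
  if "set ps <= set (all_ops W hs)" for ps
  using that
 proof (induction ps)
  case (Cons p ps)
  thus ?case using op_total[of p] by (simp add: algebra_simps)
 qed simp
 from this[of "all_ops W hs"] show ?thesis using 1 Vall_card(2) unfolding run_const_def by (simp add: algebra_simps)
qed

end


section \<open>Reading the input\<close>

definition For :: "nat => hexp => hcom => hcom" where
 "For q e c = Then (Assign q (Num 0)) (Loop (HLess (Reg q) e) (Then c (Assign q (Succ (Reg q)))))"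

text \<open>The second argument of the invariant counts the loop iterations.\<close>

lemma hrun_For:
 assumes I0: "I 0 0 (r(q := 0), m)"
  and step: "!!k t r m. k < n ==> I k t (r, m) ==> r q = k ==>
   hrun c (r, m) (%t' s'. fst s' q = k & I (Suc k) (Suc (t + t')) ((fst s')(q := Suc k), snd s'))"
  and n: "!!k t r m. k <= n ==> I k t (r, m) ==> heval (r, m) e = n"
  and P: "!!t r m. I n t (r, m) ==> P t (r, m)"
 shows "hrun (For q e c) (r, m) P"
proof -
 have loop: "hrun (Loop (HLess (Reg q) e) (Then c (Assign q (Succ (Reg q))))) (r, m) (%t'. P (t + t'))"
  if "k <= n" "I k t (r, m)" "r q = k" for k t r m
  using that
 proof (induction "n - k" arbitrary: k t r m)
  case 0
  thus ?case using n[of k t r m] P[of t r m] by (intro hrun_Loop_false) auto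
 next
  case (Suc d)
  have h: "hholds (r, m) (HLess (Reg q) e)" using Suc n[of k t r m] by auto
  have k: "k < n" using Suc by simp
  show ?case
  proof (rule hrun_Loop_true[OF h], rule hrun_Then, rule hrun_mono[OF step[OF k Suc.prems(2,3)]])
   fix t' s' assume a: "fst s' q = k & I (Suc k) (Suc (t + t')) ((fst s')(q := Suc k), snd s')"
   obtain r' m' where s': "s' = (r', m')" by (cases s')
   have "hrun (Loop (HLess (Reg q) e) (Then c (Assign q (Succ (Reg q))))) (r'(q := Suc k), m') (%t''. P (Suc (t + t') + t''))"
    using Suc.hyps k a s' by (intro Suc.hyps(1)) auto
   thus "hrun (Assign q (Succ (Reg q))) s' (%n' s''. hrun (Loop (HLess (Reg q) e) (Then c (Assign q (Succ (Reg q))))) s''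
      (%n''. P (t + Suc (t' + n' + n''))))"
    unfolding s' using a s' by (intro hrun_Assign) (simp add: add.assoc)
  qed
 qed
 show ?thesis unfolding For_def
  using loop[OF le0 I0] by (intro hrun_Then hrun_Assign) simp
qed

fun checks :: "(hexp \<times> hexp \<times> bool) list => hcom => hcom => hcom" where
 "checks [] c c' = c"
| "checks ((a, b, v) # ts) c c' = Cond (HEq a b) (if v then checks ts c c' else c') (if v then c' else checks ts c c')"

lemma hrun_checks:
 assumes "ALL (a, b, v):set ts. (heval s a = heval s b) = v ==> hrun c s P"
  and "~ (ALL (a, b, v):set ts. (heval s a = heval s b) = v) ==> hrun c' s P"
 shows "hrun (checks ts c c') s P"
 using assms
proof (induction ts)
 case (Cons t ts)
 obtain a b v where t: "t = (a, b, v)" by (cases t)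
 show ?case unfolding t checks.simps by (rule hrun_Cond) (use Cons t in \<open>auto\<close>)
qed simp

abbreviation "rI == rg 4 0"
abbreviation "rA == rg 4 1"
abbreviation "rJ == rg 4 2"

text \<open>Array 9 marks the IDB predicates, which are the heads of rules with nonempty
  body.\<close>

definition mark_code :: hcom where
 "mark_code = For rI (Cell [Num 0]) (Cond (HLess (Num 0) (Cell [Num 0, Reg rI]))
   (Put [Num 9, Cell [Num 0, Reg rI, Num 0]] (Num 1)) skip)"

definition positions :: "trm list list => (nat \<times> nat) list" where
 "positions tss = concat (map (%a. map (Pair a) [0..<length (tss ! a)]) [0..<length tss])"

text \<open>The rule in \<open>rI\<close> is compared with a shape: numbers of atoms and arguments,
  kinds, the equality pattern of the variables over all pairs of positions, and the place of the IDB
  atom by means of the marks. \<open>Succ\<close> accounts for the head. The number of tests depends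
  on the shape only.\<close>

definition shape_tests :: "shape => (hexp \<times> hexp \<times> bool) list" where
 "shape_tests h = (let tss = fst h in
   (Succ (Cell [Num 0, Reg rI]), Num (length tss), True) #
   map (%a. (Cell [Num 0, Reg rI, Num a, Num 0], Num (length (tss ! a)), True)) [0..<length tss] @
   map (%x. (Cell [Num 0, Reg rI, Num (fst x), Num (snd x), Num 0], Num (trm_kind (tss ! fst x ! snd x)), True)) (positions tss) @
   concat (map (%x. map (%y. (Cell [Num 0, Reg rI, Num (fst x), Num (snd x), Num 1],
      Cell [Num 0, Reg rI, Num (fst y), Num (snd y), Num 1], tss ! fst x ! snd x = tss ! fst y ! snd y))
     (filter (%y. trm_kind (tss ! fst y ! snd y) = 0) (positions tss)))
    (filter (%x. trm_kind (tss ! fst x ! snd x) = 0) (positions tss))) @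
   map (%a. (Cell [Num 9, Cell [Num 0, Reg rI, Num a]], Num 1, a = snd h)) [1..<length tss])"

definition fits :: "mem => nat => shape => bool" where
 "fits m i h \<longleftrightarrow> (let tss = fst h; P = set (positions tss) in
   Suc (m [0, i]) = length tss &
   (ALL a<length tss. m [0, i, a, 0] = length (tss ! a)) &
   (ALL x:P. m [0, i, fst x, snd x, 0] = trm_kind (tss ! fst x ! snd x)) &
   (ALL x:P. trm_kind (tss ! fst x ! snd x) = 0 --> (ALL y:P. trm_kind (tss ! fst y ! snd y) = 0 -->
    (m [0, i, fst x, snd x, 1] = m [0, i, fst y, snd y, 1]) = (tss ! fst x ! snd x = tss ! fst y ! snd y))) &
   (ALL a:{1..<length tss}. (m [9, m [0, i, a]] = 1) = (a = snd h)))"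

lemma set_positions: "set (positions tss) = {(a, k). a < length tss & k < length (tss ! a)}"
 unfolding positions_def by auto

lemma shape_tests_fits:
 "(ALL (a, b, v):set (shape_tests h). (heval (r, m) a = heval (r, m) b) = v) \<longleftrightarrow> fits m (r rI) h"
 unfolding shape_tests_def fits_def Let_def by (simp add: ball_Un) (simp add: Ball_def imp_conjL)

fun classify :: "shape list => nat list => hcom" where
 "classify hs [] = skip"
| "classify hs (d # ds) = checks (shape_tests (hs ! d)) (Put [Num 7, Reg rI] (Num d)) (classify hs ds)"

lemma hrun_classify:
 assumes "EX d:set ds. fits m (r rI) (hs ! d)"
  and "!!d. d \<in> set ds ==> fits m (r rI) (hs ! d) ==> P 0 (r, m([7, r rI] := d))"
 shows "hrun (classify hs ds) (r, m) P"
 using assms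
proof (induction ds)
 case (Cons d ds)
 show ?case unfolding classify.simps
 proof (rule hrun_checks; unfold shape_tests_fits)
  assume "fits m (r rI) (hs ! d)"
  hence "P 0 (r, m([7, r rI] := d))" by (intro Cons.prems(2)) simp_all
  thus "hrun (Put [Num 7, Reg rI] (Num d)) (r, m) P" by (intro hrun_Put) simp
 next
  assume "~ fits m (r rI) (hs ! d)"
  thus "hrun (classify hs ds) (r, m) P" using Cons by simp
 qed
qed simp

definition shape_code :: "shape list => hcom" where
 "shape_code hs = For rI (Cell [Num 0]) (classify hs [0..<length hs])"

definition rule_code :: "nat => hcom" where
 "rule_code W = For rI (Cell [Num 0]) (For rA (Cell [Num 0, Reg rI])
   (push (W + 3) ([Num 2, Reg rI, Succ (Reg rA)] @ replicate W (Num 0))))"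

definition atom_code :: "nat => hcom" where
 "atom_code W = For rJ (Cell [Num 1, Cell [Num 0, Reg rI, Succ (Reg rA)]])
   (push (W + 3) ([Num 0, Cell [Num 0, Reg rI, Succ (Reg rA)], Num 0] @
    map (%k. Cell [Num 1, Cell [Num 0, Reg rI, Succ (Reg rA)], Reg rJ, Num k]) [0..<W]))"

text \<open>Rules with empty body are loaded as tuples when their predicate is EDB. For IDB
  predicates they are left to the seeds, lest an IDB tuple take part in the first run.\<close>

definition head_code :: "nat => hcom" where
 "head_code W = checks [(Cell [Num 0, Reg rI], Num 0, True), (Cell [Num 9, Cell [Num 0, Reg rI, Num 0]], Num 0, True)]
   (push (W + 3) ([Num 0, Cell [Num 0, Reg rI, Num 0], Num 0] @
    map (%k. Cell [Num 0, Reg rI, Num 0, Num k, Num 1]) [0..<W])) skip"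

definition tuple_code :: "nat => hcom" where
 "tuple_code W = For rI (Cell [Num 0]) (Then (For rA (Cell [Num 0, Reg rI]) (atom_code W)) (head_code W))"

definition seed_code :: "nat => hcom" where
 "seed_code W = For rI (Cell [Num 0]) (push (W + 3) ([Num 3, Reg rI, Num 0] @ replicate W (Num 0)))"

definition pushed :: "mem => nat => (nat list => nat list) => nat => nat list list => nat list set => state => bool" where
 "pushed st L be h Q0 X s \<longleftrightarrow> fst s rHead = h & (EX Q. rep st L be Q s & (EX zs. Q = Q0 @ zs) & set Q = set Q0 Un X)"

lemma pushed_update: "pushed st L be h Q0 X (r, m) ==> pushed st L be h Q0 X (r(rg 4 k := v), m)"
proof -
 assume "pushed st L be h Q0 X (r, m)"
 then obtain Q where Q: "rep st L be Q (r, m)" "EX zs. Q = Q0 @ zs" "set Q = set Q0 Un X" "r rHead = h" unfolding pushed_def by auto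
 have "rep st L be Q (r(rg 4 k := v), m)" by (rule rep_regs[OF Q(1)]) (use Q(1) in \<open>simp_all add: rep_def\<close>)
 thus ?thesis unfolding pushed_def using Q(2-4) by auto
qed

lemma pushed_static: "pushed st L be h Q0 X (r, m) ==> c \<in> {0, 1, 7, 9} ==> m (c # a) = st (c # a)"
 unfolding pushed_def rep_def by auto

lemma hrun_push_pushed:
 assumes p: "pushed st L be h Q0 X (r, m)" and L: "4 <= L" and z: "map (heval (r, m)) es = z" "length es = L"
  and regs: "ALL e:set es. hregs e Int range (rg 3) = {}"
  and P: "!!r' m'. pushed st L be h Q0 (insert z X) (r', m') ==> ALL k. r' (rg 4 k) = r (rg 4 k) ==> P 0 (r', m')"
 shows "hrun (push L es) (r, m) P"
proof -
 obtain Q zs where Q: "rep st L be Q (r, m)" "Q = Q0 @ zs" "set Q = set Q0 Un X" "r rHead = h" using p unfolding pushed_def by auto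
 show ?thesis
 proof (rule hrun_push[OF Q(1) L z(2) regs], unfold z(1))
  fix r' m' assume r: "rep st L be (enqueue Q z) (r', m')" "ALL q. q \<notin> range (rg 3) Un {rTail, rCnt} --> r' q = r q"
  have r4: "r' (rg t k) = r (rg t k)" if "t ~= 3" "rg t k ~= rTail" "rg t k ~= rCnt" for t k
   using r(2)[rule_format, of "rg t k"] that by auto
  have "EX zs. enqueue Q z = Q0 @ zs" "set (enqueue Q z) = set Q0 Un insert z X"
   using Q(2,3) by (auto simp: enqueue_def)
  hence "pushed st L be h Q0 (insert z X) (r', m')" unfolding pushed_def using r(1) r4[of 0 0] Q(4) by auto
  thus "P 0 (r', m')" using r4 by (intro P) auto
 qed
qed

lemma hrun_For_push:
 assumes p: "pushed st L be h Q0 X (r, m)" and L: "4 <= L" and es: "length es = L" "ALL e:set es. hregs e Int range (rg 3) = {}"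
  and z: "!!r' m' X'. pushed st L be h Q0 X' (r', m') ==> ALL k. k ~= c --> r' (rg 4 k) = r (rg 4 k) ==>
   heval (r', m') e = n & (r' (rg 4 c) < n --> map (heval (r', m')) es = z (r' (rg 4 c)))"
  and P: "!!r' m'. pushed st L be h Q0 (X Un z ` {..<n}) (r', m') ==> ALL k. k ~= c --> r' (rg 4 k) = r (rg 4 k) ==> P n (r', m')"
 shows "hrun (For (rg 4 c) e (push L es)) (r, m) P"
proof (rule hrun_For[where n = n and I = "%j t s. t = j & (ALL k. k ~= c --> fst s (rg 4 k) = r (rg 4 k)) &
  pushed st L be h Q0 (X Un z ` {..<j}) s"])
 fix j t r1 m1 assume j: "j < n" and r1: "r1 (rg 4 c) = j"
  and I: "t = j & (ALL k. k ~= c --> fst (r1, m1) (rg 4 k) = r (rg 4 k)) & pushed st L be h Q0 (X Un z ` {..<j}) (r1, m1)"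
 hence "map (heval (r1, m1)) es = z j" using z[of "X Un z ` {..<j}" r1 m1] by auto
 moreover have "insert (z j) (X Un z ` {..<j}) = X Un z ` {..<Suc j}" by (auto simp: lessThan_Suc)
 ultimately show "hrun (push L es) (r1, m1) (%t' s'. fst s' (rg 4 c) = j & Suc (t + t') = Suc j &
   (ALL k. k ~= c --> fst ((fst s')(rg 4 c := Suc j), snd s') (rg 4 k) = r (rg 4 k)) &
   pushed st L be h Q0 (X Un z ` {..<Suc j}) ((fst s')(rg 4 c := Suc j), snd s'))"
  using I r1 pushed_update by (intro hrun_push_pushed[OF _ L _ es, of st be h Q0 "X Un z ` {..<j}" r1 m1 "z j"]) auto
next
 fix j t r1 m1 assume "t = j & (ALL k. k ~= c --> fst (r1, m1) (rg 4 k) = r (rg 4 k)) & pushed st L be h Q0 (X Un z ` {..<j}) (r1, m1)"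
 thus "heval (r1, m1) e = n" using z[of "X Un z ` {..<j}" r1 m1] by auto
qed (use p P pushed_update in auto)

lemma program_mem_eqs:
 assumes "i < length Rs"
 shows "input_mem Rs T [0] = length Rs" "input_mem Rs T [0, i] = length (body (Rs ! i))"
  "a < length (rule_atoms (Rs ! i)) ==> input_mem Rs T [0, i, a] = fst (rule_atoms (Rs ! i) ! a)"
  "a < length (rule_atoms (Rs ! i)) ==> input_mem Rs T [0, i, a, 0] = length (snd (rule_atoms (Rs ! i) ! a))"
  "a < length (rule_atoms (Rs ! i)) ==> input_mem Rs T [0, i, a, k, 0] = nth_or_0 (map trm_kind (snd (rule_atoms (Rs ! i) ! a))) k"
  "a < length (rule_atoms (Rs ! i)) ==> input_mem Rs T [0, i, a, k, 1] = nth_or_0 (map trm_name (snd (rule_atoms (Rs ! i) ! a))) k"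
  "input_mem Rs T [1, p] = length (T p)" "j < length (T p) ==> input_mem Rs T [1, p, j, k] = nth_or_0 (T p ! j) k"
 using assms by (simp_all add: input_mem_def split_beta)

definition shapes :: "nat => shape list" where
 "shapes s = (SOME hs. set hs = {(tss, e). length tss <= s & e < length tss &
   (ALL ts:set tss. length ts <= s & set ts <= Var ` {..<Suc s} Un {Cst 0})})"

lemma set_shapes: "set (shapes s) = {(tss, e). length tss <= s & e < length tss &
   (ALL ts:set tss. length ts <= s & set ts <= Var ` {..<Suc s} Un {Cst 0})}" (is "_ = ?S")
proof -
 have "finite {ts. set ts <= Var ` {..<Suc s} Un {Cst 0} & length ts <= s}" (is "finite ?T") by (intro finite_lists_length_le) simp
 hence "finite ({tss. set tss <= ?T & length tss <= s} \<times> {..s})" by (intro finite_cartesian_product finite_lists_length_le) simp_all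
 hence "finite ?S" by (rule finite_subset[rotated]) auto
 thus ?thesis unfolding shapes_def by (intro someI_ex[of "%hs. set hs = ?S"] finite_list)
qed

lemma rule_size_atoms:
 assumes "rule_size R <= s"
 shows "length (rule_atoms R) <= s" "A \<in> set (rule_atoms R) ==> length (snd A) < s"
proof -
 have "length As <= (SUM A<-As. 1 + length (snd A))" for As :: "atom list" by (induction As) auto
 thus "length (rule_atoms R) <= s" using assms unfolding rule_size_def by (meson le_trans)
 have "A \<in> set As ==> length (snd A) < (SUM A<-As. 1 + length (snd A))" for As :: "atom list" by (induction As) auto
 thus "A \<in> set (rule_atoms R) ==> length (snd A) < s" using assms unfolding rule_size_def by fastforce
qed

lemma card_vars_rule:
 assumes "rule_size R <= s"
 shows "finite (vars_rule R)" "card (vars_rule R) <= s"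
proof -
 show f: "finite (vars_rule R)" unfolding vars_rule_def using finite_vars_list by auto
 have v: "card (vars_list ts) <= length ts" for ts
 proof (induction ts)
  case (Cons t ts)
  have "vars_list (t # ts) = vars_trm t Un vars_list ts" unfolding vars_list_def by simp
  moreover have "card (vars_trm t) <= 1" by (cases t) auto
  ultimately show ?case using Cons card_Un_le[of "vars_trm t" "vars_list ts"] by simp
 qed (simp add: vars_list_def)
 have "card (UN A:set As. vars_list (snd A)) <= (SUM A<-As. 1 + length (snd A))" for As :: "atom list"
 proof (induction As)
  case (Cons A As)
  thus ?case using card_Un_le[of "vars_list (snd A)" "UN A:set As. vars_list (snd A)"] v[of "snd A"] by simp
 qed simp
 thus "card (vars_rule R) <= s" using assms unfolding vars_rule_def rule_size_def by (meson le_trans)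
qed


section \<open>Classification of the rules by shape and loading of the input\<close>

locale problem =
 fixes Rs :: "rule list" and D :: "fact set" and T :: "nat => nat list list" and sz N :: nat
 assumes dp: "datalog_program (set Rs)" and lin: "linear_program (set Rs)" and db: "db_instance (set Rs) D"
  and size: "!!R. R \<in> set Rs ==> rule_size R <= sz" and ew: "0 < ew (set Rs)" and N: "1 <= N"
  and edb_card: "ALL p:edb (set Rs). card (derived_relation (set Rs) D p) <= N"
  and T: "!!p. distinct (T p) & set (T p) = {t. (p, t) \<in> D}"
begin

abbreviation "M0 == input_mem Rs T"
abbreviation "n == length Rs"

text \<open>The renaming is read off the positions: \<open>f x\<close> is the shape variable at any
  occurrence of \<open>x\<close>. The pairwise equality tests make it well defined and injective,
  and the kinds ensure that constants sit where the shape has \<open>Cst 0\<close>.\<close>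

lemma fits_shape:
 assumes i: "i < n" and h: "h \<in> set (shapes sz)" and f: "fits m i h"
  and m0: "!!a. m (0 # a) = M0 (0 # a)" and m9: "!!q. m [9, q] = of_bool (q \<in> idb (set Rs))"
 obtains f where "inj_on f (vars_rule (Rs ! i))" "f ` vars_rule (Rs ! i) <= {..<Suc sz}"
  "fst h = map (%A. map (ren_trm f) (snd A)) (rule_atoms (Rs ! i))" "snd h < length (rule_atoms (Rs ! i))"
  "ALL a:{1..<length (rule_atoms (Rs ! i))}. fst (rule_atoms (Rs ! i) ! a) \<in> idb (set Rs) \<longleftrightarrow> a = snd h"
proof -
 let ?A = "rule_atoms (Rs ! i)" and ?ts = "fst h"
 note pm = program_mem_eqs[OF i]
 have len: "length ?ts = length ?A" using f unfolding fits_def Let_def m0 pm by (simp add: rule_atoms_def)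
 have la: "length (?ts ! a) = length (snd (?A ! a))" if "a < length ?A" for a
  using f that len pm(4) unfolding fits_def Let_def m0 by simp
 have pos: "(a, k) \<in> set (positions ?ts)" if "a < length ?A" "k < length (snd (?A ! a))" for a k
  using that la len by (simp add: set_positions)
 have kd: "ALL x:set (positions ?ts). m [0, i, fst x, snd x, 0] = trm_kind (?ts ! fst x ! snd x)"
  using f unfolding fits_def Let_def by (elim conjE)
 have nm: "ALL x:set (positions ?ts). trm_kind (?ts ! fst x ! snd x) = 0 --> (ALL y:set (positions ?ts). trm_kind (?ts ! fst y ! snd y) = 0 -->
    (m [0, i, fst x, snd x, 1] = m [0, i, fst y, snd y, 1]) = (?ts ! fst x ! snd x = ?ts ! fst y ! snd y))"
  using f unfolding fits_def Let_def by (elim conjE)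
 have kind: "trm_kind (snd (?A ! a) ! k) = trm_kind (?ts ! a ! k)" if ak: "a < length ?A" "k < length (snd (?A ! a))" for a k
 proof -
  have "m [0, i, a, k, 0] = trm_kind (?ts ! a ! k)" using bspec[OF kd pos[OF ak]] by simp
  thus ?thesis using ak unfolding m0 pm(5)[OF ak(1)] by (simp add: nth_or_0_def)
 qed
 have name: "x = y \<longleftrightarrow> ?ts ! a ! k = ?ts ! a' ! k'"
  if ak: "a < length ?A" "k < length (snd (?A ! a))" "a' < length ?A" "k' < length (snd (?A ! a'))"
   and xy: "snd (?A ! a) ! k = Var x" "snd (?A ! a') ! k' = Var y" for a k a' k' x y
 proof -
  have "trm_kind (?ts ! a ! k) = 0" "trm_kind (?ts ! a' ! k') = 0" using kind[OF ak(1,2)] kind[OF ak(3,4)] xy by simp_all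
  hence "(m [0, i, a, k, 1] = m [0, i, a', k', 1]) = (?ts ! a ! k = ?ts ! a' ! k')"
   using bspec[OF nm pos[OF ak(1,2)]] pos[OF ak(3,4)] by fastforce
  thus ?thesis using ak xy unfolding m0 pm(6)[OF ak(1)] pm(6)[OF ak(3)] by (simp add: nth_or_0_def)
 qed
 define f where "f x = (SOME v. EX a k. a < length ?A & k < length (snd (?A ! a)) & snd (?A ! a) ! k = Var x & ?ts ! a ! k = Var v)" for x
 have key: "?ts ! a ! k = Var (f x)" if ak: "a < length ?A" "k < length (snd (?A ! a))" "snd (?A ! a) ! k = Var x" for a k x
 proof -
  obtain v where "?ts ! a ! k = Var v" using kind[OF ak(1,2)] ak(3) by (cases "?ts ! a ! k") auto
  hence "EX v a k. a < length ?A & k < length (snd (?A ! a)) & snd (?A ! a) ! k = Var x & ?ts ! a ! k = Var v"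
   using ak by blast
  from someI_ex[OF this] obtain a' k' where "a' < length ?A" "k' < length (snd (?A ! a'))" "snd (?A ! a') ! k' = Var x" "?ts ! a' ! k' = Var (f x)"
   unfolding f_def by blast
  thus ?thesis using name[OF ak(1,2) _ _ ak(3), of a' k' x] by simp
 qed
 have ts: "?ts ! a ! k \<in> Var ` {..<Suc sz} Un {Cst 0}" if ak: "a < length ?A" "k < length (snd (?A ! a))" for a k
 proof -
  have "?ts ! a \<in> set ?ts" "?ts ! a ! k \<in> set (?ts ! a)" using ak len la by simp_all
  thus ?thesis using h unfolding set_shapes by (cases h) auto
 qed
 have "?ts ! a ! k = ren_trm f (snd (?A ! a) ! k)" if ak: "a < length ?A" "k < length (snd (?A ! a))" for a k
 proof (cases "snd (?A ! a) ! k")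
  case (Var x)
  thus ?thesis using key[OF ak] by simp
 next
  case (Cst c)
  thus ?thesis using kind[OF ak] ts[OF ak] by auto
 qed
 hence 3: "?ts = map (%A. map (ren_trm f) (snd A)) ?A"
  using len la by (intro nth_equalityI) (auto intro!: nth_equalityI)
 have var: "EX a k. a < length ?A & k < length (snd (?A ! a)) & snd (?A ! a) ! k = Var x" if x: "x \<in> vars_rule (Rs ! i)" for x
  using x unfolding vars_rule_def by (auto simp: Var_in_set in_set_conv_nth) (metis snd_conv)
 show thesis
 proof (rule that[OF _ _ 3])
  show "inj_on f (vars_rule (Rs ! i))"
  proof (rule inj_onI)
   fix x y assume "x \<in> vars_rule (Rs ! i)" "y \<in> vars_rule (Rs ! i)" and e: "f x = f y"
   then obtain a k a' k' where ak: "a < length ?A" "k < length (snd (?A ! a))" "snd (?A ! a) ! k = Var x"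
    "a' < length ?A" "k' < length (snd (?A ! a'))" "snd (?A ! a') ! k' = Var y" using var by meson
   show "x = y" using name[OF ak(1,2,4,5,3,6)] key[OF ak(1-3)] key[OF ak(4-6)] e by simp
  qed
  show "f ` vars_rule (Rs ! i) <= {..<Suc sz}"
  proof
   fix v assume "v \<in> f ` vars_rule (Rs ! i)"
   then obtain x a k where "v = f x" "a < length ?A" "k < length (snd (?A ! a))" "snd (?A ! a) ! k = Var x" using var by blast
   hence "Var v \<in> Var ` {..<Suc sz} Un {Cst 0}" using ts key by metis
   thus "v \<in> {..<Suc sz}" by auto
  qed
  show "snd h < length ?A" using h len unfolding set_shapes by (cases h) auto
  show "ALL a:{1..<length ?A}. fst (?A ! a) \<in> idb (set Rs) \<longleftrightarrow> a = snd h"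
  proof
   fix a assume a: "a \<in> {1..<length ?A}"
   hence "(m [9, m [0, i, a]] = 1) = (a = snd h)" using f len unfolding fits_def Let_def by simp
   thus "fst (?A ! a) \<in> idb (set Rs) \<longleftrightarrow> a = snd h" using a unfolding m0 m9 by (simp add: pm(3) del: One_nat_def)
  qed
 qed
qed

text \<open>A rule of size at most \<open>sz\<close> has at most \<open>sz\<close> variables, so
  they can be named injectively below \<open>Suc sz\<close>; linearity leaves at most one position
  for the IDB atom, and 0 is used if there is none.\<close>

lemma exists_fit:
 assumes i: "i < n" and m0: "!!a. m (0 # a) = M0 (0 # a)" and m9: "!!q. m [9, q] = of_bool (q \<in> idb (set Rs))"
 shows "EX h:set (shapes sz). fits m i h"
proof -
 let ?A = "rule_atoms (Rs ! i)" and ?I = "idb (set Rs)"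
 have RL: "Rs ! i \<in> set Rs" using i by simp
 note sz = rule_size_atoms[OF size[OF RL]] and vr = card_vars_rule[OF size[OF RL]] and pm = program_mem_eqs[OF i]
 obtain f where f: "f ` vars_rule (Rs ! i) <= {..<Suc sz}" "inj_on f (vars_rule (Rs ! i))"
  using card_le_inj[OF vr(1) finite_lessThan[of "Suc sz"]] vr(2) by auto
 have "card {k. k < length (body (Rs ! i)) & fst (body (Rs ! i) ! k) \<in> ?I} <= 1"
  using lin RL unfolding linear_program_def idb_atoms_def by (auto simp: length_filter_conv_card)
 hence uni: "k = k'" if "k < length (body (Rs ! i))" "fst (body (Rs ! i) ! k) \<in> ?I"
   "k' < length (body (Rs ! i))" "fst (body (Rs ! i) ! k') \<in> ?I" for k k'
  using that by (simp add: card_le_Suc0_iff_eq)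
 have "EX e<length ?A. ALL a:{1..<length ?A}. fst (?A ! a) \<in> ?I \<longleftrightarrow> a = e"
 proof (cases "EX k<length (body (Rs ! i)). fst (body (Rs ! i) ! k) \<in> ?I")
  case True
  then obtain k where k: "k < length (body (Rs ! i))" "fst (body (Rs ! i) ! k) \<in> ?I" by blast
  have "fst (?A ! a) \<in> ?I \<longleftrightarrow> a = Suc k" if "a \<in> {1..<length ?A}" for a
   using that uni[OF k, of "a - 1"] k by (cases a) (auto simp: rule_atoms_def)
  thus ?thesis using k by (intro exI[of _ "Suc k"]) (simp add: rule_atoms_def)
 next
  case False
  have "fst (?A ! a) \<in> ?I \<longleftrightarrow> a = 0" if "a \<in> {1..<length ?A}" for a
   using that False by (cases a) (auto simp: rule_atoms_def)
  thus ?thesis by (intro exI[of _ 0]) (simp add: rule_atoms_def)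
 qed
 then obtain e where e: "e < length ?A" "!!a. a \<in> {1..<length ?A} ==> fst (?A ! a) \<in> ?I \<longleftrightarrow> a = e" by blast
 let ?ts = "map (%A. map (ren_trm f) (snd A)) ?A"
 have v: "x \<in> vars_rule (Rs ! i)" if "a < length ?A" "k < length (snd (?A ! a))" "snd (?A ! a) ! k = Var x" for a k x
  using that unfolding vars_rule_def by (metis UN_I Var_in_set nth_mem)
 have kind: "trm_kind (ren_trm f t) = trm_kind t" for t by (cases t) simp_all
 have "set ts <= Var ` {..<Suc sz} Un {Cst 0}" if "ts \<in> set ?ts" for ts
 proof
  fix t assume t: "t \<in> set ts"
  obtain A u where u: "A \<in> set ?A" "u \<in> set (snd A)" "t = ren_trm f u" using \<open>ts \<in> set ?ts\<close> t by auto
  show "t \<in> Var ` {..<Suc sz} Un {Cst 0}"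
  proof (cases u)
   case (Var x)
   hence "x \<in> vars_rule (Rs ! i)" using u unfolding vars_rule_def by (auto simp: Var_in_set)
   thus ?thesis using f(1) u(3) Var by auto
  qed (use u in simp)
 qed
 hence "(?ts, e) \<in> set (shapes sz)" using sz e(1) unfolding set_shapes by (auto simp: less_imp_le)
 moreover have "fits m i (?ts, e)"
 proof -
  have "Suc (m [0, i]) = length ?ts" unfolding m0 pm by (simp add: rule_atoms_def)
  moreover have "ALL a<length ?ts. m [0, i, a, 0] = length (?ts ! a)" unfolding m0 by (simp add: pm(4))
  moreover have "ALL x:set (positions ?ts). m [0, i, fst x, snd x, 0] = trm_kind (?ts ! fst x ! snd x)"
   unfolding m0 by (auto simp: set_positions pm(5) nth_or_0_def kind simp del: One_nat_def)
  moreover have "(m [0, i, a, k, 1] = m [0, i, a', k', 1]) = (?ts ! a ! k = ?ts ! a' ! k')"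
   if x: "(a, k) \<in> set (positions ?ts)" "trm_kind (?ts ! a ! k) = 0" and y: "(a', k') \<in> set (positions ?ts)" "trm_kind (?ts ! a' ! k') = 0"
   for a k a' k'
  proof -
   have ak: "a < length ?A" "k < length (snd (?A ! a))" "a' < length ?A" "k' < length (snd (?A ! a'))"
    using x(1) y(1) by (auto simp: set_positions)
   obtain u where u: "snd (?A ! a) ! k = Var u" using x(2) ak kind by (cases "snd (?A ! a) ! k") auto
   obtain w where w: "snd (?A ! a') ! k' = Var w" using y(2) ak kind by (cases "snd (?A ! a') ! k'") auto
   have "u \<in> vars_rule (Rs ! i)" "w \<in> vars_rule (Rs ! i)" using v ak u w by blast+
   hence "u = w \<longleftrightarrow> f u = f w" using f(2) by (auto simp: inj_on_def)
   thus ?thesis unfolding m0 pm(6)[OF ak(1)] pm(6)[OF ak(3)] using ak u w by (simp add: nth_or_0_def)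
  qed
  moreover have "ALL a:{1..<length ?ts}. (m [9, m [0, i, a]] = 1) = (a = e)"
   unfolding m0 m9 using e(2) by (simp add: pm(3) del: One_nat_def)
  ultimately show ?thesis unfolding fits_def Let_def by auto
 qed
 ultimately show ?thesis by blast
qed

definition marks :: "nat => mem" where
 "marks k = (%a. if EX i<k. body (Rs ! i) ~= [] & a = [9, fst (head (Rs ! i))] then 1 else M0 a)"

lemma marks_simps:
 "c ~= 9 ==> marks k (c # a) = M0 (c # a)" "marks n [9, q] = of_bool (q \<in> idb (set Rs))"
 unfolding marks_def idb_def by (auto simp: input_mem_def in_set_conv_nth)

definition prepared :: "mem => bool" where
 "prepared m \<longleftrightarrow> (ALL a. (ALL i. a ~= [7, i]) --> m a = marks n a) &
   (ALL i<n. m [7, i] < length (shapes sz) & fits (marks n) i (shapes sz ! m [7, i]))"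

lemma preparedD:
 assumes "prepared m"
 shows "c ~= 7 ==> c ~= 9 ==> m (c # a) = M0 (c # a)" "m [9, q] = of_bool (q \<in> idb (set Rs))"
 using assms marks_simps unfolding prepared_def by auto

lemma hrun_mark_code:
 assumes "!!t r. t <= n ==> ALL q. q \<notin> range (rg 4) --> r q = 0 ==> P t (r, marks n)"
 shows "hrun mark_code (%_. 0, M0) P"
 unfolding mark_code_def
proof (rule hrun_For[where n = n and I = "%k t s. t <= k & (ALL q. q \<notin> range (rg 4) --> fst s q = 0) & snd s = marks k"])
 fix k t r m assume k: "k < n" and I: "t <= k & (ALL q. q \<notin> range (rg 4) --> fst (r, m) q = 0) & snd (r, m) = marks k" and r: "r rI = k"
 have m: "m [0, k] = length (body (Rs ! k))" "m [0, k, 0] = fst (head (Rs ! k))"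
  using I program_mem_eqs(2)[OF k, of T] program_mem_eqs(3)[OF k, of 0 T] by (simp_all add: marks_simps rule_atoms_def)
 have nxt: "marks (Suc k) = (if body (Rs ! k) = [] then marks k else (marks k)([9, fst (head (Rs ! k))] := 1))"
  unfolding marks_def by (auto simp: fun_eq_iff less_Suc_eq)
 show "hrun (Cond (HLess (Num 0) (Cell [Num 0, Reg rI])) (Put [Num 9, Cell [Num 0, Reg rI, Num 0]] (Num 1)) skip) (r, m)
   (%t' s'. fst s' rI = k & Suc (t + t') <= Suc k & (ALL q. q \<notin> range (rg 4) --> fst ((fst s')(rI := Suc k), snd s') q = 0) &
    snd ((fst s')(rI := Suc k), snd s') = marks (Suc k))"
  by (rule hrun_Cond; (rule hrun_Put | rule hrun_skip)) (use I r m nxt in auto)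
qed (use assms in \<open>auto simp: marks_simps program_mem_eqs(1)[of 0] input_mem_def marks_def\<close>)

lemma hrun_shape_code:
 assumes r0: "ALL q. q \<notin> range (rg 4) --> r q = 0"
  and P: "!!t r m. t <= n ==> ALL q. q \<notin> range (rg 4) --> r q = 0 ==> prepared m ==> P t (r, m)"
 shows "hrun (shape_code (shapes sz)) (r, marks n) P"
 unfolding shape_code_def
proof (rule hrun_For[where n = n and I = "%k t s. t <= k & (ALL q. q \<notin> range (rg 4) --> fst s q = 0) &
  (ALL a. (ALL i. a ~= [7, i]) --> snd s a = marks n a) &
  (ALL i<k. snd s [7, i] < length (shapes sz) & fits (marks n) i (shapes sz ! snd s [7, i]))"])
 fix k t r m assume k: "k < n" and r: "r rI = k" and I: "t <= k & (ALL q. q \<notin> range (rg 4) --> fst (r, m) q = 0) &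
  (ALL a. (ALL i. a ~= [7, i]) --> snd (r, m) a = marks n a) &
  (ALL i<k. snd (r, m) [7, i] < length (shapes sz) & fits (marks n) i (shapes sz ! snd (r, m) [7, i]))"
 have fm: "fits m i h = fits (marks n) i h" for i h using I unfolding fits_def Let_def by simp
 obtain h where h: "h \<in> set (shapes sz)" "fits (marks n) k h" using exists_fit[OF k, of "marks n"] marks_simps by auto
 show "hrun (classify (shapes sz) [0..<length (shapes sz)]) (r, m) (%t' s'. fst s' rI = k & Suc (t + t') <= Suc k &
   (ALL q. q \<notin> range (rg 4) --> fst ((fst s')(rI := Suc k), snd s') q = 0) &
   (ALL a. (ALL i. a ~= [7, i]) --> snd ((fst s')(rI := Suc k), snd s') a = marks n a) &
   (ALL i<Suc k. snd ((fst s')(rI := Suc k), snd s') [7, i] < length (shapes sz) &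
    fits (marks n) i (shapes sz ! snd ((fst s')(rI := Suc k), snd s') [7, i])))"
 proof (rule hrun_classify)
  show "EX d:set [0..<length (shapes sz)]. fits m (r rI) (shapes sz ! d)"
   using h unfolding fm r by (auto simp: in_set_conv_nth)
 qed (use I r fm in \<open>auto simp: less_Suc_eq\<close>)
next
 fix t and r :: "nat => nat" and m assume "t <= n & (ALL q. q \<notin> range (rg 4) --> fst (r, m) q = 0) & (ALL a. (ALL i. a ~= [7, i]) --> snd (r, m) a = marks n a) &
  (ALL i<n. snd (r, m) [7, i] < length (shapes sz) & fits (marks n) i (shapes sz ! snd (r, m) [7, i]))"
 thus "P t (r, m)" by (intro P) (auto simp: prepared_def)
qed (use r0 in \<open>auto simp: marks_simps input_mem_def\<close>)

lemma body_length: "i < n ==> length (body (Rs ! i)) <= sz"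
 using rule_size_atoms(1)[OF size[of "Rs ! i"]] by (simp add: rule_atoms_def)

text \<open>\<open>N\<close> bounds the derived EDB relations, which contain the stored ones; IDB
  predicates have no stored tuples.\<close>

lemma T_length: "p \<in> preds (set Rs) ==> length (T p) <= N"
proof (cases "p \<in> idb (set Rs)")
 case True
 hence "p \<notin> fst ` D" using db unfolding db_instance_def edb_def by blast
 hence "(p, t) \<notin> D" for t using imageI[of "(p, t)" D fst] by auto
 hence "set (T p) = {}" using T[of p] by simp
 thus ?thesis by simp
next
 assume p: "p \<in> preds (set Rs)"
 case False
 have "length (T p) = card (set (T p))" by (rule distinct_card[symmetric]) (use T in blast)
 also have "... <= card (derived_relation (set Rs) D p)"
  using T[of p] least_fixpoint_base by (intro card_mono finite_derived_edb[OF dp db False]) (auto simp: derived_relation_def)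
 also have "... <= N" using edb_card False p unfolding edb_def by blast
 finally show ?thesis .
qed

definition rule_facts :: "nat => nat list set" where
 "rule_facts k = (UN i<k. (%a. rule_fact (Suc sz) i (Suc a)) ` {..<length (body (Rs ! i))})"

definition body_tuples :: "nat => nat => nat list set" where
 "body_tuples i j = (UN A:set (take j (body (Rs ! i))). orig (Suc sz) (fst A) ` set (T (fst A)))"

definition head_tuples :: "nat => nat list set" where
 "head_tuples i = (if body (Rs ! i) = [] & fst (head (Rs ! i)) \<notin> idb (set Rs)
   then {orig (Suc sz) (fst (head (Rs ! i))) (map trm_name (snd (head (Rs ! i))))} else {})"

definition input_tuples :: "nat => nat list set" where
 "input_tuples k = (UN i<k. body_tuples i (length (body (Rs ! i))) Un head_tuples i)"

end

locale loading = problem +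
 fixes st :: mem and be :: "nat list => nat list" and h :: nat and Q0 :: "nat list list"
 assumes prep: "prepared st"
begin

abbreviation "PS == pushed st (Suc sz + 3) be h Q0"

lemma PS_read:
 assumes "PS X (r, m)"
 shows "m (0 # a) = M0 (0 # a)" "m (1 # a) = M0 (1 # a)" "m [9, q] = of_bool (q \<in> idb (set Rs))" "m [0] = n"
 using pushed_static[OF assms] preparedD[OF prep] by (auto simp: input_mem_def)

lemma hrun_rule_code:
 assumes p: "PS {} (r, m)" and P: "!!t r m. t <= n * (sz + 1) ==> PS (rule_facts n) (r, m) ==> P t (r, m)"
 shows "hrun (rule_code (Suc sz)) (r, m) P"
 unfolding rule_code_def
proof (rule hrun_For[where n = n and I = "%k t s. t <= k * (sz + 1) & PS (rule_facts k) s"])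
 fix k t r m assume k: "k < n" and I: "t <= k * (sz + 1) & PS (rule_facts k) (r, m)" and r: "r rI = k"
 note pm = program_mem_eqs(2)[OF k, of T]
 show "hrun (For rA (Cell [Num 0, Reg rI]) (push (Suc sz + 3) ([Num 2, Reg rI, Succ (Reg rA)] @ replicate (Suc sz) (Num 0)))) (r, m)
   (%t' s'. fst s' rI = k & Suc (t + t') <= Suc k * (sz + 1) & PS (rule_facts (Suc k)) ((fst s')(rI := Suc k), snd s'))"
 proof (rule hrun_For_push[OF conjunct2[OF I], where z = "%j. rule_fact (Suc sz) k (Suc j)" and n = "length (body (Rs ! k))"])
  fix r' m' X' assume "PS X' (r', m')" "ALL i. i ~= 1 --> r' (rg 4 i) = r (rg 4 i)"
  thus "heval (r', m') (Cell [Num 0, Reg rI]) = length (body (Rs ! k)) & (r' rA < length (body (Rs ! k)) -->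
    map (heval (r', m')) ([Num 2, Reg rI, Succ (Reg rA)] @ replicate (Suc sz) (Num 0)) = rule_fact (Suc sz) k (Suc (r' rA)))"
   using PS_read(1) pm r by (simp add: rule_fact_def)
 next
  fix r' m' assume "PS (rule_facts k Un (%j. rule_fact (Suc sz) k (Suc j)) ` {..<length (body (Rs ! k))}) (r', m')"
   and r': "ALL i. i ~= 1 --> r' (rg 4 i) = r (rg 4 i)"
  hence "PS (rule_facts (Suc k)) (r', m')" unfolding rule_facts_def by (simp add: lessThan_Suc Un_commute)
  thus "fst (r', m') rI = k & Suc (t + length (body (Rs ! k))) <= Suc k * (sz + 1) &
    PS (rule_facts (Suc k)) ((fst (r', m'))(rI := Suc k), snd (r', m'))"
   using I r r' pushed_update body_length[OF k] by simp
 qed auto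
next
 show "0 <= 0 * (sz + 1) & PS (rule_facts 0) (r(rI := 0), m)" using pushed_update[OF p] by (simp add: rule_facts_def)
qed (auto intro!: P dest: PS_read(4)[simplified])

lemma hrun_seed_code:
 assumes p: "PS {} (r, m)" and P: "!!r m. PS (seed (Suc sz) ` {..<n}) (r, m) ==> P n (r, m)"
 shows "hrun (seed_code (Suc sz)) (r, m) P"
 unfolding seed_code_def
 by (rule hrun_For_push[OF p, where z = "seed (Suc sz)" and n = n]) (auto simp: seed_def intro!: P dest: PS_read(4)[simplified])

lemma hrun_atom_code:
 assumes p: "PS X (r, m)" and k: "k < n" "r rI = k" and j: "j < length (body (Rs ! k))" "r rA = j"
  and P: "!!t r' m'. t <= N ==> PS (X Un orig (Suc sz) (fst (body (Rs ! k) ! j)) ` set (T (fst (body (Rs ! k) ! j)))) (r', m') ==>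
   r' rI = k ==> r' rA = j ==> P t (r', m')"
 shows "hrun (atom_code (Suc sz)) (r, m) P"
 unfolding atom_code_def
proof (rule hrun_For_push[OF p])
 let ?q = "fst (body (Rs ! k) ! j)" and ?p = "Cell [Num 0, Reg rI, Succ (Reg rA)]"
 have q: "M0 [0, k, Suc j] = ?q" using program_mem_eqs(3)[OF k(1), of "Suc j" T] j(1) by (simp add: rule_atoms_def)
 note pm = program_mem_eqs(7,8)[OF k(1), where T = T]
 {
  fix r' m' X' assume X': "PS X' (r', m')" and r': "ALL i. i ~= 2 --> r' (rg 4 i) = r (rg 4 i)"
  have pv: "heval (r', m') ?p = ?q" using PS_read(1)[OF X'] r' k j q by simp
  hence "heval (r', m') (Cell [Num 1, ?p]) = length (T ?q)" using PS_read(2)[OF X'] pm(1) by simp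
  moreover have "map (heval (r', m')) ([Num 0, ?p, Num 0] @ map (%k. Cell [Num 1, ?p, Reg rJ, Num k]) [0..<Suc sz]) = orig (Suc sz) ?q (T ?q ! r' rJ)"
   if "r' rJ < length (T ?q)"
   unfolding orig_def using PS_read(2)[OF X'] pm(2)[OF that] pv by (simp add: comp_def del: upt_Suc)
  ultimately show "heval (r', m') (Cell [Num 1, ?p]) = length (T ?q) & (r' rJ < length (T ?q) -->
   map (heval (r', m')) ([Num 0, ?p, Num 0] @ map (%k. Cell [Num 1, ?p, Reg rJ, Num k]) [0..<Suc sz]) = (%l. orig (Suc sz) ?q (T ?q ! l)) (r' rJ))"
   by blast
 }
 fix r' m' assume X: "PS (X Un (%l. orig (Suc sz) ?q (T ?q ! l)) ` {..<length (T ?q)}) (r', m')" and r': "ALL i. i ~= 2 --> r' (rg 4 i) = r (rg 4 i)"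
 have "body (Rs ! k) ! j \<in> set (rule_atoms (Rs ! k))" using j(1) by (simp add: rule_atoms_def)
 hence "?q \<in> preds (set Rs)" unfolding preds_def using nth_mem[OF k(1)] by blast
 moreover have "(%l. orig (Suc sz) ?q (T ?q ! l)) ` {..<length (T ?q)} = orig (Suc sz) ?q ` set (T ?q)"
  unfolding set_conv_nth by auto
 ultimately show "P (length (T ?q)) (r', m')" using X r' k j by (intro P T_length) simp_all
qed auto

lemma hrun_head_code:
 assumes p: "PS X (r, m)" and k: "k < n" "r rI = k" and P: "!!r' m'. PS (head_tuples k Un X) (r', m') ==> r' rI = k ==> P 0 (r', m')"
 shows "hrun (head_code (Suc sz)) (r, m) P"
 unfolding head_code_def
proof (rule hrun_checks)
 let ?H = "head (Rs ! k)"
 note rd = PS_read[OF p] and pm = program_mem_eqs[OF k(1), where T = T]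
 have hd: "M0 [0, k, 0] = fst ?H" "M0 [0, k, 0, l, 1] = nth_or_0 (map trm_name (snd ?H)) l" for l
  using pm(3)[of 0] pm(6)[of 0 l] by (simp_all add: rule_atoms_def)
 have c: "(ALL (a, b, v):set [(Cell [Num 0, Reg rI], Num 0, True), (Cell [Num 9, Cell [Num 0, Reg rI, Num 0]], Num 0, True)].
   (heval (r, m) a = heval (r, m) b) = v) \<longleftrightarrow> body (Rs ! k) = [] & fst ?H \<notin> idb (set Rs)"
  using k(2) rd pm(2) hd by auto
 {
  assume "~ (ALL (a, b, v):set [(Cell [Num 0, Reg rI], Num 0, True), (Cell [Num 9, Cell [Num 0, Reg rI, Num 0]], Num 0, True)].
   (heval (r, m) a = heval (r, m) b) = v)"
  hence "head_tuples k = {}" unfolding c head_tuples_def by auto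
  thus "hrun skip (r, m) P" using p k(2) P by (intro hrun_skip) simp
 }
 assume "ALL (a, b, v):set [(Cell [Num 0, Reg rI], Num 0, True), (Cell [Num 9, Cell [Num 0, Reg rI, Num 0]], Num 0, True)].
   (heval (r, m) a = heval (r, m) b) = v"
 hence ht: "head_tuples k = {orig (Suc sz) (fst ?H) (map trm_name (snd ?H))}" unfolding c head_tuples_def by simp
 show "hrun (push (Suc sz + 3) ([Num 0, Cell [Num 0, Reg rI, Num 0], Num 0] @ map (%k. Cell [Num 0, Reg rI, Num 0, Num k, Num 1]) [0..<Suc sz])) (r, m) P"
 proof (rule hrun_push_pushed[OF p])
  show "map (heval (r, m)) ([Num 0, Cell [Num 0, Reg rI, Num 0], Num 0] @ map (%k. Cell [Num 0, Reg rI, Num 0, Num k, Num 1]) [0..<Suc sz])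
   = orig (Suc sz) (fst ?H) (map trm_name (snd ?H))"
   unfolding orig_def using k(2) hd rd(1) by (simp add: comp_def del: upt_Suc One_nat_def)
 qed (use k(2) P in \<open>auto simp: ht\<close>)
qed

lemma hrun_tuple_code:
 assumes p: "PS {} (r, m)" and P: "!!t r m. t <= n * (sz * (N + 1) + 1) ==> PS (input_tuples n) (r, m) ==> P t (r, m)"
 shows "hrun (tuple_code (Suc sz)) (r, m) P"
 unfolding tuple_code_def
proof (rule hrun_For[where n = n and I = "%k t s. t <= k * (sz * (N + 1) + 1) & PS (input_tuples k) s"])
 fix k t r m assume k: "k < n" and I: "t <= k * (sz * (N + 1) + 1) & PS (input_tuples k) (r, m)" and r: "r rI = k"
 let ?B = "body (Rs ! k)"
 show "hrun (Then (For rA (Cell [Num 0, Reg rI]) (atom_code (Suc sz))) (head_code (Suc sz))) (r, m)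
   (%t' s'. fst s' rI = k & Suc (t + t') <= Suc k * (sz * (N + 1) + 1) & PS (input_tuples (Suc k)) ((fst s')(rI := Suc k), snd s'))"
 proof (rule hrun_Then, rule hrun_For[where n = "length ?B" and
    I = "%j t s. t <= j * (N + 1) & fst s rI = k & PS (input_tuples k Un body_tuples k j) s"])
  fix j t r m assume j: "j < length ?B" and I: "t <= j * (N + 1) & fst (r, m) rI = k & PS (input_tuples k Un body_tuples k j) (r, m)"
   and r: "r rA = j"
  have "body_tuples k (Suc j) = body_tuples k j Un orig (Suc sz) (fst (?B ! j)) ` set (T (fst (?B ! j)))"
   unfolding body_tuples_def using j by (auto simp: take_Suc_conv_app_nth)
  thus "hrun (atom_code (Suc sz)) (r, m) (%t' s'. fst s' rA = j & Suc (t + t') <= Suc j * (N + 1) &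
     fst ((fst s')(rA := Suc j), snd s') rI = k & PS (input_tuples k Un body_tuples k (Suc j)) ((fst s')(rA := Suc j), snd s'))"
   using I j k r pushed_update by (intro hrun_atom_code[where k = k and j = j and X = "input_tuples k Un body_tuples k j"]) (auto simp: Un_assoc)
 next
  fix t' r' m' assume I': "t' <= length ?B * (N + 1) & fst (r', m') rI = k & PS (input_tuples k Un body_tuples k (length ?B)) (r', m')"
  have "Suc (t + (t' + 0)) <= Suc k * (sz * (N + 1) + 1)" using I I' mult_le_mono1[OF body_length[OF k], of "N + 1"] by simp
  moreover have "input_tuples (Suc k) = head_tuples k Un (input_tuples k Un body_tuples k (length ?B))"
   unfolding input_tuples_def by (auto simp: less_Suc_eq)
  ultimately show "hrun (head_code (Suc sz)) (r', m') (%t'' s'. fst s' rI = k & Suc (t + (t' + t'')) <= Suc k * (sz * (N + 1) + 1) &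
    PS (input_tuples (Suc k)) ((fst s')(rI := Suc k), snd s'))"
   using I' k pushed_update by (intro hrun_head_code[where k = k and X = "input_tuples k Un body_tuples k (length ?B)"]) auto
 next
  fix j t' r' m' assume "t' <= j * (N + 1) & fst (r', m') rI = k & PS (input_tuples k Un body_tuples k j) (r', m')"
  thus "heval (r', m') (Cell [Num 0, Reg rI]) = length ?B"
   using PS_read(1)[of "input_tuples k Un body_tuples k j" r' m'] program_mem_eqs(2)[OF k, of T] by simp
 qed (use I r pushed_update in \<open>auto simp: body_tuples_def\<close>)
next
 show "0 <= 0 * (sz * (N + 1) + 1) & PS (input_tuples 0) (r(rI := 0), m)" using pushed_update[OF p, of 0] by (simp add: input_tuples_def)
qed (auto intro!: P dest: PS_read(4)[simplified])

end

context problem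
begin

lemma prepared_evaluation:
 assumes prep: "prepared st"
 shows "EX fm. evaluation_cost Rs D (Suc sz) (shapes sz) (%i. st [7, i]) fm st N"
proof -
 have "EX f. inj_on f (vars_rule (Rs ! i)) & f ` vars_rule (Rs ! i) <= {..<Suc sz} &
  fst (shapes sz ! st [7, i]) = map (%A. map (ren_trm f) (snd A)) (rule_atoms (Rs ! i)) &
  snd (shapes sz ! st [7, i]) < length (rule_atoms (Rs ! i)) &
  (ALL a:{1..<length (rule_atoms (Rs ! i))}. fst (rule_atoms (Rs ! i) ! a) \<in> idb (set Rs) \<longleftrightarrow> a = snd (shapes sz ! st [7, i]))"
  if i: "i < n" for i
 proof -
  have h: "shapes sz ! st [7, i] \<in> set (shapes sz)" "fits (marks n) i (shapes sz ! st [7, i])"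
   using prep i unfolding prepared_def by auto
  show ?thesis by (rule fits_shape[OF i h]) (use marks_simps in auto)
 qed
 then obtain fm where fm: "!!i. i < n ==> inj_on (fm i) (vars_rule (Rs ! i)) & fm i ` vars_rule (Rs ! i) <= {..<Suc sz} &
  fst (shapes sz ! st [7, i]) = map (%A. map (ren_trm (fm i)) (snd A)) (rule_atoms (Rs ! i)) &
  snd (shapes sz ! st [7, i]) < length (rule_atoms (Rs ! i)) &
  (ALL a:{1..<length (rule_atoms (Rs ! i))}. fst (rule_atoms (Rs ! i) ! a) \<in> idb (set Rs) \<longleftrightarrow> a = snd (shapes sz ! st [7, i]))"
  by metis
 have "evaluation_cost Rs D (Suc sz) (shapes sz) (%i. st [7, i]) fm st N"
 proof
  fix i A assume "i < n" "A \<in> set (rule_atoms (Rs ! i))"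
  thus "length (snd A) <= Suc sz" using rule_size_atoms(2)[OF size[of "Rs ! i"]] by fastforce
 qed (use dp lin db ew N edb_card fm prep preparedD(1)[OF prep] program_mem_eqs(3,6)
   in \<open>auto simp: prepared_def nth_or_0_def simp del: One_nat_def\<close>)
 thus ?thesis by blast
qed

end

context evaluation_run
begin

text \<open>Tuples are stored behind a header and padded with zeros; as all tuples of
  \<open>q\<close> have the same length, cutting the facts to it is injective.\<close>

lemma output_outputs:
 assumes rep: "rep st (W + 3) be Q (r, m)" and q: "q \<in> idb (set Rs)"
 shows "output_relation m q (derived_relation (set Rs) D q)"
proof -
 obtain R where R: "R \<in> set Rs" "q = fst (head R)" using q unfolding idb_def by blast
 then obtain i where i: "i < length Rs" "q = fst (atm i 0)" by (auto simp: in_set_conv_nth rule_atoms_def)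
 define ar where "ar = length (snd (atm i 0))"
 have len: "length t = ar & ar <= W" if "(q, t) \<in> LF" for t
  using LF_length[OF _ i(1) rule_atoms_pos, of t] that i(2) unfolding ar_def by simp
 define xs where "xs = map (%z. take ar (drop 3 z)) (outputs q Q)"
 have tk: "take ar (drop 3 (orig W q t)) = t" if "(q, t) \<in> LF" for t
  using len[OF that] unfolding orig_def by (intro nth_equalityI) (auto simp: nth_or_0_def)
 have out: "EX t. z = orig W q t & (q, t) \<in> LF" if z: "z \<in> set (outputs q Q)" for z
 proof -
  have "z \<in> Vall" "z ! 0 = 0" "z ! 1 = q" using z QV unfolding outputs_def by auto
  hence "z \<in> Vorig" "z ! 1 = q" using Vall_kind(1) by auto
  thus ?thesis unfolding Vorig_def by auto
 qed
 show ?thesis unfolding output_relation_def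
 proof (intro exI[of _ xs] conjI allI impI)
  have "distinct (outputs q Q)" using rep unfolding outputs_def rep_def by simp
  moreover have "inj_on (%z. take ar (drop 3 z)) (set (outputs q Q))"
  proof (rule inj_onI)
   fix x y assume x: "x \<in> set (outputs q Q)" and y: "y \<in> set (outputs q Q)" and e: "take ar (drop 3 x) = take ar (drop 3 y)"
   obtain t u where "x = orig W q t" "(q, t) \<in> LF" "y = orig W q u" "(q, u) \<in> LF" using out[OF x] out[OF y] by blast
   thus "x = y" using tk e by simp
  qed
  ultimately show "distinct xs" unfolding xs_def by (simp add: distinct_map)
  show "set xs = derived_relation (set Rs) D q"
  proof (intro equalityI subsetI)
   fix t assume "t \<in> set xs"
   then obtain z where z: "z \<in> set (outputs q Q)" "t = take ar (drop 3 z)" unfolding xs_def by auto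
   obtain u where "z = orig W q u" "(q, u) \<in> LF" using out[OF z(1)] by blast
   thus "t \<in> derived_relation (set Rs) D q" using z(2) tk unfolding derived_relation_def by simp
  next
   fix t assume "t \<in> derived_relation (set Rs) D q"
   hence t: "(q, t) \<in> LF" unfolding derived_relation_def by simp
   hence "orig W q t \<in> set (outputs q Q)" using LF_complete[OF t] q unfolding outputs_def by simp
   thus "t \<in> set xs" unfolding xs_def using tk[OF t] by (force simp: image_iff)
  qed
  have r: "m [2, q] = length (outputs q Q)" "!!j k. j < length (outputs q Q) ==> k + 3 < W + 3 ==> m [2, q, j, k] = outputs q Q ! j ! (k + 3)"
   using rep unfolding rep_def by auto
  thus "m [2, q] = length xs" unfolding xs_def by simp
  fix j k assume j: "j < length xs" and k: "k < length (xs ! j)"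
  have j': "j < length (outputs q Q)" using j unfolding xs_def by simp
  have "outputs q Q ! j \<in> set (outputs q Q)" using j' by simp
  then obtain t where t: "outputs q Q ! j = orig W q t" "(q, t) \<in> LF" using out by blast
  have kW: "k < ar" "ar <= W" using k len[OF t(2)] j' unfolding xs_def by auto
  hence "m [2, q, j, k] = outputs q Q ! j ! (k + 3)" using r(2)[OF j'] by simp
  thus "m [2, q, j, k] = xs ! j ! k" unfolding xs_def using j' kW t(1) by (simp add: add.commute)
 qed
qed

end

section \<open>Assembly of the evaluator and its total running time\<close>

lemma fcghw_ge_one:
 assumes "datalog_program \<Pi>" "0 < ew \<Pi>"
 shows "1 <= fcghw \<Pi>"
proof -
 obtain R where R: "R \<in> \<Pi>" "vars_list (snd (head R)) ~= {}" using ew_ge_one(3)[OF assms] by blast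
 have "rule_out R <= rule_vertices R"
  unfolding rule_out_def rule_vertices_def rule_edges_def using vars_head_body[OF assms(1) R(1)] by blast
 hence "1 <= fcghw_rule R" using R(2) by (intro fcghw_rule_ge_one) (auto simp: rule_out_def)
 also have "... <= fcghw \<Pi>" using R(1) assms(1) unfolding datalog_program_def by (intro fcghw_rule_le) auto
 finally show ?thesis .
qed

text \<open>The same engine is run twice. Its head register persists, so the second run resumes
  behind the first one instead of repeating it.\<close>

definition evaluator_code :: "nat => hcom" where
 "evaluator_code sz = (let en = engine (Suc sz + 3) (key_specs (Suc sz)) (all_ops (Suc sz) (shapes sz)) in
   Then mark_code (Then (shape_code (shapes sz)) (Then (rule_code (Suc sz)) (Then (tuple_code (Suc sz))
    (Then en (Then (seed_code (Suc sz)) en))))))"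

text \<open>In units of the number of rules times the relation bound: 1 each for marking,
  classification and seeds, \<open>sz + 1\<close> for the rule facts, \<open>2 * sz + 1\<close> for
  the tuples, and \<open>run_const\<close> for each of the two runs.\<close>

definition time_const :: "nat => nat" where
 "time_const sz = 3 * sz + 5 + 2 * evaluation_cost.run_const (Suc sz) (shapes sz)"

lemma (in evaluation) distinct_keys: "x \<in> Vall ==> distinct (kf x)"
proof -
 assume "x \<in> Vall"
 then consider "x \<in> Vorig" | "x \<in> Vrule" | "x \<in> Vseed" | "x \<in> Vatom" | "x \<in> Vlab" unfolding Vall_def by blast
 thus ?thesis
 proof cases
  case 4
  then obtain i a g where "x = aux W i (2 * a) g" "ALL k>=W. g k = 0" unfolding Vatom_def using Rel_zero batoms_lt by blast
  thus ?thesis using distinct_keys_aux by simp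
 next
  case 5
  then obtain i l g where "x = aux W i l g" "ALL k>=W. g k = 0" unfolding Vlab_def using valid_zero by blast
  thus ?thesis using distinct_keys_aux by simp
 qed (auto simp: Vorig_def Vrule_def Vseed_def keys_orig keys_rule_fact keys_seed)
qed

context problem
begin

text \<open>All arrays written by the engine are still 0, which represents the empty queue with
  empty buckets.\<close>

lemma prepared_rep:
 assumes "prepared m" "ALL q. q \<notin> range (rg 4) --> r q = 0"
 shows "pushed m L (%_. []) 0 [] {} (r, m)"
proof -
 have z: "m (c # a) = 0" if "c \<notin> {0, 1, 7, 9}" for c a
  using preparedD(1)[OF assms(1), of c a] that by (simp add: input_mem_def)
 have r: "r (rg t k) = 0" if "t ~= 4" for t k using assms(2) that by auto
 show ?thesis unfolding pushed_def rep_def using z r by (auto simp: outputs_def)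
qed

lemma ground_head:
 assumes "i < n" "body (Rs ! i) = []"
 shows "ground_atom (%_. 0) (head (Rs ! i)) = (fst (head (Rs ! i)), map trm_name (snd (head (Rs ! i))))"
proof -
 have v: "vars_list (snd (head (Rs ! i))) = {}" using vars_head_body[OF dp, of "Rs ! i"] assms by fastforce
 have "ground_trm (%_. 0) t = trm_name t" if "t \<in> set (snd (head (Rs ! i)))" for t
  using v that by (cases t) (auto simp: Var_in_set)
 thus ?thesis by (simp add: ground_atom_def)
qed

lemma derived_input:
 assumes prep: "prepared st" and E: "evaluation Rs D (Suc sz) (shapes sz) (%i. st [7, i]) fm st"
 shows "input_tuples n <= evaluation.Vall Rs D (Suc sz) (shapes sz) (%i. st [7, i]) fm Int evaluation.stage1 Rs D (Suc sz) (shapes sz) (%i. st [7, i]) fm"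
proof
 interpret E: evaluation Rs D "Suc sz" "shapes sz" "%i. st [7, i]" fm st by (rule E)
 fix x assume "x \<in> input_tuples n"
 then obtain i where i: "i < n" "x \<in> body_tuples i (length (body (Rs ! i))) Un head_tuples i" unfolding input_tuples_def by auto
 have "EX p t. x = orig (Suc sz) p t & (p, t) \<in> E.LF & length t <= Suc sz & p \<notin> idb (set Rs)"
  using i(2)
 proof
  assume "x \<in> body_tuples i (length (body (Rs ! i)))"
  then obtain A t where A: "A \<in> set (body (Rs ! i))" "t \<in> set (T (fst A))" "x = orig (Suc sz) (fst A) t"
   unfolding body_tuples_def by auto
  have D: "(fst A, t) \<in> D" using A(2) T by auto
  obtain a where a: "a \<in> E.batoms i" "A = rule_atoms (Rs ! i) ! a" using A(1) unfolding E.batoms_body by blast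
  have LF: "(fst A, t) \<in> E.LF" by (rule least_fixpoint_base[OF D])
  have "length t <= Suc sz" using E.LF_length[of i a t] LF i(1) E.batoms_lt[OF a(1)] a(2) by blast
  moreover have "fst A \<notin> idb (set Rs)" using D db unfolding db_instance_def edb_def by force
  ultimately show ?thesis using A(3) LF by blast
 next
  let ?H = "head (Rs ! i)"
  assume "x \<in> head_tuples i"
  hence H: "body (Rs ! i) = []" "fst ?H \<notin> idb (set Rs)" "x = orig (Suc sz) (fst ?H) (map trm_name (snd ?H))"
   unfolding head_tuples_def by (auto split: if_splits)
  have g: "ground_atom (%_. 0) ?H = (fst ?H, map trm_name (snd ?H))" by (rule ground_head[OF i(1) H(1)])
  have LF: "ground_atom (%_. 0) ?H \<in> E.LF" by (rule least_fixpoint_rule) (use i(1) H(1) in auto)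
  have "length (snd ?H) <= Suc sz" using E.arity[OF i(1), of ?H] by (simp add: rule_atoms_def)
  thus ?thesis using H(2,3) LF unfolding g by (intro exI[of _ "fst ?H"] exI[of _ "map trm_name (snd ?H)"]) simp
 qed
 thus "x \<in> E.Vall Int E.stage1" using E.VallI(1) unfolding E.stage1_def by blast
qed

lemma rule_facts_Vrule:
 assumes "evaluation Rs D (Suc sz) (shapes sz) (%i. st [7, i]) fm st"
 shows "rule_facts n = evaluation.Vrule Rs (Suc sz)"
proof -
 interpret E: evaluation Rs D "Suc sz" "shapes sz" "%i. st [7, i]" fm st by (rule assms)
 have "E.batoms i = Suc ` {..<length (body (Rs ! i))}" for i
  unfolding E.batoms_def rule_atoms_def lessThan_atLeast0 by (simp add: image_Suc_atLeastLessThan)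
 thus ?thesis unfolding rule_facts_def E.Vrule_def by auto
qed

lemma run_evaluation:
 assumes prep: "prepared st" and E: "evaluation Rs D (Suc sz) (shapes sz) (%i. st [7, i]) fm st"
  and C1: "closed_upto st (keys st (key_specs (Suc sz))) (all_ops (Suc sz) (shapes sz)) Q1 (length Q1)"
  and C: "closed_upto st (keys st (key_specs (Suc sz))) (all_ops (Suc sz) (shapes sz)) Q (length Q)"
  and Q0: "set Q0 = rule_facts n" and Q1: "Q1 = Q0 @ zs" "input_tuples n <= set Q1"
   "set Q1 <= evaluation.stage1 Rs D (Suc sz) (shapes sz) (%i. st [7, i]) fm"
  and Q: "EX zs. Q = Q1 @ zs" "seed (Suc sz) ` {..<n} <= set Q" "set Q <= evaluation.Vall Rs D (Suc sz) (shapes sz) (%i. st [7, i]) fm"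
 shows "evaluation_run Rs D (Suc sz) (shapes sz) (%i. st [7, i]) fm st Q1 Q (length Q0)"
proof -
 interpret E: evaluation Rs D "Suc sz" "shapes sz" "%i. st [7, i]" fm st by (rule E)
 note rf = rule_facts_Vrule[OF E]
 show ?thesis
 proof
  show "closed_upto st (keys st (key_specs (Suc sz))) (all_ops (Suc sz) (shapes sz)) Q1 (length Q1)" by (rule C1)
  show "closed_upto st (keys st (key_specs (Suc sz))) (all_ops (Suc sz) (shapes sz)) Q (length Q)" by (rule C)
  fix j assume "j < length Q0"
  hence "Q1 ! j \<in> rule_facts n" unfolding Q1(1) Q0[symmetric] by (simp add: nth_append)
  thus "Q1 ! j \<in> E.Vrule" unfolding rf .
 next
  fix i a assume "i < n" "a \<in> E.batoms i"
  hence "rule_fact (Suc sz) i a \<in> set Q0" unfolding Q0 rf E.Vrule_def by blast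
  thus "EX j<length Q0. Q1 ! j = rule_fact (Suc sz) i a" unfolding Q1(1) by (metis in_set_conv_nth nth_append)
 next
  fix p t assume D: "(p, t) \<in> D" "p \<in> E.body_preds"
  then obtain R A where R: "R \<in> set Rs" "A \<in> set (body R)" "p = fst A" unfolding E.body_preds_def by blast
  then obtain i where i: "i < n" "A \<in> set (body (Rs ! i))" by (metis in_set_conv_nth)
  hence "orig (Suc sz) p t \<in> body_tuples i (length (body (Rs ! i)))" unfolding body_tuples_def using D(1) T R(3) by auto
  hence "orig (Suc sz) p t \<in> input_tuples n" unfolding input_tuples_def using i(1) by blast
  thus "orig (Suc sz) p t \<in> set Q1" using Q1(2) by blast
 next
  fix R assume R: "R \<in> set Rs" "body R = []" "fst (head R) \<notin> idb (set Rs)"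
  then obtain i where i: "i < n" "R = Rs ! i" by (auto simp: in_set_conv_nth)
  have "orig (Suc sz) (fst (head R)) (snd (ground_atom (%_. 0) (head R))) \<in> head_tuples i"
   using R ground_head[OF i(1)] unfolding i(2) head_tuples_def by simp
  hence "orig (Suc sz) (fst (head R)) (snd (ground_atom (%_. 0) (head R))) \<in> input_tuples n" unfolding input_tuples_def using i(1) by blast
  thus "orig (Suc sz) (fst (head R)) (snd (ground_atom (%_. 0) (head R))) \<in> set Q1" using Q1(2) by blast
 qed (use Q Q1 in auto)
qed

lemma hrun_evaluator:
 "hrun (evaluator_code sz) (%_. 0, M0) (%t s.
   real t <= real (adornment_count (set Rs)) * real N powr (ew (set Rs) + fcghw (set Rs) - 1) * real n * real (time_const sz) &
   (ALL q:idb (set Rs). output_relation (snd s) q (derived_relation (set Rs) D q)))"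
 unfolding evaluator_code_def Let_def
proof (rule hrun_Then, rule hrun_mark_code, rule hrun_Then, rule hrun_shape_code, assumption, goal_cases)
 case (1 t1 r1 t2 r2 st)
 note prep = 1(5) and times = 1(1,3)
 have ld: "loading Rs D T sz N st" by unfold_locales (rule prep)
 let ?L = "Suc sz + 3" and ?ops = "all_ops (Suc sz) (shapes sz)" and ?kf = "keys st (key_specs (Suc sz))"
 obtain fm where E: "evaluation_cost Rs D (Suc sz) (shapes sz) (%i. st [7, i]) fm st N" using prepared_evaluation[OF prep] by blast
 interpret E: evaluation_cost Rs D "Suc sz" "shapes sz" "%i. st [7, i]" fm st N by (rule E)
 have opsL: "ALL p:set ?ops. length (result p) = ?L & addrs p ~= []" using length_results addrs_nonempty by simp
 have L: "4 <= ?L" by simp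
 \<comment> \<open>Bounding the first run by this set, rather than by \<open>E.Vall\<close>, shows
   that it derives nothing outside \<open>E.stage1\<close>.\<close>
 let ?V1 = "E.Vall Int E.stage1"
 show ?case
 proof (rule hrun_Then, rule loading.hrun_rule_code[OF ld prepared_rep[OF prep 1(4)]], rule hrun_Then, goal_cases)
  case (1 t3 r3 m3)
  note times = times 1(1)
  obtain Q0 where Q0: "rep st ?L (%_. []) Q0 (r3, m3)" "set Q0 = rule_facts n" "r3 rHead = 0" using 1(2) unfolding pushed_def by auto
  hence p0: "pushed st ?L (%_. []) 0 Q0 {} (r3, m3)" unfolding pushed_def by auto
  show ?case
  proof (rule loading.hrun_tuple_code[OF ld p0], rule hrun_Then, goal_cases)
   case (1 t4 r4 m4)
   note times = times 1(1)
   obtain Qa za where Qa: "rep st ?L (%_. []) Qa (r4, m4)" "Qa = Q0 @ za" "set Qa = set Q0 Un input_tuples n" "r4 rHead = 0"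
    using 1(2) unfolding pushed_def by auto
   have b0: "bucket ?kf Qa 0 = (%_. [])" by (simp add: bucket_def fun_eq_iff)
   have "rule_facts n <= ?V1" unfolding rule_facts_Vrule[OF E.evaluation_axioms] E.stage1_def E.Vall_def by blast
   hence QV: "set Qa <= ?V1" using Qa(3) Q0(2) derived_input[OF prep E.evaluation_axioms] by simp
   show ?case
   proof (rule hrun_engine[OF Qa(1)[folded b0] Qa(4) le0 QV _ L E.stage1_sound opsL], goal_cases)
    case 1
    show ?case using E.Vall_card(1) by simp
   next
    case 2
    show ?case using E.distinct_keys by simp
   next
    case 3
    show ?case by (simp add: closed_upto_def)
   next
    case (4 t5 Q1 r5 m5)
    have "real t5 <= real (\<Sum>k=0..<length Q1. 1 + (SUM p<-?ops. op_cost st ?kf ?V1 (Q1 ! k) p))" by (rule of_nat_mono[OF 4(6)])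
    also have "... <= real n * E.label_bound * real E.run_const"
     by (rule E.run_cost[OF _ 4(4)]) (use 4(1) in \<open>auto simp: rep_def\<close>)
    finally have t5: "real t5 <= real n * E.label_bound * real E.run_const" .
    have p1: "pushed st ?L (bucket ?kf Q1 (length Q1)) (length Q1) Q1 {} (r5, m5)" using 4(1,2) unfolding pushed_def by auto
    show ?case
    proof (rule hrun_Then, rule loading.hrun_seed_code[OF ld p1], goal_cases)
     case (1 r6 m6)
     obtain Q2 zb where Q2: "rep st ?L (bucket ?kf Q1 (length Q1)) Q2 (r6, m6)" "Q2 = Q1 @ zb"
      "set Q2 = set Q1 Un seed (Suc sz) ` {..<n}" "r6 rHead = length Q1" using 1 unfolding pushed_def by auto
     have R: "rep st ?L (bucket ?kf Q2 (length Q1)) Q2 (r6, m6)" using Q2(1) unfolding Q2(2) by (simp add: bucket_append)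
     have le: "length Q1 <= length Q2" using Q2(2) by simp
     have QV: "set Q2 <= E.Vall" using 4(4) E.VallI(3) unfolding Q2(3) by auto
     \<comment> \<open>Appending the seeds does not spoil closedness, so the second run may begin at
       the end of \<open>Q1\<close>.\<close>
     have C: "closed_upto st ?kf ?ops Q2 (length Q1)" unfolding Q2(2) by (rule closed_upto_append[OF 4(5)]) simp
     have dk: "ALL x:E.Vall. distinct (?kf x)" using E.distinct_keys by blast
     show ?case
     proof (rule hrun_engine[OF R Q2(4) le QV E.Vall_card(1) L E.sound_Vall opsL dk C], goal_cases)
      case (1 t7 Q3 r7 m7)
      have "real t7 <= real (\<Sum>k=length Q1..<length Q3. 1 + (SUM p<-?ops. op_cost st ?kf E.Vall (Q3 ! k) p))" by (rule of_nat_mono[OF 1(6)])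
      also have "... <= real n * E.label_bound * real E.run_const"
       by (rule E.run_cost[OF _ 1(4)]) (use 1(1) in \<open>auto simp: rep_def\<close>)
      finally have t7: "real t7 <= real n * E.label_bound * real E.run_const" .
      interpret F: evaluation_run Rs D "Suc sz" "shapes sz" "%i. st [7, i]" fm st Q1 Q3 "length Q0"
      proof -
       obtain zc where "Q1 = Qa @ zc" using 4(3) by blast
       hence q1: "Q1 = Q0 @ (za @ zc)" "input_tuples n <= set Q1" using Qa(2,3) by auto
       obtain zd where q3: "Q3 = Q2 @ zd" using 1(3) by blast
       show "evaluation_run Rs D (Suc sz) (shapes sz) (%i. st [7, i]) fm st Q1 Q3 (length Q0)"
        by (rule run_evaluation[OF prep E.evaluation_axioms 4(5) 1(5) Q0(2) q1]) (use 4(4) 1(4) q3 Q2(2,3) in auto)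
      qed
      have out: "ALL q:idb (set Rs). output_relation m7 q (derived_relation (set Rs) D q)"
       using F.output_outputs[OF 1(1)] by blast
      let ?B = "E.label_bound" and ?n = "real n"
      have B: "1 <= ?B" "real N <= ?B" using E.one_le_label E.N_le_idb E.idb_le_label by linarith+
      have nB: "0 <= ?n * ?B" using B by simp
      have n1: "?n <= ?n * ?B" using mult_left_mono[OF B(1), of ?n] by simp
      have t3: "real t3 <= ?n * ?B * (real sz + 1)"
      proof -
       have "real t3 <= ?n * (real sz + 1)" using of_nat_mono[OF times(3), where 'a = real] by (simp add: algebra_simps)
       also have "... <= ?n * ?B * (real sz + 1)" using n1 by (intro mult_right_mono) auto
       finally show ?thesis .
      qed
      have t4: "real t4 <= ?n * ?B * (2 * real sz + 1)"
      proof -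
       have "real t4 <= ?n * (real sz * (real N + 1) + 1)" using of_nat_mono[OF times(4), where 'a = real] by (simp add: algebra_simps)
       also have "... <= ?n * (real sz * (2 * ?B) + ?B)" using B by (intro mult_left_mono add_mono) auto
       finally show ?thesis by (simp add: algebra_simps)
      qed
      have ts: "real t1 <= ?n * ?B" "real t2 <= ?n * ?B" "?n <= ?n * ?B" using times n1 by (meson of_nat_mono order_trans)+
      have "real (t1 + (t2 + (t3 + (t4 + (t5 + (n + t7)))))) <= ?n * ?B * (3 * real sz + 5 + 2 * real E.run_const)"
       using ts t3 t4 t5 t7 by (simp add: algebra_simps)
      also have "... = real (adornment_count (set Rs)) * real N powr (ew (set Rs) + fcghw (set Rs) - 1) * ?n * real (time_const sz)"
       unfolding E.label_bound_def time_const_def by (simp add: algebra_simps)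
      finally show ?case using out by simp
     qed
    qed
   qed
  qed
 qed
qed

end

theorem theorem7p6:
  fixes s :: nat
  shows "\<exists>(evaluator :: com) (C :: real).
    \<forall>(\<Pi> :: program) (D :: fact set) (N :: nat).
      datalog_program \<Pi> \<and> linear_program \<Pi> \<and> (\<forall>R\<in>\<Pi>. rule_size R \<le> s) \<and> 0 < ew \<Pi> \<and>
      db_instance \<Pi> D \<and> 1 \<le> N \<and> (\<forall>p\<in>edb \<Pi>. card (derived_relation \<Pi> D p) \<le> N) \<longrightarrow>
      evaluates_within evaluator \<Pi> D
        (C * real (adornment_count \<Pi>) * real (card \<Pi>) * real N powr (ew \<Pi> + fcghw \<Pi> - 1))"
proof -
 obtain c K where cK: "!!s0 n s' r. hexec (evaluator_code s) s0 n s' ==> odd_regs r = fst s0 ==>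
   EX t r'. exec c (r, snd s0) t (r', snd s') & odd_regs r' = fst s' & t <= K * (n + 1)"
  using compile[of "evaluator_code s"] unfolding simulates_def by blast
 \<comment> \<open>\<open>K\<close> is the slowdown of compilation, and the extra 1 absorbs the
   additive term in \<open>K * (n + 1)\<close>.\<close>
 let ?C = "real K * (real (time_const s) + 1)"
 show ?thesis
 proof (intro exI[of _ c] exI[of _ ?C] allI impI)
  fix \<Pi> :: program and D :: "fact set" and N :: nat
  assume asm: "datalog_program \<Pi> & linear_program \<Pi> & (ALL R:\<Pi>. rule_size R <= s) & 0 < ew \<Pi> &
   db_instance \<Pi> D & 1 <= N & (ALL p:edb \<Pi>. card (derived_relation \<Pi> D p) <= N)"
  show "evaluates_within c \<Pi> D (?C * real (adornment_count \<Pi>) * real (card \<Pi>) * real N powr (ew \<Pi> + fcghw \<Pi> - 1))"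
   unfolding evaluates_within_def
  proof (intro allI impI)
   fix Rs T assume RT: "distinct Rs & set Rs = \<Pi> & (ALL p. distinct (T p) & set (T p) = {t. (p, t) \<in> D})"
   interpret P: problem Rs D T s N by unfold_locales (use asm RT in auto)
   have Pi: "set Rs = \<Pi>" and card: "card \<Pi> = length Rs" using RT by (auto simp: distinct_card)
   let ?B = "real (adornment_count \<Pi>) * real N powr (ew \<Pi> + fcghw \<Pi> - 1) * real (length Rs)"
   obtain n m' r0 where n: "hexec (evaluator_code s) (%_. 0, input_mem Rs T) n (r0, m')" "real n <= ?B * real (time_const s)"
    "ALL q:idb \<Pi>. output_relation m' q (derived_relation \<Pi> D q)"
    using P.hrun_evaluator unfolding hrun_def Pi by auto
   obtain t r' where t: "exec c (%_. 0, input_mem Rs T) t (r', m')" "t <= K * (n + 1)"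
    using cK[OF n(1), of "%_. 0"] by (auto simp: odd_regs_def)
   \<comment> \<open>Positivity of \<open>ew\<close> makes the program nonempty and all factors at
     least 1, so that the additive term stays within the bound.\<close>
   have B1: "1 <= ?B"
   proof -
    have "\<Pi> ~= {}" using ew_ge_one(3)[OF P.dp P.ew] Pi by auto
    hence "1 <= length Rs" using Pi by (cases Rs) auto
    moreover have "1 <= adornment_count \<Pi>" "1 <= ew \<Pi>" using ew_ge_one(1,2)[OF P.dp P.ew] unfolding Pi by auto
    moreover have "1 <= fcghw \<Pi>" using fcghw_ge_one[OF P.dp P.ew] unfolding Pi .
    ultimately have "1 * 1 * 1 <= ?B" using P.N by (intro mult_mono ge_one_powr_ge_zero) auto
    thus ?thesis by simp
   qed
   have "real t <= real K * (real n + 1)" using of_nat_mono[OF t(2), where 'a = real] by (simp add: algebra_simps)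
   also have "... <= real K * (?B * real (time_const s) + ?B)" using n(2) B1 by (intro mult_left_mono add_mono) auto
   also have "... = ?C * real (adornment_count \<Pi>) * real (card \<Pi>) * real N powr (ew \<Pi> + fcghw \<Pi> - 1)"
    unfolding card by (simp add: algebra_simps)
   finally show "EX t r m. exec c (%_. 0, input_mem Rs T) t (r, m) &
     real t <= ?C * real (adornment_count \<Pi>) * real (card \<Pi>) * real N powr (ew \<Pi> + fcghw \<Pi> - 1) &
     (ALL q:idb \<Pi>. output_relation m q (derived_relation \<Pi> D q))"
    using t(1) n(3) by blast
  qed
 qed
qed

end
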